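(* Let $\alpha:R\to A$, $\beta:S\to B$, $\kappa:Z\to K$ be ring homomorphisms. Let $(T,\gamma_T)$ be a $B$-$A$ herd with pen $\widehat{T}$ and $(P,\gamma_P)$ an $A$-$K$ herd with pen $\widehat{P}$. Denote by $\mathcal{C}=\widehat{T}\otimes_S T$ the $A$-coring associated to $T$ and by $\mathcal{E}=P\otimes_Z\widehat{P}$ the $A$-coring associated to $P$. Then $V=T\otimes_A P$ is a $B$-$K$ herd, with pen $\widehat{V}=\widehat{P}\otimes_A\widehat{T}$ and with a shepherd $\gamma_V$ satisfying $$\gamma_{T,A}\otimes_A P=(T\otimes_A\widehat{\mathrm{ev}}_P\otimes_A\widehat{T}\otimes_S T\otimes_A P)\circ\gamma_V,$$ $$T\otimes_A\gamma_{P,A}=(T\otimes_A P\otimes_Z\widehat{P}\otimes_A\mathrm{ev}_T\otimes_A P)\circ\gamma_V,$$ if and only if there exists a map $\sigma:\mathcal{C}\otimes_A\mathcal{E}\to\mathcal{E}\otimes_A\mathcal{C}$ which defines a smash coproduct $\mathcal{E}\otimes_\sigma\mathcal{C}$ (hence $\mathcal{E}\otimes_A\mathcal{C}$ is an $A$-coring).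
   Context: All rings are associative and unital. $A$-, $B$-, $K$-modules are regarded as $R$-, $S$-, $Z$-modules via $\alpha$, $\beta$, $\kappa$ respectively. The identity map on an object $X$ is denoted $X$. Formal dual (relative to $\alpha:R\to A$, $\beta:S\to B$): given a $B$-$A$ bimodule $T$, an $A$-$B$ bimodule $\widehat{T}$ is a formal dual of $T$ if there exist an $A$-bimodule map $\mathrm{ev}_T:\widehat{T}\otimes_S T\to A$ and a $B$-bimodule map $\widehat{\mathrm{ev}}_T:T\otimes_R\widehat{T}\to B$ such that for all $x,y\in T$, $\hat{x},\hat{y}\in\widehat{T}$: $\widehat{\mathrm{ev}}_T(x\otimes_R\hat{x})y=x\,\mathrm{ev}_T(\hat{x}\otimes_S y)$ and $\hat{x}\,\widehat{\mathrm{ev}}_T(x\otimes_R\hat{y})=\mathrm{ev}_T(\hat{x}\otimes_S x)\hat{y}$. Herd: a $B$-$A$ bimodule $T$ with a formal dual $\widehat{T}$ (the pen) is a $B$-$A$ herd $(T,\gamma_T)$ if there is an $S$-$R$ bimodule map (the shepherd) $\gamma_T:T\to T\otimes_R\widehat{T}\otimes_S T$, written $\gamma_T(x)=x^{\langle1\rangle}\otimes_R x^{\langle2\rangle}\otimes_S x^{\langle3\rangle}$ (summation implicit), such that for all $x\in T$: $\widehat{\mathrm{ev}}_T(x^{\langle1\rangle}\otimes_R x^{\langle2\rangle})\otimes_S x^{\langle3\rangle}=1_B\otimes_S x$; $x^{\langle1\rangle}\otimes_R\mathrm{ev}_T(x^{\langle2\rangle}\otimes_S x^{\langle3\rangle})=x\otimes_R1_A$;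 and $(\gamma_T\otimes_R\widehat{T}\otimes_S T)\circ\gamma_T=(T\otimes_R\widehat{T}\otimes_S\gamma_T)\circ\gamma_T$. The same definitions are applied to the $A$-$K$ bimodule $P$ relative to $\kappa:Z\to K$ and $\alpha:R\to A$ (so $\mathrm{ev}_P:\widehat{P}\otimes_R P\to K$, $\widehat{\mathrm{ev}}_P:P\otimes_Z\widehat{P}\to A$, $\gamma_P:P\to P\otimes_Z\widehat{P}\otimes_R P$), and to the $B$-$K$ bimodule $V$ relative to $\kappa$ and $\beta$ (so $\gamma_V:V\to V\otimes_Z\widehat{V}\otimes_S V$). $\gamma_{T,A}:T\to T\otimes_A\widehat{T}\otimes_S T$ and $\gamma_{P,A}:P\to P\otimes_Z\widehat{P}\otimes_A P$ denote the compositions of $\gamma_T$, $\gamma_P$ with the canonical projections; they are right, resp. left, $A$-linear. The $A$-corings: $\mathcal{C}=\widehat{T}\otimes_S T$ has coproduct $\hat{x}\otimes_S x\mapsto\hat{x}\otimes_S\gamma_{T,A}(x)$ and counit $\mathrm{ev}_T$; $\mathcal{E}=P\otimes_Z\widehat{P}$ has coproduct $p\otimes_Z\hat{p}\mapsto\gamma_{P,A}(p)\otimes_Z\hat{p}$ and counit $\widehat{\mathrm{ev}}_P$. Formal dual of $V$: $\widehat{V}=\widehat{P}\otimes_A\widehat{T}$ with $\mathrm{ev}_V=\mathrm{ev}_P\circ(\widehat{P}\otimes_A\mathrm{ev}_T\otimes_A P):\widehat{P}\otimes_A\widehat{T}\otimes_S T\otimes_A P\to K$ and $\widehat{\mathrm{ev}}_V=\widehat{\mathrm{ev}}_T\circ(T\otimes_A\widehat{\mathrm{ev}}_P\otimes_A\widehat{T}):T\otimes_A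 P\otimes_Z\widehat{P}\otimes_A\widehat{T}\to B$, where $\mathrm{ev}_P$ and $\widehat{\mathrm{ev}}_T$ are viewed as maps on $\widehat{P}\otimes_A P$ and $T\otimes_A\widehat{T}$. Smash coproduct: for $A$-corings $\mathcal{C}$, $\mathcal{E}$, an $A$-bimodule map $\sigma:\mathcal{C}\otimes_A\mathcal{E}\to\mathcal{E}\otimes_A\mathcal{C}$ defines a smash coproduct $\mathcal{E}\otimes_\sigma\mathcal{C}$ if $$(\mathcal{E}\otimes_A\Delta_{\mathcal{C}})\circ\sigma=(\sigma\otimes_A\mathcal{C})\circ(\mathcal{C}\otimes_A\sigma)\circ(\Delta_{\mathcal{C}}\otimes_A\mathcal{E}),\quad(\Delta_{\mathcal{E}}\otimes_A\mathcal{C})\circ\sigma=(\mathcal{E}\otimes_A\sigma)\circ(\sigma\otimes_A\mathcal{E})\circ(\mathcal{C}\otimes_A\Delta_{\mathcal{E}}),$$ $$(\varepsilon_{\mathcal{E}}\otimes_A\mathcal{C})\circ\sigma=\mathcal{C}\otimes_A\varepsilon_{\mathcal{E}},\qquad(\mathcal{E}\otimes_A\varepsilon_{\mathcal{C}})\circ\sigma=\varepsilon_{\mathcal{C}}\otimes_A\mathcal{E}$$ (up to the canonical identifications). Then $\mathcal{E}\otimes_A\mathcal{C}$ is an $A$-coring, denoted $\mathcal{E}\otimes_\sigma\mathcal{C}$, with coproduct $(\mathcal{E}\otimes_A\sigma\otimes_A\mathcal{C})\circ(\Delta_{\mathcal{E}}\otimes_A\Delta_{\mathcal{C}})$ and counit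 $\varepsilon_{\mathcal{E}}\otimes_A\varepsilon_{\mathcal{C}}$.
   Formalization: The coring is stated on C⊗_A E, with coproduct (C⊗σ⊗E)∘(Δ_C⊗Δ_E) and counit ε_C⊗ε_E, instead of on E⊗_A C, because σ is defined on C⊗_A E and the coproduct printed for E⊗_A C applies it to E⊗_A C. *)

theory Defs
  imports "HOL-Algebra.Algebra"
begin

section \<open>Bimodules over noncommutative rings\<close>

text \<open>
  The locale \<open>module\<close> of the library requires a commutative ring.  As in the library's record
  \<open>module\<close>, the multiplicative fields inherited from \<open>ring\<close> play no role here.
\<close>

record ('l, 'r, 'm) bimod = "'m ring" +
  lact :: "'l \<Rightarrow> 'm \<Rightarrow> 'm"
  ract :: "'m \<Rightarrow> 'r \<Rightarrow> 'm"

locale bimodule = L: ring L + R: ring R + M: abelian_group M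
  for L :: "('l, 'l1) ring_scheme" and R :: "('r, 'r1) ring_scheme"
    and M :: "('l, 'r, 'm, 'm1) bimod_scheme" +
  assumes lact_closed: "\<lbrakk>a \<in> carrier L; x \<in> carrier M\<rbrakk> \<Longrightarrow> lact M a x \<in> carrier M"
    and lact_add_left: "\<lbrakk>a \<in> carrier L; b \<in> carrier L; x \<in> carrier M\<rbrakk>
      \<Longrightarrow> lact M (a \<oplus>\<^bsub>L\<^esub> b) x = lact M a x \<oplus>\<^bsub>M\<^esub> lact M b x"
    and lact_add_right: "\<lbrakk>a \<in> carrier L; x \<in> carrier M; y \<in> carrier M\<rbrakk>
      \<Longrightarrow> lact M a (x \<oplus>\<^bsub>M\<^esub> y) = lact M a x \<oplus>\<^bsub>M\<^esub> lact M a y"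
    and lact_mult: "\<lbrakk>a \<in> carrier L; b \<in> carrier L; x \<in> carrier M\<rbrakk>
      \<Longrightarrow> lact M (a \<otimes>\<^bsub>L\<^esub> b) x = lact M a (lact M b x)"
    and lact_one: "x \<in> carrier M \<Longrightarrow> lact M \<one>\<^bsub>L\<^esub> x = x"
    and ract_closed: "\<lbrakk>x \<in> carrier M; r \<in> carrier R\<rbrakk> \<Longrightarrow> ract M x r \<in> carrier M"
    and ract_add_right: "\<lbrakk>x \<in> carrier M; r \<in> carrier R; s \<in> carrier R\<rbrakk>
      \<Longrightarrow> ract M x (r \<oplus>\<^bsub>R\<^esub> s) = ract M x r \<oplus>\<^bsub>M\<^esub> ract M x s"
    and ract_add_left: "\<lbrakk>x \<in> carrier M; y \<in> carrier M; r \<in> carrier R\<rbrakk>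
      \<Longrightarrow> ract M (x \<oplus>\<^bsub>M\<^esub> y) r = ract M x r \<oplus>\<^bsub>M\<^esub> ract M y r"
    and ract_mult: "\<lbrakk>x \<in> carrier M; r \<in> carrier R; s \<in> carrier R\<rbrakk>
      \<Longrightarrow> ract M x (r \<otimes>\<^bsub>R\<^esub> s) = ract M (ract M x r) s"
    and ract_one: "x \<in> carrier M \<Longrightarrow> ract M x \<one>\<^bsub>R\<^esub> = x"
    and lact_ract: "\<lbrakk>a \<in> carrier L; x \<in> carrier M; r \<in> carrier R\<rbrakk>
      \<Longrightarrow> ract M (lact M a x) r = lact M a (ract M x r)"

definition bimod_hom ::
  "('l, 'l1) ring_scheme \<Rightarrow> ('r, 'r1) ring_scheme \<Rightarrow> ('l, 'r, 'm, 'm1) bimod_scheme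
    \<Rightarrow> ('l, 'r, 'n, 'n1) bimod_scheme \<Rightarrow> ('m \<Rightarrow> 'n) set"
  where "bimod_hom L R M N =
    {f \<in> carrier M \<rightarrow> carrier N.
      (\<forall>x\<in>carrier M. \<forall>y\<in>carrier M. f (x \<oplus>\<^bsub>M\<^esub> y) = f x \<oplus>\<^bsub>N\<^esub> f y) \<and>
      (\<forall>a\<in>carrier L. \<forall>x\<in>carrier M. f (lact M a x) = lact N a (f x)) \<and>
      (\<forall>x\<in>carrier M. \<forall>b\<in>carrier R. f (ract M x b) = ract N (f x) b)}"

definition regular :: "('a, 'a1) ring_scheme \<Rightarrow> ('a, 'a, 'a) bimod"
  where "regular A =
    \<lparr>carrier = carrier A, monoid.mult = monoid.mult A, one = one A, ring.zero = ring.zero A, ring.add = ring.add A,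
     lact = monoid.mult A, ract = monoid.mult A\<rparr>"

text \<open>Restriction of scalars along \<open>f\<close> on the left and \<open>g\<close> on the right.\<close>

definition restr ::
  "('l \<Rightarrow> 'l2) \<Rightarrow> ('r \<Rightarrow> 'r2) \<Rightarrow> ('l2, 'r2, 'm, 'm1) bimod_scheme \<Rightarrow> ('l, 'r, 'm) bimod"
  where "restr f g M =
    \<lparr>carrier = carrier M, monoid.mult = monoid.mult M, one = one M, ring.zero = ring.zero M, ring.add = ring.add M,
     lact = (\<lambda>a. lact M (f a)), ract = (\<lambda>x b. ract M x (g b))\<rparr>"


section \<open>Tensor products\<close>

text \<open>
  \<open>M \<otimes>\<^sub>R N\<close> is the quotient of the free abelian group on the set of pairs by the subgroup generated
  by the usual relations; its elements are cosets.
\<close>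

type_synonym ('m, 'n) tens = "(('m \<times> 'n) \<Rightarrow>\<^sub>0 int) set"

definition tensor_rels ::
  "('x, 'x1) ring_scheme \<Rightarrow> ('l, 'x, 'm, 'm1) bimod_scheme \<Rightarrow> ('x, 'r, 'n, 'n1) bimod_scheme
    \<Rightarrow> (('m \<times> 'n) \<Rightarrow>\<^sub>0 int) set"
  where "tensor_rels R M N =
    {frag_of (x \<oplus>\<^bsub>M\<^esub> x', y) - frag_of (x, y) - frag_of (x', y) | x x' y.
       x \<in> carrier M \<and> x' \<in> carrier M \<and> y \<in> carrier N} \<union>
    {frag_of (x, y \<oplus>\<^bsub>N\<^esub> y') - frag_of (x, y) - frag_of (x, y') | x y y'.
       x \<in> carrier M \<and> y \<in> carrier N \<and> y' \<in> carrier N} \<union>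
    {frag_of (ract M x r, y) - frag_of (x, lact N r y) | x r y.
       x \<in> carrier M \<and> r \<in> carrier R \<and> y \<in> carrier N}"

definition tensor_group ::
  "('x, 'x1) ring_scheme \<Rightarrow> ('l, 'x, 'm, 'm1) bimod_scheme \<Rightarrow> ('x, 'r, 'n, 'n1) bimod_scheme
    \<Rightarrow> ('m, 'n) tens ring"
  where "tensor_group R M N =
    (let F = free_Abelian_group (carrier M \<times> carrier N);
         Q = F Mod generate F (tensor_rels R M N)
     in \<lparr>carrier = carrier Q, monoid.mult = undefined, one = undefined,
         ring.zero = one Q, ring.add = monoid.mult Q\<rparr>)"

text \<open>The class of \<open>(x, y)\<close>: the unique coset in the tensor product \<open>Q\<close> containing that generator.\<close>

definition pure_tensor ::
  "(('m, 'n) tens, 'q) ring_scheme \<Rightarrow> 'm \<Rightarrow> 'n \<Rightarrow> ('m, 'n) tens"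
  where "pure_tensor Q x y = (THE u. u \<in> carrier Q \<and> frag_of (x, y) \<in> u)"

notation pure_tensor (\<open>(_ \<diamondop>\<index> _)\<close> [71, 70] 70)

text \<open>
  The additive map \<open>M \<otimes>\<^sub>R N \<rightarrow> G\<close> with \<open>x \<otimes> y \<mapsto> f x y\<close>, for a balanced biadditive \<open>f\<close> into an
  abelian group \<open>G\<close>: \<open>f\<close> is extended linearly to the free abelian group, and the value on a coset is
  the common value on its elements.
\<close>

definition tlift ::
  "('g, 'g1) ring_scheme \<Rightarrow> ('m \<Rightarrow> 'n \<Rightarrow> 'g) \<Rightarrow> ('m, 'n) tens \<Rightarrow> 'g"
  where "tlift G f u =
    the_elem ((\<lambda>c. finsum G (\<lambda>p. add_pow G (Poly_Mapping.lookup c p) (f (fst p) (snd p)))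
      (Poly_Mapping.keys c)) ` u)"

text \<open>
  \<open>tlift G (\<lambda>x y. e) u\<close> and \<open>tlift3 G (\<lambda>x y z. e) u\<close> render the Sweedler-type notation in which
  \<open>x \<otimes> y\<close>, resp. \<open>x \<otimes> (y \<otimes> z)\<close>, stands for the element \<open>u\<close> with summation understood.
\<close>

definition tlift3 ::
  "('g, 'g1) ring_scheme \<Rightarrow> ('m \<Rightarrow> 'n \<Rightarrow> 'k \<Rightarrow> 'g) \<Rightarrow> ('m, ('n, 'k) tens) tens \<Rightarrow> 'g"
  where "tlift3 G f = tlift G (\<lambda>x. tlift G (f x))"

definition tensor ::
  "('x, 'x1) ring_scheme \<Rightarrow> ('l, 'x, 'm, 'm1) bimod_scheme \<Rightarrow> ('x, 'r, 'n, 'n1) bimod_scheme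
    \<Rightarrow> ('l, 'r, ('m, 'n) tens) bimod"
  where "tensor R M N =
    (let G = tensor_group R M N in
     ring.extend G (bimod.fields
       (\<lambda>a. tlift G (\<lambda>x y. lact M a x \<diamondop>\<^bsub>G\<^esub> y))
       (\<lambda>u b. tlift G (\<lambda>x y. x \<diamondop>\<^bsub>G\<^esub> ract N y b) u)))"

abbreviation tensor_over (\<open>(_ \<^bold>\<otimes>\<^bsub>_\<^esub> _)\<close> [66, 0, 65] 65)
  where "M \<^bold>\<otimes>\<^bsub>R\<^esub> N \<equiv> tensor R M N"

text \<open>The tensor product over \<open>R\<close> of modules over \<open>Y\<close>, viewed as \<open>R\<close>-modules via \<open>f : R \<rightarrow> Y\<close>.\<close>

abbreviation tensor_via (\<open>(_ \<^bold>\<otimes>\<^bsub>_,_\<^esub> _)\<close> [66, 0, 0, 65] 65)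
  where "M \<^bold>\<otimes>\<^bsub>R,f\<^esub> N \<equiv> tensor R (restr id f M) (restr f id N)"

definition tmap ::
  "('a, 'a1) ring_scheme \<Rightarrow> ('l, 'a, 'm, 'm1) bimod_scheme \<Rightarrow> ('a, 'r, 'n, 'n1) bimod_scheme
    \<Rightarrow> ('m2 \<Rightarrow> 'm) \<Rightarrow> ('n2 \<Rightarrow> 'n) \<Rightarrow> ('m2, 'n2) tens \<Rightarrow> ('m, 'n) tens"
  where "tmap A M N f g = tlift (M \<^bold>\<otimes>\<^bsub>A\<^esub> N) (\<lambda>x y. f x \<diamondop>\<^bsub>M \<^bold>\<otimes>\<^bsub>A\<^esub> N\<^esub> g y)"

definition assoc ::
  "('a, 'a1) ring_scheme \<Rightarrow> ('a, 'a, 'l) bimod \<Rightarrow> ('a, 'a, 'm) bimod \<Rightarrow> ('a, 'a, 'n) bimod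
    \<Rightarrow> (('l, 'm) tens, 'n) tens \<Rightarrow> ('l, ('m, 'n) tens) tens"
  where "assoc A L M N =
    (let Q = L \<^bold>\<otimes>\<^bsub>A\<^esub> (M \<^bold>\<otimes>\<^bsub>A\<^esub> N)
     in tlift Q (\<lambda>u z. tlift Q (\<lambda>x y. x \<diamondop>\<^bsub>Q\<^esub> (y \<diamondop>\<^bsub>M \<^bold>\<otimes>\<^bsub>A\<^esub> N\<^esub> z)) u))"

definition assoc_inv ::
  "('a, 'a1) ring_scheme \<Rightarrow> ('a, 'a, 'l) bimod \<Rightarrow> ('a, 'a, 'm) bimod \<Rightarrow> ('a, 'a, 'n) bimod
    \<Rightarrow> ('l, ('m, 'n) tens) tens \<Rightarrow> (('l, 'm) tens, 'n) tens"
  where "assoc_inv A L M N =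
    (let Q = (L \<^bold>\<otimes>\<^bsub>A\<^esub> M) \<^bold>\<otimes>\<^bsub>A\<^esub> N
     in tlift3 Q (\<lambda>x y z. (x \<diamondop>\<^bsub>L \<^bold>\<otimes>\<^bsub>A\<^esub> M\<^esub> y) \<diamondop>\<^bsub>Q\<^esub> z))"


section \<open>Corings and smash coproducts\<close>

locale coring = bimodule A A C
  for A :: "('a, 'a1) ring_scheme" and C :: "('a, 'a, 'c) bimod" +
  fixes \<Delta> :: "'c \<Rightarrow> ('c, 'c) tens" and \<epsilon> :: "'c \<Rightarrow> 'a"
  assumes comult_hom: "\<Delta> \<in> bimod_hom A A C (C \<^bold>\<otimes>\<^bsub>A\<^esub> C)"
    and counit_hom: "\<epsilon> \<in> bimod_hom A A C (regular A)"
    and coassoc: "c \<in> carrier C \<Longrightarrow>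
      assoc A C C C (tmap A (C \<^bold>\<otimes>\<^bsub>A\<^esub> C) C \<Delta> id (\<Delta> c)) = tmap A C (C \<^bold>\<otimes>\<^bsub>A\<^esub> C) id \<Delta> (\<Delta> c)"
    and counit_left: "c \<in> carrier C \<Longrightarrow> tlift C (\<lambda>c1 c2. lact C (\<epsilon> c1) c2) (\<Delta> c) = c"
    and counit_right: "c \<in> carrier C \<Longrightarrow> tlift C (\<lambda>c1 c2. ract C c1 (\<epsilon> c2)) (\<Delta> c) = c"

text \<open>
  The last two conditions use \<open>A \<otimes>\<^sub>A C \<cong> C \<cong> C \<otimes>\<^sub>A A\<close> and \<open>E \<otimes>\<^sub>A A \<cong> E \<cong> A \<otimes>\<^sub>A E\<close>.
\<close>

definition smash_coproduct ::
  "('a, 'a1) ring_scheme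
    \<Rightarrow> ('a, 'a, 'c) bimod \<Rightarrow> ('c \<Rightarrow> ('c, 'c) tens) \<Rightarrow> ('c \<Rightarrow> 'a)
    \<Rightarrow> ('a, 'a, 'e) bimod \<Rightarrow> ('e \<Rightarrow> ('e, 'e) tens) \<Rightarrow> ('e \<Rightarrow> 'a)
    \<Rightarrow> (('c, 'e) tens \<Rightarrow> ('e, 'c) tens) \<Rightarrow> bool"
  where "smash_coproduct A C \<Delta>\<^sub>C \<epsilon>\<^sub>C E \<Delta>\<^sub>E \<epsilon>\<^sub>E \<sigma> \<longleftrightarrow>
    \<sigma> \<in> bimod_hom A A (C \<^bold>\<otimes>\<^bsub>A\<^esub> E) (E \<^bold>\<otimes>\<^bsub>A\<^esub> C) \<and>
    (\<forall>u\<in>carrier (C \<^bold>\<otimes>\<^bsub>A\<^esub> E).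
      tmap A E (C \<^bold>\<otimes>\<^bsub>A\<^esub> C) id \<Delta>\<^sub>C (\<sigma> u) =
        (assoc A E C C \<circ> tmap A (E \<^bold>\<otimes>\<^bsub>A\<^esub> C) C \<sigma> id \<circ> assoc_inv A C E C \<circ>
          tmap A C (E \<^bold>\<otimes>\<^bsub>A\<^esub> C) id \<sigma> \<circ> assoc A C C E \<circ> tmap A (C \<^bold>\<otimes>\<^bsub>A\<^esub> C) E \<Delta>\<^sub>C id) u \<and>
      tmap A (E \<^bold>\<otimes>\<^bsub>A\<^esub> E) C \<Delta>\<^sub>E id (\<sigma> u) =
        (assoc_inv A E E C \<circ> tmap A E (E \<^bold>\<otimes>\<^bsub>A\<^esub> C) id \<sigma> \<circ> assoc A E C E \<circ>
          tmap A (E \<^bold>\<otimes>\<^bsub>A\<^esub> C) E \<sigma> id \<circ> assoc_inv A C E E \<circ> tmap A C (E \<^bold>\<otimes>\<^bsub>A\<^esub> E) id \<Delta>\<^sub>E) u \<and>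
      tlift C (\<lambda>e c. lact C (\<epsilon>\<^sub>E e) c) (\<sigma> u) = tlift C (\<lambda>c e. ract C c (\<epsilon>\<^sub>E e)) u \<and>
      tlift E (\<lambda>e c. ract E e (\<epsilon>\<^sub>C c)) (\<sigma> u) = tlift E (\<lambda>c e. lact E (\<epsilon>\<^sub>C c) e) u)"

text \<open>
  Since \<open>\<sigma> : C \<otimes>\<^sub>A E \<rightarrow> E \<otimes>\<^sub>A C\<close>, the coring it defines lives on \<open>C \<otimes>\<^sub>A E\<close>: the coproduct is
  \<open>(C \<otimes> \<sigma> \<otimes> E) \<circ> (\<Delta>\<^sub>C \<otimes> \<Delta>\<^sub>E)\<close>, where \<open>\<sigma>\<close> is applied to the two middle factors \<open>C \<otimes>\<^sub>A E\<close>, and the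
  counit is \<open>\<epsilon>\<^sub>C \<otimes> \<epsilon>\<^sub>E\<close>.
\<close>

definition smash_comult ::
  "('a, 'a1) ring_scheme \<Rightarrow> ('a, 'a, 'c) bimod \<Rightarrow> ('c \<Rightarrow> ('c, 'c) tens)
    \<Rightarrow> ('a, 'a, 'e) bimod \<Rightarrow> ('e \<Rightarrow> ('e, 'e) tens) \<Rightarrow> (('c, 'e) tens \<Rightarrow> ('e, 'c) tens)
    \<Rightarrow> ('c, 'e) tens \<Rightarrow> (('c, 'e) tens, ('c, 'e) tens) tens"
  where "smash_comult A C \<Delta>\<^sub>C E \<Delta>\<^sub>E \<sigma> =
    (let D = C \<^bold>\<otimes>\<^bsub>A\<^esub> E; Q = D \<^bold>\<otimes>\<^bsub>A\<^esub> D in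
     tlift Q (\<lambda>c e.
       tlift Q (\<lambda>c1 c2.
         tlift Q (\<lambda>e1 e2.
           tlift Q (\<lambda>e' c'. (c1 \<diamondop>\<^bsub>D\<^esub> e') \<diamondop>\<^bsub>Q\<^esub> (c' \<diamondop>\<^bsub>D\<^esub> e2)) (\<sigma> (c2 \<diamondop>\<^bsub>D\<^esub> e1)))
         (\<Delta>\<^sub>E e))
       (\<Delta>\<^sub>C c)))"

definition smash_counit ::
  "('a, 'a1) ring_scheme \<Rightarrow> ('c \<Rightarrow> 'a) \<Rightarrow> ('e \<Rightarrow> 'a) \<Rightarrow> ('c, 'e) tens \<Rightarrow> 'a"
  where "smash_counit A \<epsilon>\<^sub>C \<epsilon>\<^sub>E = tlift A (\<lambda>c e. \<epsilon>\<^sub>C c \<otimes>\<^bsub>A\<^esub> \<epsilon>\<^sub>E e)"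


section \<open>Herds\<close>

text \<open>\<open>T'\<close> and \<open>ev'\<close> are the formal dual and the second evaluation, usually written with a hat.\<close>

locale formal_dual = \<alpha>: ring_hom_ring R A \<alpha> + \<beta>: ring_hom_ring S B \<beta> +
    T: bimodule B A T + T': bimodule A B T'
  for R :: "('r, 'r1) ring_scheme" and A :: "('a, 'a1) ring_scheme" and \<alpha>
    and S :: "('s, 's1) ring_scheme" and B :: "('b, 'b1) ring_scheme" and \<beta>
    and T :: "('b, 'a, 't) bimod" and T' :: "('a, 'b, 'u) bimod" +
  fixes ev :: "('u, 't) tens \<Rightarrow> 'a" and ev' :: "('t, 'u) tens \<Rightarrow> 'b"
  assumes ev_hom: "ev \<in> bimod_hom A A (T' \<^bold>\<otimes>\<^bsub>S,\<beta>\<^esub> T) (regular A)"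
    and ev'_hom: "ev' \<in> bimod_hom B B (T \<^bold>\<otimes>\<^bsub>R,\<alpha>\<^esub> T') (regular B)"
    and ev'_ev: "\<lbrakk>x \<in> carrier T; u \<in> carrier T'; y \<in> carrier T\<rbrakk> \<Longrightarrow>
      lact T (ev' (x \<diamondop>\<^bsub>T \<^bold>\<otimes>\<^bsub>R,\<alpha>\<^esub> T'\<^esub> u)) y = ract T x (ev (u \<diamondop>\<^bsub>T' \<^bold>\<otimes>\<^bsub>S,\<beta>\<^esub> T\<^esub> y))"
    and ev_ev': "\<lbrakk>u \<in> carrier T'; x \<in> carrier T; v \<in> carrier T'\<rbrakk> \<Longrightarrow>
      ract T' u (ev' (x \<diamondop>\<^bsub>T \<^bold>\<otimes>\<^bsub>R,\<alpha>\<^esub> T'\<^esub> v)) = lact T' (ev (u \<diamondop>\<^bsub>T' \<^bold>\<otimes>\<^bsub>S,\<beta>\<^esub> T\<^esub> x)) v"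

locale herd = formal_dual R A \<alpha> S B \<beta> T T' ev ev'
  for R :: "('r, 'r1) ring_scheme" and A :: "('a, 'a1) ring_scheme" and \<alpha>
    and S :: "('s, 's1) ring_scheme" and B :: "('b, 'b1) ring_scheme" and \<beta>
    and T :: "('b, 'a, 't) bimod" and T' :: "('a, 'b, 'u) bimod"
    and ev :: "('u, 't) tens \<Rightarrow> 'a" and ev' :: "('t, 'u) tens \<Rightarrow> 'b" +
  fixes \<gamma> :: "'t \<Rightarrow> ('t, ('u, 't) tens) tens"
  assumes shepherd_hom: "\<gamma> \<in> bimod_hom S R (restr \<beta> \<alpha> T)
      (restr \<beta> \<alpha> (T \<^bold>\<otimes>\<^bsub>R,\<alpha>\<^esub> (T' \<^bold>\<otimes>\<^bsub>S,\<beta>\<^esub> T)))"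
    and shepherd_ev': "x \<in> carrier T \<Longrightarrow>
      (let Q = regular B \<^bold>\<otimes>\<^bsub>S,\<beta>\<^esub> T in
        tlift3 Q (\<lambda>x1 x2 x3. ev' (x1 \<diamondop>\<^bsub>T \<^bold>\<otimes>\<^bsub>R,\<alpha>\<^esub> T'\<^esub> x2) \<diamondop>\<^bsub>Q\<^esub> x3) (\<gamma> x) = \<one>\<^bsub>B\<^esub> \<diamondop>\<^bsub>Q\<^esub> x)"
    and shepherd_ev: "x \<in> carrier T \<Longrightarrow>
      (let Q = T \<^bold>\<otimes>\<^bsub>R,\<alpha>\<^esub> regular A in
        tlift3 Q (\<lambda>x1 x2 x3. x1 \<diamondop>\<^bsub>Q\<^esub> ev (x2 \<diamondop>\<^bsub>T' \<^bold>\<otimes>\<^bsub>S,\<beta>\<^esub> T\<^esub> x3)) (\<gamma> x) = x \<diamondop>\<^bsub>Q\<^esub> \<one>\<^bsub>A\<^esub>)"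
    and shepherd_coassoc: "x \<in> carrier T \<Longrightarrow>
      (let C = T' \<^bold>\<otimes>\<^bsub>S,\<beta>\<^esub> T; W = T \<^bold>\<otimes>\<^bsub>R,\<alpha>\<^esub> C; W' = T' \<^bold>\<otimes>\<^bsub>S,\<beta>\<^esub> W; Q = T \<^bold>\<otimes>\<^bsub>R,\<alpha>\<^esub> W' in
        tlift3 Q (\<lambda>x1 x2 x3.
          tlift3 Q (\<lambda>y1 y2 y3. y1 \<diamondop>\<^bsub>Q\<^esub> (y2 \<diamondop>\<^bsub>W'\<^esub> (y3 \<diamondop>\<^bsub>W\<^esub> (x2 \<diamondop>\<^bsub>C\<^esub> x3)))) (\<gamma> x1)) (\<gamma> x) =
        tlift3 Q (\<lambda>x1 x2 x3. x1 \<diamondop>\<^bsub>Q\<^esub> (x2 \<diamondop>\<^bsub>W'\<^esub> \<gamma> x3)) (\<gamma> x))"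

text \<open>
  The shepherd followed by the canonical projection onto \<open>T \<otimes>\<^sub>A T' \<otimes>\<^sub>S T\<close>, resp. onto
  \<open>T \<otimes>\<^sub>R T' \<otimes>\<^sub>B T\<close>.  The latter is the map \<open>\<gamma>\<^sub>P\<^sub>,\<^sub>A\<close> of an \<open>A\<close>-\<open>K\<close> herd \<open>P\<close>.
\<close>

definition shepherd_right ::
  "('a, 'a1) ring_scheme \<Rightarrow> ('s, 's1) ring_scheme \<Rightarrow> ('s \<Rightarrow> 'b)
    \<Rightarrow> ('b, 'a, 't) bimod \<Rightarrow> ('a, 'b, 'u) bimod \<Rightarrow> ('t \<Rightarrow> ('t, ('u, 't) tens) tens)
    \<Rightarrow> 't \<Rightarrow> ('t, ('u, 't) tens) tens"
  where "shepherd_right A S \<beta> T T' \<gamma> x =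
    (let Q = T \<^bold>\<otimes>\<^bsub>A\<^esub> (T' \<^bold>\<otimes>\<^bsub>S,\<beta>\<^esub> T) in tlift Q (\<lambda>x1 c. x1 \<diamondop>\<^bsub>Q\<^esub> c) (\<gamma> x))"

definition shepherd_left ::
  "('r, 'r1) ring_scheme \<Rightarrow> ('r \<Rightarrow> 'a) \<Rightarrow> ('b, 'b1) ring_scheme
    \<Rightarrow> ('b, 'a, 't) bimod \<Rightarrow> ('a, 'b, 'u) bimod \<Rightarrow> ('t \<Rightarrow> ('t, ('u, 't) tens) tens)
    \<Rightarrow> 't \<Rightarrow> ('t, ('u, 't) tens) tens"
  where "shepherd_left R \<alpha> B T T' \<gamma> x =
    (let D = T' \<^bold>\<otimes>\<^bsub>B\<^esub> T; Q = T \<^bold>\<otimes>\<^bsub>R,\<alpha>\<^esub> D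
     in tlift3 Q (\<lambda>x1 x2 x3. x1 \<diamondop>\<^bsub>Q\<^esub> (x2 \<diamondop>\<^bsub>D\<^esub> x3)) (\<gamma> x))"

text \<open>
  The coproduct \<open>u \<otimes> x \<mapsto> u \<otimes> \<gamma>\<^sub>T\<^sub>,\<^sub>A(x)\<close> of \<open>C = T' \<otimes>\<^sub>S T\<close>, with
  \<open>T' \<otimes>\<^sub>S (T \<otimes>\<^sub>A C)\<close> identified with \<open>C \<otimes>\<^sub>A C\<close>.
\<close>

definition right_coring_comult ::
  "('a, 'a1) ring_scheme \<Rightarrow> ('s, 's1) ring_scheme \<Rightarrow> ('s \<Rightarrow> 'b)
    \<Rightarrow> ('b, 'a, 't) bimod \<Rightarrow> ('a, 'b, 'u) bimod \<Rightarrow> ('t \<Rightarrow> ('t, ('u, 't) tens) tens)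
    \<Rightarrow> ('u, 't) tens \<Rightarrow> (('u, 't) tens, ('u, 't) tens) tens"
  where "right_coring_comult A S \<beta> T T' \<gamma> =
    (let C = T' \<^bold>\<otimes>\<^bsub>S,\<beta>\<^esub> T; Q = C \<^bold>\<otimes>\<^bsub>A\<^esub> C in
     tlift Q (\<lambda>u x. tlift Q (\<lambda>x1 c. (u \<diamondop>\<^bsub>C\<^esub> x1) \<diamondop>\<^bsub>Q\<^esub> c) (shepherd_right A S \<beta> T T' \<gamma> x)))"

text \<open>
  The coproduct \<open>x \<otimes> u \<mapsto> \<gamma>\<^sub>T\<^sub>,\<^sub>B(x) \<otimes> u\<close> of \<open>E = T \<otimes>\<^sub>R T'\<close>, with
  \<open>(T \<otimes>\<^sub>R (T' \<otimes>\<^sub>B T)) \<otimes>\<^sub>R T'\<close> identified with \<open>E \<otimes>\<^sub>B E\<close>.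
\<close>

definition left_coring_comult ::
  "('r, 'r1) ring_scheme \<Rightarrow> ('r \<Rightarrow> 'a) \<Rightarrow> ('b, 'b1) ring_scheme
    \<Rightarrow> ('b, 'a, 't) bimod \<Rightarrow> ('a, 'b, 'u) bimod \<Rightarrow> ('t \<Rightarrow> ('t, ('u, 't) tens) tens)
    \<Rightarrow> ('t, 'u) tens \<Rightarrow> (('t, 'u) tens, ('t, 'u) tens) tens"
  where "left_coring_comult R \<alpha> B T T' \<gamma> =
    (let E = T \<^bold>\<otimes>\<^bsub>R,\<alpha>\<^esub> T'; Q = E \<^bold>\<otimes>\<^bsub>B\<^esub> E in
     tlift Q (\<lambda>x u. tlift3 Q (\<lambda>x1 x2 x3. (x1 \<diamondop>\<^bsub>E\<^esub> x2) \<diamondop>\<^bsub>Q\<^esub> (x3 \<diamondop>\<^bsub>E\<^esub> u))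
       (shepherd_left R \<alpha> B T T' \<gamma> x)))"


section \<open>The composite of two herds\<close>

text \<open>
  For \<open>V = T \<otimes>\<^sub>A P\<close> and \<open>V' = P' \<otimes>\<^sub>A T'\<close> these are
  \<open>p' \<otimes> t' \<otimes> t \<otimes> p \<mapsto> ev\<^sub>P(p' \<otimes> ev\<^sub>T(t' \<otimes> t) p)\<close> on \<open>V' \<otimes>\<^sub>S V\<close> and
  \<open>t \<otimes> p \<otimes> p' \<otimes> t' \<mapsto> ev'\<^sub>T(t ev'\<^sub>P(p \<otimes> p') \<otimes> t')\<close> on \<open>V \<otimes>\<^sub>Z V'\<close>.
\<close>

definition comp_ev ::
  "('r, 'r1) ring_scheme \<Rightarrow> ('r \<Rightarrow> 'a) \<Rightarrow> ('s, 's1) ring_scheme \<Rightarrow> ('s \<Rightarrow> 'b)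
    \<Rightarrow> ('k, 'k1) ring_scheme
    \<Rightarrow> ('b, 'a, 't) bimod \<Rightarrow> ('a, 'b, 'u) bimod \<Rightarrow> (('u, 't) tens \<Rightarrow> 'a)
    \<Rightarrow> ('a, 'k, 'p) bimod \<Rightarrow> ('k, 'a, 'q) bimod \<Rightarrow> (('q, 'p) tens \<Rightarrow> 'k)
    \<Rightarrow> (('q, 'u) tens, ('t, 'p) tens) tens \<Rightarrow> 'k"
  where "comp_ev R \<alpha> S \<beta> K T T' ev\<^sub>T P P' ev\<^sub>P =
    tlift K (\<lambda>v' v.
      tlift K (\<lambda>p' t'.
        tlift K (\<lambda>t p.
          ev\<^sub>P (p' \<diamondop>\<^bsub>P' \<^bold>\<otimes>\<^bsub>R,\<alpha>\<^esub> P\<^esub> lact P (ev\<^sub>T (t' \<diamondop>\<^bsub>T' \<^bold>\<otimes>\<^bsub>S,\<beta>\<^esub> T\<^esub> t)) p)) v) v')"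

definition comp_ev' ::
  "('r, 'r1) ring_scheme \<Rightarrow> ('r \<Rightarrow> 'a) \<Rightarrow> ('z, 'z1) ring_scheme \<Rightarrow> ('z \<Rightarrow> 'k)
    \<Rightarrow> ('b, 'b1) ring_scheme
    \<Rightarrow> ('b, 'a, 't) bimod \<Rightarrow> ('a, 'b, 'u) bimod \<Rightarrow> (('t, 'u) tens \<Rightarrow> 'b)
    \<Rightarrow> ('a, 'k, 'p) bimod \<Rightarrow> ('k, 'a, 'q) bimod \<Rightarrow> (('p, 'q) tens \<Rightarrow> 'a)
    \<Rightarrow> (('t, 'p) tens, ('q, 'u) tens) tens \<Rightarrow> 'b"
  where "comp_ev' R \<alpha> Z \<kappa> B T T' ev'\<^sub>T P P' ev'\<^sub>P =
    tlift B (\<lambda>v v'.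
      tlift B (\<lambda>t p.
        tlift B (\<lambda>p' t'.
          ev'\<^sub>T (ract T t (ev'\<^sub>P (p \<diamondop>\<^bsub>P \<^bold>\<otimes>\<^bsub>Z,\<kappa>\<^esub> P'\<^esub> p')) \<diamondop>\<^bsub>T \<^bold>\<otimes>\<^bsub>R,\<alpha>\<^esub> T'\<^esub> t')) v') v)"

text \<open>
  \<open>\<gamma>\<^sub>T\<^sub>,\<^sub>A \<otimes>\<^sub>A P = (T \<otimes>\<^sub>A ev'\<^sub>P \<otimes>\<^sub>A T' \<otimes>\<^sub>S T \<otimes>\<^sub>A P) \<circ> \<gamma>\<^sub>V\<close>, both sides taking values in
  \<open>T \<otimes>\<^sub>A (T' \<otimes>\<^sub>S (T \<otimes>\<^sub>A P))\<close>.
\<close>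

definition shepherd_compat_right ::
  "('a, 'a1) ring_scheme \<Rightarrow> ('s, 's1) ring_scheme \<Rightarrow> ('s \<Rightarrow> 'b)
    \<Rightarrow> ('z, 'z1) ring_scheme \<Rightarrow> ('z \<Rightarrow> 'k)
    \<Rightarrow> ('b, 'a, 't) bimod \<Rightarrow> ('a, 'b, 'u) bimod \<Rightarrow> ('t \<Rightarrow> ('t, ('u, 't) tens) tens)
    \<Rightarrow> ('a, 'k, 'p) bimod \<Rightarrow> ('k, 'a, 'q) bimod \<Rightarrow> (('p, 'q) tens \<Rightarrow> 'a)
    \<Rightarrow> (('t, 'p) tens \<Rightarrow> (('t, 'p) tens, (('q, 'u) tens, ('t, 'p) tens) tens) tens) \<Rightarrow> bool"
  where "shepherd_compat_right A S \<beta> Z \<kappa> T T' \<gamma>\<^sub>T P P' ev'\<^sub>P \<gamma>\<^sub>V \<longleftrightarrow>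
    (let V = T \<^bold>\<otimes>\<^bsub>A\<^esub> P; W = T' \<^bold>\<otimes>\<^bsub>S,\<beta>\<^esub> V; Q = T \<^bold>\<otimes>\<^bsub>A\<^esub> W in
     \<forall>v\<in>carrier V.
       tlift Q (\<lambda>t p.
         tlift3 Q (\<lambda>t1 t2 t3. t1 \<diamondop>\<^bsub>Q\<^esub> (t2 \<diamondop>\<^bsub>W\<^esub> (t3 \<diamondop>\<^bsub>V\<^esub> p))) (shepherd_right A S \<beta> T T' \<gamma>\<^sub>T t)) v =
       tlift3 Q (\<lambda>v1 v2 v3.
         tlift Q (\<lambda>t p.
           tlift Q (\<lambda>p' t'. ract T t (ev'\<^sub>P (p \<diamondop>\<^bsub>P \<^bold>\<otimes>\<^bsub>Z,\<kappa>\<^esub> P'\<^esub> p')) \<diamondop>\<^bsub>Q\<^esub> (t' \<diamondop>\<^bsub>W\<^esub> v3)) v2) v1)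
         (\<gamma>\<^sub>V v))"

text \<open>
  \<open>T \<otimes>\<^sub>A \<gamma>\<^sub>P\<^sub>,\<^sub>A = (T \<otimes>\<^sub>A P \<otimes>\<^sub>Z P' \<otimes>\<^sub>A ev\<^sub>T \<otimes>\<^sub>A P) \<circ> \<gamma>\<^sub>V\<close>, both sides taking values in
  \<open>(T \<otimes>\<^sub>A P) \<otimes>\<^sub>Z (P' \<otimes>\<^sub>A P)\<close>.
\<close>

definition shepherd_compat_left ::
  "('a, 'a1) ring_scheme \<Rightarrow> ('s, 's1) ring_scheme \<Rightarrow> ('s \<Rightarrow> 'b)
    \<Rightarrow> ('z, 'z1) ring_scheme \<Rightarrow> ('z \<Rightarrow> 'k)
    \<Rightarrow> ('b, 'a, 't) bimod \<Rightarrow> ('a, 'b, 'u) bimod \<Rightarrow> (('u, 't) tens \<Rightarrow> 'a)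
    \<Rightarrow> ('a, 'k, 'p) bimod \<Rightarrow> ('k, 'a, 'q) bimod \<Rightarrow> ('p \<Rightarrow> ('p, ('q, 'p) tens) tens)
    \<Rightarrow> (('t, 'p) tens \<Rightarrow> (('t, 'p) tens, (('q, 'u) tens, ('t, 'p) tens) tens) tens) \<Rightarrow> bool"
  where "shepherd_compat_left A S \<beta> Z \<kappa> T T' ev\<^sub>T P P' \<gamma>\<^sub>P \<gamma>\<^sub>V \<longleftrightarrow>
    (let V = T \<^bold>\<otimes>\<^bsub>A\<^esub> P; W = P' \<^bold>\<otimes>\<^bsub>A\<^esub> P; Q = V \<^bold>\<otimes>\<^bsub>Z,\<kappa>\<^esub> W in
     \<forall>v\<in>carrier V.
       tlift Q (\<lambda>t p.
         tlift Q (\<lambda>p1 w. (t \<diamondop>\<^bsub>V\<^esub> p1) \<diamondop>\<^bsub>Q\<^esub> w) (shepherd_left Z \<kappa> A P P' \<gamma>\<^sub>P p)) v =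
       tlift3 Q (\<lambda>v1 v2 v3.
         tlift Q (\<lambda>p' t'.
           tlift Q (\<lambda>t p. v1 \<diamondop>\<^bsub>Q\<^esub> (p' \<diamondop>\<^bsub>W\<^esub> lact P (ev\<^sub>T (t' \<diamondop>\<^bsub>T' \<^bold>\<otimes>\<^bsub>S,\<beta>\<^esub> T\<^esub> t)) p)) v3) v2)
         (\<gamma>\<^sub>V v))"

end

theory Submission
  imports Defs
begin

text \<open>
  Write \<open>\<theta>\<^sub>1(t', t \<otimes> p) = ev\<^sub>T(t' \<otimes> t) p\<close> and \<open>\<theta>\<^sub>3(t \<otimes> p, p') = t ev'\<^sub>P(p \<otimes> p')\<close> for the two partial
  evaluations of \<open>V = T \<otimes>\<^sub>A P\<close>.

  Given a shepherd with \<open>\<gamma>\<^sub>V(t \<otimes> p) = v\<^sub>1 \<otimes> (q \<otimes> u) \<otimes> v\<^sub>3\<close>, one sets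
  \<open>\<sigma>((t' \<otimes> t) \<otimes> (p \<otimes> p')) = (\<theta>\<^sub>1(t', v\<^sub>1) \<otimes> q) \<otimes> (u \<otimes> \<theta>\<^sub>3(v\<^sub>3, p'))\<close>.  The two compatibility conditions compute
  the right \<open>C\<close>-coaction of \<open>T\<close> on \<open>\<theta>\<^sub>3(v, p')\<close> and the left \<open>E\<close>-coaction of \<open>P\<close> on \<open>\<theta>\<^sub>1(t', v)\<close> in terms of
  \<open>\<gamma>\<^sub>V\<close>; with this the multiplicativity of \<open>\<sigma>\<close> becomes the coassociativity of \<open>\<gamma>\<^sub>V\<close>, and its counit
  conditions follow from those of \<open>\<gamma>\<^sub>T\<close> and \<open>\<gamma>\<^sub>P\<close>.

  Conversely, given \<open>\<sigma>\<close>, let \<open>C\<close> coact on \<open>t\<close> and \<open>E\<close> on \<open>p\<close> and exchange the two middle factors by \<open>\<sigma>\<close>: this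
  is \<open>\<gamma>\<^sub>V(t \<otimes> p)\<close>.  The compatibility conditions are the counit conditions of \<open>\<sigma>\<close>, and they imply the two
  evaluation laws of \<open>\<gamma>\<^sub>V\<close>.  The coassociativity of \<open>\<gamma>\<^sub>V\<close> and that of the smash coproduct are the cases
  \<open>(M, N) = (T, P)\<close> and \<open>(M, N) = (C, E)\<close> of one identity for a right \<open>C\<close>-comodule \<open>M\<close> and a left
  \<open>E\<close>-comodule \<open>N\<close>.

  Shepherds are linear only over the small rings.  The linearity of the coactions over the large ones comes from
  the identity \<open>ev'\<^sub>T(x \<otimes> u) \<gamma>\<^sub>T\<^sub>,\<^sub>A(y) = x \<otimes> (u \<otimes> y)\<close> together with the evaluation laws.
\<close>

section \<open>The universal property of the tensor product\<close>

text \<open>A tensor product is a set of cosets, so Sweedler sums become nested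
  \<open>tlift\<close>s, and a \<open>tlift\<close> means something only when its integrand is
  balanced. Every rewriting step thus carries linearity conditions on all its parts. To keep these
  mechanical, an equation is mostly stated after integration against an arbitrary balanced map
  (names in \<open>_int\<close>), and rule collections discharge the conditions. A second obstacle
  is that two rings act at each tensor sign: a herd is formed over the small rings, while
  \<open>V\<close> and the products of corings are formed over \<open>A\<close>. Both evaluations of
  a herd, given over a small ring, must first be shown to be balanced over the large one.

  The formula for \<open>\<sigma>\<close> comes from reading
  \<open>V \<otimes> V' \<otimes> V\<close> as \<open>T \<otimes> P \<otimes> P' \<otimes> T'
  \<otimes> T \<otimes> P\<close>. Tensoring with \<open>T'\<close> on the left and
  \<open>P'\<close> on the right and contracting the two outermost pairs leaves
  \<open>P \<otimes> P' \<otimes> T' \<otimes> T\<close>, which is \<open>E \<otimes> C\<close>; the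
  contractions are the partial evaluations.\<close>

definition lmod :: "('x, 'x1) ring_scheme \<Rightarrow> ('x, 'r, 'm, 'm1) bimod_scheme \<Rightarrow> bool"
  where "lmod H M \<longleftrightarrow> abelian_group M \<and> (\<forall>r\<in>carrier H. \<forall>x\<in>carrier M. lact M r x \<in> carrier M)"

definition rmod :: "('x, 'x1) ring_scheme \<Rightarrow> ('l, 'x, 'm, 'm1) bimod_scheme \<Rightarrow> bool"
  where "rmod H M \<longleftrightarrow> abelian_group M \<and> (\<forall>r\<in>carrier H. \<forall>x\<in>carrier M. ract M x r \<in> carrier M)"

definition add_map :: "('m, 'm1) ring_scheme \<Rightarrow> ('g, 'g1) ring_scheme \<Rightarrow> ('m \<Rightarrow> 'g) \<Rightarrow> bool"
  where "add_map M G f \<longleftrightarrow> abelian_group M \<and> abelian_group G \<and> f \<in> carrier M \<rightarrow> carrier G \<and>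
    (\<forall>x\<in>carrier M. \<forall>y\<in>carrier M. f (x \<oplus>\<^bsub>M\<^esub> y) = f x \<oplus>\<^bsub>G\<^esub> f y)"

definition llin ::
  "('x, 'x1) ring_scheme \<Rightarrow> ('x, 'r, 'm, 'm1) bimod_scheme \<Rightarrow> ('x, 's, 'n, 'n1) bimod_scheme
    \<Rightarrow> ('m \<Rightarrow> 'n) \<Rightarrow> bool"
  where "llin H M N f \<longleftrightarrow> lmod H M \<and> lmod H N \<and> add_map M N f \<and>
    (\<forall>r\<in>carrier H. \<forall>x\<in>carrier M. f (lact M r x) = lact N r (f x))"

definition rlin ::
  "('x, 'x1) ring_scheme \<Rightarrow> ('l, 'x, 'm, 'm1) bimod_scheme \<Rightarrow> ('k, 'x, 'n, 'n1) bimod_scheme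
    \<Rightarrow> ('m \<Rightarrow> 'n) \<Rightarrow> bool"
  where "rlin H M N f \<longleftrightarrow> rmod H M \<and> rmod H N \<and> add_map M N f \<and>
    (\<forall>r\<in>carrier H. \<forall>x\<in>carrier M. f (ract M x r) = ract N (f x) r)"

text \<open>The conditions on the modules and on \<open>G\<close> are bundled in, so that a single
  fact about the integrand yields what the rules for \<open>tlift\<close> ask for.
  \<open>rmod\<close> and \<open>lmod\<close> record closure of the action, which is what the
  relations of a tensor product refer to.\<close>

definition balanced ::
  "('x, 'x1) ring_scheme \<Rightarrow> ('l, 'x, 'm, 'm1) bimod_scheme \<Rightarrow> ('x, 'r, 'n, 'n1) bimod_scheme
    \<Rightarrow> ('g, 'g1) ring_scheme \<Rightarrow> ('m \<Rightarrow> 'n \<Rightarrow> 'g) \<Rightarrow> bool"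
  where "balanced H M N G f \<longleftrightarrow> rmod H M \<and> lmod H N \<and>
    (\<forall>y\<in>carrier N. add_map M G (\<lambda>x. f x y)) \<and> (\<forall>x\<in>carrier M. add_map N G (f x)) \<and>
    (\<forall>x\<in>carrier M. \<forall>r\<in>carrier H. \<forall>y\<in>carrier N. f (ract M x r) y = f x (lact N r y))"

lemma add_mapI:
  assumes "abelian_group M" "abelian_group G" "\<And>x. x \<in> carrier M \<Longrightarrow> f x \<in> carrier G"
    and "\<And>x y. x \<in> carrier M \<Longrightarrow> y \<in> carrier M \<Longrightarrow> f (x \<oplus>\<^bsub>M\<^esub> y) = f x \<oplus>\<^bsub>G\<^esub> f y"
  shows "add_map M G f"
  using assms by (auto simp: add_map_def)

lemma add_map_closed: "add_map M G f \<Longrightarrow> x \<in> carrier M \<Longrightarrow> f x \<in> carrier G"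
  by (auto simp: add_map_def)

lemma add_map_add:
  "add_map M G f \<Longrightarrow> x \<in> carrier M \<Longrightarrow> y \<in> carrier M \<Longrightarrow> f (x \<oplus>\<^bsub>M\<^esub> y) = f x \<oplus>\<^bsub>G\<^esub> f y"
  by (auto simp: add_map_def)

lemma add_map_groups: "add_map M G f \<Longrightarrow> abelian_group M" "add_map M G f \<Longrightarrow> abelian_group G"
  by (auto simp: add_map_def)

lemma add_map_zero:
  assumes "add_map M G f"
  shows "f \<zero>\<^bsub>M\<^esub> = \<zero>\<^bsub>G\<^esub>"
proof -
  interpret M: abelian_group M using assms by (rule add_map_groups)
  interpret G: abelian_group G using assms by (rule add_map_groups)
  have "f \<zero>\<^bsub>M\<^esub> \<oplus>\<^bsub>G\<^esub> f \<zero>\<^bsub>M\<^esub> = f \<zero>\<^bsub>M\<^esub> \<oplus>\<^bsub>G\<^esub> \<zero>\<^bsub>G\<^esub>"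
    using add_map_add[OF assms, of "\<zero>\<^bsub>M\<^esub>" "\<zero>\<^bsub>M\<^esub>"] add_map_closed[OF assms, of "\<zero>\<^bsub>M\<^esub>"] by simp
  then show ?thesis
    using add_map_closed[OF assms, of "\<zero>\<^bsub>M\<^esub>"] by (metis G.add.l_cancel G.zero_closed M.zero_closed)
qed

lemma add_map_minus:
  assumes "add_map M G f" "x \<in> carrier M"
  shows "f (\<ominus>\<^bsub>M\<^esub> x) = \<ominus>\<^bsub>G\<^esub> f x"
proof -
  interpret M: abelian_group M using assms by (auto simp: add_map_def)
  interpret G: abelian_group G using assms by (auto simp: add_map_def)
  have "f (\<ominus>\<^bsub>M\<^esub> x) \<oplus>\<^bsub>G\<^esub> f x = \<zero>\<^bsub>G\<^esub>"
    using add_map_add[OF assms(1), of "\<ominus>\<^bsub>M\<^esub> x" x] assms add_map_zero[OF assms(1)]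
    by (simp add: M.l_neg)
  then show ?thesis
    using assms by (metis G.minus_equality M.a_inv_closed add_map_closed)
qed

lemma balancedD:
  assumes "balanced H M N G f"
  shows "rmod H M" "lmod H N" "abelian_group G"
    and "y \<in> carrier N \<Longrightarrow> add_map M G (\<lambda>x. f x y)" "x \<in> carrier M \<Longrightarrow> add_map N G (f x)"
    and "x \<in> carrier M \<Longrightarrow> y \<in> carrier N \<Longrightarrow> f x y \<in> carrier G"
    and "x \<in> carrier M \<Longrightarrow> x' \<in> carrier M \<Longrightarrow> y \<in> carrier N \<Longrightarrow>
      f (x \<oplus>\<^bsub>M\<^esub> x') y = f x y \<oplus>\<^bsub>G\<^esub> f x' y"
    and "x \<in> carrier M \<Longrightarrow> y \<in> carrier N \<Longrightarrow> y' \<in> carrier N \<Longrightarrow>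
      f x (y \<oplus>\<^bsub>N\<^esub> y') = f x y \<oplus>\<^bsub>G\<^esub> f x y'"
    and "x \<in> carrier M \<Longrightarrow> r \<in> carrier H \<Longrightarrow> y \<in> carrier N \<Longrightarrow> f (ract M x r) y = f x (lact N r y)"
proof -
  show "rmod H M" "lmod H N" using assms by (auto simp: balanced_def)
  \<comment> \<open>Zero provides an argument at which a partial map exists; the additivity of that
    map contains the fact that \<open>G\<close> is a group.\<close>
  then have "\<zero>\<^bsub>M\<^esub> \<in> carrier M"
    by (auto simp: rmod_def abelian_group_def abelian_monoid.zero_closed)
  then show "abelian_group G"
    using assms by (auto simp: balanced_def add_map_def)
qed (use assms in \<open>auto simp: balanced_def add_map_def\<close>)

lemma balancedI:
  assumes "rmod H M" "lmod H N" "abelian_group G"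
    and "\<And>x y. x \<in> carrier M \<Longrightarrow> y \<in> carrier N \<Longrightarrow> f x y \<in> carrier G"
    and "\<And>x x' y. x \<in> carrier M \<Longrightarrow> x' \<in> carrier M \<Longrightarrow> y \<in> carrier N \<Longrightarrow>
      f (x \<oplus>\<^bsub>M\<^esub> x') y = f x y \<oplus>\<^bsub>G\<^esub> f x' y"
    and "\<And>x y y'. x \<in> carrier M \<Longrightarrow> y \<in> carrier N \<Longrightarrow> y' \<in> carrier N \<Longrightarrow>
      f x (y \<oplus>\<^bsub>N\<^esub> y') = f x y \<oplus>\<^bsub>G\<^esub> f x y'"
    and "\<And>x r y. x \<in> carrier M \<Longrightarrow> r \<in> carrier H \<Longrightarrow> y \<in> carrier N \<Longrightarrow>
      f (ract M x r) y = f x (lact N r y)"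
  shows "balanced H M N G f"
  using assms by (auto simp: balanced_def add_map_def rmod_def lmod_def)

section \<open>Cosets in the free abelian group on pairs\<close>

locale tensorable =
  fixes H :: "('x, 'x1) ring_scheme" and M :: "('l, 'x, 'm, 'm1) bimod_scheme"
    and N :: "('x, 'r, 'n, 'n1) bimod_scheme"
  assumes rmod: "rmod H M" and lmod: "lmod H N"
begin

sublocale M: abelian_group M using rmod by (simp add: rmod_def)
sublocale N: abelian_group N using lmod by (simp add: lmod_def)

abbreviation "FG \<equiv> free_Abelian_group (carrier M \<times> carrier N)"
abbreviation "Rel \<equiv> generate FG (tensor_rels H M N)"

sublocale F: comm_group FG by (rule abelian_free_Abelian_group)

lemma rels_subset: "tensor_rels H M N \<subseteq> carrier FG"
  using rmod lmod unfolding tensor_rels_def rmod_def lmod_def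
  by (auto dest!: subsetD[OF keys_diff])

lemma subgroup_Rel: "subgroup Rel FG"
  by (rule F.generate_is_subgroup[OF rels_subset])

sublocale I: normal Rel FG
  using F.subgroup_imp_normal[OF subgroup_Rel] .

lemma tensor_group_simps:
  "carrier (tensor_group H M N) = rcosets\<^bsub>FG\<^esub> Rel"
  "u \<oplus>\<^bsub>tensor_group H M N\<^esub> v = u <#>\<^bsub>FG\<^esub> v"
  "\<zero>\<^bsub>tensor_group H M N\<^esub> = Rel"
  by (simp_all add: tensor_group_def FactGroup_def Let_def)

lemma abelian_group_tensor_group: "abelian_group (tensor_group H M N)"
proof -
  have "comm_group (FG Mod Rel)"
    by (rule F.abelian_FactGroup[OF subgroup_Rel])
  moreover have "add_monoid (tensor_group H M N) = FG Mod Rel"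
    by (simp add: tensor_group_def FactGroup_def Let_def)
  ultimately show ?thesis
    by (simp add: abelian_group_def abelian_monoid_def abelian_group_axioms_def comm_group_def)
qed

lemma coset_cases:
  assumes "u \<in> carrier (tensor_group H M N)"
  obtains c where "Poly_Mapping.keys c \<subseteq> carrier M \<times> carrier N" "u = Rel #>\<^bsub>FG\<^esub> c"
  using assms by (auto simp: tensor_group_simps RCOSETS_def)

text \<open>The description in \<open>pure_tensor\<close> has exactly one solution because the
  cosets partition the free abelian group: a coset that contains the generator is the coset of the
  generator.\<close>

lemma pure_tensor_coset:
  assumes "x \<in> carrier M" "y \<in> carrier N" "carrier Q = carrier (tensor_group H M N)"
  shows "pure_tensor Q x y = Rel #>\<^bsub>FG\<^esub> frag_of (x, y)"
proof -
  have xy: "frag_of (x, y) \<in> carrier FG" using assms by simp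
  show ?thesis unfolding pure_tensor_def assms(3) tensor_group_simps
  proof (rule the_equality)
    show "Rel #>\<^bsub>FG\<^esub> frag_of (x, y) \<in> rcosets\<^bsub>FG\<^esub> Rel \<and> frag_of (x, y) \<in> Rel #>\<^bsub>FG\<^esub> frag_of (x, y)"
      using F.rcos_self[OF xy subgroup_Rel] F.rcosetsI[OF I.subset xy] by blast
  next
    fix u assume u: "u \<in> rcosets\<^bsub>FG\<^esub> Rel \<and> frag_of (x, y) \<in> u"
    then obtain c where c: "c \<in> carrier FG" "u = Rel #>\<^bsub>FG\<^esub> c" by (auto simp: RCOSETS_def)
    show "u = Rel #>\<^bsub>FG\<^esub> frag_of (x, y)"
      using u c F.repr_independence[OF _ c(1) subgroup_Rel] by blast
  qed
qed

lemma coset_diff: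
  assumes "Poly_Mapping.keys c \<subseteq> carrier M \<times> carrier N" "Poly_Mapping.keys d \<subseteq> carrier M \<times> carrier N"
    and "c - d \<in> Rel"
  shows "Rel #>\<^bsub>FG\<^esub> c = Rel #>\<^bsub>FG\<^esub> d"
proof -
  have "c = (c - d) \<otimes>\<^bsub>FG\<^esub> d" by simp
  then have "c \<in> Rel #>\<^bsub>FG\<^esub> d" using assms(3) unfolding r_coset_def by blast
  then show ?thesis using F.repr_independence[of c Rel d] assms subgroup_Rel by simp
qed

lemma coset_plus:
  assumes "Poly_Mapping.keys c \<subseteq> carrier M \<times> carrier N" "Poly_Mapping.keys d \<subseteq> carrier M \<times> carrier N"
  shows "Rel #>\<^bsub>FG\<^esub> (c + d) = (Rel #>\<^bsub>FG\<^esub> c) \<oplus>\<^bsub>tensor_group H M N\<^esub> (Rel #>\<^bsub>FG\<^esub> d)"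
  using I.rcos_sum[of c d] assms by (simp add: tensor_group_simps)

lemma coset_uminus:
  assumes "Poly_Mapping.keys c \<subseteq> carrier M \<times> carrier N"
  shows "Rel #>\<^bsub>FG\<^esub> (- c) = \<ominus>\<^bsub>tensor_group H M N\<^esub> (Rel #>\<^bsub>FG\<^esub> c)"
proof -
  interpret Q: abelian_group "tensor_group H M N" by (rule abelian_group_tensor_group)
  have k: "Poly_Mapping.keys (- c) \<subseteq> carrier M \<times> carrier N" using assms by simp
  have "Rel #>\<^bsub>FG\<^esub> (0::('m \<times> 'n) \<Rightarrow>\<^sub>0 int) = Rel"
    using F.coset_mult_one[OF I.subset] by simp
  then have "(Rel #>\<^bsub>FG\<^esub> (- c)) \<oplus>\<^bsub>tensor_group H M N\<^esub> (Rel #>\<^bsub>FG\<^esub> c) = \<zero>\<^bsub>tensor_group H M N\<^esub>"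
    using coset_plus[OF k assms] by (simp add: tensor_group_simps)
  moreover have "Rel #>\<^bsub>FG\<^esub> c \<in> carrier (tensor_group H M N)"
    "Rel #>\<^bsub>FG\<^esub> (-c) \<in> carrier (tensor_group H M N)"
    using assms k by (auto simp: tensor_group_simps intro!: F.rcosetsI I.subset)
  ultimately show ?thesis using Q.minus_equality by metis
qed

lemma pure_tensor_group:
  shows "\<lbrakk>x \<in> carrier M; y \<in> carrier N\<rbrakk> \<Longrightarrow>
      pure_tensor (tensor_group H M N) x y \<in> carrier (tensor_group H M N)"
    and "\<lbrakk>x \<in> carrier M; x' \<in> carrier M; y \<in> carrier N\<rbrakk> \<Longrightarrow>
      pure_tensor (tensor_group H M N) (x \<oplus>\<^bsub>M\<^esub> x') y =
        pure_tensor (tensor_group H M N) x y \<oplus>\<^bsub>tensor_group H M N\<^esub> pure_tensor (tensor_group H M N) x' y"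
    and "\<lbrakk>x \<in> carrier M; y \<in> carrier N; y' \<in> carrier N\<rbrakk> \<Longrightarrow>
      pure_tensor (tensor_group H M N) x (y \<oplus>\<^bsub>N\<^esub> y') =
        pure_tensor (tensor_group H M N) x y \<oplus>\<^bsub>tensor_group H M N\<^esub> pure_tensor (tensor_group H M N) x y'"
    and "\<lbrakk>x \<in> carrier M; r \<in> carrier H; y \<in> carrier N\<rbrakk> \<Longrightarrow>
      pure_tensor (tensor_group H M N) (ract M x r) y = pure_tensor (tensor_group H M N) x (lact N r y)"
proof -
  note [simp] = pure_tensor_coset[OF _ _ refl]
  show "pure_tensor (tensor_group H M N) x y \<in> carrier (tensor_group H M N)"
    if "x \<in> carrier M" "y \<in> carrier N"
    using that by (auto simp: tensor_group_simps intro!: F.rcosetsI I.subset)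
  show "pure_tensor (tensor_group H M N) (x \<oplus>\<^bsub>M\<^esub> x') y =
      pure_tensor (tensor_group H M N) x y \<oplus>\<^bsub>tensor_group H M N\<^esub> pure_tensor (tensor_group H M N) x' y"
    if h: "x \<in> carrier M" "x' \<in> carrier M" "y \<in> carrier N"
  proof -
    have "frag_of (x \<oplus>\<^bsub>M\<^esub> x', y) - (frag_of (x, y) + frag_of (x', y)) \<in> tensor_rels H M N"
      using h unfolding tensor_rels_def by (auto simp: diff_diff_eq[symmetric])
    then have "Rel #>\<^bsub>FG\<^esub> frag_of (x \<oplus>\<^bsub>M\<^esub> x', y) = Rel #>\<^bsub>FG\<^esub> (frag_of (x, y) + frag_of (x', y))"
      using h by (intro coset_diff generate.incl) (auto intro!: order_trans[OF keys_add])
    then show ?thesis using h by (simp add: coset_plus)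
  qed
  show "pure_tensor (tensor_group H M N) x (y \<oplus>\<^bsub>N\<^esub> y') =
      pure_tensor (tensor_group H M N) x y \<oplus>\<^bsub>tensor_group H M N\<^esub> pure_tensor (tensor_group H M N) x y'"
    if h: "x \<in> carrier M" "y \<in> carrier N" "y' \<in> carrier N"
  proof -
    have "frag_of (x, y \<oplus>\<^bsub>N\<^esub> y') - (frag_of (x, y) + frag_of (x, y')) \<in> tensor_rels H M N"
      using h unfolding tensor_rels_def by (auto simp: diff_diff_eq[symmetric])
    then have "Rel #>\<^bsub>FG\<^esub> frag_of (x, y \<oplus>\<^bsub>N\<^esub> y') = Rel #>\<^bsub>FG\<^esub> (frag_of (x, y) + frag_of (x, y'))"
      using h by (intro coset_diff generate.incl) (auto intro!: order_trans[OF keys_add])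
    then show ?thesis using h by (simp add: coset_plus)
  qed
  show "pure_tensor (tensor_group H M N) (ract M x r) y = pure_tensor (tensor_group H M N) x (lact N r y)"
    if h: "x \<in> carrier M" "r \<in> carrier H" "y \<in> carrier N"
  proof -
    have c: "ract M x r \<in> carrier M" "lact N r y \<in> carrier N"
      using h rmod lmod by (auto simp: rmod_def lmod_def)
    have "frag_of (ract M x r, y) - frag_of (x, lact N r y) \<in> tensor_rels H M N"
      using h unfolding tensor_rels_def by auto
    then have "Rel #>\<^bsub>FG\<^esub> frag_of (ract M x r, y) = Rel #>\<^bsub>FG\<^esub> frag_of (x, lact N r y)"
      using h c by (intro coset_diff generate.incl) auto
    then show ?thesis using h c by simp
  qed
qed

text \<open>Negatives and zero get no case of their own: the negative of a pure tensor is pure, with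
  the sign put on \<open>x\<close>, and zero is a pure tensor with first entry zero.\<close>

lemma tensor_group_induct:
  assumes u: "u \<in> carrier (tensor_group H M N)"
    and pure: "\<And>x y. x \<in> carrier M \<Longrightarrow> y \<in> carrier N \<Longrightarrow> P (pure_tensor (tensor_group H M N) x y)"
    and plus: "\<And>u v. \<lbrakk>u \<in> carrier (tensor_group H M N); v \<in> carrier (tensor_group H M N); P u; P v\<rbrakk>
      \<Longrightarrow> P (u \<oplus>\<^bsub>tensor_group H M N\<^esub> v)"
  shows "P u"
proof -
  let ?Q = "tensor_group H M N"
  interpret Q: abelian_group ?Q by (rule abelian_group_tensor_group)
  have neg: "\<ominus>\<^bsub>?Q\<^esub> pure_tensor ?Q x y = pure_tensor ?Q (\<ominus>\<^bsub>M\<^esub> x) y" and zero: "pure_tensor ?Q \<zero>\<^bsub>M\<^esub> y = \<zero>\<^bsub>?Q\<^esub>"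
    if "x \<in> carrier M" "y \<in> carrier N" for x y
  proof -
    have a: "add_map M ?Q (\<lambda>x. pure_tensor ?Q x y)"
      using that by (intro add_mapI) (auto simp: pure_tensor_group M.abelian_group_axioms Q.abelian_group_axioms)
    show "\<ominus>\<^bsub>?Q\<^esub> pure_tensor ?Q x y = pure_tensor ?Q (\<ominus>\<^bsub>M\<^esub> x) y" "pure_tensor ?Q \<zero>\<^bsub>M\<^esub> y = \<zero>\<^bsub>?Q\<^esub>"
      using add_map_minus[OF a] add_map_zero[OF a] that by auto
  qed
  \<comment> \<open>The induction principle of the free abelian group passes from \<open>c\<close>
    and \<open>d\<close> to \<open>c - d\<close>, so the property is carried along for a coset
    together with its negative.\<close>
  have "P (Rel #>\<^bsub>FG\<^esub> c) \<and> P (Rel #>\<^bsub>FG\<^esub> (- c))" if "Poly_Mapping.keys c \<subseteq> carrier M \<times> carrier N" for c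
  proof (rule free_Abelian_group_induct[OF that])
    have "Rel #>\<^bsub>FG\<^esub> (0::('m \<times> 'n) \<Rightarrow>\<^sub>0 int) = \<zero>\<^bsub>?Q\<^esub>"
      using F.coset_mult_one[OF I.subset] by (simp add: tensor_group_simps)
    then show "P (Rel #>\<^bsub>FG\<^esub> 0) \<and> P (Rel #>\<^bsub>FG\<^esub> (- 0))"
      using pure[of "\<zero>\<^bsub>M\<^esub>" "\<zero>\<^bsub>N\<^esub>"] zero[of "\<zero>\<^bsub>M\<^esub>" "\<zero>\<^bsub>N\<^esub>"] by simp
  next
    fix c d assume 2: "Poly_Mapping.keys c \<subseteq> carrier M \<times> carrier N" "Poly_Mapping.keys d \<subseteq> carrier M \<times> carrier N"
      "P (Rel #>\<^bsub>FG\<^esub> c) \<and> P (Rel #>\<^bsub>FG\<^esub> (- c))" "P (Rel #>\<^bsub>FG\<^esub> d) \<and> P (Rel #>\<^bsub>FG\<^esub> (- d))"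
    have Q: "Rel #>\<^bsub>FG\<^esub> a \<in> carrier ?Q" if "Poly_Mapping.keys a \<subseteq> carrier M \<times> carrier N" for a
      using that by (auto simp: tensor_group_simps intro!: F.rcosetsI I.subset)
    have "P (Rel #>\<^bsub>FG\<^esub> (c + - d))" "P (Rel #>\<^bsub>FG\<^esub> (- c + d))"
      using 2 coset_plus[of c "- d"] coset_plus[of "- c" d] Q
      by (auto intro!: plus)
    then show "P (Rel #>\<^bsub>FG\<^esub> (c - d)) \<and> P (Rel #>\<^bsub>FG\<^esub> (- (c - d)))"
      by (simp add: add.commute[of "- c" d])
  next
    fix a assume "a \<in> carrier M \<times> carrier N"
    then obtain x y where a: "a = (x, y)" "x \<in> carrier M" "y \<in> carrier N" by auto
    have "Rel #>\<^bsub>FG\<^esub> frag_of a = pure_tensor ?Q x y" 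
      using a pure_tensor_coset by auto
    moreover have "Rel #>\<^bsub>FG\<^esub> (- frag_of a) = pure_tensor ?Q (\<ominus>\<^bsub>M\<^esub> x) y"
      using a coset_uminus[of "frag_of a"] neg[of x y] pure_tensor_coset[OF a(2,3) refl] by auto
    ultimately show "P (Rel #>\<^bsub>FG\<^esub> frag_of a) \<and> P (Rel #>\<^bsub>FG\<^esub> (- frag_of a))"
      using pure a by auto
  qed
  then show ?thesis using u coset_cases by metis
qed

end

text \<open>The linear extension to the free abelian group underlying \<^const>\<open>tlift\<close>.\<close>

definition frag_lift :: "('g, 'g1) ring_scheme \<Rightarrow> ('m \<Rightarrow> 'n \<Rightarrow> 'g) \<Rightarrow> (('m \<times> 'n) \<Rightarrow>\<^sub>0 int) \<Rightarrow> 'g"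
  where "frag_lift G f c =
    finsum G (\<lambda>p. add_pow G (Poly_Mapping.lookup c p) (f (fst p) (snd p))) (Poly_Mapping.keys c)"

lemma add_pow_closed:
  assumes "abelian_group G" "x \<in> carrier G"
  shows "add_pow G (k::int) x \<in> carrier G"
  using group.int_pow_closed[OF abelian_group.a_group[OF assms(1)], of x k] assms(2)
  by (simp add: add_pow_def)

lemma add_pow_plus:
  assumes "abelian_group G" "x \<in> carrier G"
  shows "add_pow G (k + l :: int) x = add_pow G k x \<oplus>\<^bsub>G\<^esub> add_pow G l x"
  using group.int_pow_mult[OF abelian_group.a_group[OF assms(1)], of x k l] assms(2)
  by (simp add: add_pow_def)

text \<open>Keys outside the support have coefficient zero and contribute nothing. This allows the
  sums for two elements to be taken over a common index set.\<close>

lemma frag_lift_superset: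
  assumes "abelian_group G" "finite B" "Poly_Mapping.keys c \<subseteq> B"
    and f: "\<And>p. p \<in> B \<Longrightarrow> f (fst p) (snd p) \<in> carrier G"
  shows "frag_lift G f c = finsum G (\<lambda>p. add_pow G (Poly_Mapping.lookup c p) (f (fst p) (snd p))) B"
proof -
  interpret G: abelian_group G by fact
  show ?thesis unfolding frag_lift_def
    using assms add_pow_closed[OF assms(1)]
    by (intro G.add.finprod_mono_neutral_cong_left) (auto simp: add_pow_def in_keys_iff)
qed

lemma frag_lift_add:
  assumes G: "abelian_group G"
    and f: "\<And>p. p \<in> Poly_Mapping.keys c \<union> Poly_Mapping.keys d \<Longrightarrow> f (fst p) (snd p) \<in> carrier G"
  shows "frag_lift G f (c + d) = frag_lift G f c \<oplus>\<^bsub>G\<^esub> frag_lift G f d"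
proof -
  interpret G: abelian_group G by fact
  let ?B = "Poly_Mapping.keys c \<union> Poly_Mapping.keys d"
  have cl: "add_pow G (k::int) (f (fst p) (snd p)) \<in> carrier G" if "p \<in> ?B" for k p
    using f[OF that] by (rule add_pow_closed[OF G])
  have "frag_lift G f (c + d) = finsum G (\<lambda>p. add_pow G (Poly_Mapping.lookup (c + d) p) (f (fst p) (snd p))) ?B"
    using f keys_add[of c d] by (intro frag_lift_superset[OF G]) auto
  also have "\<dots> = finsum G (\<lambda>p. add_pow G (Poly_Mapping.lookup c p) (f (fst p) (snd p)) \<oplus>\<^bsub>G\<^esub>
      add_pow G (Poly_Mapping.lookup d p) (f (fst p) (snd p))) ?B"
    using cl f by (intro G.add.finprod_cong') (auto simp: lookup_add add_pow_plus[OF G])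
  also have "\<dots> = finsum G (\<lambda>p. add_pow G (Poly_Mapping.lookup c p) (f (fst p) (snd p))) ?B \<oplus>\<^bsub>G\<^esub>
      finsum G (\<lambda>p. add_pow G (Poly_Mapping.lookup d p) (f (fst p) (snd p))) ?B"
    using cl by (intro G.finsum_addf) auto
  also have "\<dots> = frag_lift G f c \<oplus>\<^bsub>G\<^esub> frag_lift G f d"
    using frag_lift_superset[OF G, of ?B c f] frag_lift_superset[OF G, of ?B d f] f by simp
  finally show ?thesis .
qed

lemma frag_lift_closed:
  assumes G: "abelian_group G"
    and f: "\<And>p. p \<in> Poly_Mapping.keys c \<Longrightarrow> f (fst p) (snd p) \<in> carrier G"
  shows "frag_lift G f c \<in> carrier G"
proof -
  interpret G: abelian_group G by fact
  show ?thesis unfolding frag_lift_def using f by (intro G.finsum_closed) (auto intro: add_pow_closed[OF G])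
qed

lemma frag_lift_of:
  assumes G: "abelian_group G" and f: "f x y \<in> carrier G"
  shows "frag_lift G f (frag_of (x, y)) = f x y"
proof -
  interpret G: abelian_group G by fact
  show ?thesis
    using f G.finsum_insert[of "{}" "(x, y)" "\<lambda>p. add_pow G (1::int) (f (fst p) (snd p))"]
    unfolding frag_lift_def
    by (simp add: add_pow_def group.int_pow_1[OF abelian_group.a_group[OF G]] cong: G.finsum_cong)
qed


section \<open>Well-definedness of the lift of a balanced map\<close>

context tensorable
begin

lemma frag_lift_hom:
  assumes f: "balanced H M N G f"
  shows "group_hom FG (add_monoid G) (frag_lift G f)"
proof -
  interpret G: abelian_group G using balancedD(3)[OF f] .
  note G = G.abelian_group_axioms
  have cl: "f (fst p) (snd p) \<in> carrier G" if "p \<in> carrier M \<times> carrier N" for p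
    using that balancedD(6)[OF f] by auto
  have "frag_lift G f \<in> hom FG (add_monoid G)"
  proof (rule homI)
    show "frag_lift G f c \<in> carrier (add_monoid G)" if "c \<in> carrier FG" for c
      using that cl by (auto intro!: frag_lift_closed[OF G])
    show "frag_lift G f (c \<otimes>\<^bsub>FG\<^esub> d) = frag_lift G f c \<otimes>\<^bsub>add_monoid G\<^esub> frag_lift G f d"
      if "c \<in> carrier FG" "d \<in> carrier FG" for c d
      using that cl by (auto intro!: frag_lift_add[OF G])
  qed
  then show ?thesis
    by (simp add: group_hom_def group_hom_axioms_def G.a_group)
qed

text \<open>The elements sent to zero form a subgroup, so the three families of generating relations
  suffice; on these the vanishing is additivity in either argument and the middle law.\<close>

lemma frag_lift_Rel:
  assumes f: "balanced H M N G f" and c: "c \<in> Rel"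
  shows "frag_lift G f c = \<zero>\<^bsub>G\<^esub>"
proof -
  interpret G: abelian_group G using balancedD(3)[OF f] .
  note G = G.abelian_group_axioms
  interpret h: group_hom FG "add_monoid G" "frag_lift G f" by (rule frag_lift_hom[OF f])
  have diff: "frag_lift G f (a - b) = frag_lift G f a \<oplus>\<^bsub>G\<^esub> (\<ominus>\<^bsub>G\<^esub> frag_lift G f b)"
    if "a \<in> carrier FG" "b \<in> carrier FG" for a b
    using that h.hom_mult[of a "- b"] h.hom_inv[of b] by (simp add: a_inv_def)
  have of: "frag_lift G f (frag_of (x, y)) = f x y" if "x \<in> carrier M" "y \<in> carrier N" for x y
    using that balancedD(6)[OF f] by (intro frag_lift_of[OF G])
  have closed: "ract M x r \<in> carrier M" "lact N r y \<in> carrier N"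
    if "x \<in> carrier M" "r \<in> carrier H" "y \<in> carrier N" for x r y
    using that rmod lmod by (auto simp: rmod_def lmod_def)
  note fc = balancedD(6)[OF f]
  have "tensor_rels H M N \<subseteq> kernel FG (add_monoid G) (frag_lift G f)"
  proof
    fix a assume a: "a \<in> tensor_rels H M N"
    then have aF: "a \<in> carrier FG" using rels_subset by blast
    have k: "frag_of (x, y) - frag_of (x', y') \<in> carrier FG"
      if "x \<in> carrier M" "x' \<in> carrier M" "y \<in> carrier N" "y' \<in> carrier N" for x y x' y'
      using that by (auto dest!: subsetD[OF keys_diff])
    from a have "frag_lift G f a = \<zero>\<^bsub>G\<^esub>"
      unfolding tensor_rels_def
    proof (elim UnE CollectE exE conjE)
      fix x x' y assume h: "x \<in> carrier M" "x' \<in> carrier M" "y \<in> carrier N"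
        and a: "a = frag_of (x \<oplus>\<^bsub>M\<^esub> x', y) - frag_of (x, y) - frag_of (x', y)"
      show ?thesis
        unfolding a
        using h k[of "x \<oplus>\<^bsub>M\<^esub> x'" x y y] fc balancedD(7)[OF f]
        by (simp add: diff of del: carrier_free_Abelian_group_iff) 
           (simp add: diff of G.a_ac G.r_neg G.r_neg1)
    next
      fix x y y' assume h: "x \<in> carrier M" "y \<in> carrier N" "y' \<in> carrier N"
        and a: "a = frag_of (x, y \<oplus>\<^bsub>N\<^esub> y') - frag_of (x, y) - frag_of (x, y')"
      show ?thesis
        unfolding a
        using h k[of x x "y \<oplus>\<^bsub>N\<^esub> y'" y] fc balancedD(8)[OF f]
        by (simp add: diff of del: carrier_free_Abelian_group_iff)
           (simp add: diff of G.a_ac G.r_neg G.r_neg1)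
    next
      fix x r y assume h: "x \<in> carrier M" "r \<in> carrier H" "y \<in> carrier N"
        and a: "a = frag_of (ract M x r, y) - frag_of (x, lact N r y)"
      show ?thesis
        unfolding a using h closed[OF h] fc balancedD(9)[OF f] by (simp add: diff of G.r_neg)
    qed
    then show "a \<in> kernel FG (add_monoid G) (frag_lift G f)"
      using aF by (simp add: kernel_def)
  qed
  then have "Rel \<subseteq> kernel FG (add_monoid G) (frag_lift G f)"
    by (rule F.generate_subgroup_incl[OF _ h.subgroup_kernel])
  then show ?thesis using c by (auto simp: kernel_def)
qed

text \<open>Two elements of a coset differ by a relation, on which the linear extension vanishes.
  The image of the coset is therefore a singleton, and \<open>the_elem\<close> in
  \<open>tlift\<close> returns its element.\<close>

lemma tlift_coset:
  assumes f: "balanced H M N G f" and c: "c \<in> carrier FG"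
  shows "tlift G f (Rel #>\<^bsub>FG\<^esub> c) = frag_lift G f c"
proof -
  interpret G: abelian_group G using balancedD(3)[OF f] .
  interpret h: group_hom FG "add_monoid G" "frag_lift G f" by (rule frag_lift_hom[OF f])
  have "frag_lift G f d = frag_lift G f c" if "d \<in> Rel #>\<^bsub>FG\<^esub> c" for d
  proof -
    from that obtain a where a: "a \<in> Rel" "d = a \<otimes>\<^bsub>FG\<^esub> c" unfolding r_coset_def by blast
    then show ?thesis
      using h.hom_mult[of a c] c I.subset frag_lift_Rel[OF f a(1)] h.hom_closed[OF c] by auto
  qed
  then have "frag_lift G f ` (Rel #>\<^bsub>FG\<^esub> c) = {frag_lift G f c}"
    using F.rcos_self[OF c subgroup_Rel] by blast
  then show ?thesis
    unfolding tlift_def frag_lift_def[abs_def] by simp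
qed

lemma tlift_pure_group:
  assumes f: "balanced H M N G f" and "x \<in> carrier M" "y \<in> carrier N"
  shows "tlift G f (pure_tensor (tensor_group H M N) x y) = f x y"
  using assms balancedD(3)[OF f] balancedD(6)[OF f]
  by (simp add: pure_tensor_coset tlift_coset frag_lift_of)

lemma tlift_add_map_group:
  assumes f: "balanced H M N G f"
  shows "add_map (tensor_group H M N) G (tlift G f)"
proof (rule add_mapI[OF abelian_group_tensor_group balancedD(3)[OF f]])
  interpret h: group_hom FG "add_monoid G" "frag_lift G f" by (rule frag_lift_hom[OF f])
  show "tlift G f u \<in> carrier G" if u: "u \<in> carrier (tensor_group H M N)" for u
  proof -
    obtain c where "Poly_Mapping.keys c \<subseteq> carrier M \<times> carrier N" "u = Rel #>\<^bsub>FG\<^esub> c"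
      by (rule coset_cases[OF u])
    then show ?thesis using tlift_coset[OF f, of c] h.hom_closed[of c] by simp
  qed
  show "tlift G f (u \<oplus>\<^bsub>tensor_group H M N\<^esub> v) = tlift G f u \<oplus>\<^bsub>G\<^esub> tlift G f v"
    if u: "u \<in> carrier (tensor_group H M N)" and v: "v \<in> carrier (tensor_group H M N)" for u v
  proof -
    obtain c where c: "Poly_Mapping.keys c \<subseteq> carrier M \<times> carrier N" "u = Rel #>\<^bsub>FG\<^esub> c"
      by (rule coset_cases[OF u])
    obtain d where d: "Poly_Mapping.keys d \<subseteq> carrier M \<times> carrier N" "v = Rel #>\<^bsub>FG\<^esub> d"
      by (rule coset_cases[OF v])
    have "Poly_Mapping.keys (c + d) \<subseteq> carrier M \<times> carrier N"
      using c d keys_add[of c d] by blast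
    then show ?thesis
      using c d h.hom_mult[of c d] by (simp add: coset_plus[symmetric] tlift_coset[OF f])
  qed
qed

end

text \<open>The actions of \<open>tensor\<close> are themselves lifts, with values in
  \<open>tensor_group\<close>. The universal property is therefore established for the bare group
  and then transported to \<open>tensor\<close>, which has the same carrier, addition and pure
  tensors.\<close>

lemma tensor_fields:
  "carrier (tensor H M N) = carrier (tensor_group H M N)"
  "u \<oplus>\<^bsub>tensor H M N\<^esub> v = u \<oplus>\<^bsub>tensor_group H M N\<^esub> v"
  "\<zero>\<^bsub>tensor H M N\<^esub> = \<zero>\<^bsub>tensor_group H M N\<^esub>"
  "lact (tensor H M N) a =
    tlift (tensor_group H M N) (\<lambda>x y. pure_tensor (tensor_group H M N) (lact M a x) y)"
  "ract (tensor H M N) u b =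
    tlift (tensor_group H M N) (\<lambda>x y. pure_tensor (tensor_group H M N) x (ract N y b)) u"
  by (simp_all add: tensor_def Let_def ring.defs bimod.defs)

lemma pure_tensor_tensor: "pure_tensor (tensor H M N) = pure_tensor (tensor_group H M N)"
  by (simp add: fun_eq_iff pure_tensor_def tensor_fields)

lemma abelian_group_transfer:
  assumes "abelian_group G" "carrier G' = carrier G" "\<zero>\<^bsub>G'\<^esub> = \<zero>\<^bsub>G\<^esub>"
    and "\<And>x y. x \<oplus>\<^bsub>G'\<^esub> y = x \<oplus>\<^bsub>G\<^esub> y"
  shows "abelian_group G'"
proof -
  interpret G: abelian_group G by fact
  show ?thesis
  proof (rule abelian_groupI)
    show "\<exists>y\<in>carrier G'. y \<oplus>\<^bsub>G'\<^esub> x = \<zero>\<^bsub>G'\<^esub>" if "x \<in> carrier G'" for x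
      using that G.l_neg[of x] by (intro bexI[of _ "\<ominus>\<^bsub>G\<^esub> x"]) (simp_all add: assms(2-4))
  qed (simp_all add: assms(2-4) G.a_ac)
qed

lemma abelian_group_tensor:
  assumes "rmod H M" "lmod H N"
  shows "abelian_group (tensor H M N)"
proof -
  interpret tensorable H M N using assms by unfold_locales
  show ?thesis by (rule abelian_group_transfer[OF abelian_group_tensor_group]) (simp_all add: tensor_fields)
qed

lemma pure_tensor_simps:
  assumes "rmod H M" "lmod H N"
  shows pure_closed: "\<lbrakk>x \<in> carrier M; y \<in> carrier N\<rbrakk> \<Longrightarrow> x \<diamondop>\<^bsub>tensor H M N\<^esub> y \<in> carrier (tensor H M N)"
    and pure_add_left: "\<lbrakk>x \<in> carrier M; x' \<in> carrier M; y \<in> carrier N\<rbrakk> \<Longrightarrow>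
      (x \<oplus>\<^bsub>M\<^esub> x') \<diamondop>\<^bsub>tensor H M N\<^esub> y = (x \<diamondop>\<^bsub>tensor H M N\<^esub> y) \<oplus>\<^bsub>tensor H M N\<^esub> (x' \<diamondop>\<^bsub>tensor H M N\<^esub> y)"
    and pure_add_right: "\<lbrakk>x \<in> carrier M; y \<in> carrier N; y' \<in> carrier N\<rbrakk> \<Longrightarrow>
      x \<diamondop>\<^bsub>tensor H M N\<^esub> (y \<oplus>\<^bsub>N\<^esub> y') = (x \<diamondop>\<^bsub>tensor H M N\<^esub> y) \<oplus>\<^bsub>tensor H M N\<^esub> (x \<diamondop>\<^bsub>tensor H M N\<^esub> y')"
    and pure_middle: "\<lbrakk>x \<in> carrier M; r \<in> carrier H; y \<in> carrier N\<rbrakk> \<Longrightarrow>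
      ract M x r \<diamondop>\<^bsub>tensor H M N\<^esub> y = x \<diamondop>\<^bsub>tensor H M N\<^esub> lact N r y"
proof -
  interpret tensorable H M N using assms by unfold_locales
  show "\<lbrakk>x \<in> carrier M; y \<in> carrier N\<rbrakk> \<Longrightarrow> x \<diamondop>\<^bsub>tensor H M N\<^esub> y \<in> carrier (tensor H M N)"
    "\<lbrakk>x \<in> carrier M; x' \<in> carrier M; y \<in> carrier N\<rbrakk> \<Longrightarrow>
      (x \<oplus>\<^bsub>M\<^esub> x') \<diamondop>\<^bsub>tensor H M N\<^esub> y = (x \<diamondop>\<^bsub>tensor H M N\<^esub> y) \<oplus>\<^bsub>tensor H M N\<^esub> (x' \<diamondop>\<^bsub>tensor H M N\<^esub> y)"
    "\<lbrakk>x \<in> carrier M; y \<in> carrier N; y' \<in> carrier N\<rbrakk> \<Longrightarrow>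
      x \<diamondop>\<^bsub>tensor H M N\<^esub> (y \<oplus>\<^bsub>N\<^esub> y') = (x \<diamondop>\<^bsub>tensor H M N\<^esub> y) \<oplus>\<^bsub>tensor H M N\<^esub> (x \<diamondop>\<^bsub>tensor H M N\<^esub> y')"
    "\<lbrakk>x \<in> carrier M; r \<in> carrier H; y \<in> carrier N\<rbrakk> \<Longrightarrow>
      ract M x r \<diamondop>\<^bsub>tensor H M N\<^esub> y = x \<diamondop>\<^bsub>tensor H M N\<^esub> lact N r y"
    by (simp_all add: tensor_fields pure_tensor_tensor pure_tensor_group)
qed

lemma tlift_pure:
  assumes "balanced H M N G f" "x \<in> carrier M" "y \<in> carrier N"
  shows "tlift G f (x \<diamondop>\<^bsub>tensor H M N\<^esub> y) = f x y"
proof -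
  interpret tensorable H M N using assms(1) by unfold_locales (auto dest: balancedD(1,2))
  show ?thesis using tlift_pure_group[OF assms] by (simp add: pure_tensor_tensor)
qed

lemma tlift_add_map:
  assumes "balanced H M N G f"
  shows "add_map (tensor H M N) G (tlift G f)"
proof -
  interpret tensorable H M N using assms(1) by unfold_locales (auto dest: balancedD(1,2))
  show ?thesis
    using tlift_add_map_group[OF assms] abelian_group_tensor[OF rmod lmod]
    by (simp add: add_map_def tensor_fields)
qed

lemma tensor_induct [consumes 3, case_names pure plus]:
  assumes "u \<in> carrier (tensor H M N)" "rmod H M" "lmod H N"
    and "\<And>x y. x \<in> carrier M \<Longrightarrow> y \<in> carrier N \<Longrightarrow> P (x \<diamondop>\<^bsub>tensor H M N\<^esub> y)"
    and "\<And>u v. \<lbrakk>u \<in> carrier (tensor H M N); v \<in> carrier (tensor H M N); P u; P v\<rbrakk>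
      \<Longrightarrow> P (u \<oplus>\<^bsub>tensor H M N\<^esub> v)"
  shows "P u"
proof -
  interpret tensorable H M N using assms by unfold_locales
  show ?thesis
    using assms by (intro tensor_group_induct[of u P]) (simp_all add: tensor_fields pure_tensor_tensor)
qed

text \<open>The usual route to an identity between elements: one tensor argument is allowed to vary,
  so that both sides become additive maps, and these are determined by their values on pure
  tensors.\<close>

lemma tensor_ext:
  assumes "add_map (tensor H M N) G h" "add_map (tensor H M N) G k" "rmod H M" "lmod H N"
    and "\<And>x y. x \<in> carrier M \<Longrightarrow> y \<in> carrier N \<Longrightarrow>
      h (x \<diamondop>\<^bsub>tensor H M N\<^esub> y) = k (x \<diamondop>\<^bsub>tensor H M N\<^esub> y)"
    and "u \<in> carrier (tensor H M N)"
  shows "h u = k u"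
  using assms(6,3,4)
proof (induction rule: tensor_induct)
  case (pure x y) then show ?case by (rule assms(5))
next
  case (plus u v) then show ?case
    using assms(1,2) by (simp add: add_map_add)
qed

section \<open>Tensor products of bimodules\<close>

lemma lmodD: "lmod H M \<Longrightarrow> abelian_group M" "lmod H M \<Longrightarrow> r \<in> carrier H \<Longrightarrow> x \<in> carrier M \<Longrightarrow> lact M r x \<in> carrier M"
  by (auto simp: lmod_def)

lemma rmodD: "rmod H M \<Longrightarrow> abelian_group M" "rmod H M \<Longrightarrow> x \<in> carrier M \<Longrightarrow> r \<in> carrier H \<Longrightarrow> ract M x r \<in> carrier M"
  by (auto simp: rmod_def)

lemma lmod_zero: "lmod H M \<Longrightarrow> \<zero>\<^bsub>M\<^esub> \<in> carrier M" and rmod_zero: "rmod H N \<Longrightarrow> \<zero>\<^bsub>N\<^esub> \<in> carrier N"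
  by (auto simp: lmod_def rmod_def abelian_group_def abelian_monoid.zero_closed)

lemma bimodule_mods:
  "bimodule L H M \<Longrightarrow> rmod H M" "bimodule L H M \<Longrightarrow> lmod L M"
  "bimodule L H M \<Longrightarrow> abelian_group M" "bimodule L H M \<Longrightarrow> ring L" "bimodule L H M \<Longrightarrow> ring H"
  by (auto simp: rmod_def lmod_def bimodule_def bimodule_axioms_def)

lemma llinD:
  assumes "llin H M N f"
  shows "lmod H M" "lmod H N" "add_map M N f" "x \<in> carrier M \<Longrightarrow> f x \<in> carrier N"
    "x \<in> carrier M \<Longrightarrow> y \<in> carrier M \<Longrightarrow> f (x \<oplus>\<^bsub>M\<^esub> y) = f x \<oplus>\<^bsub>N\<^esub> f y"
    "r \<in> carrier H \<Longrightarrow> x \<in> carrier M \<Longrightarrow> f (lact M r x) = lact N r (f x)"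
  using assms by (auto simp: llin_def add_map_def)

lemma rlinD:
  assumes "rlin H M N f"
  shows "rmod H M" "rmod H N" "add_map M N f" "x \<in> carrier M \<Longrightarrow> f x \<in> carrier N"
    "x \<in> carrier M \<Longrightarrow> y \<in> carrier M \<Longrightarrow> f (x \<oplus>\<^bsub>M\<^esub> y) = f x \<oplus>\<^bsub>N\<^esub> f y"
    "r \<in> carrier H \<Longrightarrow> x \<in> carrier M \<Longrightarrow> f (ract M x r) = ract N (f x) r"
  using assms by (auto simp: rlin_def add_map_def)

lemma llinI:
  assumes "lmod H M" "lmod H N" "add_map M N f"
    "\<And>r x. r \<in> carrier H \<Longrightarrow> x \<in> carrier M \<Longrightarrow> f (lact M r x) = lact N r (f x)"
  shows "llin H M N f"
  using assms by (auto simp: llin_def)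

lemma rlinI:
  assumes "rmod H M" "rmod H N" "add_map M N f"
    "\<And>r x. r \<in> carrier H \<Longrightarrow> x \<in> carrier M \<Longrightarrow> f (ract M x r) = ract N (f x) r"
  shows "rlin H M N f"
  using assms by (auto simp: rlin_def)

lemma bimod_homD:
  assumes "f \<in> bimod_hom L R M N" "bimodule L R M" "bimodule L R N"
  shows "llin L M N f" "rlin R M N f" "add_map M N f"
proof -
  show "add_map M N f"
    using assms bimodule_mods(3)[OF assms(2)] bimodule_mods(3)[OF assms(3)]
    by (auto simp: bimod_hom_def add_map_def)
  then show "llin L M N f" "rlin R M N f"
    using assms bimodule_mods(1,2)[OF assms(2)] bimodule_mods(1,2)[OF assms(3)]
    by (auto simp: bimod_hom_def llin_def rlin_def)
qed

lemma bimod_homI: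
  assumes "llin L M N f" "rlin R M N f"
  shows "f \<in> bimod_hom L R M N"
  using assms by (auto simp: bimod_hom_def llin_def rlin_def add_map_def)

lemma balanced_pure:
  assumes "rmod H M" "lmod H N"
  shows "balanced H M N (tensor H M N) (\<lambda>x y. x \<diamondop>\<^bsub>tensor H M N\<^esub> y)"
  using assms by (intro balancedI) (auto simp: pure_tensor_simps abelian_group_tensor)

lemma balanced_map:
  assumes "add_map G G' k" "balanced H M N G g"
  shows "balanced H M N G' (\<lambda>x y. k (g x y))"
  using balancedD(1,2)[OF assms(2)] add_map_groups(2)[OF assms(1)]
  by (intro balancedI)
    (auto simp: add_map_closed[OF assms(1)] add_map_add[OF assms(1)] balancedD(6-9)[OF assms(2)])

lemma balanced_precomp:
  assumes "balanced H M' N' G f" "rlin H M M' h" "llin H N N' k"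
  shows "balanced H M N G (\<lambda>x y. f (h x) (k y))"
  using rlinD[OF assms(2)] llinD[OF assms(3)] balancedD[OF assms(1)]
  by (intro balancedI) auto

lemma balanced_tlift:
  assumes "balanced H M N (tensor K P Q) g" "balanced K P Q G f"
  shows "balanced H M N G (\<lambda>x y. tlift G f (g x y))"
  by (rule balanced_map[OF tlift_add_map[OF assms(2)] assms(1)])


text \<open>Acting on an outer side is balanced over the ring in the middle because the two actions
  of a bimodule commute.\<close>

lemma tensor_act:
  assumes M: "bimodule L H M" and N: "bimodule H R N"
  shows lact_pure: "\<lbrakk>a \<in> carrier L; x \<in> carrier M; y \<in> carrier N\<rbrakk> \<Longrightarrow>
      lact (tensor H M N) a (x \<diamondop>\<^bsub>tensor H M N\<^esub> y) = lact M a x \<diamondop>\<^bsub>tensor H M N\<^esub> y"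
    and ract_pure: "\<lbrakk>b \<in> carrier R; x \<in> carrier M; y \<in> carrier N\<rbrakk> \<Longrightarrow>
      ract (tensor H M N) (x \<diamondop>\<^bsub>tensor H M N\<^esub> y) b = x \<diamondop>\<^bsub>tensor H M N\<^esub> ract N y b"
    and lact_add_map: "a \<in> carrier L \<Longrightarrow> add_map (tensor H M N) (tensor H M N) (lact (tensor H M N) a)"
    and ract_add_map: "b \<in> carrier R \<Longrightarrow>
      add_map (tensor H M N) (tensor H M N) (\<lambda>u. ract (tensor H M N) u b)"
proof -
  interpret M: bimodule L H M by fact
  interpret N: bimodule H R N by fact
  interpret tensorable H M N using bimodule_mods(1)[OF M] bimodule_mods(2)[OF N] by unfold_locales
  let ?T = "tensor H M N" and ?G = "tensor_group H M N"
  note ab = abelian_group_tensor[OF rmod lmod]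
  have trans: "add_map ?G ?G f \<longleftrightarrow> add_map ?T ?T f" for f
    using ab abelian_group_tensor_group by (simp add: add_map_def tensor_fields)
  have l: "balanced H M N ?G (\<lambda>x y. pure_tensor ?G (lact M a x) y)" if a: "a \<in> carrier L" for a
    using a rmod lmod
    by (intro balancedI)
      (auto simp: pure_tensor_group abelian_group_tensor_group M.lact_closed M.lact_add_right M.lact_ract
        pure_tensor_group(4)[symmetric])
  have r: "balanced H M N ?G (\<lambda>x y. pure_tensor ?G x (ract N y b))" if b: "b \<in> carrier R" for b
    using b rmod lmod
    by (intro balancedI)
      (auto simp: pure_tensor_group abelian_group_tensor_group N.ract_closed N.ract_add_left N.lact_ract)
  show "lact ?T a (x \<diamondop>\<^bsub>?T\<^esub> y) = lact M a x \<diamondop>\<^bsub>?T\<^esub> y" if "a \<in> carrier L" "x \<in> carrier M" "y \<in> carrier N" for a x y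
    using tlift_pure_group[OF l] that by (simp add: tensor_fields pure_tensor_tensor)
  show "ract ?T (x \<diamondop>\<^bsub>?T\<^esub> y) b = x \<diamondop>\<^bsub>?T\<^esub> ract N y b" if "b \<in> carrier R" "x \<in> carrier M" "y \<in> carrier N" for b x y
    using tlift_pure_group[OF r] that by (simp add: tensor_fields pure_tensor_tensor)
  show "add_map ?T ?T (lact ?T a)" if "a \<in> carrier L" for a
    using tlift_add_map_group[OF l[OF that]] by (simp add: trans[symmetric] tensor_fields)
  show "add_map ?T ?T (\<lambda>u. ract ?T u b)" if "b \<in> carrier R" for b
    using tlift_add_map_group[OF r[OF that]] by (simp add: trans[symmetric] tensor_fields)
qed

lemma add_map_id: "abelian_group M \<Longrightarrow> add_map M M (\<lambda>x. x)"
  by (simp add: add_map_def)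

lemma add_map_comp:
  assumes "add_map N G k" "add_map M N h"
  shows "add_map M G (\<lambda>x. k (h x))"
  using add_map_groups(2)[OF assms(1)] add_map_groups(1)[OF assms(2)]
  by (intro add_mapI)
    (auto simp: add_map_closed[OF assms(1)] add_map_add[OF assms(1)] add_map_closed[OF assms(2)] add_map_add[OF assms(2)])

lemma add_map_plus:
  assumes "add_map M G h" "add_map M G k"
  shows "add_map M G (\<lambda>x. h x \<oplus>\<^bsub>G\<^esub> k x)"
proof -
  interpret G: abelian_group G using assms(1) by (rule add_map_groups)
  show ?thesis
    using add_map_groups[OF assms(1)]
    by (intro add_mapI)
      (auto simp: add_map_closed[OF assms(1)] add_map_add[OF assms(1)] add_map_closed[OF assms(2)]
        add_map_add[OF assms(2)] G.a_ac)
qed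

text \<open>For fixed scalars both sides of each axiom are additive in the tensor argument, so the
  axiom is inherited from the factors on pure tensors.\<close>

lemma bimodule_tensor:
  assumes M: "bimodule L H M" and N: "bimodule H R N"
  shows "bimodule L R (tensor H M N)"
proof -
  interpret M: bimodule L H M by fact
  interpret N: bimodule H R N by fact
  let ?T = "tensor H M N"
  have mods: "rmod H M" "lmod H N" using bimodule_mods(1)[OF M] bimodule_mods(2)[OF N] .
  interpret T: abelian_group ?T by (rule abelian_group_tensor[OF mods])
  note lm = lact_add_map[OF M N] and rm = ract_add_map[OF M N]
  note lp = lact_pure[OF M N] and rp = ract_pure[OF M N]
  note lc = add_map_closed[OF lm] and rc = add_map_closed[OF rm]
  note pc = pure_closed[OF mods]
  note id = add_map_id[OF T.abelian_group_axioms]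
  show ?thesis
  proof (unfold_locales)
    show "lact ?T a x \<in> carrier ?T" if "a \<in> carrier L" "x \<in> carrier ?T" for a x
      using lc that .
    show "ract ?T x r \<in> carrier ?T" if "x \<in> carrier ?T" "r \<in> carrier R" for x r
      using rc that by blast
    show "lact ?T a (x \<oplus>\<^bsub>?T\<^esub> y) = lact ?T a x \<oplus>\<^bsub>?T\<^esub> lact ?T a y"
      if "a \<in> carrier L" "x \<in> carrier ?T" "y \<in> carrier ?T" for a x y
      using add_map_add[OF lm] that .
    show "ract ?T (x \<oplus>\<^bsub>?T\<^esub> y) r = ract ?T x r \<oplus>\<^bsub>?T\<^esub> ract ?T y r"
      if "x \<in> carrier ?T" "y \<in> carrier ?T" "r \<in> carrier R" for x y r
      using add_map_add[OF rm] that by blast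
    show "lact ?T (a \<oplus>\<^bsub>L\<^esub> b) x = lact ?T a x \<oplus>\<^bsub>?T\<^esub> lact ?T b x"
      if "a \<in> carrier L" "b \<in> carrier L" "x \<in> carrier ?T" for a b x
      by (rule tensor_ext[OF lm add_map_plus[OF lm lm] mods _ that(3)])
         (use that in \<open>auto simp: lp M.lact_add_left M.lact_closed pure_add_left[OF mods]\<close>)
    show "ract ?T x (a \<oplus>\<^bsub>R\<^esub> b) = ract ?T x a \<oplus>\<^bsub>?T\<^esub> ract ?T x b"
      if "x \<in> carrier ?T" "a \<in> carrier R" "b \<in> carrier R" for a b x
      by (rule tensor_ext[OF rm add_map_plus[OF rm rm] mods _ that(1)])
         (use that in \<open>auto simp: rp N.ract_add_right N.ract_closed pure_add_right[OF mods]\<close>)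
    show "lact ?T (a \<otimes>\<^bsub>L\<^esub> b) x = lact ?T a (lact ?T b x)"
      if "a \<in> carrier L" "b \<in> carrier L" "x \<in> carrier ?T" for a b x
      by (rule tensor_ext[OF lm add_map_comp[OF lm lm] mods _ that(3)])
         (use that in \<open>auto simp: lp M.lact_mult M.lact_closed\<close>)
    show "ract ?T x (a \<otimes>\<^bsub>R\<^esub> b) = ract ?T (ract ?T x a) b"
      if "x \<in> carrier ?T" "a \<in> carrier R" "b \<in> carrier R" for a b x
      by (rule tensor_ext[OF rm add_map_comp[OF rm rm] mods _ that(1)])
         (use that in \<open>auto simp: rp N.ract_mult N.ract_closed\<close>)
    show "lact ?T \<one>\<^bsub>L\<^esub> x = x" if "x \<in> carrier ?T" for x
      by (rule tensor_ext[OF lm id mods _ that]) (auto simp: lp M.lact_one)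
    show "ract ?T x \<one>\<^bsub>R\<^esub> = x" if "x \<in> carrier ?T" for x
      by (rule tensor_ext[OF rm id mods _ that]) (auto simp: rp N.ract_one)
    show "ract ?T (lact ?T a x) r = lact ?T a (ract ?T x r)"
      if "a \<in> carrier L" "x \<in> carrier ?T" "r \<in> carrier R" for a x r
      by (rule tensor_ext[OF add_map_comp[OF rm lm] add_map_comp[OF lm rm] mods _ that(2)])
         (use that in \<open>auto simp: rp lp N.ract_closed M.lact_closed\<close>)
  qed
qed

section \<open>Restricted and regular bimodules\<close>

lemma restr_simps:
  "carrier (restr f g M) = carrier M" "ring.add (restr f g M) = ring.add M"
  "ring.zero (restr f g M) = ring.zero M"
  "lact (restr f g M) r = lact M (f r)" "ract (restr f g M) x s = ract M x (g s)"
  by (simp_all add: restr_def)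

lemma regular_simps:
  "carrier (regular A) = carrier A" "ring.add (regular A) = ring.add A"
  "ring.zero (regular A) = ring.zero A"
  "lact (regular A) = monoid.mult A" "ract (regular A) = monoid.mult A"
  by (simp_all add: regular_def)

lemma abelian_group_restr: "abelian_group M \<Longrightarrow> abelian_group (restr f g M)"
  by (rule abelian_group_transfer) (simp_all add: restr_simps)

lemma bimodule_regular: assumes "ring A" shows "bimodule A A (regular A)"
proof -
  interpret ring A by fact
  have "abelian_group (regular A)"
    by (rule abelian_group_transfer[OF abelian_group_axioms]) (simp_all add: regular_simps)
  then show ?thesis
    by (intro bimodule.intro bimodule_axioms.intro)
      (auto simp: regular_simps assms l_distr r_distr m_assoc)
qed

lemma ring_hom_ring_id: "ring A \<Longrightarrow> ring_hom_ring A A id"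
  by (intro ring_hom_ringI) (auto intro: ring.ring_simprules)

lemma bimodule_restr:
  assumes "ring_hom_ring L L' f" "ring_hom_ring R R' g" "bimodule L' R' M"
  shows "bimodule L R (restr f g M)"
proof -
  interpret f: ring_hom_ring L L' f by fact
  interpret g: ring_hom_ring R R' g by fact
  interpret M: bimodule L' R' M by fact
  show ?thesis
    by (intro bimodule.intro bimodule_axioms.intro f.R.ring_axioms g.R.ring_axioms
        abelian_group_restr M.M.abelian_group_axioms)
      (auto simp: restr_simps M.lact_closed M.ract_closed M.lact_add_left M.lact_add_right
        M.ract_add_left M.ract_add_right M.lact_mult M.ract_mult M.lact_one M.ract_one M.lact_ract)
qed

section \<open>Calculus of balanced maps\<close>

text \<open>
  Goals about balanced maps, linearity and membership are solved by exhaustive resolution with these rules.  In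
  such calls the order matters: specific facts come first, and the rules for restricted scalars come before
  those for the unrestricted ones, since a wrong branch is abandoned only after a long search.
\<close>

named_theorems bal

lemma tlift_closed:
  "u \<in> carrier (tensor H M N) \<Longrightarrow> balanced H M N G f \<Longrightarrow> tlift G f u \<in> carrier G"
  by (rule add_map_closed[OF tlift_add_map])

lemma balanced_cong:
  assumes "balanced H M N G f" "\<And>x y. x \<in> carrier M \<Longrightarrow> y \<in> carrier N \<Longrightarrow> f x y = g x y"
  shows "balanced H M N G g"
proof -
  note [simp] = assms(2)[symmetric]
  show ?thesis
    using balancedD[OF assms(1)] rmodD[OF balancedD(1)[OF assms(1)]] lmodD[OF balancedD(2)[OF assms(1)]]
      abelian_group.axioms(1)
    by (intro balancedI) (auto simp: abelian_monoid.a_closed abelian_group.axioms(1))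
qed

lemma tlift_ext:
  assumes "u \<in> carrier (tensor H M N)" "balanced H M N G f" "add_map (tensor H M N) G k"
    and "\<And>x y. x \<in> carrier M \<Longrightarrow> y \<in> carrier N \<Longrightarrow> f x y = k (x \<diamondop>\<^bsub>tensor H M N\<^esub> y)"
  shows "tlift G f u = k u"
  by (rule tensor_ext[OF tlift_add_map[OF assms(2)] assms(3) _ _ _ assms(1)])
     (use assms balancedD(1,2)[OF assms(2)] in \<open>auto simp: tlift_pure[OF assms(2)]\<close>)

text \<open>Rewriting under the sum. A map that agrees with \<open>f\<close> on the carriers
  inherits balancedness from \<open>f\<close>, so one such condition covers both sides.\<close>

lemma tlift_cong:
  assumes "u \<in> carrier (tensor H M N)" "balanced H M N G f"
    and "\<And>x y. x \<in> carrier M \<Longrightarrow> y \<in> carrier N \<Longrightarrow> f x y = g x y"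
  shows "tlift G f u = tlift G g u"
proof -
  have "balanced H M N G g" by (rule balanced_cong[OF assms(2,3)])
  then show ?thesis
    using assms by (intro tlift_ext[OF assms(1,2)] tlift_add_map) (auto simp: tlift_pure)
qed

lemma tlift_map:
  assumes "u \<in> carrier (tensor H M N)" "add_map G G' k" "balanced H M N G f"
  shows "k (tlift G f u) = tlift G' (\<lambda>x y. k (f x y)) u"
  by (rule tlift_ext[symmetric, OF assms(1) balanced_map[OF assms(2,3)]
        add_map_comp[OF assms(2) tlift_add_map[OF assms(3)]]])
     (simp add: tlift_pure[OF assms(3)])

lemma tlift_plus:
  assumes "u \<in> carrier (tensor H M N)" "balanced H M N G f" "balanced H M N G g"
  shows "tlift G (\<lambda>x y. f x y \<oplus>\<^bsub>G\<^esub> g x y) u = tlift G f u \<oplus>\<^bsub>G\<^esub> tlift G g u"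
proof -
  interpret G: abelian_group G using assms(2) by (rule balancedD)
  have "balanced H M N G (\<lambda>x y. f x y \<oplus>\<^bsub>G\<^esub> g x y)"
    using balancedD(1-3)[OF assms(2)] balancedD(6-9)[OF assms(2)] balancedD(6-9)[OF assms(3)]
    by (intro balancedI) (auto simp: G.a_ac)
  then show ?thesis
    by (rule tlift_ext[OF assms(1) _ add_map_plus[OF tlift_add_map tlift_add_map]])
       (use assms in \<open>auto simp: tlift_pure\<close>)
qed

lemma add_map_tlift_arg:
  assumes "add_map M0 (tensor K P Q) h" "balanced K P Q G f"
  shows "add_map M0 G (\<lambda>x. tlift G f (h x))"
  by (rule add_map_comp[OF tlift_add_map[OF assms(2)] assms(1)])

lemma add_map_tlift_fun:
  assumes u: "u \<in> carrier (tensor K P Q)" and ab: "abelian_group M0" "rmod K P" "lmod K Q"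
    and f: "\<And>x. x \<in> carrier M0 \<Longrightarrow> balanced K P Q G (f x)"
    and a: "\<And>z w. z \<in> carrier P \<Longrightarrow> w \<in> carrier Q \<Longrightarrow> add_map M0 G (\<lambda>x. f x z w)"
  shows "add_map M0 G (\<lambda>x. tlift G (f x) u)"
proof (rule add_mapI)
  interpret M0: abelian_group M0 by fact
  show "abelian_group M0" by fact
  show G: "abelian_group G"
    using add_map_groups(2)[OF a[OF rmod_zero[OF ab(2)] lmod_zero[OF ab(3)]]] .
  show "tlift G (f x) u \<in> carrier G" if "x \<in> carrier M0" for x
    by (rule tlift_closed[OF u f[OF that]])
  show "tlift G (f (x \<oplus>\<^bsub>M0\<^esub> y)) u = tlift G (f x) u \<oplus>\<^bsub>G\<^esub> tlift G (f y) u"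
    if "x \<in> carrier M0" "y \<in> carrier M0" for x y
    unfolding tlift_plus[OF u f[OF that(1)] f[OF that(2)], symmetric]
    by (rule tlift_cong[OF u f]) (use that add_map_add[OF a] in auto)
qed

text \<open>The case of variables in the integrand, the tensor \<open>u\<close> being fixed. In
  \<open>balanced_tlift_left\<close> and \<open>balanced_tlift_right\<close> one variable enters
  through the tensor itself.\<close>

lemma balanced_tlift_fun:
  assumes u: "u \<in> carrier (tensor K P Q)" and ab: "rmod H M" "lmod H N" "rmod K P" "lmod K Q"
    and f: "\<And>x y. x \<in> carrier M \<Longrightarrow> y \<in> carrier N \<Longrightarrow> balanced K P Q G (f x y)"
    and b: "\<And>z w. z \<in> carrier P \<Longrightarrow> w \<in> carrier Q \<Longrightarrow> balanced H M N G (\<lambda>x y. f x y z w)"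
  shows "balanced H M N G (\<lambda>x y. tlift G (f x y) u)"
  unfolding balanced_def
proof (intro conjI ballI ab)
  show "add_map M G (\<lambda>x. tlift G (f x y) u)" if "y \<in> carrier N" for y
    by (rule add_map_tlift_fun[OF u rmodD(1)[OF ab(1)] ab(3,4) f balancedD(4)[OF b]]) (use that in auto)
  show "add_map N G (\<lambda>y. tlift G (f x y) u)" if "x \<in> carrier M" for x
    by (rule add_map_tlift_fun[OF u lmodD(1)[OF ab(2)] ab(3,4) f balancedD(5)[OF b]]) (use that in auto)
  show "tlift G (f (ract M x r) y) u = tlift G (f x (lact N r y)) u"
    if "x \<in> carrier M" "r \<in> carrier H" "y \<in> carrier N" for x r y
    by (rule tlift_cong[OF u f]) (use that rmodD[OF ab(1)] balancedD(9)[OF b] in auto)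
qed

lemma tlift_ract:
  assumes PQ: "bimodule L K P" "bimodule K H Q" and f: "balanced K P Q G f" "balanced K P Q G g"
    and r: "r \<in> carrier H" and u: "u \<in> carrier (tensor K P Q)"
    and eq: "\<And>z w. z \<in> carrier P \<Longrightarrow> w \<in> carrier Q \<Longrightarrow> f z (ract Q w r) = g z w"
  shows "tlift G f (ract (tensor K P Q) u r) = tlift G g u"
proof -
  interpret Q: bimodule K H Q by fact
  show ?thesis
    by (rule tensor_ext[OF add_map_comp[OF tlift_add_map[OF f(1)] ract_add_map[OF PQ r]]
          tlift_add_map[OF f(2)] bimodule_mods(1)[OF PQ(1)] bimodule_mods(2)[OF PQ(2)] _ u])
       (simp add: ract_pure[OF PQ r] tlift_pure[OF f(1)] tlift_pure[OF f(2)] Q.ract_closed r eq)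
qed

lemma tlift_lact:
  assumes PQ: "bimodule H K P" "bimodule K R Q" and f: "balanced K P Q G f" "balanced K P Q G g"
    and r: "r \<in> carrier H" and u: "u \<in> carrier (tensor K P Q)"
    and eq: "\<And>z w. z \<in> carrier P \<Longrightarrow> w \<in> carrier Q \<Longrightarrow> f (lact P r z) w = g z w"
  shows "tlift G f (lact (tensor K P Q) r u) = tlift G g u"
proof -
  interpret P: bimodule H K P by fact
  show ?thesis
    by (rule tensor_ext[OF add_map_comp[OF tlift_add_map[OF f(1)] lact_add_map[OF PQ r]]
          tlift_add_map[OF f(2)] bimodule_mods(1)[OF PQ(1)] bimodule_mods(2)[OF PQ(2)] _ u])
       (simp add: lact_pure[OF PQ r] tlift_pure[OF f(1)] tlift_pure[OF f(2)] P.lact_closed r eq)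
qed

text \<open>The pattern of a coaction: \<open>x\<close> enters through \<open>h x\<close> in
  \<open>P \<otimes> Q\<close>, and \<open>y\<close> through the integrand. By linearity of
  \<open>h\<close> a scalar between \<open>x\<close> and \<open>y\<close> lands on the factor
  \<open>Q\<close>, so across the two the integrand has to be balanced between \<open>w\<close> and
  \<open>y\<close>.\<close>

lemma balanced_tlift_left:
  assumes h: "rlin H M (tensor K P Q) h" and P: "bimodule L K P" and Q: "bimodule K H Q"
    and N: "lmod H N"
    and f: "\<And>y. y \<in> carrier N \<Longrightarrow> balanced K P Q G (f y)"
    and b: "\<And>z. z \<in> carrier P \<Longrightarrow> balanced H Q N G (\<lambda>w y. f y z w)"
  shows "balanced H M N G (\<lambda>x y. tlift G (f y) (h x))"
  unfolding balanced_def
proof (intro conjI ballI N rlinD(1)[OF h])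
  note hc = rlinD(4)[OF h]
  note mods = bimodule_mods(1)[OF P] bimodule_mods(2)[OF Q]
  show "add_map M G (\<lambda>x. tlift G (f y) (h x))" if "y \<in> carrier N" for y
    by (rule add_map_tlift_arg[OF rlinD(3)[OF h] f[OF that]])
  show "add_map N G (\<lambda>y. tlift G (f y) (h x))" if "x \<in> carrier M" for x
    by (rule add_map_tlift_fun[OF hc[OF that] lmodD(1)[OF N] mods f balancedD(5)[OF b]])
  show "tlift G (f y) (h (ract M x r)) = tlift G (f (lact N r y)) (h x)"
    if "x \<in> carrier M" "r \<in> carrier H" "y \<in> carrier N" for x r y
    unfolding rlinD(6)[OF h that(2,1)]
    by (rule tlift_ract[OF P Q f f that(2) hc]) (use that lmodD(2)[OF N] balancedD(9)[OF b] in auto)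
qed

lemma balanced_tlift_right:
  assumes h: "llin H N (tensor K P Q) h" and P: "bimodule H K P" and Q: "bimodule K R Q"
    and M: "rmod H M"
    and f: "\<And>x. x \<in> carrier M \<Longrightarrow> balanced K P Q G (f x)"
    and b: "\<And>w. w \<in> carrier Q \<Longrightarrow> balanced H M P G (\<lambda>x z. f x z w)"
  shows "balanced H M N G (\<lambda>x y. tlift G (f x) (h y))"
  unfolding balanced_def
proof (intro conjI ballI M llinD(1)[OF h])
  note hc = llinD(4)[OF h]
  note mods = bimodule_mods(1)[OF P] bimodule_mods(2)[OF Q]
  show "add_map N G (\<lambda>y. tlift G (f x) (h y))" if "x \<in> carrier M" for x
    by (rule add_map_tlift_arg[OF llinD(3)[OF h] f[OF that]])
  show "add_map M G (\<lambda>x. tlift G (f x) (h y))" if "y \<in> carrier N" for y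
    by (rule add_map_tlift_fun[OF hc[OF that] rmodD(1)[OF M] mods f balancedD(4)[OF b]])
  show "tlift G (f (ract M x r)) (h y) = tlift G (f x) (h (lact N r y))"
    if "x \<in> carrier M" "r \<in> carrier H" "y \<in> carrier N" for x r y
    unfolding llinD(6)[OF h that(2,3)]
    by (rule tlift_lact[OF P Q f f that(2) hc, symmetric]) (use that rmodD(2)[OF M] balancedD(9)[OF b] in auto)
qed

lemma rlin_tlift_arg:
  assumes h: "rlin H M (tensor K P Q) h" and P: "bimodule L K P" and Q: "bimodule K H Q"
    and N: "bimodule L' H N" and f: "balanced K P Q N f" and b: "\<And>z. z \<in> carrier P \<Longrightarrow> rlin H Q N (f z)"
  shows "rlin H M N (\<lambda>x. tlift N f (h x))"
proof (rule rlinI)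
  interpret N: bimodule L' H N by fact
  show "rmod H M" "rmod H N" using rlinD(1)[OF h] bimodule_mods(1)[OF N] .
  show "add_map M N (\<lambda>x. tlift N f (h x))"
    by (rule add_map_tlift_arg[OF rlinD(3)[OF h] f])
  show "tlift N f (h (ract M x r)) = ract N (tlift N f (h x)) r" if r: "r \<in> carrier H" and x: "x \<in> carrier M" for r x
  proof -
    have am: "add_map N N (\<lambda>y. ract N y r)"
      using r by (intro add_mapI) (auto simp: N.ract_closed N.ract_add_left N.M.abelian_group_axioms)
    show ?thesis
      unfolding rlinD(6)[OF h r x] tlift_map[OF rlinD(4)[OF h x] am f]
      by (rule tlift_ract[OF P Q f balanced_map[OF am f] r rlinD(4)[OF h x]]) (use rlinD(6)[OF b r] in auto)
  qed
qed

lemma llin_tlift_arg: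
  assumes h: "llin H M (tensor K P Q) h" and P: "bimodule H K P" and Q: "bimodule K R Q"
    and N: "bimodule H R' N" and f: "balanced K P Q N f"
    and b: "\<And>w. w \<in> carrier Q \<Longrightarrow> llin H P N (\<lambda>z. f z w)"
  shows "llin H M N (\<lambda>x. tlift N f (h x))"
proof (rule llinI)
  interpret N: bimodule H R' N by fact
  show "lmod H M" "lmod H N" using llinD(1)[OF h] bimodule_mods(2)[OF N] .
  show "add_map M N (\<lambda>x. tlift N f (h x))"
    by (rule add_map_tlift_arg[OF llinD(3)[OF h] f])
  show "tlift N f (h (lact M r x)) = lact N r (tlift N f (h x))" if r: "r \<in> carrier H" and x: "x \<in> carrier M" for r x
  proof -
    have am: "add_map N N (lact N r)"
      using r by (intro add_mapI) (auto simp: N.lact_closed N.lact_add_right N.M.abelian_group_axioms)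
    show ?thesis
      unfolding llinD(6)[OF h r x] tlift_map[OF llinD(4)[OF h x] am f]
      by (rule tlift_lact[OF P Q f balanced_map[OF am f] r llinD(4)[OF h x]]) (use llinD(6)[OF b r] in auto)
  qed
qed

lemma rlin_tlift_fun:
  assumes u: "u \<in> carrier (tensor K P Q)" and ab: "rmod H M" "rmod K P" "lmod K Q"
    and N: "bimodule L H N" and f: "\<And>x. x \<in> carrier M \<Longrightarrow> balanced K P Q N (f x)"
    and b: "\<And>z w. z \<in> carrier P \<Longrightarrow> w \<in> carrier Q \<Longrightarrow> rlin H M N (\<lambda>x. f x z w)"
  shows "rlin H M N (\<lambda>x. tlift N (f x) u)"
proof (rule rlinI)
  interpret N: bimodule L H N by fact
  show "rmod H M" "rmod H N" using ab(1) bimodule_mods(1)[OF N] .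
  show "add_map M N (\<lambda>x. tlift N (f x) u)"
    by (rule add_map_tlift_fun[OF u rmodD(1)[OF ab(1)] ab(2,3) f rlinD(3)[OF b]])
  show "tlift N (f (ract M x r)) u = ract N (tlift N (f x) u) r" if r: "r \<in> carrier H" and x: "x \<in> carrier M" for r x
  proof -
    have am: "add_map N N (\<lambda>y. ract N y r)"
      using r by (intro add_mapI) (auto simp: N.ract_closed N.ract_add_left N.M.abelian_group_axioms)
    show ?thesis
      unfolding tlift_map[OF u am f[OF x]]
      by (rule tlift_cong[OF u f]) (use rmodD(2)[OF ab(1)] r x rlinD(6)[OF b r x] in auto)
  qed
qed

lemma llin_tlift_fun:
  assumes u: "u \<in> carrier (tensor K P Q)" and ab: "lmod H M" "rmod K P" "lmod K Q"
    and N: "bimodule H R N" and f: "\<And>x. x \<in> carrier M \<Longrightarrow> balanced K P Q N (f x)"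
    and b: "\<And>z w. z \<in> carrier P \<Longrightarrow> w \<in> carrier Q \<Longrightarrow> llin H M N (\<lambda>x. f x z w)"
  shows "llin H M N (\<lambda>x. tlift N (f x) u)"
proof (rule llinI)
  interpret N: bimodule H R N by fact
  show "lmod H M" "lmod H N" using ab(1) bimodule_mods(2)[OF N] .
  show "add_map M N (\<lambda>x. tlift N (f x) u)"
    by (rule add_map_tlift_fun[OF u lmodD(1)[OF ab(1)] ab(2,3) f llinD(3)[OF b]])
  show "tlift N (f (lact M r x)) u = lact N r (tlift N (f x) u)" if r: "r \<in> carrier H" and x: "x \<in> carrier M" for r x
  proof -
    have am: "add_map N N (lact N r)"
      using r by (intro add_mapI) (auto simp: N.lact_closed N.lact_add_right N.M.abelian_group_axioms)
    show ?thesis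
      unfolding tlift_map[OF u am f[OF x]]
      by (rule tlift_cong[OF u f]) (use lmodD(2)[OF ab(1)] r x llinD(6)[OF b r x] in auto)
  qed
qed

text \<open>Fubini for lifts. Both sides are additive in \<open>u\<close>, and at a pure tensor the
  lift over \<open>u\<close> disappears from either side.\<close>

lemma tlift_swap:
  assumes u: "u \<in> carrier (tensor H M N)" and v: "v \<in> carrier (tensor K P Q)"
    and ab: "rmod H M" "lmod H N" "rmod K P" "lmod K Q"
    and f: "\<And>x y. x \<in> carrier M \<Longrightarrow> y \<in> carrier N \<Longrightarrow> balanced K P Q G (f x y)"
    and b: "\<And>z w. z \<in> carrier P \<Longrightarrow> w \<in> carrier Q \<Longrightarrow> balanced H M N G (\<lambda>x y. f x y z w)"
  shows "tlift G (\<lambda>x y. tlift G (f x y) v) u = tlift G (\<lambda>z w. tlift G (\<lambda>x y. f x y z w) u) v"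
proof -
  have b1: "balanced H M N G (\<lambda>x y. tlift G (f x y) v)"
    by (rule balanced_tlift_fun[OF v ab f b])
  have b2: "balanced K P Q G (\<lambda>z w. tlift G (\<lambda>x y. f x y z w) u')" if "u' \<in> carrier (tensor H M N)" for u'
    by (rule balanced_tlift_fun[OF that ab(3,4,1,2) b f])
  have am: "add_map (tensor H M N) G (\<lambda>u. tlift G (\<lambda>z w. tlift G (\<lambda>x y. f x y z w) u) v)"
    by (rule add_map_tlift_fun[OF v abelian_group_tensor[OF ab(1,2)] ab(3,4) b2 tlift_add_map[OF b]])
  show ?thesis
  proof (rule tlift_ext[OF u b1 am])
    fix x y assume xy: "x \<in> carrier M" "y \<in> carrier N"
    then have p: "x \<diamondop>\<^bsub>tensor H M N\<^esub> y \<in> carrier (tensor H M N)" by (rule pure_closed[OF ab(1,2)])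
    show "tlift G (f x y) v = tlift G (\<lambda>z w. tlift G (\<lambda>x y. f x y z w) (x \<diamondop>\<^bsub>tensor H M N\<^esub> y)) v"
      by (rule tlift_cong[OF v f[OF xy]]) (simp add: tlift_pure[OF b] xy)
  qed
qed

section \<open>Balanced maps along a ring homomorphism\<close>

lemma balanced_restr:
  assumes f: "balanced A M N G f" and a: "ring_hom_ring R A \<alpha>"
  shows "balanced R (restr \<phi> \<alpha> M) (restr \<alpha> \<psi> N) G f"
proof -
  interpret a: ring_hom_ring R A \<alpha> by fact
  note D = balancedD[OF f]
  show ?thesis
    using D(1,2)
    by (intro balancedI D(3)) (auto simp: restr_simps D(6-9) rmod_def lmod_def intro: abelian_group_restr)
qed

lemma rlin_restr:
  assumes f: "rlin A M N f" and a: "ring_hom_ring R A \<alpha>"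
  shows "rlin R (restr \<phi> \<alpha> M) (restr \<psi> \<alpha> N) f"
proof -
  interpret a: ring_hom_ring R A \<alpha> by fact
  show ?thesis using f by (auto simp: rlin_def rmod_def add_map_def restr_simps abelian_group_restr)
qed

lemma llin_restr:
  assumes f: "llin A M N f" and a: "ring_hom_ring R A \<alpha>"
  shows "llin R (restr \<alpha> \<phi> M) (restr \<alpha> \<psi> N) f"
proof -
  interpret a: ring_hom_ring R A \<alpha> by fact
  show ?thesis using f by (auto simp: llin_def lmod_def add_map_def restr_simps abelian_group_restr)
qed

lemma abelian_group_restr_iff: "abelian_group (restr f g M) = abelian_group M"
proof
  show "abelian_group M" if "abelian_group (restr f g M)"
    by (rule abelian_group_transfer[OF that]) (simp_all add: restr_simps)
qed (rule abelian_group_restr)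

text \<open>A tensor product over a small ring wraps each factor in \<open>restr\<close> with
  \<open>id\<close> on the outer side. The wrapped bimodule is a different record, but one-sided
  linearity reads only the side on which the wrapper is \<open>id\<close>; these equivalences take
  the wrapper off.\<close>

lemma rlin_restr_id_source: "rlin A (restr f id M) N h \<longleftrightarrow> rlin A M N h"
  by (simp add: rlin_def rmod_def add_map_def restr_simps abelian_group_restr_iff)

lemma rlin_restr_id_target: "rlin A M (restr f id N) h \<longleftrightarrow> rlin A M N h"
  by (simp add: rlin_def rmod_def add_map_def restr_simps abelian_group_restr_iff)

lemma llin_restr_id_source: "llin A (restr id f M) N h \<longleftrightarrow> llin A M N h"
  by (simp add: llin_def lmod_def add_map_def restr_simps abelian_group_restr_iff)

lemma llin_restr_id_target: "llin A M (restr id f N) h \<longleftrightarrow> llin A M N h"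
  by (simp add: llin_def lmod_def add_map_def restr_simps abelian_group_restr_iff)

lemma add_map_restr_source: "add_map (restr f g M) G h \<longleftrightarrow> add_map M G h"
  by (simp add: add_map_def restr_simps abelian_group_restr_iff)

lemma add_map_restr_target: "add_map G (restr f g M) h \<longleftrightarrow> add_map G M h"
  by (simp add: add_map_def restr_simps abelian_group_restr_iff)

lemma balanced_restr_id_left: "balanced A (restr f id M) N G k \<longleftrightarrow> balanced A M N G k"
  by (simp add: balanced_def rmod_def add_map_def restr_simps abelian_group_restr_iff)

lemma balanced_restr_id_right: "balanced A M (restr id f N) G k \<longleftrightarrow> balanced A M N G k"
  by (simp add: balanced_def lmod_def add_map_def restr_simps abelian_group_restr_iff)

lemma balanced_restr_target: "balanced H M N (restr f g G) k \<longleftrightarrow> balanced H M N G k"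
  by (simp add: balanced_def add_map_restr_target)

lemmas restr_id_iff = rlin_restr_id_source rlin_restr_id_target llin_restr_id_source llin_restr_id_target
  add_map_restr_source add_map_restr_target balanced_restr_id_left balanced_restr_id_right balanced_restr_target

lemma add_map_pure_left:
  assumes "add_map M0 M h" "y \<in> carrier N" "rmod H M" "lmod H N"
  shows "add_map M0 (tensor H M N) (\<lambda>x. h x \<diamondop>\<^bsub>tensor H M N\<^esub> y)"
  by (rule add_map_comp[OF balancedD(4)[OF balanced_pure] assms(1)]) (rule assms)+

lemma add_map_pure_right:
  assumes "add_map M0 N h" "x \<in> carrier M" "rmod H M" "lmod H N"
  shows "add_map M0 (tensor H M N) (\<lambda>y. x \<diamondop>\<^bsub>tensor H M N\<^esub> h y)"
  by (rule add_map_comp[OF balancedD(5)[OF balanced_pure] assms(1)]) (rule assms)+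

lemma rlin_id: "rmod H M \<Longrightarrow> rlin H M M (\<lambda>x. x)"
  by (auto simp: rlin_def add_map_def rmod_def)

lemma llin_id: "lmod H M \<Longrightarrow> llin H M M (\<lambda>x. x)"
  by (auto simp: llin_def add_map_def lmod_def)

lemma rlin_comp: "rlin H N N' k \<Longrightarrow> rlin H M N h \<Longrightarrow> rlin H M N' (\<lambda>x. k (h x))"
  by (simp add: rlin_def add_map_def Pi_iff)

lemma llin_comp: "llin H N N' k \<Longrightarrow> llin H M N h \<Longrightarrow> llin H M N' (\<lambda>x. k (h x))"
  by (simp add: llin_def add_map_def Pi_iff)

lemma rlin_pure:
  assumes "rlin H M N h" "x \<in> carrier P" "bimodule L K P" "bimodule K H N"
  shows "rlin H M (tensor K P N) (\<lambda>y. x \<diamondop>\<^bsub>tensor K P N\<^esub> h y)"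
proof (rule rlin_comp[OF _ assms(1)])
  note mods = bimodule_mods(1)[OF assms(3)] bimodule_mods(2)[OF assms(4)]
  show "rlin H N (tensor K P N) (\<lambda>y. x \<diamondop>\<^bsub>tensor K P N\<^esub> y)"
    by (rule rlinI[OF _ _ balancedD(5)[OF balanced_pure[OF mods]]])
      (use assms bimodule_mods(1)[OF bimodule_tensor[OF assms(3,4)]] in \<open>auto intro: bimodule_mods simp: ract_pure[OF assms(3,4)]\<close>)
qed

lemma llin_pure:
  assumes "llin H M N h" "y \<in> carrier P" "bimodule H K N" "bimodule K R P"
  shows "llin H M (tensor K N P) (\<lambda>x. h x \<diamondop>\<^bsub>tensor K N P\<^esub> y)"
proof (rule llin_comp[OF _ assms(1)])
  note mods = bimodule_mods(1)[OF assms(3)] bimodule_mods(2)[OF assms(4)]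
  show "llin H N (tensor K N P) (\<lambda>x. x \<diamondop>\<^bsub>tensor K N P\<^esub> y)"
    by (rule llinI[OF _ _ balancedD(4)[OF balanced_pure[OF mods]]])
      (use assms bimodule_mods(2)[OF bimodule_tensor[OF assms(3,4)]] in \<open>auto intro: bimodule_mods simp: lact_pure[OF assms(3,4)]\<close>)
qed

lemma rlin_lact:
  assumes "rlin H M N h" "a \<in> carrier L" "bimodule L H N"
  shows "rlin H M N (\<lambda>x. lact N a (h x))"
proof -
  interpret bimodule L H N by fact
  have "rlin H N N (lact N a)"
    using assms(2) bimodule_mods(1)[OF assms(3)]
    by (intro rlinI add_mapI) (auto simp: M.abelian_group_axioms lact_closed lact_add_right lact_ract)
  then show ?thesis by (rule rlin_comp[OF _ assms(1)])
qed

lemma llin_ract: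
  assumes "llin H M N h" "a \<in> carrier R" "bimodule H R N"
  shows "llin H M N (\<lambda>x. ract N (h x) a)"
proof -
  interpret bimodule H R N by fact
  have "llin H N N (\<lambda>x. ract N x a)"
    using assms(2) bimodule_mods(2)[OF assms(3)]
    by (intro llinI add_mapI) (auto simp: M.abelian_group_axioms ract_closed ract_add_left lact_ract)
  then show ?thesis by (rule llin_comp[OF _ assms(1)])
qed

lemma balanced_lact_act:
  assumes "bimodule L R N" shows "balanced L (regular L) N N (lact N)"
proof -
  interpret bimodule L R N by fact
  show ?thesis
    using bimodule_mods(1)[OF bimodule_regular[OF L.ring_axioms]] bimodule_mods(2)[OF assms]
    by (intro balancedI)
      (auto simp: M.abelian_group_axioms regular_simps lact_closed lact_add_left lact_add_right lact_mult)
qed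

lemma balanced_ract_act:
  assumes "bimodule L R N" shows "balanced R N (regular R) N (ract N)"
proof -
  interpret bimodule L R N by fact
  show ?thesis
    using bimodule_mods(2)[OF bimodule_regular[OF R.ring_axioms]] bimodule_mods(1)[OF assms]
    by (intro balancedI)
      (auto simp: M.abelian_group_axioms regular_simps ract_closed ract_add_left ract_add_right ract_mult)
qed

lemma rlin_ract_right:
  assumes "rlin H M (regular H) h" "x \<in> carrier N" "bimodule L H N"
  shows "rlin H M N (\<lambda>y. ract N x (h y))"
proof -
  interpret bimodule L H N by fact
  note b = balancedD(5)[OF balanced_ract_act[OF assms(3)]]
  show ?thesis
    using rlinD[OF assms(1)] assms(2) bimodule_mods(1)[OF assms(3)]
    by (intro rlinI add_map_comp[OF b]) (auto simp: regular_simps ract_mult)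
qed

lemma llin_lact_left:
  assumes "llin H M (regular H) h" "x \<in> carrier N" "bimodule H R N"
  shows "llin H M N (\<lambda>y. lact N (h y) x)"
proof -
  interpret bimodule H R N by fact
  note b = balancedD(4)[OF balanced_lact_act[OF assms(3)]]
  show ?thesis
    using llinD[OF assms(1)] assms(2) bimodule_mods(2)[OF assms(3)]
    by (intro llinI add_map_comp[OF b]) (auto simp: regular_simps lact_mult)
qed

lemma balanced_pure_maps:
  assumes "rlin H M M' h" "llin H N N' k"
  shows "balanced H M N (tensor H M' N') (\<lambda>x y. h x \<diamondop>\<^bsub>tensor H M' N'\<^esub> k y)"
  by (rule balanced_precomp[OF balanced_pure[OF rlinD(2)[OF assms(1)] llinD(2)[OF assms(2)]] assms])

lemma balanced_pure_left:
  assumes "balanced H M N M' g" "y \<in> carrier N'" "rmod K M'" "lmod K N'"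
  shows "balanced H M N (tensor K M' N') (\<lambda>x z. g x z \<diamondop>\<^bsub>tensor K M' N'\<^esub> y)"
  by (rule balanced_map[OF balancedD(4)[OF balanced_pure] assms(1)]) (rule assms)+

lemma balanced_pure_right:
  assumes "balanced H M N N' g" "x \<in> carrier M'" "rmod K M'" "lmod K N'"
  shows "balanced H M N (tensor K M' N') (\<lambda>y z. x \<diamondop>\<^bsub>tensor K M' N'\<^esub> g y z)"
  by (rule balanced_map[OF balancedD(5)[OF balanced_pure] assms(1)]) (rule assms)+

lemma balanced_lact_maps:
  assumes "rlin L M (regular L) h" "llin L N N' k" "bimodule L R N'"
  shows "balanced L M N N' (\<lambda>x y. lact N' (h x) (k y))"
  by (rule balanced_precomp[OF balanced_lact_act[OF assms(3)] assms(1,2)])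

lemma balanced_ract_maps:
  assumes "rlin R M N' h" "llin R N (regular R) k" "bimodule L R N'"
  shows "balanced R M N N' (\<lambda>x y. ract N' (h x) (k y))"
  by (rule balanced_precomp[OF balanced_ract_act[OF assms(3)] assms(1,2)])

lemma balanced_lact_left:
  assumes "balanced H M N (regular L) g" "z \<in> carrier N'" "bimodule L R N'"
  shows "balanced H M N N' (\<lambda>x y. lact N' (g x y) z)"
  by (rule balanced_map[OF balancedD(4)[OF balanced_lact_act] assms(1)]) (rule assms)+

lemma balanced_lact_right:
  assumes "balanced H M N N' g" "z \<in> carrier L" "bimodule L R N'"
  shows "balanced H M N N' (\<lambda>x y. lact N' z (g x y))"
  by (rule balanced_map[OF balancedD(5)[OF balanced_lact_act] assms(1)])
    (use assms in \<open>auto simp: regular_simps\<close>)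

lemma balanced_ract_left:
  assumes "balanced H M N N' g" "z \<in> carrier R" "bimodule L R N'"
  shows "balanced H M N N' (\<lambda>x y. ract N' (g x y) z)"
  by (rule balanced_map[OF balancedD(4)[OF balanced_ract_act] assms(1)])
    (use assms in \<open>auto simp: regular_simps\<close>)

lemma balanced_ract_right:
  assumes "balanced H M N (regular R) g" "z \<in> carrier N'" "bimodule L R N'"
  shows "balanced H M N N' (\<lambda>x y. ract N' z (g x y))"
  by (rule balanced_map[OF balancedD(5)[OF balanced_ract_act] assms(1)]) (rule assms)+

lemmas restr_intros = restr_id_iff[THEN iffD2]

lemma bimodule_restr':
  "bimodule L' R' M \<Longrightarrow> ring_hom_ring L L' f \<Longrightarrow> ring_hom_ring R R' g \<Longrightarrow> bimodule L R (restr f g M)"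
  by (rule bimodule_restr)

lemma lact_in: "x \<in> carrier M \<Longrightarrow> bimodule L R M \<Longrightarrow> a \<in> carrier L \<Longrightarrow> lact M a x \<in> carrier M"
  by (rule bimodule.lact_closed)

lemma ract_in: "x \<in> carrier M \<Longrightarrow> bimodule L R M \<Longrightarrow> a \<in> carrier R \<Longrightarrow> ract M x a \<in> carrier M"
  by (rule bimodule.ract_closed)

lemma pure_in: "x \<in> carrier M \<Longrightarrow> y \<in> carrier N \<Longrightarrow> rmod H M \<Longrightarrow> lmod H N \<Longrightarrow>
    x \<diamondop>\<^bsub>tensor H M N\<^esub> y \<in> carrier (tensor H M N)"
  by (rule pure_closed)

lemma regular_in: "x \<in> carrier A \<Longrightarrow> x \<in> carrier (regular A)"
  by (simp add: regular_simps)

text \<open>\<open>rotated 2\<close> moves the bimodule premise to the front: it fixes the ring that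
  the conclusion does not mention, before membership in the carrier of that ring is
  attempted.\<close>

lemmas [bal] = regular_in
  balanced_pure_left balanced_pure_right balanced_pure_maps
  balanced_lact_left balanced_lact_right[rotated 2] balanced_lact_maps
  balanced_ract_left[rotated 2] balanced_ract_right balanced_ract_maps
  balanced_tlift balanced_tlift_left balanced_tlift_right balanced_tlift_fun
  rlin_id rlin_pure rlin_lact[rotated 2] rlin_ract_right rlin_tlift_arg rlin_tlift_fun
  llin_id llin_pure llin_ract[rotated 2] llin_lact_left llin_tlift_arg llin_tlift_fun
  add_map_id add_map_pure_left add_map_pure_right add_map_tlift_arg add_map_tlift_fun
  bimodule_tensor bimodule_restr' bimodule_regular ring_hom_ring_id
  bimodule_mods(1,2,3) pure_in lact_in ract_in tlift_closed

section \<open>Evaluation of nested lifts\<close>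

lemma tlift_tlift_eq:
  assumes "u \<in> carrier (tensor H M N)" "balanced H M N (tensor K P Q) f" "balanced K P Q G k"
    and "\<And>x y. x \<in> carrier M \<Longrightarrow> y \<in> carrier N \<Longrightarrow> tlift G k (f x y) = g x y"
  shows "tlift G k (tlift (tensor K P Q) f u) = tlift G g u"
  unfolding tlift_map[OF assms(1) tlift_add_map[OF assms(3)] assms(2)]
  by (rule tlift_cong[OF assms(1) balanced_tlift[OF assms(2,3)]]) (rule assms(4))

lemma tlift_map_eq:
  assumes "add_map G G' k" "u \<in> carrier (tensor H M N)" "balanced H M N G f"
    and "\<And>x y. x \<in> carrier M \<Longrightarrow> y \<in> carrier N \<Longrightarrow> k (f x y) = g x y"
  shows "k (tlift G f u) = tlift G' g u"
  unfolding tlift_map[OF assms(2,1,3)]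
  by (rule tlift_cong[OF assms(2) balanced_map[OF assms(1,3)]]) (rule assms(4))

lemma tlift_pure_eq:
  assumes "balanced H M N G f" "x \<in> carrier M" "y \<in> carrier N" "f x y = z"
  shows "tlift G f (x \<diamondop>\<^bsub>tensor H M N\<^esub> y) = z"
  using tlift_pure[OF assms(1-3)] assms(4) by simp

lemma pure_tlift_right:
  assumes "x \<in> carrier P" "rmod K P" "lmod K Q" "u \<in> carrier (tensor H M N)" "balanced H M N Q f"
    and "\<And>y z. y \<in> carrier M \<Longrightarrow> z \<in> carrier N \<Longrightarrow> x \<diamondop>\<^bsub>tensor K P Q\<^esub> f y z = g y z"
  shows "x \<diamondop>\<^bsub>tensor K P Q\<^esub> tlift Q f u = tlift (tensor K P Q) g u"
  by (rule tlift_map_eq[OF balancedD(5)[OF balanced_pure]]) (rule assms | assumption)+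

lemma pure_tlift_left:
  assumes "x \<in> carrier Q" "rmod K P" "lmod K Q" "u \<in> carrier (tensor H M N)" "balanced H M N P f"
    and "\<And>y z. y \<in> carrier M \<Longrightarrow> z \<in> carrier N \<Longrightarrow> f y z \<diamondop>\<^bsub>tensor K P Q\<^esub> x = g y z"
  shows "tlift P f u \<diamondop>\<^bsub>tensor K P Q\<^esub> x = tlift (tensor K P Q) g u"
  by (rule tlift_map_eq[OF balancedD(4)[OF balanced_pure]]) (rule assms | assumption)+

lemma lact_tlift:
  assumes "bimodule L R G" "a \<in> carrier L" "u \<in> carrier (tensor H M N)" "balanced H M N G f"
    and "\<And>y z. y \<in> carrier M \<Longrightarrow> z \<in> carrier N \<Longrightarrow> lact G a (f y z) = g y z"
  shows "lact G a (tlift G f u) = tlift G g u"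
proof (rule tlift_map_eq)
  show "add_map G G (lact G a)"
    using balancedD(5)[OF balanced_lact_act[OF assms(1)], of a] assms(2) by (simp add: regular_simps)
qed (rule assms | assumption)+

lemma ract_tlift:
  assumes "bimodule L R G" "a \<in> carrier R" "u \<in> carrier (tensor H M N)" "balanced H M N G f"
    and "\<And>y z. y \<in> carrier M \<Longrightarrow> z \<in> carrier N \<Longrightarrow> ract G (f y z) a = g y z"
  shows "ract G (tlift G f u) a = tlift G g u"
proof (rule tlift_map_eq)
  show "add_map G G (\<lambda>x. ract G x a)"
    using balancedD(4)[OF balanced_ract_act[OF assms(1)], of a] assms(2) by (simp add: regular_simps)
qed (rule assms | assumption)+

lemma add_map_regular: "ring A \<Longrightarrow> add_map M (regular A) f \<longleftrightarrow> add_map M A f"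
  using bimodule_mods(3)[OF bimodule_regular, of A] 
  by (auto simp: add_map_def regular_simps ring_def)

lemma balanced_regular: "ring A \<Longrightarrow> balanced H M N (regular A) f \<longleftrightarrow> balanced H M N A f"
  by (simp add: balanced_def add_map_regular)

text \<open>\<open>comp_ev\<close> and \<open>smash_counit\<close> lift into the ring itself,
  whereas the linearity rules speak of its regular bimodule. This lets a lift change its target from
  one record to the other.\<close>

lemma tlift_regular:
  assumes "ring A" "u \<in> carrier (tensor H M N)" "balanced H M N (regular A) f"
  shows "tlift A f u = tlift (regular A) f u"
proof (rule tlift_ext[OF assms(2)])
  show "balanced H M N A f" using assms by (simp add: balanced_regular)
  show "add_map (tensor H M N) A (tlift (regular A) f)"
    using tlift_add_map[OF assms(3)] by (simp add: add_map_regular[OF assms(1)])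
qed (simp add: tlift_pure[OF assms(3)])

lemma lact_pure_eq:
  assumes "bimodule L H M" "bimodule H R N" "a \<in> carrier L" "x \<in> carrier M" "y \<in> carrier N"
  shows "lact (tensor H M N) a (x \<diamondop>\<^bsub>tensor H M N\<^esub> y) = lact M a x \<diamondop>\<^bsub>tensor H M N\<^esub> y"
  using lact_pure[OF assms] .

lemma ract_pure_eq:
  assumes "bimodule L H M" "bimodule H R N" "a \<in> carrier R" "x \<in> carrier M" "y \<in> carrier N"
  shows "ract (tensor H M N) (x \<diamondop>\<^bsub>tensor H M N\<^esub> y) a = x \<diamondop>\<^bsub>tensor H M N\<^esub> ract N y a"
  using ract_pure[OF assms] .

lemma pure_middle_eq:
  assumes "x \<in> carrier M" "r \<in> carrier H" "y \<in> carrier N" "rmod H M" "lmod H N"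
  shows "ract M x r \<diamondop>\<^bsub>tensor H M N\<^esub> y = x \<diamondop>\<^bsub>tensor H M N\<^esub> lact N r y"
  using pure_middle[OF assms(4,5,1-3)] .

text \<open>Each rule pushes an outer map into a lift or evaluates it at a pure tensor, and leaves
  the equality of the integrands as a premise. Repeated resolution thus evaluates a composite from
  the outside inwards until \<open>refl\<close> applies.\<close>

lemmas evals = refl tlift_tlift_eq tlift_pure_eq pure_tlift_left pure_tlift_right lact_tlift ract_tlift tlift_cong

section \<open>Smash coproducts in Sweedler form\<close>

text \<open>The ring \<open>L\<close> on the left is a parameter because of the two instances that
  occur: \<open>T\<close>, a left \<open>B\<close>-module, and the coring itself, a left
  \<open>A\<close>-module.\<close>

locale right_comodule =
  fixes A :: "('a, 'a1) ring_scheme" and L :: "('l, 'l1) ring_scheme"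
    and C :: "('a, 'a, 'c) bimod" and \<Delta> :: "'c \<Rightarrow> ('c, 'c) tens"
    and M :: "('l, 'a, 'm) bimod" and \<rho> :: "'m \<Rightarrow> ('m, 'c) tens"
  assumes C [bal]: "bimodule A A C" and M [bal]: "bimodule L A M"
    and \<Delta>l: "llin A C (C \<^bold>\<otimes>\<^bsub>A\<^esub> C) \<Delta>" and \<Delta>r: "rlin A C (C \<^bold>\<otimes>\<^bsub>A\<^esub> C) \<Delta>"
    and \<rho>r: "rlin A M (M \<^bold>\<otimes>\<^bsub>A\<^esub> C) \<rho>"
    and coassoc: "m \<in> carrier M \<Longrightarrow>
      tlift (M \<^bold>\<otimes>\<^bsub>A\<^esub> (C \<^bold>\<otimes>\<^bsub>A\<^esub> C)) (\<lambda>m1 c. tlift (M \<^bold>\<otimes>\<^bsub>A\<^esub> (C \<^bold>\<otimes>\<^bsub>A\<^esub> C))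
        (\<lambda>m0 d. m0 \<diamondop>\<^bsub>M \<^bold>\<otimes>\<^bsub>A\<^esub> (C \<^bold>\<otimes>\<^bsub>A\<^esub> C)\<^esub> (d \<diamondop>\<^bsub>C \<^bold>\<otimes>\<^bsub>A\<^esub> C\<^esub> c)) (\<rho> m1)) (\<rho> m) =
      tlift (M \<^bold>\<otimes>\<^bsub>A\<^esub> (C \<^bold>\<otimes>\<^bsub>A\<^esub> C)) (\<lambda>m0 c. m0 \<diamondop>\<^bsub>M \<^bold>\<otimes>\<^bsub>A\<^esub> (C \<^bold>\<otimes>\<^bsub>A\<^esub> C)\<^esub> \<Delta> c) (\<rho> m)"
begin

lemmas [bal] = rlin_comp[OF \<Delta>r] rlin_comp[OF \<rho>r] llin_comp[OF \<Delta>l]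
  rlinD(4)[OF \<Delta>r] rlinD(4)[OF \<rho>r]
  balanced_map[OF rlinD(3)[OF \<rho>r]] balanced_map[OF rlinD(3)[OF \<Delta>r]]

text \<open>Both sides of \<open>coassoc\<close> are fed to the map induced by an arbitrary
  integrand \<open>f\<close>. In this form coassociativity applies inside any Sweedler sum and no
  associator is left.\<close>

lemma coassoc_int:
  assumes m: "m \<in> carrier M"
    and f1: "\<And>c. c \<in> carrier C \<Longrightarrow> balanced A M C G (\<lambda>m d. f m d c)"
    and f2: "\<And>m. m \<in> carrier M \<Longrightarrow> balanced A C C G (f m)"
  shows "tlift G (\<lambda>m1 c. tlift G (\<lambda>m0 d. f m0 d c) (\<rho> m1)) (\<rho> m) =
    tlift G (\<lambda>m0 c. tlift G (f m0) (\<Delta> c)) (\<rho> m)"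
proof -
  have bk: "balanced A M (C \<^bold>\<otimes>\<^bsub>A\<^esub> C) G (\<lambda>m. tlift G (f m))"
    by (rule f1 f2 bal | assumption)+
  show ?thesis
    apply (rule trans[OF trans[OF _ arg_cong[OF coassoc[OF m], of "tlift G (\<lambda>m. tlift G (f m))"]]])
     apply (rule sym)
    by (rule evals f1 f2 bk bal m | assumption)+
qed

end

locale left_comodule =
  fixes A :: "('a, 'a1) ring_scheme" and R :: "('r, 'r1) ring_scheme"
    and E :: "('a, 'a, 'e) bimod" and \<Delta> :: "'e \<Rightarrow> ('e, 'e) tens"
    and N :: "('a, 'r, 'n) bimod" and \<rho> :: "'n \<Rightarrow> ('e, 'n) tens"
  assumes E [bal]: "bimodule A A E" and N [bal]: "bimodule A R N"
    and \<Delta>l: "llin A E (E \<^bold>\<otimes>\<^bsub>A\<^esub> E) \<Delta>" and \<Delta>r: "rlin A E (E \<^bold>\<otimes>\<^bsub>A\<^esub> E) \<Delta>"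
    and \<rho>l: "llin A N (E \<^bold>\<otimes>\<^bsub>A\<^esub> N) \<rho>"
    and coassoc: "n \<in> carrier N \<Longrightarrow>
      tlift ((E \<^bold>\<otimes>\<^bsub>A\<^esub> E) \<^bold>\<otimes>\<^bsub>A\<^esub> N) (\<lambda>e n1. tlift ((E \<^bold>\<otimes>\<^bsub>A\<^esub> E) \<^bold>\<otimes>\<^bsub>A\<^esub> N)
        (\<lambda>d n0. (e \<diamondop>\<^bsub>E \<^bold>\<otimes>\<^bsub>A\<^esub> E\<^esub> d) \<diamondop>\<^bsub>(E \<^bold>\<otimes>\<^bsub>A\<^esub> E) \<^bold>\<otimes>\<^bsub>A\<^esub> N\<^esub> n0) (\<rho> n1)) (\<rho> n) =
      tlift ((E \<^bold>\<otimes>\<^bsub>A\<^esub> E) \<^bold>\<otimes>\<^bsub>A\<^esub> N) (\<lambda>e n0. \<Delta> e \<diamondop>\<^bsub>(E \<^bold>\<otimes>\<^bsub>A\<^esub> E) \<^bold>\<otimes>\<^bsub>A\<^esub> N\<^esub> n0) (\<rho> n)"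
begin

lemmas [bal] = rlin_comp[OF \<Delta>r] llin_comp[OF \<rho>l] llin_comp[OF \<Delta>l]
  llinD(4)[OF \<Delta>l] llinD(4)[OF \<rho>l]
  balanced_map[OF llinD(3)[OF \<rho>l]] balanced_map[OF llinD(3)[OF \<Delta>l]]

lemma coassoc_int:
  assumes n: "n \<in> carrier N"
    and f1: "\<And>e. e \<in> carrier E \<Longrightarrow> balanced A E N G (f e)"
    and f2: "\<And>n. n \<in> carrier N \<Longrightarrow> balanced A E E G (\<lambda>e d. f e d n)"
  shows "tlift G (\<lambda>e n1. tlift G (\<lambda>d n0. f e d n0) (\<rho> n1)) (\<rho> n) =
    tlift G (\<lambda>e n0. tlift G (\<lambda>e1 e2. f e1 e2 n0) (\<Delta> e)) (\<rho> n)"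
proof -
  have bk: "balanced A (E \<^bold>\<otimes>\<^bsub>A\<^esub> E) N G (\<lambda>u n. tlift G (\<lambda>e1 e2. f e1 e2 n) u)"
    by (rule f1 f2 bal | assumption)+
  show ?thesis
    apply (rule trans[OF trans[OF _ arg_cong[OF coassoc[OF n], of "tlift G (\<lambda>u n. tlift G (\<lambda>e1 e2. f e1 e2 n) u)"]]])
     apply (rule sym)
    by (rule evals f1 f2 bk bal n | assumption)+
qed

end

section \<open>The conditions on a smash coproduct at pure tensors\<close>

locale coring_pair =
  fixes A :: "('a, 'a1) ring_scheme"
    and C :: "('a, 'a, 'c) bimod" and \<Delta>\<^sub>C :: "'c \<Rightarrow> ('c, 'c) tens" and \<epsilon>\<^sub>C :: "'c \<Rightarrow> 'a"
    and E :: "('a, 'a, 'e) bimod" and \<Delta>\<^sub>E :: "'e \<Rightarrow> ('e, 'e) tens" and \<epsilon>\<^sub>E :: "'e \<Rightarrow> 'a"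
  assumes C: "bimodule A A C" and E: "bimodule A A E"
    and \<Delta>\<^sub>C: "\<Delta>\<^sub>C \<in> bimod_hom A A C (C \<^bold>\<otimes>\<^bsub>A\<^esub> C)" and \<Delta>\<^sub>E: "\<Delta>\<^sub>E \<in> bimod_hom A A E (E \<^bold>\<otimes>\<^bsub>A\<^esub> E)"
    and \<epsilon>\<^sub>C: "\<epsilon>\<^sub>C \<in> bimod_hom A A C (regular A)" and \<epsilon>\<^sub>E: "\<epsilon>\<^sub>E \<in> bimod_hom A A E (regular A)"
begin

lemma A: "ring A" using C by (rule bimodule_mods)

lemmas \<Delta>\<^sub>CD = bimod_homD[OF \<Delta>\<^sub>C C bimodule_tensor[OF C C]]
  and \<Delta>\<^sub>ED = bimod_homD[OF \<Delta>\<^sub>E E bimodule_tensor[OF E E]]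
  and \<epsilon>\<^sub>CD = bimod_homD[OF \<epsilon>\<^sub>C C bimodule_regular[OF A]]
  and \<epsilon>\<^sub>ED = bimod_homD[OF \<epsilon>\<^sub>E E bimodule_regular[OF A]]

lemma \<epsilon>_closed: "c \<in> carrier C \<Longrightarrow> \<epsilon>\<^sub>C c \<in> carrier A" "e \<in> carrier E \<Longrightarrow> \<epsilon>\<^sub>E e \<in> carrier A"
  using llinD(4)[OF \<epsilon>\<^sub>CD(1)] llinD(4)[OF \<epsilon>\<^sub>ED(1)] by (auto simp: regular_simps)

lemmas [bal] = C E A
  rlin_comp[OF \<Delta>\<^sub>CD(2)] llin_comp[OF \<Delta>\<^sub>CD(1)] add_map_comp[OF \<Delta>\<^sub>CD(3)] balanced_map[OF \<Delta>\<^sub>CD(3)] llinD(4)[OF \<Delta>\<^sub>CD(1)]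
  rlin_comp[OF \<Delta>\<^sub>ED(2)] llin_comp[OF \<Delta>\<^sub>ED(1)] add_map_comp[OF \<Delta>\<^sub>ED(3)] balanced_map[OF \<Delta>\<^sub>ED(3)] llinD(4)[OF \<Delta>\<^sub>ED(1)]
  rlin_comp[OF \<epsilon>\<^sub>CD(2)] llin_comp[OF \<epsilon>\<^sub>CD(1)] balanced_map[OF \<epsilon>\<^sub>CD(3)]
  rlin_comp[OF \<epsilon>\<^sub>ED(2)] llin_comp[OF \<epsilon>\<^sub>ED(1)] balanced_map[OF \<epsilon>\<^sub>ED(3)] \<epsilon>_closed

end

text \<open>The compatibility of \<open>\<sigma>\<close> with the coproduct of \<open>C\<close> once
  the associators are evaluated away: \<open>e\<close> is exchanged with \<open>c2\<close>, and the
  resulting \<open>e'\<close> with \<open>c1\<close>.\<close>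

abbreviation (input) smash_mult_left where
  "smash_mult_left A C \<Delta>\<^sub>C E \<sigma> c e \<equiv>
    tlift (E \<^bold>\<otimes>\<^bsub>A\<^esub> (C \<^bold>\<otimes>\<^bsub>A\<^esub> C)) (\<lambda>e' c'. e' \<diamondop>\<^bsub>E \<^bold>\<otimes>\<^bsub>A\<^esub> (C \<^bold>\<otimes>\<^bsub>A\<^esub> C)\<^esub> \<Delta>\<^sub>C c') (\<sigma> (c \<diamondop>\<^bsub>C \<^bold>\<otimes>\<^bsub>A\<^esub> E\<^esub> e)) =
    tlift (E \<^bold>\<otimes>\<^bsub>A\<^esub> (C \<^bold>\<otimes>\<^bsub>A\<^esub> C)) (\<lambda>c1 c2.
      tlift (E \<^bold>\<otimes>\<^bsub>A\<^esub> (C \<^bold>\<otimes>\<^bsub>A\<^esub> C)) (\<lambda>e' c'.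
        tlift (E \<^bold>\<otimes>\<^bsub>A\<^esub> (C \<^bold>\<otimes>\<^bsub>A\<^esub> C)) (\<lambda>e'' c''. e'' \<diamondop>\<^bsub>E \<^bold>\<otimes>\<^bsub>A\<^esub> (C \<^bold>\<otimes>\<^bsub>A\<^esub> C)\<^esub> (c'' \<diamondop>\<^bsub>C \<^bold>\<otimes>\<^bsub>A\<^esub> C\<^esub> c'))
          (\<sigma> (c1 \<diamondop>\<^bsub>C \<^bold>\<otimes>\<^bsub>A\<^esub> E\<^esub> e'))) (\<sigma> (c2 \<diamondop>\<^bsub>C \<^bold>\<otimes>\<^bsub>A\<^esub> E\<^esub> e))) (\<Delta>\<^sub>C c)"

abbreviation (input) smash_mult_right where
  "smash_mult_right A C E \<Delta>\<^sub>E \<sigma> c e \<equiv>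
    tlift ((E \<^bold>\<otimes>\<^bsub>A\<^esub> E) \<^bold>\<otimes>\<^bsub>A\<^esub> C) (\<lambda>e' c'. \<Delta>\<^sub>E e' \<diamondop>\<^bsub>(E \<^bold>\<otimes>\<^bsub>A\<^esub> E) \<^bold>\<otimes>\<^bsub>A\<^esub> C\<^esub> c') (\<sigma> (c \<diamondop>\<^bsub>C \<^bold>\<otimes>\<^bsub>A\<^esub> E\<^esub> e)) =
    tlift ((E \<^bold>\<otimes>\<^bsub>A\<^esub> E) \<^bold>\<otimes>\<^bsub>A\<^esub> C) (\<lambda>e1 e2.
      tlift ((E \<^bold>\<otimes>\<^bsub>A\<^esub> E) \<^bold>\<otimes>\<^bsub>A\<^esub> C) (\<lambda>e' c'.
        tlift ((E \<^bold>\<otimes>\<^bsub>A\<^esub> E) \<^bold>\<otimes>\<^bsub>A\<^esub> C) (\<lambda>e'' c''. (e' \<diamondop>\<^bsub>E \<^bold>\<otimes>\<^bsub>A\<^esub> E\<^esub> e'') \<diamondop>\<^bsub>(E \<^bold>\<otimes>\<^bsub>A\<^esub> E) \<^bold>\<otimes>\<^bsub>A\<^esub> C\<^esub> c'')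
          (\<sigma> (c' \<diamondop>\<^bsub>C \<^bold>\<otimes>\<^bsub>A\<^esub> E\<^esub> e2))) (\<sigma> (c \<diamondop>\<^bsub>C \<^bold>\<otimes>\<^bsub>A\<^esub> E\<^esub> e1))) (\<Delta>\<^sub>E e)"

text \<open>Both sides of each of the four conditions are additive in \<open>u\<close> and may be
  compared at pure tensors, where the composites of \<open>tmap\<close> and the associators evaluate
  to nested lifts.\<close>

lemma (in coring_pair) smash_coproduct_iff:
  "smash_coproduct A C \<Delta>\<^sub>C \<epsilon>\<^sub>C E \<Delta>\<^sub>E \<epsilon>\<^sub>E \<sigma> \<longleftrightarrow>
    \<sigma> \<in> bimod_hom A A (C \<^bold>\<otimes>\<^bsub>A\<^esub> E) (E \<^bold>\<otimes>\<^bsub>A\<^esub> C) \<and>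
    (\<forall>c\<in>carrier C. \<forall>e\<in>carrier E. 
      smash_mult_left A C \<Delta>\<^sub>C E \<sigma> c e \<and> smash_mult_right A C E \<Delta>\<^sub>E \<sigma> c e \<and>
      tlift C (\<lambda>e c. lact C (\<epsilon>\<^sub>E e) c) (\<sigma> (c \<diamondop>\<^bsub>C \<^bold>\<otimes>\<^bsub>A\<^esub> E\<^esub> e)) = ract C c (\<epsilon>\<^sub>E e) \<and>
      tlift E (\<lambda>e c. ract E e (\<epsilon>\<^sub>C c)) (\<sigma> (c \<diamondop>\<^bsub>C \<^bold>\<otimes>\<^bsub>A\<^esub> E\<^esub> e)) = lact E (\<epsilon>\<^sub>C c) e)"
proof (cases "\<sigma> \<in> bimod_hom A A (C \<^bold>\<otimes>\<^bsub>A\<^esub> E) (E \<^bold>\<otimes>\<^bsub>A\<^esub> C)")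
  case True
  let ?CE = "C \<^bold>\<otimes>\<^bsub>A\<^esub> E" and ?EC = "E \<^bold>\<otimes>\<^bsub>A\<^esub> C" and ?CC = "C \<^bold>\<otimes>\<^bsub>A\<^esub> C" and ?EE = "E \<^bold>\<otimes>\<^bsub>A\<^esub> E"
  note \<sigma> = bimod_homD[OF True bimodule_tensor[OF C E] bimodule_tensor[OF E C]]
  note rules = rlin_comp[OF \<sigma>(2)] llin_comp[OF \<sigma>(1)] add_map_comp[OF \<sigma>(3)] balanced_map[OF \<sigma>(3)] llinD(4)[OF \<sigma>(1)] bal
  have ext: "(\<forall>u\<in>carrier ?CE. f u = g u) \<longleftrightarrow> (\<forall>c\<in>carrier C. \<forall>e\<in>carrier E. f' c e = g' c e)"
    if "add_map ?CE G f" "add_map ?CE G g"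
      "\<And>c e. c \<in> carrier C \<Longrightarrow> e \<in> carrier E \<Longrightarrow> f (c \<diamondop>\<^bsub>?CE\<^esub> e) = f' c e"
      "\<And>c e. c \<in> carrier C \<Longrightarrow> e \<in> carrier E \<Longrightarrow> g (c \<diamondop>\<^bsub>?CE\<^esub> e) = g' c e" for G f g f' g'
  proof -
    have "rmod A C" "lmod A E" by (rule bal)+
    then show ?thesis
      using tensor_ext[OF that(1,2)] pure_closed[of A C E] that(3,4) by metis
  qed
  have abCE: "abelian_group ?CE" by (rule bimodule_mods(3)[OF bimodule_tensor[OF C E]])
  have 3: "(\<forall>u\<in>carrier ?CE. tlift C (\<lambda>e c. lact C (\<epsilon>\<^sub>E e) c) (\<sigma> u) = tlift C (\<lambda>c e. ract C c (\<epsilon>\<^sub>E e)) u) \<longleftrightarrow>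
    (\<forall>c\<in>carrier C. \<forall>e\<in>carrier E. tlift C (\<lambda>e c. lact C (\<epsilon>\<^sub>E e) c) (\<sigma> (c \<diamondop>\<^bsub>?CE\<^esub> e)) = ract C c (\<epsilon>\<^sub>E e))"
    by (rule ext; (rule refl tlift_pure_eq add_map_tlift_arg abCE rules | assumption)+)
  have 4: "(\<forall>u\<in>carrier ?CE. tlift E (\<lambda>e c. ract E e (\<epsilon>\<^sub>C c)) (\<sigma> u) = tlift E (\<lambda>c e. lact E (\<epsilon>\<^sub>C c) e) u) \<longleftrightarrow>
    (\<forall>c\<in>carrier C. \<forall>e\<in>carrier E. tlift E (\<lambda>e c. ract E e (\<epsilon>\<^sub>C c)) (\<sigma> (c \<diamondop>\<^bsub>?CE\<^esub> e)) = lact E (\<epsilon>\<^sub>C c) e)"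
    by (rule ext; (rule refl tlift_pure_eq add_map_tlift_arg abCE rules | assumption)+)
  have 1: "(\<forall>u\<in>carrier ?CE.  tmap A E ?CC id \<Delta>\<^sub>C (\<sigma> u) =
        (assoc A E C C \<circ> tmap A ?EC C \<sigma> id \<circ> assoc_inv A C E C \<circ>
          tmap A C ?EC id \<sigma> \<circ> assoc A C C E \<circ> tmap A ?CC E \<Delta>\<^sub>C id) u) \<longleftrightarrow>
    (\<forall>c\<in>carrier C. \<forall>e\<in>carrier E. smash_mult_left A C \<Delta>\<^sub>C E \<sigma> c e)"
  proof (rule ext, unfold comp_def tmap_def assoc_def assoc_inv_def tlift3_def Let_def id_def)
    let ?Q = "E \<^bold>\<otimes>\<^bsub>A\<^esub> ?CC"
    show "add_map ?CE ?Q (\<lambda>u. tlift ?Q (\<lambda>x y. x \<diamondop>\<^bsub>?Q\<^esub> \<Delta>\<^sub>C y) (\<sigma> u))"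
      by (rule abCE rules | assumption)+
    show "tlift ?Q (\<lambda>x y. x \<diamondop>\<^bsub>?Q\<^esub> \<Delta>\<^sub>C y) (\<sigma> (c \<diamondop>\<^bsub>?CE\<^esub> e)) = tlift ?Q (\<lambda>x y. x \<diamondop>\<^bsub>?Q\<^esub> \<Delta>\<^sub>C y) (\<sigma> (c \<diamondop>\<^bsub>?CE\<^esub> e))" for c e ..
    let ?f1 = "tlift (?CC \<^bold>\<otimes>\<^bsub>A\<^esub> E) (\<lambda>x y. \<Delta>\<^sub>C x \<diamondop>\<^bsub>?CC \<^bold>\<otimes>\<^bsub>A\<^esub> E\<^esub> y)"
    let ?f2 = "tlift (C \<^bold>\<otimes>\<^bsub>A\<^esub> ?CE) (\<lambda>u z. tlift (C \<^bold>\<otimes>\<^bsub>A\<^esub> ?CE) (\<lambda>x y. x \<diamondop>\<^bsub>C \<^bold>\<otimes>\<^bsub>A\<^esub> ?CE\<^esub> (y \<diamondop>\<^bsub>?CE\<^esub> z)) u)"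
    let ?f3 = "tlift (C \<^bold>\<otimes>\<^bsub>A\<^esub> ?EC) (\<lambda>x y. x \<diamondop>\<^bsub>C \<^bold>\<otimes>\<^bsub>A\<^esub> ?EC\<^esub> \<sigma> y)"
    let ?f4 = "tlift (?CE \<^bold>\<otimes>\<^bsub>A\<^esub> C) (\<lambda>x. tlift (?CE \<^bold>\<otimes>\<^bsub>A\<^esub> C) (\<lambda>y z. (x \<diamondop>\<^bsub>?CE\<^esub> y) \<diamondop>\<^bsub>?CE \<^bold>\<otimes>\<^bsub>A\<^esub> C\<^esub> z))"
    let ?f5 = "tlift (?EC \<^bold>\<otimes>\<^bsub>A\<^esub> C) (\<lambda>x y. \<sigma> x \<diamondop>\<^bsub>?EC \<^bold>\<otimes>\<^bsub>A\<^esub> C\<^esub> y)"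
    let ?f6 = "tlift ?Q (\<lambda>u z. tlift ?Q (\<lambda>x y. x \<diamondop>\<^bsub>?Q\<^esub> (y \<diamondop>\<^bsub>?CC\<^esub> z)) u)"
    show "add_map ?CE ?Q (\<lambda>u. ?f6 (?f5 (?f4 (?f3 (?f2 (?f1 u))))))"
      by (rule abCE rules | assumption)+
    fix c e assume c: "c \<in> carrier C" and e: "e \<in> carrier E"
    note r = evals c e rules
    \<comment> \<open>The composite is evaluated one factor at a time, with the result written in
      Sweedler form after each factor.\<close>
    have 1: "?f1 (c \<diamondop>\<^bsub>?CE\<^esub> e) = \<Delta>\<^sub>C c \<diamondop>\<^bsub>?CC \<^bold>\<otimes>\<^bsub>A\<^esub> E\<^esub> e"
      by (rule r | assumption)+
    have 2: "?f2 (\<Delta>\<^sub>C c \<diamondop>\<^bsub>?CC \<^bold>\<otimes>\<^bsub>A\<^esub> E\<^esub> e) = tlift (C \<^bold>\<otimes>\<^bsub>A\<^esub> ?CE) (\<lambda>x y. x \<diamondop>\<^bsub>C \<^bold>\<otimes>\<^bsub>A\<^esub> ?CE\<^esub> (y \<diamondop>\<^bsub>?CE\<^esub> e)) (\<Delta>\<^sub>C c)"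
      by (rule r | assumption)+
    have 3: "?f3 (tlift (C \<^bold>\<otimes>\<^bsub>A\<^esub> ?CE) (\<lambda>x y. x \<diamondop>\<^bsub>C \<^bold>\<otimes>\<^bsub>A\<^esub> ?CE\<^esub> (y \<diamondop>\<^bsub>?CE\<^esub> e)) (\<Delta>\<^sub>C c)) =
      tlift (C \<^bold>\<otimes>\<^bsub>A\<^esub> ?EC) (\<lambda>x y. x \<diamondop>\<^bsub>C \<^bold>\<otimes>\<^bsub>A\<^esub> ?EC\<^esub> \<sigma> (y \<diamondop>\<^bsub>?CE\<^esub> e)) (\<Delta>\<^sub>C c)"
      by (rule r | assumption)+
    have 4: "?f4 (tlift (C \<^bold>\<otimes>\<^bsub>A\<^esub> ?EC) (\<lambda>x y. x \<diamondop>\<^bsub>C \<^bold>\<otimes>\<^bsub>A\<^esub> ?EC\<^esub> \<sigma> (y \<diamondop>\<^bsub>?CE\<^esub> e)) (\<Delta>\<^sub>C c)) =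
      tlift (?CE \<^bold>\<otimes>\<^bsub>A\<^esub> C) (\<lambda>c1 c2. tlift (?CE \<^bold>\<otimes>\<^bsub>A\<^esub> C) (\<lambda>e' c'. (c1 \<diamondop>\<^bsub>?CE\<^esub> e') \<diamondop>\<^bsub>?CE \<^bold>\<otimes>\<^bsub>A\<^esub> C\<^esub> c') (\<sigma> (c2 \<diamondop>\<^bsub>?CE\<^esub> e))) (\<Delta>\<^sub>C c)"
      by (rule r | assumption)+
    have 5: "?f5 (tlift (?CE \<^bold>\<otimes>\<^bsub>A\<^esub> C) (\<lambda>c1 c2. tlift (?CE \<^bold>\<otimes>\<^bsub>A\<^esub> C) (\<lambda>e' c'. (c1 \<diamondop>\<^bsub>?CE\<^esub> e') \<diamondop>\<^bsub>?CE \<^bold>\<otimes>\<^bsub>A\<^esub> C\<^esub> c') (\<sigma> (c2 \<diamondop>\<^bsub>?CE\<^esub> e))) (\<Delta>\<^sub>C c)) =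
      tlift (?EC \<^bold>\<otimes>\<^bsub>A\<^esub> C) (\<lambda>c1 c2. tlift (?EC \<^bold>\<otimes>\<^bsub>A\<^esub> C) (\<lambda>e' c'. \<sigma> (c1 \<diamondop>\<^bsub>?CE\<^esub> e') \<diamondop>\<^bsub>?EC \<^bold>\<otimes>\<^bsub>A\<^esub> C\<^esub> c') (\<sigma> (c2 \<diamondop>\<^bsub>?CE\<^esub> e))) (\<Delta>\<^sub>C c)"
      by (rule r | assumption)+
    have 6: "?f6 (tlift (?EC \<^bold>\<otimes>\<^bsub>A\<^esub> C) (\<lambda>c1 c2. tlift (?EC \<^bold>\<otimes>\<^bsub>A\<^esub> C) (\<lambda>e' c'. \<sigma> (c1 \<diamondop>\<^bsub>?CE\<^esub> e') \<diamondop>\<^bsub>?EC \<^bold>\<otimes>\<^bsub>A\<^esub> C\<^esub> c') (\<sigma> (c2 \<diamondop>\<^bsub>?CE\<^esub> e))) (\<Delta>\<^sub>C c)) =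
      tlift ?Q (\<lambda>c1 c2. tlift ?Q (\<lambda>e' c'. tlift ?Q (\<lambda>e'' c''. e'' \<diamondop>\<^bsub>?Q\<^esub> (c'' \<diamondop>\<^bsub>?CC\<^esub> c')) (\<sigma> (c1 \<diamondop>\<^bsub>?CE\<^esub> e'))) (\<sigma> (c2 \<diamondop>\<^bsub>?CE\<^esub> e))) (\<Delta>\<^sub>C c)"
      by (rule r | assumption)+
    show "?f6 (?f5 (?f4 (?f3 (?f2 (?f1 (c \<diamondop>\<^bsub>?CE\<^esub> e)))))) = 
      tlift ?Q (\<lambda>c1 c2. tlift ?Q (\<lambda>e' c'. tlift ?Q (\<lambda>e'' c''. e'' \<diamondop>\<^bsub>?Q\<^esub> (c'' \<diamondop>\<^bsub>?CC\<^esub> c')) (\<sigma> (c1 \<diamondop>\<^bsub>?CE\<^esub> e'))) (\<sigma> (c2 \<diamondop>\<^bsub>?CE\<^esub> e))) (\<Delta>\<^sub>C c)"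
      by (simp only: 1 2 3 4 5 6)
  qed
  have 2: "(\<forall>u\<in>carrier ?CE. tmap A ?EE C \<Delta>\<^sub>E id (\<sigma> u) =
        (assoc_inv A E E C \<circ> tmap A E ?EC id \<sigma> \<circ> assoc A E C E \<circ>
          tmap A ?EC E \<sigma> id \<circ> assoc_inv A C E E \<circ> tmap A C ?EE id \<Delta>\<^sub>E) u) \<longleftrightarrow>
    (\<forall>c\<in>carrier C. \<forall>e\<in>carrier E. smash_mult_right A C E \<Delta>\<^sub>E \<sigma> c e)"
  proof (rule ext, unfold comp_def tmap_def assoc_def assoc_inv_def tlift3_def Let_def id_def)
    let ?Q = "?EE \<^bold>\<otimes>\<^bsub>A\<^esub> C"
    show "add_map ?CE ?Q (\<lambda>u. tlift ?Q (\<lambda>x y. \<Delta>\<^sub>E x \<diamondop>\<^bsub>?Q\<^esub> y) (\<sigma> u))"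
      by (rule abCE rules | assumption)+
    show "tlift ?Q (\<lambda>x y. \<Delta>\<^sub>E x \<diamondop>\<^bsub>?Q\<^esub> y) (\<sigma> (c \<diamondop>\<^bsub>?CE\<^esub> e)) = tlift ?Q (\<lambda>x y. \<Delta>\<^sub>E x \<diamondop>\<^bsub>?Q\<^esub> y) (\<sigma> (c \<diamondop>\<^bsub>?CE\<^esub> e))" for c e ..
    let ?f1 = "tlift (C \<^bold>\<otimes>\<^bsub>A\<^esub> ?EE) (\<lambda>x y. x \<diamondop>\<^bsub>C \<^bold>\<otimes>\<^bsub>A\<^esub> ?EE\<^esub> \<Delta>\<^sub>E y)"
    let ?f2 = "tlift (?CE \<^bold>\<otimes>\<^bsub>A\<^esub> E) (\<lambda>x. tlift (?CE \<^bold>\<otimes>\<^bsub>A\<^esub> E) (\<lambda>y z. (x \<diamondop>\<^bsub>?CE\<^esub> y) \<diamondop>\<^bsub>?CE \<^bold>\<otimes>\<^bsub>A\<^esub> E\<^esub> z))"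
    let ?f3 = "tlift (?EC \<^bold>\<otimes>\<^bsub>A\<^esub> E) (\<lambda>x y. \<sigma> x \<diamondop>\<^bsub>?EC \<^bold>\<otimes>\<^bsub>A\<^esub> E\<^esub> y)"
    let ?f4 = "tlift (E \<^bold>\<otimes>\<^bsub>A\<^esub> ?CE) (\<lambda>u z. tlift (E \<^bold>\<otimes>\<^bsub>A\<^esub> ?CE) (\<lambda>x y. x \<diamondop>\<^bsub>E \<^bold>\<otimes>\<^bsub>A\<^esub> ?CE\<^esub> (y \<diamondop>\<^bsub>?CE\<^esub> z)) u)"
    let ?f5 = "tlift (E \<^bold>\<otimes>\<^bsub>A\<^esub> ?EC) (\<lambda>x y. x \<diamondop>\<^bsub>E \<^bold>\<otimes>\<^bsub>A\<^esub> ?EC\<^esub> \<sigma> y)"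
    let ?f6 = "tlift ?Q (\<lambda>x. tlift ?Q (\<lambda>y z. (x \<diamondop>\<^bsub>?EE\<^esub> y) \<diamondop>\<^bsub>?Q\<^esub> z))"
    show "add_map ?CE ?Q (\<lambda>u. ?f6 (?f5 (?f4 (?f3 (?f2 (?f1 u))))))"
      by (rule abCE rules | assumption)+
    fix c e assume c: "c \<in> carrier C" and e: "e \<in> carrier E"
    note r = evals c e rules
    have 1: "?f1 (c \<diamondop>\<^bsub>?CE\<^esub> e) = c \<diamondop>\<^bsub>C \<^bold>\<otimes>\<^bsub>A\<^esub> ?EE\<^esub> \<Delta>\<^sub>E e"
      by (rule r | assumption)+
    have 2: "?f2 (c \<diamondop>\<^bsub>C \<^bold>\<otimes>\<^bsub>A\<^esub> ?EE\<^esub> \<Delta>\<^sub>E e) = tlift (?CE \<^bold>\<otimes>\<^bsub>A\<^esub> E) (\<lambda>x y. (c \<diamondop>\<^bsub>?CE\<^esub> x) \<diamondop>\<^bsub>?CE \<^bold>\<otimes>\<^bsub>A\<^esub> E\<^esub> y) (\<Delta>\<^sub>E e)"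
      by (rule r | assumption)+
    have 3: "?f3 (tlift (?CE \<^bold>\<otimes>\<^bsub>A\<^esub> E) (\<lambda>x y. (c \<diamondop>\<^bsub>?CE\<^esub> x) \<diamondop>\<^bsub>?CE \<^bold>\<otimes>\<^bsub>A\<^esub> E\<^esub> y) (\<Delta>\<^sub>E e)) =
      tlift (?EC \<^bold>\<otimes>\<^bsub>A\<^esub> E) (\<lambda>x y. \<sigma> (c \<diamondop>\<^bsub>?CE\<^esub> x) \<diamondop>\<^bsub>?EC \<^bold>\<otimes>\<^bsub>A\<^esub> E\<^esub> y) (\<Delta>\<^sub>E e)"
      by (rule r | assumption)+
    have 4: "?f4 (tlift (?EC \<^bold>\<otimes>\<^bsub>A\<^esub> E) (\<lambda>x y. \<sigma> (c \<diamondop>\<^bsub>?CE\<^esub> x) \<diamondop>\<^bsub>?EC \<^bold>\<otimes>\<^bsub>A\<^esub> E\<^esub> y) (\<Delta>\<^sub>E e)) =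
      tlift (E \<^bold>\<otimes>\<^bsub>A\<^esub> ?CE) (\<lambda>e1 e2. tlift (E \<^bold>\<otimes>\<^bsub>A\<^esub> ?CE) (\<lambda>e' c'. e' \<diamondop>\<^bsub>E \<^bold>\<otimes>\<^bsub>A\<^esub> ?CE\<^esub> (c' \<diamondop>\<^bsub>?CE\<^esub> e2)) (\<sigma> (c \<diamondop>\<^bsub>?CE\<^esub> e1))) (\<Delta>\<^sub>E e)"
      by (rule r | assumption)+
    have 5: "?f5 (tlift (E \<^bold>\<otimes>\<^bsub>A\<^esub> ?CE) (\<lambda>e1 e2. tlift (E \<^bold>\<otimes>\<^bsub>A\<^esub> ?CE) (\<lambda>e' c'. e' \<diamondop>\<^bsub>E \<^bold>\<otimes>\<^bsub>A\<^esub> ?CE\<^esub> (c' \<diamondop>\<^bsub>?CE\<^esub> e2)) (\<sigma> (c \<diamondop>\<^bsub>?CE\<^esub> e1))) (\<Delta>\<^sub>E e)) =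
      tlift (E \<^bold>\<otimes>\<^bsub>A\<^esub> ?EC) (\<lambda>e1 e2. tlift (E \<^bold>\<otimes>\<^bsub>A\<^esub> ?EC) (\<lambda>e' c'. e' \<diamondop>\<^bsub>E \<^bold>\<otimes>\<^bsub>A\<^esub> ?EC\<^esub> \<sigma> (c' \<diamondop>\<^bsub>?CE\<^esub> e2)) (\<sigma> (c \<diamondop>\<^bsub>?CE\<^esub> e1))) (\<Delta>\<^sub>E e)"
      by (rule r | assumption)+
    have 6: "?f6 (tlift (E \<^bold>\<otimes>\<^bsub>A\<^esub> ?EC) (\<lambda>e1 e2. tlift (E \<^bold>\<otimes>\<^bsub>A\<^esub> ?EC) (\<lambda>e' c'. e' \<diamondop>\<^bsub>E \<^bold>\<otimes>\<^bsub>A\<^esub> ?EC\<^esub> \<sigma> (c' \<diamondop>\<^bsub>?CE\<^esub> e2)) (\<sigma> (c \<diamondop>\<^bsub>?CE\<^esub> e1))) (\<Delta>\<^sub>E e)) =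
      tlift ?Q (\<lambda>e1 e2. tlift ?Q (\<lambda>e' c'. tlift ?Q (\<lambda>e'' c''. (e' \<diamondop>\<^bsub>?EE\<^esub> e'') \<diamondop>\<^bsub>?Q\<^esub> c'') (\<sigma> (c' \<diamondop>\<^bsub>?CE\<^esub> e2))) (\<sigma> (c \<diamondop>\<^bsub>?CE\<^esub> e1))) (\<Delta>\<^sub>E e)"
      by (rule r | assumption)+
    show "?f6 (?f5 (?f4 (?f3 (?f2 (?f1 (c \<diamondop>\<^bsub>?CE\<^esub> e)))))) = 
      tlift ?Q (\<lambda>e1 e2. tlift ?Q (\<lambda>e' c'. tlift ?Q (\<lambda>e'' c''. (e' \<diamondop>\<^bsub>?EE\<^esub> e'') \<diamondop>\<^bsub>?Q\<^esub> c'') (\<sigma> (c' \<diamondop>\<^bsub>?CE\<^esub> e2))) (\<sigma> (c \<diamondop>\<^bsub>?CE\<^esub> e1))) (\<Delta>\<^sub>E e)"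
      by (simp only: 1 2 3 4 5 6)
  qed
  show ?thesis
    unfolding smash_coproduct_def ball_conj_distrib 1 2 3 4 ..
next
  case False
  then show ?thesis by (simp add: smash_coproduct_def)
qed

locale smash = coring_pair +
  fixes \<sigma> :: "('c, 'e) tens \<Rightarrow> ('e, 'c) tens"
  assumes smash: "smash_coproduct A C \<Delta>\<^sub>C \<epsilon>\<^sub>C E \<Delta>\<^sub>E \<epsilon>\<^sub>E \<sigma>"
begin

lemma \<sigma>_hom: "\<sigma> \<in> bimod_hom A A (C \<^bold>\<otimes>\<^bsub>A\<^esub> E) (E \<^bold>\<otimes>\<^bsub>A\<^esub> C)"
  using smash by (simp add: smash_coproduct_def)

lemmas \<sigma>D = bimod_homD[OF \<sigma>_hom bimodule_tensor[OF C E] bimodule_tensor[OF E C]]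

lemmas [bal] = rlin_comp[OF \<sigma>D(2)] llin_comp[OF \<sigma>D(1)] add_map_comp[OF \<sigma>D(3)]
  balanced_map[OF \<sigma>D(3)] llinD(4)[OF \<sigma>D(1)]

text \<open>Moves a coproduct of \<open>C\<close> from after an exchange to before it, at the price
  of a second exchange.\<close>

lemma smash_left_int:
  assumes c: "c \<in> carrier C" and e: "e \<in> carrier E"
    and f1: "\<And>c. c \<in> carrier C \<Longrightarrow> balanced A E C G (\<lambda>e d. f e d c)"
    and f2: "\<And>e. e \<in> carrier E \<Longrightarrow> balanced A C C G (f e)"
  shows "tlift G (\<lambda>e' c'. tlift G (f e') (\<Delta>\<^sub>C c')) (\<sigma> (c \<diamondop>\<^bsub>C \<^bold>\<otimes>\<^bsub>A\<^esub> E\<^esub> e)) =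
    tlift G (\<lambda>c1 c2. tlift G (\<lambda>e' c'. tlift G (\<lambda>e'' c''. f e'' c'' c')
      (\<sigma> (c1 \<diamondop>\<^bsub>C \<^bold>\<otimes>\<^bsub>A\<^esub> E\<^esub> e'))) (\<sigma> (c2 \<diamondop>\<^bsub>C \<^bold>\<otimes>\<^bsub>A\<^esub> E\<^esub> e))) (\<Delta>\<^sub>C c)"
proof -
  have bk: "balanced A E (C \<^bold>\<otimes>\<^bsub>A\<^esub> C) G (\<lambda>m. tlift G (f m))"
    by (rule f1 f2 bal | assumption)+
  have eq: "smash_mult_left A C \<Delta>\<^sub>C E \<sigma> c e"
    using smash c e unfolding smash_coproduct_iff by blast
  show ?thesis
    apply (rule trans[OF trans[OF _ arg_cong[OF eq, of "tlift G (\<lambda>m. tlift G (f m))"]]])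
     apply (rule sym)
    by (rule evals f1 f2 bk c e bal | assumption)+
qed

lemma smash_right_int:
  assumes c: "c \<in> carrier C" and e: "e \<in> carrier E"
    and f1: "\<And>e. e \<in> carrier E \<Longrightarrow> balanced A E C G (f e)"
    and f2: "\<And>c. c \<in> carrier C \<Longrightarrow> balanced A E E G (\<lambda>e d. f e d c)"
  shows "tlift G (\<lambda>e' c'. tlift G (\<lambda>e1 e2. f e1 e2 c') (\<Delta>\<^sub>E e')) (\<sigma> (c \<diamondop>\<^bsub>C \<^bold>\<otimes>\<^bsub>A\<^esub> E\<^esub> e)) =
    tlift G (\<lambda>e1 e2. tlift G (\<lambda>e' c'. tlift G (\<lambda>e'' c''. f e' e'' c'')
      (\<sigma> (c' \<diamondop>\<^bsub>C \<^bold>\<otimes>\<^bsub>A\<^esub> E\<^esub> e2))) (\<sigma> (c \<diamondop>\<^bsub>C \<^bold>\<otimes>\<^bsub>A\<^esub> E\<^esub> e1))) (\<Delta>\<^sub>E e)"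
proof -
  have bk: "balanced A (E \<^bold>\<otimes>\<^bsub>A\<^esub> E) C G (\<lambda>u n. tlift G (\<lambda>e1 e2. f e1 e2 n) u)"
    by (rule f1 f2 bal | assumption)+
  have eq: "smash_mult_right A C E \<Delta>\<^sub>E \<sigma> c e"
    using smash c e unfolding smash_coproduct_iff by blast
  show ?thesis
    apply (rule trans[OF trans[OF _ arg_cong[OF eq, of "tlift G (\<lambda>u n. tlift G (\<lambda>e1 e2. f e1 e2 n) u)"]]])
     apply (rule sym)
    by (rule evals f1 f2 bk c e bal | assumption)+
qed

lemma smash_counit:
  assumes c: "c \<in> carrier C" and e: "e \<in> carrier E"
  shows "tlift C (\<lambda>e c. lact C (\<epsilon>\<^sub>E e) c) (\<sigma> (c \<diamondop>\<^bsub>C \<^bold>\<otimes>\<^bsub>A\<^esub> E\<^esub> e)) = ract C c (\<epsilon>\<^sub>E e)"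
    and "tlift E (\<lambda>e c. ract E e (\<epsilon>\<^sub>C c)) (\<sigma> (c \<diamondop>\<^bsub>C \<^bold>\<otimes>\<^bsub>A\<^esub> E\<^esub> e)) = lact E (\<epsilon>\<^sub>C c) e"
  using smash c e unfolding smash_coproduct_iff by blast+

end

locale smash_comodules = smash A C \<Delta>\<^sub>C \<epsilon>\<^sub>C E \<Delta>\<^sub>E \<epsilon>\<^sub>E \<sigma> + M: right_comodule A L C \<Delta>\<^sub>C M \<rho> +
    N: left_comodule A R E \<Delta>\<^sub>E N \<tau>
  for A :: "('a, 'a1) ring_scheme"
    and C :: "('a, 'a, 'c) bimod" and \<Delta>\<^sub>C and \<epsilon>\<^sub>C and E :: "('a, 'a, 'e) bimod" and \<Delta>\<^sub>E and \<epsilon>\<^sub>E and \<sigma>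
    and L :: "('l, 'l1) ring_scheme" and M :: "('l, 'a, 'm) bimod" and \<rho>
    and R :: "('r, 'r1) ring_scheme" and N :: "('a, 'r, 'n) bimod" and \<tau>
begin

text \<open>Both sides are brought to one form: the coproducts split \<open>c\<close> and
  \<open>e\<close> into \<open>c1\<close>, \<open>c2\<close> and \<open>e1\<close>,
  \<open>e2\<close>, and three exchanges are made, \<open>c2\<close> with \<open>e1\<close>, then
  \<open>c'\<close> with \<open>e2\<close> and \<open>c1\<close> with \<open>x\<close>. The left
  side gets there by coassociativity of \<open>M\<close> and the compatibility of
  \<open>\<sigma>\<close> with the coproduct of \<open>E\<close>, the right side by coassociativity
  of \<open>N\<close> and the compatibility with the coproduct of \<open>C\<close>. The integrand
  \<open>F\<close> has its six arguments in the order \<open>M, E, C, E, C, N\<close> and is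
  balanced across each of the five gaps; being arbitrary, it serves for a coproduct as well as for a
  shepherd.\<close>

lemma comult_coassoc:
  assumes m: "m \<in> carrier M" and n: "n \<in> carrier N"
    and b1: "\<And>d e2 c n. \<lbrakk>d \<in> carrier C; e2 \<in> carrier E; c \<in> carrier C; n \<in> carrier N\<rbrakk> \<Longrightarrow>
      balanced A M E G (\<lambda>m e1. F m e1 d e2 c n)"
    and b2: "\<And>m e2 c n. \<lbrakk>m \<in> carrier M; e2 \<in> carrier E; c \<in> carrier C; n \<in> carrier N\<rbrakk> \<Longrightarrow>
      balanced A E C G (\<lambda>e1 d. F m e1 d e2 c n)"
    and b3: "\<And>m e1 c n. \<lbrakk>m \<in> carrier M; e1 \<in> carrier E; c \<in> carrier C; n \<in> carrier N\<rbrakk> \<Longrightarrow>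
      balanced A C E G (\<lambda>d e2. F m e1 d e2 c n)"
    and b4: "\<And>m e1 d n. \<lbrakk>m \<in> carrier M; e1 \<in> carrier E; d \<in> carrier C; n \<in> carrier N\<rbrakk> \<Longrightarrow>
      balanced A E C G (\<lambda>e2 c. F m e1 d e2 c n)"
    and b5: "\<And>m e1 d e2. \<lbrakk>m \<in> carrier M; e1 \<in> carrier E; d \<in> carrier C; e2 \<in> carrier E\<rbrakk> \<Longrightarrow>
      balanced A C N G (\<lambda>c n. F m e1 d e2 c n)"
  shows "tlift G (\<lambda>m0 c. tlift G (\<lambda>e n0. tlift G (\<lambda>e' c'.
      tlift G (\<lambda>m1 d. tlift G (\<lambda>e1 e2. tlift G (\<lambda>e1' d'. F m1 e1' d' e2 c' n0)
        (\<sigma> (d \<diamondop>\<^bsub>C \<^bold>\<otimes>\<^bsub>A\<^esub> E\<^esub> e1))) (\<Delta>\<^sub>E e')) (\<rho> m0))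
      (\<sigma> (c \<diamondop>\<^bsub>C \<^bold>\<otimes>\<^bsub>A\<^esub> E\<^esub> e))) (\<tau> n)) (\<rho> m) =
    tlift G (\<lambda>m0 c. tlift G (\<lambda>e n0. tlift G (\<lambda>e' c'.
      tlift G (\<lambda>f n1. tlift G (\<lambda>c1 c2. tlift G (\<lambda>f' c2'. F m0 e' c1 f' c2' n1)
        (\<sigma> (c2 \<diamondop>\<^bsub>C \<^bold>\<otimes>\<^bsub>A\<^esub> E\<^esub> f))) (\<Delta>\<^sub>C c')) (\<tau> n0))
      (\<sigma> (c \<diamondop>\<^bsub>C \<^bold>\<otimes>\<^bsub>A\<^esub> E\<^esub> e))) (\<tau> n)) (\<rho> m)"
    (is "?lhs = ?rhs")
proof -
  note r = b1 b2 b3 b4 b5 m n bal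
  let ?I = "tlift G"
  let ?s = "\<lambda>c e. \<sigma> (c \<diamondop>\<^bsub>C \<^bold>\<otimes>\<^bsub>A\<^esub> E\<^esub> e)"
  \<comment> \<open>This swap and the next bring the second coaction next to
    \<open>\<rho> m\<close>, where coassociativity of \<open>M\<close> can replace it by the
    coproduct of \<open>C\<close>.\<close>
  have "?lhs = ?I (\<lambda>m0 c. ?I (\<lambda>e n0. ?I (\<lambda>m1 d. ?I (\<lambda>e' c'. ?I (\<lambda>e1 e2. ?I (\<lambda>e1' d'.
      F m1 e1' d' e2 c' n0) (?s d e1)) (\<Delta>\<^sub>E e')) (?s c e)) (\<rho> m0)) (\<tau> n)) (\<rho> m)"
    by (rule refl tlift_swap tlift_cong r | assumption)+
  also have "\<dots> = ?I (\<lambda>m0 c. ?I (\<lambda>m1 d. ?I (\<lambda>e n0. ?I (\<lambda>e' c'. ?I (\<lambda>e1 e2. ?I (\<lambda>e1' d'.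
      F m1 e1' d' e2 c' n0) (?s d e1)) (\<Delta>\<^sub>E e')) (?s c e)) (\<tau> n)) (\<rho> m0)) (\<rho> m)"
    by (rule refl tlift_swap tlift_cong r | assumption)+
  also have "\<dots> = ?I (\<lambda>m0 c. ?I (\<lambda>c1 c2. ?I (\<lambda>e n0. ?I (\<lambda>e' c'. ?I (\<lambda>e1 e2. ?I (\<lambda>e1' d'.
      F m0 e1' d' e2 c' n0) (?s c1 e1)) (\<Delta>\<^sub>E e')) (?s c2 e)) (\<tau> n)) (\<Delta>\<^sub>C c)) (\<rho> m)"
    by (rule M.coassoc_int r | assumption)+
  also have "\<dots> = ?I (\<lambda>m0 c. ?I (\<lambda>c1 c2. ?I (\<lambda>e n0. ?I (\<lambda>e1 e2. ?I (\<lambda>x c'. ?I (\<lambda>y c''. ?I (\<lambda>x' d'.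
      F m0 x' d' y c'' n0) (?s c1 x)) (?s c' e2)) (?s c2 e1)) (\<Delta>\<^sub>E e)) (\<tau> n)) (\<Delta>\<^sub>C c)) (\<rho> m)"
    by (rule refl smash_right_int tlift_cong r | assumption)+
  finally have l: "?lhs = \<dots>" .
  have "?rhs = ?I (\<lambda>m0 c. ?I (\<lambda>e n0. ?I (\<lambda>f n1. ?I (\<lambda>e' c'. ?I (\<lambda>c1 c2. ?I (\<lambda>f' c2'.
      F m0 e' c1 f' c2' n1) (?s c2 f)) (\<Delta>\<^sub>C c')) (?s c e)) (\<tau> n0)) (\<tau> n)) (\<rho> m)"
    by (rule refl tlift_swap tlift_cong r | assumption)+
  also have "\<dots> = ?I (\<lambda>m0 c. ?I (\<lambda>e n0. ?I (\<lambda>e1 e2. ?I (\<lambda>e' c'. ?I (\<lambda>c1 c2. ?I (\<lambda>f' c2'.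
      F m0 e' c1 f' c2' n0) (?s c2 e2)) (\<Delta>\<^sub>C c')) (?s c e1)) (\<Delta>\<^sub>E e)) (\<tau> n)) (\<rho> m)"
    by (rule refl N.coassoc_int tlift_cong r | assumption)+
  also have "\<dots> = ?I (\<lambda>m0 c. ?I (\<lambda>e n0. ?I (\<lambda>e1 e2. ?I (\<lambda>c1 c2. ?I (\<lambda>x c'. ?I (\<lambda>x' d'. ?I (\<lambda>y c''.
      F m0 x' d' y c'' n0) (?s c' e2)) (?s c1 x)) (?s c2 e1)) (\<Delta>\<^sub>C c)) (\<Delta>\<^sub>E e)) (\<tau> n)) (\<rho> m)"
    by (rule refl smash_left_int tlift_cong r | assumption)+
  \<comment> \<open>The exchanges of \<open>c1\<close> with \<open>x\<close> and of
    \<open>c'\<close> with \<open>e2\<close> concern disjoint factors, so their order is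
    immaterial.\<close>
  also have "\<dots> = ?I (\<lambda>m0 c. ?I (\<lambda>e n0. ?I (\<lambda>e1 e2. ?I (\<lambda>c1 c2. ?I (\<lambda>x c'. ?I (\<lambda>y c''. ?I (\<lambda>x' d'. 
      F m0 x' d' y c'' n0) (?s c1 x)) (?s c' e2)) (?s c2 e1)) (\<Delta>\<^sub>C c)) (\<Delta>\<^sub>E e)) (\<tau> n)) (\<rho> m)"
    by (rule refl tlift_swap tlift_cong r | assumption)+
  also have "\<dots> = ?I (\<lambda>m0 c. ?I (\<lambda>e n0. ?I (\<lambda>c1 c2. ?I (\<lambda>e1 e2. ?I (\<lambda>x c'. ?I (\<lambda>y c''. ?I (\<lambda>x' d'. 
      F m0 x' d' y c'' n0) (?s c1 x)) (?s c' e2)) (?s c2 e1)) (\<Delta>\<^sub>E e)) (\<Delta>\<^sub>C c)) (\<tau> n)) (\<rho> m)"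
    by (rule refl tlift_swap tlift_cong r | assumption)+
  also have "\<dots> = ?I (\<lambda>m0 c. ?I (\<lambda>c1 c2. ?I (\<lambda>e n0. ?I (\<lambda>e1 e2. ?I (\<lambda>x c'. ?I (\<lambda>y c''. ?I (\<lambda>x' d'. 
      F m0 x' d' y c'' n0) (?s c1 x)) (?s c' e2)) (?s c2 e1)) (\<Delta>\<^sub>E e)) (\<tau> n)) (\<Delta>\<^sub>C c)) (\<rho> m)"
    by (rule refl tlift_swap tlift_cong r | assumption)+
  finally show ?thesis unfolding l ..
qed

end

text \<open>Used where a map as it is defined agrees on the carrier with a form that the linearity
  rules accept.\<close>

lemma bimod_hom_cong:
  assumes "f \<in> bimod_hom L R M N" "bimodule L R M" "\<And>x. x \<in> carrier M \<Longrightarrow> g x = f x"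
  shows "g \<in> bimod_hom L R M N"
proof -
  interpret bimodule L R M by fact
  show ?thesis
    using assms(1) by (simp add: bimod_hom_def Pi_iff assms(3) lact_closed ract_closed)
qed

section \<open>The smash coproduct as a coring\<close>

locale smash_corings = smash_comodules A C \<Delta>\<^sub>C \<epsilon>\<^sub>C E \<Delta>\<^sub>E \<epsilon>\<^sub>E \<sigma> A C \<Delta>\<^sub>C A E \<Delta>\<^sub>E
  for A :: "('a, 'a1) ring_scheme"
    and C :: "('a, 'a, 'c) bimod" and \<Delta>\<^sub>C and \<epsilon>\<^sub>C and E :: "('a, 'a, 'e) bimod" and \<Delta>\<^sub>E and \<epsilon>\<^sub>E and \<sigma> +
  assumes counit_C: "c \<in> carrier C \<Longrightarrow> tlift C (\<lambda>c1 c2. lact C (\<epsilon>\<^sub>C c1) c2) (\<Delta>\<^sub>C c) = c"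
    "c \<in> carrier C \<Longrightarrow> tlift C (\<lambda>c1 c2. ract C c1 (\<epsilon>\<^sub>C c2)) (\<Delta>\<^sub>C c) = c"
    and counit_E: "e \<in> carrier E \<Longrightarrow> tlift E (\<lambda>e1 e2. lact E (\<epsilon>\<^sub>E e1) e2) (\<Delta>\<^sub>E e) = e"
    "e \<in> carrier E \<Longrightarrow> tlift E (\<lambda>e1 e2. ract E e1 (\<epsilon>\<^sub>E e2)) (\<Delta>\<^sub>E e) = e"
begin

abbreviation "D \<equiv> C \<^bold>\<otimes>\<^bsub>A\<^esub> E"
abbreviation "DD \<equiv> D \<^bold>\<otimes>\<^bsub>A\<^esub> D"
abbreviation "\<Delta> \<equiv> smash_comult A C \<Delta>\<^sub>C E \<Delta>\<^sub>E \<sigma>"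
abbreviation "\<epsilon> \<equiv> smash_counit A \<epsilon>\<^sub>C \<epsilon>\<^sub>E"

lemma comult_eq: "\<Delta> = tlift DD (\<lambda>c e. tlift DD (\<lambda>c1 c2. tlift DD (\<lambda>e1 e2.
    tlift DD (\<lambda>e' c'. (c1 \<diamondop>\<^bsub>D\<^esub> e') \<diamondop>\<^bsub>DD\<^esub> (c' \<diamondop>\<^bsub>D\<^esub> e2)) (\<sigma> (c2 \<diamondop>\<^bsub>D\<^esub> e1))) (\<Delta>\<^sub>E e)) (\<Delta>\<^sub>C c))"
  by (simp add: smash_comult_def Let_def)

lemma comult_hom: "\<Delta> \<in> bimod_hom A A D DD"
  unfolding comult_eq
  by (rule bimod_homI bal | assumption)+

lemma comult_pure:
  assumes "c \<in> carrier C" "e \<in> carrier E"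
  shows "\<Delta> (c \<diamondop>\<^bsub>D\<^esub> e) = tlift DD (\<lambda>c1 c2. tlift DD (\<lambda>e1 e2.
    tlift DD (\<lambda>e' c'. (c1 \<diamondop>\<^bsub>D\<^esub> e') \<diamondop>\<^bsub>DD\<^esub> (c' \<diamondop>\<^bsub>D\<^esub> e2)) (\<sigma> (c2 \<diamondop>\<^bsub>D\<^esub> e1))) (\<Delta>\<^sub>E e)) (\<Delta>\<^sub>C c)"
  unfolding comult_eq
  by (rule tlift_pure_eq assms refl bal | assumption)+

lemma comult_int:
  assumes "c \<in> carrier C" "e \<in> carrier E" "balanced A D D G f"
  shows "tlift G f (\<Delta> (c \<diamondop>\<^bsub>D\<^esub> e)) = tlift G (\<lambda>c1 c2. tlift G (\<lambda>e1 e2.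
    tlift G (\<lambda>e' c'. f (c1 \<diamondop>\<^bsub>D\<^esub> e') (c' \<diamondop>\<^bsub>D\<^esub> e2)) (\<sigma> (c2 \<diamondop>\<^bsub>D\<^esub> e1))) (\<Delta>\<^sub>E e)) (\<Delta>\<^sub>C c)"
  unfolding comult_pure[OF assms(1,2)]
  by (rule evals assms bal | assumption)+

text \<open>The product of the counits is written as an action on the regular bimodule, the form in
  which the linearity rules recognise it.\<close>

lemma balanced_mult: "balanced A C E (regular A) (\<lambda>c e. lact (regular A) (\<epsilon>\<^sub>C c) (\<epsilon>\<^sub>E e))"
  by (rule bal)+

lemma counit_pure:
  assumes "c \<in> carrier C" "e \<in> carrier E"
  shows "\<epsilon> (c \<diamondop>\<^bsub>D\<^esub> e) = \<epsilon>\<^sub>C c \<otimes>\<^bsub>A\<^esub> \<epsilon>\<^sub>E e"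
  unfolding smash_counit_def
  using balanced_mult assms by (intro tlift_pure_eq) (auto simp: regular_simps balanced_regular[OF A])

lemma counit_hom: "\<epsilon> \<in> bimod_hom A A D (regular A)"
proof -
  have "tlift (regular A) (\<lambda>c e. lact (regular A) (\<epsilon>\<^sub>C c) (\<epsilon>\<^sub>E e)) \<in> bimod_hom A A D (regular A)"
    by (rule bimod_homI bal | assumption)+
  moreover have "\<epsilon> u = tlift (regular A) (\<lambda>c e. lact (regular A) (\<epsilon>\<^sub>C c) (\<epsilon>\<^sub>E e)) u" if "u \<in> carrier D" for u
    using tlift_regular[OF A that balanced_mult] by (simp add: smash_counit_def regular_simps)
  ultimately show ?thesis by (rule bimod_hom_cong[OF _ bimodule_tensor[OF C E]])
qed

lemmas \<Delta>D = bimod_homD[OF comult_hom bimodule_tensor[OF C E] bimodule_tensor[OF bimodule_tensor[OF C E] bimodule_tensor[OF C E]]]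
  and \<epsilon>D = bimod_homD[OF counit_hom bimodule_tensor[OF C E] bimodule_regular[OF A]]

lemma \<epsilon>_closed': "u \<in> carrier D \<Longrightarrow> \<epsilon> u \<in> carrier A"
  using llinD(4)[OF \<epsilon>D(1)] by (simp add: regular_simps)

lemmas D_rules = rlin_comp[OF \<Delta>D(2)] llin_comp[OF \<Delta>D(1)] add_map_comp[OF \<Delta>D(3)]
  balanced_map[OF \<Delta>D(3)] llinD(4)[OF \<Delta>D(1)]
  rlin_comp[OF \<epsilon>D(2)] llin_comp[OF \<epsilon>D(1)] balanced_map[OF \<epsilon>D(3)] \<epsilon>_closed'

lemma ext:
  assumes "u \<in> carrier D" "add_map D G f" "add_map D G g"
    "\<And>c e. c \<in> carrier C \<Longrightarrow> e \<in> carrier E \<Longrightarrow> f (c \<diamondop>\<^bsub>D\<^esub> e) = g (c \<diamondop>\<^bsub>D\<^esub> e)"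
  shows "f u = g u"
  by (rule tensor_ext[OF assms(2,3) _ _ _ assms(1)]) (rule assms bal | assumption)+

lemma ab: "abelian_group D" by (rule bimodule_mods(3)[OF bimodule_tensor[OF C E]])

text \<open>The core is \<open>comult_coassoc\<close> with \<open>M = C\<close> and
  \<open>N = E\<close>, \<open>F\<close> being the tensor of the six factors grouped in pairs; what
  surrounds it opens and closes the outer and inner coproducts by \<open>comult_int\<close> and
  \<open>comult_pure\<close>.\<close>

lemma smash_coassoc:
  assumes u: "u \<in> carrier D"
  shows "assoc A D D D (tmap A DD D \<Delta> id (\<Delta> u)) = tmap A D DD id \<Delta> (\<Delta> u)"
  unfolding tmap_def assoc_def Let_def id_def
proof (rule ext[OF u])
  let ?Q = "D \<^bold>\<otimes>\<^bsub>A\<^esub> DD"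
  let ?f = "\<lambda>u. tlift ?Q (\<lambda>u z. tlift ?Q (\<lambda>x y. x \<diamondop>\<^bsub>?Q\<^esub> (y \<diamondop>\<^bsub>DD\<^esub> z)) u)
       (tlift (DD \<^bold>\<otimes>\<^bsub>A\<^esub> D) (\<lambda>x y. \<Delta> x \<diamondop>\<^bsub>DD \<^bold>\<otimes>\<^bsub>A\<^esub> D\<^esub> y) (\<Delta> u))"
  let ?g = "\<lambda>u. tlift ?Q (\<lambda>x y. x \<diamondop>\<^bsub>?Q\<^esub> \<Delta> y) (\<Delta> u)"
  show "add_map D ?Q ?f" "add_map D ?Q ?g"
    by (rule ab D_rules bal | assumption)+
  fix c e assume c: "c \<in> carrier C" and e: "e \<in> carrier E"
  note r = c e D_rules bal
  let ?I = "tlift ?Q" let ?s = "\<lambda>c e. \<sigma> (c \<diamondop>\<^bsub>D\<^esub> e)"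
  define F where "F m e1 d e2 c n = (m \<diamondop>\<^bsub>D\<^esub> e1) \<diamondop>\<^bsub>?Q\<^esub> ((d \<diamondop>\<^bsub>D\<^esub> e2) \<diamondop>\<^bsub>DD\<^esub> (c \<diamondop>\<^bsub>D\<^esub> n))" for m e1 d e2 c n
  have "?f (c \<diamondop>\<^bsub>D\<^esub> e) = ?I (\<lambda>x z. ?I (\<lambda>x y. x \<diamondop>\<^bsub>?Q\<^esub> (y \<diamondop>\<^bsub>DD\<^esub> z)) (\<Delta> x)) (\<Delta> (c \<diamondop>\<^bsub>D\<^esub> e))"
    by (rule evals r | assumption)+
  also have "\<dots> = ?I (\<lambda>m0 c. ?I (\<lambda>e n0. ?I (\<lambda>e' c'. ?I (\<lambda>x y. x \<diamondop>\<^bsub>?Q\<^esub> (y \<diamondop>\<^bsub>DD\<^esub> (c' \<diamondop>\<^bsub>D\<^esub> n0))) (\<Delta> (m0 \<diamondop>\<^bsub>D\<^esub> e')))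
      (?s c e)) (\<Delta>\<^sub>E e)) (\<Delta>\<^sub>C c)"
    by (rule comult_int r | assumption)+
  also have "\<dots> = ?I (\<lambda>m0 c. ?I (\<lambda>e n0. ?I (\<lambda>e' c'.
      ?I (\<lambda>m1 d. ?I (\<lambda>e1 e2. ?I (\<lambda>e1' d'. F m1 e1' d' e2 c' n0)
        (?s d e1)) (\<Delta>\<^sub>E e')) (\<Delta>\<^sub>C m0)) (?s c e)) (\<Delta>\<^sub>E e)) (\<Delta>\<^sub>C c)"
    unfolding F_def
    by (rule comult_int refl tlift_cong r | assumption)+
  also have "\<dots> = ?I (\<lambda>m0 c. ?I (\<lambda>e n0. ?I (\<lambda>e' c'.
      ?I (\<lambda>f n1. ?I (\<lambda>c1 c2. ?I (\<lambda>f' c2'. F m0 e' c1 f' c2' n1)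
        (?s c2 f)) (\<Delta>\<^sub>C c')) (\<Delta>\<^sub>E n0)) (?s c e)) (\<Delta>\<^sub>E e)) (\<Delta>\<^sub>C c)"
    apply (rule comult_coassoc[where F = F])
    apply (unfold F_def)
    apply (rule r | assumption)+
    done
  \<comment> \<open>\<open>comult_coassoc\<close> sums over the coproduct of \<open>n0\<close>
    outside that of \<open>c'\<close>, the coproduct on \<open>C \<otimes> E\<close> the other way
    round.\<close>
  also have "\<dots> = ?I (\<lambda>m0 c. ?I (\<lambda>e n0. ?I (\<lambda>e' c'.
      ?I (\<lambda>c1 c2. ?I (\<lambda>f n1. ?I (\<lambda>f' c2'. F m0 e' c1 f' c2' n1)
        (?s c2 f)) (\<Delta>\<^sub>E n0)) (\<Delta>\<^sub>C c')) (?s c e)) (\<Delta>\<^sub>E e)) (\<Delta>\<^sub>C c)"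
    unfolding F_def
    by (rule refl tlift_swap tlift_cong r | assumption)+
  also have "\<dots> = ?I (\<lambda>m0 c. ?I (\<lambda>e n0. ?I (\<lambda>e' c'. (m0 \<diamondop>\<^bsub>D\<^esub> e') \<diamondop>\<^bsub>?Q\<^esub> \<Delta> (c' \<diamondop>\<^bsub>D\<^esub> n0))
      (?s c e)) (\<Delta>\<^sub>E e)) (\<Delta>\<^sub>C c)"
  proof -
    have eq: "?I (\<lambda>c1 c2. ?I (\<lambda>f n1. ?I (\<lambda>f' c2'. F m0 e' c1 f' c2' n1) (?s c2 f)) (\<Delta>\<^sub>E n0)) (\<Delta>\<^sub>C c') =
        (m0 \<diamondop>\<^bsub>D\<^esub> e') \<diamondop>\<^bsub>?Q\<^esub> \<Delta> (c' \<diamondop>\<^bsub>D\<^esub> n0)"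
      if h: "m0 \<in> carrier C" "e' \<in> carrier E" "c' \<in> carrier C" "n0 \<in> carrier E" for m0 e' c' n0
      unfolding F_def comult_pure[OF h(3,4)]
      by (rule sym, (rule evals h r | assumption)+)
    note eq' = eq[unfolded F_def]
    show ?thesis
      unfolding F_def by (rule eq' tlift_cong r | assumption)+
  qed
  also have "\<dots> = ?g (c \<diamondop>\<^bsub>D\<^esub> e)"
    by (rule sym, (rule comult_int r | assumption)+)
  finally show "?f (c \<diamondop>\<^bsub>D\<^esub> e) = ?g (c \<diamondop>\<^bsub>D\<^esub> e)" .
qed

text \<open>The counit at \<open>c1 \<otimes> e'\<close> is the product of
  \<open>\<epsilon>\<^sub>C c1\<close> and \<open>\<epsilon>\<^sub>E e'\<close>. The second factor
  meets \<open>\<sigma>\<close> and by its counit condition becomes the action of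
  \<open>\<epsilon>\<^sub>E e1\<close> on \<open>c2\<close>; from there it passes to
  \<open>e2\<close>, and the left counit laws of \<open>E\<close> and \<open>C\<close>
  remain.\<close>

lemma smash_counit_left:
  assumes u: "u \<in> carrier D"
  shows "tlift D (\<lambda>x y. lact D (\<epsilon> x) y) (\<Delta> u) = u"
proof (rule ext[OF u])
  show "add_map D D (\<lambda>u. tlift D (\<lambda>x y. lact D (\<epsilon> x) y) (\<Delta> u))" "add_map D D (\<lambda>u. u)"
    by (rule ab D_rules bal | assumption)+
  fix c e assume c: "c \<in> carrier C" and e: "e \<in> carrier E"
  note r = c e D_rules bal
  interpret D: bimodule A A D by (rule bal)+
  have "tlift D (\<lambda>x y. lact D (\<epsilon> x) y) (\<Delta> (c \<diamondop>\<^bsub>D\<^esub> e)) = tlift D (\<lambda>c1 c2. tlift D (\<lambda>e1 e2.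
    tlift D (\<lambda>e' c'. lact D (\<epsilon> (c1 \<diamondop>\<^bsub>D\<^esub> e')) (c' \<diamondop>\<^bsub>D\<^esub> e2)) (\<sigma> (c2 \<diamondop>\<^bsub>D\<^esub> e1))) (\<Delta>\<^sub>E e)) (\<Delta>\<^sub>C c)"
    by (rule comult_int r | assumption)+
  also have "\<dots> = tlift D (\<lambda>c1 c2. tlift D (\<lambda>e1 e2.
    lact D (\<epsilon>\<^sub>C c1) (tlift C (\<lambda>e c. lact C (\<epsilon>\<^sub>E e) c) (\<sigma> (c2 \<diamondop>\<^bsub>D\<^esub> e1)) \<diamondop>\<^bsub>D\<^esub> e2)) (\<Delta>\<^sub>E e)) (\<Delta>\<^sub>C c)"
  proof -
    have "lact D (\<epsilon>\<^sub>C c1) (tlift C (\<lambda>e c. lact C (\<epsilon>\<^sub>E e) c) (\<sigma> (c2 \<diamondop>\<^bsub>D\<^esub> e1)) \<diamondop>\<^bsub>D\<^esub> e2) = 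
        tlift D (\<lambda>e' c'. lact D (\<epsilon> (c1 \<diamondop>\<^bsub>D\<^esub> e')) (c' \<diamondop>\<^bsub>D\<^esub> e2)) (\<sigma> (c2 \<diamondop>\<^bsub>D\<^esub> e1))"
      if h: "c1 \<in> carrier C" "c2 \<in> carrier C" "e1 \<in> carrier E" "e2 \<in> carrier E" for c1 c2 e1 e2
    proof -
      have "tlift C (\<lambda>e c. lact C (\<epsilon>\<^sub>E e) c) (\<sigma> (c2 \<diamondop>\<^bsub>D\<^esub> e1)) \<diamondop>\<^bsub>D\<^esub> e2 = 
         tlift D (\<lambda>e c. lact C (\<epsilon>\<^sub>E e) c \<diamondop>\<^bsub>D\<^esub> e2) (\<sigma> (c2 \<diamondop>\<^bsub>D\<^esub> e1))"
        by (rule evals h r | assumption)+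
      then show ?thesis
        apply (simp only:)
        apply (rule lact_tlift h r | assumption)+
        apply (subst counit_pure, rule h, assumption)
        apply (subst D.lact_mult, (rule h r | assumption)+)
        apply (rule arg_cong[where f = "lact D (\<epsilon>\<^sub>C c1)"])
        apply (rule lact_pure_eq[symmetric], (rule h r refl | assumption)+)
        done
    qed
    note eq = this[symmetric]
    show ?thesis
      by (rule eq tlift_cong r | assumption)+
  qed
  also have "\<dots> = tlift D (\<lambda>c1 c2. tlift D (\<lambda>e1 e2.
    lact D (\<epsilon>\<^sub>C c1) (c2 \<diamondop>\<^bsub>D\<^esub> lact E (\<epsilon>\<^sub>E e1) e2)) (\<Delta>\<^sub>E e)) (\<Delta>\<^sub>C c)"
  proof -
    have eq: "lact D (\<epsilon>\<^sub>C c1) (tlift C (\<lambda>e c. lact C (\<epsilon>\<^sub>E e) c) (\<sigma> (c2 \<diamondop>\<^bsub>D\<^esub> e1)) \<diamondop>\<^bsub>D\<^esub> e2) =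
      lact D (\<epsilon>\<^sub>C c1) (c2 \<diamondop>\<^bsub>D\<^esub> lact E (\<epsilon>\<^sub>E e1) e2)"
      if h: "c1 \<in> carrier C" "c2 \<in> carrier C" "e1 \<in> carrier E" "e2 \<in> carrier E" for c1 c2 e1 e2
      unfolding smash_counit(1)[OF h(2,3)]
      by (subst pure_middle_eq) (rule h r refl)+
    show ?thesis
      by (rule eq tlift_cong r | assumption)+
  qed
  also have "\<dots> = tlift D (\<lambda>c1 c2. lact D (\<epsilon>\<^sub>C c1) (c2 \<diamondop>\<^bsub>D\<^esub> tlift E (\<lambda>e1 e2. lact E (\<epsilon>\<^sub>E e1) e2) (\<Delta>\<^sub>E e))) (\<Delta>\<^sub>C c)"
  proof -
    have eq: "tlift D (\<lambda>e1 e2. lact D (\<epsilon>\<^sub>C c1) (c2 \<diamondop>\<^bsub>D\<^esub> lact E (\<epsilon>\<^sub>E e1) e2)) (\<Delta>\<^sub>E e) = 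
        lact D (\<epsilon>\<^sub>C c1) (c2 \<diamondop>\<^bsub>D\<^esub> tlift E (\<lambda>e1 e2. lact E (\<epsilon>\<^sub>E e1) e2) (\<Delta>\<^sub>E e))"
      if h: "c1 \<in> carrier C" "c2 \<in> carrier C" for c1 c2
    proof -
      have "c2 \<diamondop>\<^bsub>D\<^esub> tlift E (\<lambda>e1 e2. lact E (\<epsilon>\<^sub>E e1) e2) (\<Delta>\<^sub>E e) = tlift D (\<lambda>e1 e2. c2 \<diamondop>\<^bsub>D\<^esub> lact E (\<epsilon>\<^sub>E e1) e2) (\<Delta>\<^sub>E e)"
        by (rule evals h r | assumption)+
      then show ?thesis by (simp only:) (rule sym, (rule evals h r | assumption)+)
    qed
    show ?thesis
      by (rule eq tlift_cong r | assumption)+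
  qed
  also have "\<dots> = tlift D (\<lambda>c1 c2. lact D (\<epsilon>\<^sub>C c1) (c2 \<diamondop>\<^bsub>D\<^esub> e)) (\<Delta>\<^sub>C c)"
    unfolding counit_E(1)[OF e] ..
  also have "\<dots> = tlift C (\<lambda>c1 c2. lact C (\<epsilon>\<^sub>C c1) c2) (\<Delta>\<^sub>C c) \<diamondop>\<^bsub>D\<^esub> e"
    by (rule sym, (rule lact_pure_eq[symmetric] evals r | assumption)+)
  also have "\<dots> = c \<diamondop>\<^bsub>D\<^esub> e"
    unfolding counit_C(1)[OF c] ..
  finally show "tlift D (\<lambda>x y. lact D (\<epsilon> x) y) (\<Delta> (c \<diamondop>\<^bsub>D\<^esub> e)) = c \<diamondop>\<^bsub>D\<^esub> e" .
qed

lemma smash_counit_right: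
  assumes u: "u \<in> carrier D"
  shows "tlift D (\<lambda>x y. ract D x (\<epsilon> y)) (\<Delta> u) = u"
proof (rule ext[OF u])
  show "add_map D D (\<lambda>u. tlift D (\<lambda>x y. ract D x (\<epsilon> y)) (\<Delta> u))" "add_map D D (\<lambda>u. u)"
    by (rule ab D_rules bal | assumption)+
  fix c e assume c: "c \<in> carrier C" and e: "e \<in> carrier E"
  note r = c e D_rules bal
  interpret D: bimodule A A D by (rule bal)+
  have "tlift D (\<lambda>x y. ract D x (\<epsilon> y)) (\<Delta> (c \<diamondop>\<^bsub>D\<^esub> e)) = tlift D (\<lambda>c1 c2. tlift D (\<lambda>e1 e2.
    tlift D (\<lambda>e' c'. ract D (c1 \<diamondop>\<^bsub>D\<^esub> e') (\<epsilon> (c' \<diamondop>\<^bsub>D\<^esub> e2))) (\<sigma> (c2 \<diamondop>\<^bsub>D\<^esub> e1))) (\<Delta>\<^sub>E e)) (\<Delta>\<^sub>C c)"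
    by (rule comult_int r | assumption)+
  also have "\<dots> = tlift D (\<lambda>c1 c2. tlift D (\<lambda>e1 e2.
    ract D (c1 \<diamondop>\<^bsub>D\<^esub> tlift E (\<lambda>e c. ract E e (\<epsilon>\<^sub>C c)) (\<sigma> (c2 \<diamondop>\<^bsub>D\<^esub> e1))) (\<epsilon>\<^sub>E e2)) (\<Delta>\<^sub>E e)) (\<Delta>\<^sub>C c)"
  proof -
    have "ract D (c1 \<diamondop>\<^bsub>D\<^esub> tlift E (\<lambda>e c. ract E e (\<epsilon>\<^sub>C c)) (\<sigma> (c2 \<diamondop>\<^bsub>D\<^esub> e1))) (\<epsilon>\<^sub>E e2) = 
        tlift D (\<lambda>e' c'. ract D (c1 \<diamondop>\<^bsub>D\<^esub> e') (\<epsilon> (c' \<diamondop>\<^bsub>D\<^esub> e2))) (\<sigma> (c2 \<diamondop>\<^bsub>D\<^esub> e1))"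
      if h: "c1 \<in> carrier C" "c2 \<in> carrier C" "e1 \<in> carrier E" "e2 \<in> carrier E" for c1 c2 e1 e2
    proof -
      have "c1 \<diamondop>\<^bsub>D\<^esub> tlift E (\<lambda>e c. ract E e (\<epsilon>\<^sub>C c)) (\<sigma> (c2 \<diamondop>\<^bsub>D\<^esub> e1)) = 
         tlift D (\<lambda>e c. c1 \<diamondop>\<^bsub>D\<^esub> ract E e (\<epsilon>\<^sub>C c)) (\<sigma> (c2 \<diamondop>\<^bsub>D\<^esub> e1))"
        by (rule evals h r | assumption)+
      then show ?thesis
        apply (simp only:)
        apply (rule ract_tlift h r | assumption)+
        apply (subst counit_pure, assumption, rule h)
        apply (subst D.ract_mult, (rule h r | assumption)+)
        apply (rule arg_cong[where f = "\<lambda>x. ract D x (\<epsilon>\<^sub>E e2)"])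
        apply (rule ract_pure_eq[symmetric], (rule h r refl | assumption)+)
        done
    qed
    note eq = this[symmetric]
    show ?thesis
      by (rule eq tlift_cong r | assumption)+
  qed
  also have "\<dots> = tlift D (\<lambda>c1 c2. tlift D (\<lambda>e1 e2.
    ract C c1 (\<epsilon>\<^sub>C c2) \<diamondop>\<^bsub>D\<^esub> ract E e1 (\<epsilon>\<^sub>E e2)) (\<Delta>\<^sub>E e)) (\<Delta>\<^sub>C c)"
  proof -
    have eq: "ract D (c1 \<diamondop>\<^bsub>D\<^esub> tlift E (\<lambda>e c. ract E e (\<epsilon>\<^sub>C c)) (\<sigma> (c2 \<diamondop>\<^bsub>D\<^esub> e1))) (\<epsilon>\<^sub>E e2) =
      ract C c1 (\<epsilon>\<^sub>C c2) \<diamondop>\<^bsub>D\<^esub> ract E e1 (\<epsilon>\<^sub>E e2)"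
      if h: "c1 \<in> carrier C" "c2 \<in> carrier C" "e1 \<in> carrier E" "e2 \<in> carrier E" for c1 c2 e1 e2
      unfolding smash_counit(2)[OF h(2,3)]
      by (subst pure_middle_eq[symmetric], (rule h r refl)+, rule ract_pure_eq) (rule h r refl)+
    show ?thesis
      by (rule eq tlift_cong r | assumption)+
  qed
  also have "\<dots> = tlift D (\<lambda>c1 c2. ract C c1 (\<epsilon>\<^sub>C c2) \<diamondop>\<^bsub>D\<^esub> tlift E (\<lambda>e1 e2. ract E e1 (\<epsilon>\<^sub>E e2)) (\<Delta>\<^sub>E e)) (\<Delta>\<^sub>C c)"
  proof -
    have eq: "tlift D (\<lambda>e1 e2. ract C c1 (\<epsilon>\<^sub>C c2) \<diamondop>\<^bsub>D\<^esub> ract E e1 (\<epsilon>\<^sub>E e2)) (\<Delta>\<^sub>E e) = 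
        ract C c1 (\<epsilon>\<^sub>C c2) \<diamondop>\<^bsub>D\<^esub> tlift E (\<lambda>e1 e2. ract E e1 (\<epsilon>\<^sub>E e2)) (\<Delta>\<^sub>E e)"
      if h: "c1 \<in> carrier C" "c2 \<in> carrier C" for c1 c2
      by (rule sym, (rule evals h r | assumption)+)
    show ?thesis
      by (rule eq tlift_cong r | assumption)+
  qed
  also have "\<dots> = tlift D (\<lambda>c1 c2. ract C c1 (\<epsilon>\<^sub>C c2) \<diamondop>\<^bsub>D\<^esub> e) (\<Delta>\<^sub>C c)"
    unfolding counit_E(2)[OF e] ..
  also have "\<dots> = tlift C (\<lambda>c1 c2. ract C c1 (\<epsilon>\<^sub>C c2)) (\<Delta>\<^sub>C c) \<diamondop>\<^bsub>D\<^esub> e"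
    by (rule sym, (rule evals r | assumption)+)
  also have "\<dots> = c \<diamondop>\<^bsub>D\<^esub> e"
    unfolding counit_C(2)[OF c] ..
  finally show "tlift D (\<lambda>x y. ract D x (\<epsilon> y)) (\<Delta> (c \<diamondop>\<^bsub>D\<^esub> e)) = c \<diamondop>\<^bsub>D\<^esub> e" .
qed

lemma coring_smash: "coring A D \<Delta> \<epsilon>"
  by (intro coring.intro coring_axioms.intro bimodule_tensor[OF C E] comult_hom counit_hom
    smash_coassoc smash_counit_left smash_counit_right)

end

section \<open>Restriction of scalars\<close>

text \<open>A shepherd is linear over the small ring \<open>H\<close>, while the left action on
  \<open>P \<otimes> Q\<close> comes from the large ring \<open>L\<close>. In this variant of
  \<open>balanced_tlift_right\<close> the map \<open>h\<close> is therefore linear after restriction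
  along \<open>\<phi>\<close>, and the integrand is balanced over \<open>H\<close> in the same
  restricted sense.\<close>

lemma balanced_tlift_right_restr:
  assumes h: "llin H (restr \<phi> \<psi> N) (restr \<phi> \<chi> (tensor K P Q)) h" and P: "bimodule L K P"
    and Q: "bimodule K R Q" and \<phi>: "ring_hom_ring H L \<phi>" and M: "rmod H M"
    and f: "\<And>x. x \<in> carrier M \<Longrightarrow> balanced K P Q G (f x)"
    and b: "\<And>w. w \<in> carrier Q \<Longrightarrow> balanced H M (restr \<phi> id P) G (\<lambda>x z. f x z w)"
  shows "balanced H M (restr \<phi> \<psi> N) G (\<lambda>x y. tlift G (f x) (h y))"
  unfolding balanced_def
proof (intro conjI ballI M llinD(1)[OF h])
  interpret \<phi>: ring_hom_ring H L \<phi> by fact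
  note hc = llinD(4)[OF h, unfolded restr_simps]
  note mods = bimodule_mods(1)[OF P] bimodule_mods(2)[OF Q]
  show "add_map (restr \<phi> \<psi> N) G (\<lambda>y. tlift G (f x) (h y))" if "x \<in> carrier M" for x
    using llinD(3)[OF h] unfolding restr_id_iff by (rule add_map_tlift_arg[OF _ f[OF that]])
  show "add_map M G (\<lambda>x. tlift G (f x) (h y))" if "y \<in> carrier (restr \<phi> \<psi> N)" for y
    by (rule add_map_tlift_fun[OF hc rmodD(1)[OF M] mods f balancedD(4)[OF b]])
      (use that in \<open>auto simp: restr_simps\<close>)
  show "tlift G (f (ract M x r)) (h y) = tlift G (f x) (h (lact (restr \<phi> \<psi> N) r y))"
    if "x \<in> carrier M" "r \<in> carrier H" "y \<in> carrier (restr \<phi> \<psi> N)" for x r y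
    unfolding llinD(6)[OF h that(2,3)] unfolding restr_simps
    by (rule tlift_lact[OF P Q f f _ hc, symmetric])
      (use that rmodD(2)[OF M] balancedD(9)[OF b] in \<open>auto simp: restr_simps\<close>)
qed

lemma balanced_tlift_left_restr:
  assumes h: "rlin H (restr \<psi> \<phi> M) (restr \<chi> \<phi> (tensor K P Q)) h" and P: "bimodule R K P"
    and Q: "bimodule K L Q" and \<phi>: "ring_hom_ring H L \<phi>" and N: "lmod H N"
    and f: "\<And>y. y \<in> carrier N \<Longrightarrow> balanced K P Q G (f y)"
    and b: "\<And>z. z \<in> carrier P \<Longrightarrow> balanced H (restr id \<phi> Q) N G (\<lambda>w y. f y z w)"
  shows "balanced H (restr \<psi> \<phi> M) N G (\<lambda>x y. tlift G (f y) (h x))"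
  unfolding balanced_def
proof (intro conjI ballI N rlinD(1)[OF h])
  interpret \<phi>: ring_hom_ring H L \<phi> by fact
  note hc = rlinD(4)[OF h, unfolded restr_simps]
  note mods = bimodule_mods(1)[OF P] bimodule_mods(2)[OF Q]
  show "add_map (restr \<psi> \<phi> M) G (\<lambda>x. tlift G (f y) (h x))" if "y \<in> carrier N" for y
    using rlinD(3)[OF h] unfolding restr_id_iff by (rule add_map_tlift_arg[OF _ f[OF that]])
  show "add_map N G (\<lambda>y. tlift G (f y) (h x))" if "x \<in> carrier (restr \<psi> \<phi> M)" for x
    by (rule add_map_tlift_fun[OF hc lmodD(1)[OF N] mods f balancedD(5)[OF b]])
      (use that in \<open>auto simp: restr_simps\<close>)
  show "tlift G (f y) (h (ract (restr \<psi> \<phi> M) x r)) = tlift G (f (lact N r y)) (h x)"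
    if "x \<in> carrier (restr \<psi> \<phi> M)" "r \<in> carrier H" "y \<in> carrier N" for x r y
    unfolding rlinD(6)[OF h that(2,1)] unfolding restr_simps
    by (rule tlift_ract[OF P Q f f _ hc])
      (use that lmodD(2)[OF N] balancedD(9)[OF b] in \<open>auto simp: restr_simps\<close>)
qed

lemma llin_tlift_arg_restr:
  assumes h: "llin H (restr \<phi> \<psi> M) (restr \<phi> \<omega> (tensor K P Q)) h" and P: "bimodule L K P"
    and Q: "bimodule K R Q" and \<phi>: "ring_hom_ring H L \<phi>" and N: "bimodule L R' N"
    and f: "balanced K P Q N f"
    and b: "\<And>w. w \<in> carrier Q \<Longrightarrow> llin H (restr \<phi> id P) (restr \<phi> id N) (\<lambda>z. f z w)"
  shows "llin H (restr \<phi> \<psi> M) (restr \<phi> \<chi> N) (\<lambda>x. tlift N f (h x))"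
proof (rule llinI)
  interpret N: bimodule L R' N by fact
  interpret \<phi>: ring_hom_ring H L \<phi> by fact
  note hc = llinD(4)[OF h, unfolded restr_simps]
  show "lmod H (restr \<phi> \<psi> M)" using llinD(1)[OF h] .
  show "lmod H (restr \<phi> \<chi> N)"
    using bimodule_mods(2)[OF N] by (auto simp: lmod_def abelian_group_restr restr_simps)
  show "add_map (restr \<phi> \<psi> M) (restr \<phi> \<chi> N) (\<lambda>x. tlift N f (h x))"
    using llinD(3)[OF h] unfolding restr_id_iff by (rule add_map_tlift_arg[OF _ f])
  show "tlift N f (h (lact (restr \<phi> \<psi> M) r x)) = lact (restr \<phi> \<chi> N) r (tlift N f (h x))"
    if r: "r \<in> carrier H" and x: "x \<in> carrier (restr \<phi> \<psi> M)" for r x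
  proof -
    have x': "x \<in> carrier M" using x by (simp add: restr_simps)
    have am: "add_map N N (lact N (\<phi> r))"
      using r by (intro add_mapI) (auto simp: N.lact_closed N.lact_add_right N.M.abelian_group_axioms)
    show ?thesis
      unfolding llinD(6)[OF h r x] unfolding restr_simps tlift_map[OF hc[OF x'] am f]
      by (rule tlift_lact[OF P Q f balanced_map[OF am f] _ hc[OF x']])
         (use llinD(6)[OF b r] r in \<open>auto simp: restr_simps\<close>)
  qed
qed

lemma rlin_tlift_arg_restr:
  assumes h: "rlin H (restr \<psi> \<phi> M) (restr \<omega> \<phi> (tensor K P Q)) h" and P: "bimodule R K P"
    and Q: "bimodule K L Q" and \<phi>: "ring_hom_ring H L \<phi>" and N: "bimodule R' L N"
    and f: "balanced K P Q N f"
    and b: "\<And>z. z \<in> carrier P \<Longrightarrow> rlin H (restr id \<phi> Q) (restr id \<phi> N) (f z)"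
  shows "rlin H (restr \<psi> \<phi> M) (restr \<chi> \<phi> N) (\<lambda>x. tlift N f (h x))"
proof (rule rlinI)
  interpret N: bimodule R' L N by fact
  interpret \<phi>: ring_hom_ring H L \<phi> by fact
  note hc = rlinD(4)[OF h, unfolded restr_simps]
  show "rmod H (restr \<psi> \<phi> M)" using rlinD(1)[OF h] .
  show "rmod H (restr \<chi> \<phi> N)"
    using bimodule_mods(1)[OF N] by (auto simp: rmod_def abelian_group_restr restr_simps)
  show "add_map (restr \<psi> \<phi> M) (restr \<chi> \<phi> N) (\<lambda>x. tlift N f (h x))"
    using rlinD(3)[OF h] unfolding restr_id_iff by (rule add_map_tlift_arg[OF _ f])
  show "tlift N f (h (ract (restr \<psi> \<phi> M) x r)) = ract (restr \<chi> \<phi> N) (tlift N f (h x)) r"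
    if r: "r \<in> carrier H" and x: "x \<in> carrier (restr \<psi> \<phi> M)" for r x
  proof -
    have x': "x \<in> carrier M" using x by (simp add: restr_simps)
    have am: "add_map N N (\<lambda>y. ract N y (\<phi> r))"
      using r by (intro add_mapI) (auto simp: N.ract_closed N.ract_add_left N.M.abelian_group_axioms)
    show ?thesis
      unfolding rlinD(6)[OF h r x] unfolding restr_simps tlift_map[OF hc[OF x'] am f]
      by (rule tlift_ract[OF P Q f balanced_map[OF am f] _ hc[OF x']])
         (use rlinD(6)[OF b r] r in \<open>auto simp: restr_simps\<close>)
  qed
qed

text \<open>A factor already restricted on one side by an inner tensor product gets restricted on
  the other side by the rules above. Each of the four statements discards the restriction on the
  side that the property does not read.\<close>

lemma balanced_restr_restr_right:
  "balanced H M (restr \<phi> id N) G k \<Longrightarrow> balanced H M (restr \<phi> \<psi> (restr id g N)) G k"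
  by (simp add: balanced_def lmod_def add_map_def restr_simps abelian_group_restr_iff)

lemma balanced_restr_restr_left:
  "balanced H (restr id \<phi> M) N G k \<Longrightarrow> balanced H (restr \<psi> \<phi> (restr g id M)) N G k"
  by (simp add: balanced_def rmod_def add_map_def restr_simps abelian_group_restr_iff)

lemma llin_restr_restr: "llin H (restr \<phi> id M) N h \<Longrightarrow> llin H (restr \<phi> \<psi> (restr id g M)) N h"
  by (simp add: llin_def lmod_def add_map_def restr_simps abelian_group_restr_iff)

lemma rlin_restr_restr: "rlin H (restr id \<phi> M) N h \<Longrightarrow> rlin H (restr \<psi> \<phi> (restr g id M)) N h"
  by (simp add: rlin_def rmod_def add_map_def restr_simps abelian_group_restr_iff)

lemmas restr_strip = balanced_restr_restr_right balanced_restr_restr_left llin_restr_restr rlin_restr_restr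

lemma llin_restr_source: "llin H (restr \<phi> \<psi> M) N h \<Longrightarrow> llin H (restr \<phi> \<psi>' M) N h"
  by (simp add: llin_def lmod_def add_map_def restr_simps abelian_group_restr_iff)

lemma llin_restr_target: "llin H M (restr \<phi> \<psi> N) h \<Longrightarrow> llin H M (restr \<phi> \<psi>' N) h"
  by (simp add: llin_def lmod_def add_map_def restr_simps abelian_group_restr_iff)

lemma rlin_restr_source: "rlin H (restr \<psi> \<phi> M) N h \<Longrightarrow> rlin H (restr \<psi>' \<phi> M) N h"
  by (simp add: rlin_def rmod_def add_map_def restr_simps abelian_group_restr_iff)

lemma rlin_restr_target: "rlin H M (restr \<psi> \<phi> N) h \<Longrightarrow> rlin H M (restr \<psi>' \<phi> N) h"
  by (simp add: rlin_def rmod_def add_map_def restr_simps abelian_group_restr_iff)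

lemma balanced_pure_maps_restr:
  assumes "rlin L M M' h" "llin L N N' k" "ring_hom_ring H L \<phi>"
  shows "balanced H (restr \<psi> \<phi> M) (restr \<phi> \<chi> N) (tensor L M' N') (\<lambda>x y. h x \<diamondop>\<^bsub>tensor L M' N'\<^esub> k y)"
  by (rule balanced_restr[OF balanced_pure_maps[OF assms(1,2)] assms(3)])

lemma balanced_lact_maps_restr:
  assumes "bimodule L R N'" "rlin L M (regular L) h" "llin L N N' k" "ring_hom_ring H L \<phi>"
  shows "balanced H (restr \<psi> \<phi> M) (restr \<phi> \<chi> N) N' (\<lambda>x y. lact N' (h x) (k y))"
  by (rule balanced_restr[OF balanced_lact_maps[OF assms(2,3,1)] assms(4)])

lemma balanced_ract_maps_restr:
  assumes "bimodule L R N'" "rlin R M N' h" "llin R N (regular R) k" "ring_hom_ring H R \<phi>"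
  shows "balanced H (restr \<psi> \<phi> M) (restr \<phi> \<chi> N) N' (\<lambda>x y. ract N' (h x) (k y))"
  by (rule balanced_restr[OF balanced_ract_maps[OF assms(2,3,1)] assms(4)])

lemma restr_in: "x \<in> carrier M \<Longrightarrow> x \<in> carrier (restr f g M)"
  and restr_out: "x \<in> carrier (restr f g M) \<Longrightarrow> x \<in> carrier M"
  by (simp_all add: restr_simps)

text \<open>The converse of evaluating a lift: an additive map of \<open>c\<close> is the lift of
  its values at pure tensors. It introduces the components of \<open>c\<close> into a Sweedler sum,
  or merges them again.\<close>

lemma tlift_expand:
  assumes "c \<in> carrier (tensor H M N)" "rmod H M" "lmod H N" "add_map (tensor H M N) G k"
  shows "tlift G (\<lambda>x y. k (x \<diamondop>\<^bsub>tensor H M N\<^esub> y)) c = k c"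
  by (rule tlift_ext[OF assms(1) balanced_map[OF assms(4) balanced_pure[OF assms(2,3)]] assms(4)]) simp

lemmas rbal = restr_intros restr_strip restr_in balanced_tlift_right_restr balanced_tlift_left_restr
  llin_tlift_arg_restr rlin_tlift_arg_restr balanced_lact_maps_restr balanced_ract_maps_restr balanced_pure_maps_restr

section \<open>Herds\<close>

context herd
begin

abbreviation "C \<equiv> T' \<^bold>\<otimes>\<^bsub>S,\<beta>\<^esub> T"
abbreviation "E \<equiv> T \<^bold>\<otimes>\<^bsub>R,\<alpha>\<^esub> T'"
abbreviation "TC \<equiv> T \<^bold>\<otimes>\<^bsub>R,\<alpha>\<^esub> C"
abbreviation "\<gamma>A \<equiv> shepherd_right A S \<beta> T T' \<gamma>"

lemma herd_structure [bal]: "ring_hom_ring R A \<alpha>" "ring_hom_ring S B \<beta>" "bimodule B A T" "bimodule A B T'"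
  "ring A" "ring B"
  by (rule \<alpha>.ring_hom_ring_axioms \<beta>.ring_hom_ring_axioms T.bimodule_axioms T'.bimodule_axioms
    bimodule_mods(4,5)[OF T.bimodule_axioms])+

lemma bimodule_C: "bimodule A A C" and bimodule_E: "bimodule B B E"
  by (rule bal)+

lemmas evD = bimod_homD[OF ev_hom bimodule_C bimodule_regular[OF herd_structure(5)]]
lemmas ev'D = bimod_homD[OF ev'_hom bimodule_E bimodule_regular[OF herd_structure(6)]]

lemma ev_closed: "c \<in> carrier C \<Longrightarrow> ev c \<in> carrier A" and ev'_closed: "e \<in> carrier E \<Longrightarrow> ev' e \<in> carrier B"
  using llinD(4)[OF evD(1)] llinD(4)[OF ev'D(1)] by (auto simp: regular_simps)

text \<open>The homomorphism property is split into its two sides, with the restriction on the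
  respective other side set to \<open>id\<close>, which is the form that the rules for one-sided
  linearity match.\<close>

lemma \<gamma>l: "llin S (restr \<beta> id T) (restr \<beta> id TC) \<gamma>" and \<gamma>r: "rlin R (restr id \<alpha> T) (restr id \<alpha> TC) \<gamma>"
  and \<gamma>_add: "add_map T TC \<gamma>"
proof -
  have "bimodule S R (restr \<beta> \<alpha> T)" "bimodule S R (restr \<beta> \<alpha> TC)"
    by (rule bal)+
  note D = bimod_homD[OF shepherd_hom this]
  show "llin S (restr \<beta> id T) (restr \<beta> id TC) \<gamma>"
    by (rule llin_restr_source[OF llin_restr_target[OF D(1)]])
  show "rlin R (restr id \<alpha> T) (restr id \<alpha> TC) \<gamma>"
    by (rule rlin_restr_source[OF rlin_restr_target[OF D(2)]])
  show "add_map T TC \<gamma>" using D(3) unfolding restr_id_iff .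
qed

lemmas herd_maps = rlin_comp[OF evD(2)] llin_comp[OF evD(1)] add_map_comp[OF evD(3)] balanced_map[OF evD(3)] ev_closed
  rlin_comp[OF ev'D(2)] llin_comp[OF ev'D(1)] add_map_comp[OF ev'D(3)] balanced_map[OF ev'D(3)] ev'_closed
  llin_comp[OF \<gamma>l] rlin_comp[OF \<gamma>r] add_map_comp[OF \<gamma>_add] add_map_closed[OF \<gamma>_add]

text \<open>The map induced by \<open>g\<close> is applied to the evaluation law. Read backwards the
  equation inserts a shepherd, replacing a unit by \<open>ev' (x1 \<otimes> x2)\<close> and
  \<open>x\<close> by \<open>x3\<close>.\<close>

lemma shepherd_ev'_int:
  assumes x: "x \<in> carrier T" and g: "balanced S (restr id \<beta> (regular B)) (restr \<beta> id T) G g"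
  shows "tlift G (\<lambda>x1 c. tlift G (\<lambda>x2 x3. g (ev' (x1 \<diamondop>\<^bsub>E\<^esub> x2)) x3) c) (\<gamma> x) = g \<one>\<^bsub>B\<^esub> x"
proof -
  let ?Q = "regular B \<^bold>\<otimes>\<^bsub>S,\<beta>\<^esub> T"
  note eq = shepherd_ev'[OF x, unfolded Let_def tlift3_def]
  have g': "balanced R (restr id \<alpha> T) (restr \<alpha> id T') G (\<lambda>x1 x2. g (ev' (x1 \<diamondop>\<^bsub>E\<^esub> x2)) x3)" if "x3 \<in> carrier T" for x3
  proof (rule balanced_map[of "regular B"])
    show "add_map (regular B) G (\<lambda>b. g b x3)"
      using balancedD(4)[OF g, of x3] that by (simp add: restr_id_iff restr_simps)
  qed (rule herd_maps rbal bal)+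
  have g'': "balanced S (restr id \<beta> T') (restr \<beta> id T) G (\<lambda>x2 x3. g (ev' (x1 \<diamondop>\<^bsub>E\<^esub> x2)) x3)" if "x1 \<in> carrier T" for x1
    apply (rule balanced_precomp[OF g])
    by (rule that herd_maps rbal bal rlin_restr)+
  note r = g' g'' herd_maps rbal bal rlin_restr llin_restr
  have "tlift G (\<lambda>x1 c. tlift G (\<lambda>x2 x3. g (ev' (x1 \<diamondop>\<^bsub>E\<^esub> x2)) x3) c) (\<gamma> x) =
    tlift G g (tlift ?Q (\<lambda>x1. tlift ?Q (\<lambda>x2 x3. ev' (x1 \<diamondop>\<^bsub>E\<^esub> x2) \<diamondop>\<^bsub>?Q\<^esub> x3)) (\<gamma> x))"
    by (rule sym, (rule evals g x r | assumption | drule restr_out)+)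
  also have "\<dots> = g \<one>\<^bsub>B\<^esub> x"
    unfolding eq
    by (rule tlift_pure_eq[OF g]) (use x in \<open>auto simp: restr_simps regular_simps\<close>)
  finally show ?thesis .
qed

lemma shepherd_ev_int:
  assumes x: "x \<in> carrier T" and g: "balanced R (restr id \<alpha> T) (restr \<alpha> id (regular A)) G g"
  shows "tlift G (\<lambda>x1 c. g x1 (ev c)) (\<gamma> x) = g x \<one>\<^bsub>A\<^esub>"
proof -
  let ?Q = "T \<^bold>\<otimes>\<^bsub>R,\<alpha>\<^esub> regular A"
  note eq = shepherd_ev[OF x, unfolded Let_def tlift3_def]
  have g': "balanced R (restr id \<alpha> T) (restr \<alpha> id C) G (\<lambda>x1 c. g x1 (ev c))"
    apply (rule balanced_precomp[OF g])
    by (rule herd_maps rbal bal rlin_restr llin_restr)+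
  note r = g' herd_maps rbal bal rlin_restr llin_restr
  have "tlift G (\<lambda>x1 c. g x1 (ev c)) (\<gamma> x) =
    tlift G g (tlift ?Q (\<lambda>x1 c. x1 \<diamondop>\<^bsub>?Q\<^esub> ev c) (\<gamma> x))"
    by (rule sym, (rule evals g x r | assumption | drule restr_out)+)
  also have "tlift ?Q (\<lambda>x1 c. x1 \<diamondop>\<^bsub>?Q\<^esub> ev c) (\<gamma> x) = tlift ?Q (\<lambda>x1. tlift ?Q (\<lambda>x2 x3. x1 \<diamondop>\<^bsub>?Q\<^esub> ev (x2 \<diamondop>\<^bsub>C\<^esub> x3))) (\<gamma> x)"
    apply (rule tlift_cong, (rule r x)+)
    apply (rule tlift_expand[symmetric])
    apply (rule r | assumption | drule restr_out)+
    done
  also have "tlift G g \<dots> = g x \<one>\<^bsub>A\<^esub>"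
    unfolding eq
    by (rule tlift_pure_eq[OF g]) (use x in \<open>auto simp: restr_simps regular_simps\<close>)
  finally show ?thesis .
qed

lemmas hbal = herd_maps rbal bal rlin_restr llin_restr

section \<open>Balancedness of the evaluations over the large rings\<close>

lemma ev_simps:
  "\<lbrakk>a \<in> carrier A; u \<in> carrier T'; x \<in> carrier T\<rbrakk> \<Longrightarrow> ev (lact T' a u \<diamondop>\<^bsub>C\<^esub> x) = a \<otimes>\<^bsub>A\<^esub> ev (u \<diamondop>\<^bsub>C\<^esub> x)"
  "\<lbrakk>a \<in> carrier A; u \<in> carrier T'; x \<in> carrier T\<rbrakk> \<Longrightarrow> ev (u \<diamondop>\<^bsub>C\<^esub> ract T x a) = ev (u \<diamondop>\<^bsub>C\<^esub> x) \<otimes>\<^bsub>A\<^esub> a"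
proof -
  have l: "llin A T' (regular A) (\<lambda>u. ev (u \<diamondop>\<^bsub>C\<^esub> x))" if "x \<in> carrier T" for x
    by (rule that hbal)+
  have r: "rlin A T (regular A) (\<lambda>x. ev (u \<diamondop>\<^bsub>C\<^esub> x))" if "u \<in> carrier T'" for u
    by (rule that hbal)+
  show "\<lbrakk>a \<in> carrier A; u \<in> carrier T'; x \<in> carrier T\<rbrakk> \<Longrightarrow> ev (lact T' a u \<diamondop>\<^bsub>C\<^esub> x) = a \<otimes>\<^bsub>A\<^esub> ev (u \<diamondop>\<^bsub>C\<^esub> x)"
    using llinD(6)[OF l] by (simp add: regular_simps)
  show "\<lbrakk>a \<in> carrier A; u \<in> carrier T'; x \<in> carrier T\<rbrakk> \<Longrightarrow> ev (u \<diamondop>\<^bsub>C\<^esub> ract T x a) = ev (u \<diamondop>\<^bsub>C\<^esub> x) \<otimes>\<^bsub>A\<^esub> a"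
    using rlinD(6)[OF r] by (simp add: regular_simps)
qed

lemma ev'_simps:
  "\<lbrakk>b \<in> carrier B; u \<in> carrier T'; x \<in> carrier T\<rbrakk> \<Longrightarrow> ev' (lact T b x \<diamondop>\<^bsub>E\<^esub> u) = b \<otimes>\<^bsub>B\<^esub> ev' (x \<diamondop>\<^bsub>E\<^esub> u)"
  "\<lbrakk>b \<in> carrier B; u \<in> carrier T'; x \<in> carrier T\<rbrakk> \<Longrightarrow> ev' (x \<diamondop>\<^bsub>E\<^esub> ract T' u b) = ev' (x \<diamondop>\<^bsub>E\<^esub> u) \<otimes>\<^bsub>B\<^esub> b"
proof -
  have l: "llin B T (regular B) (\<lambda>x. ev' (x \<diamondop>\<^bsub>E\<^esub> u))" if "u \<in> carrier T'" for u
    by (rule that hbal)+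
  have r: "rlin B T' (regular B) (\<lambda>u. ev' (x \<diamondop>\<^bsub>E\<^esub> u))" if "x \<in> carrier T" for x
    by (rule that hbal)+
  show "\<lbrakk>b \<in> carrier B; u \<in> carrier T'; x \<in> carrier T\<rbrakk> \<Longrightarrow> ev' (lact T b x \<diamondop>\<^bsub>E\<^esub> u) = b \<otimes>\<^bsub>B\<^esub> ev' (x \<diamondop>\<^bsub>E\<^esub> u)"
    using llinD(6)[OF l] by (simp add: regular_simps)
  show "\<lbrakk>b \<in> carrier B; u \<in> carrier T'; x \<in> carrier T\<rbrakk> \<Longrightarrow> ev' (x \<diamondop>\<^bsub>E\<^esub> ract T' u b) = ev' (x \<diamondop>\<^bsub>E\<^esub> u) \<otimes>\<^bsub>B\<^esub> b"
    using rlinD(6)[OF r] by (simp add: regular_simps)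
qed

lemma pure_C_closed: "u \<in> carrier T' \<Longrightarrow> x \<in> carrier T \<Longrightarrow> u \<diamondop>\<^bsub>C\<^esub> x \<in> carrier C"
  and pure_E_closed: "x \<in> carrier T \<Longrightarrow> u \<in> carrier T' \<Longrightarrow> x \<diamondop>\<^bsub>E\<^esub> u \<in> carrier E"
  by (rule hbal | assumption)+

lemmas ev_pure_closed = ev_closed[OF pure_C_closed] ev'_closed[OF pure_E_closed]

lemma act_C:
  "\<lbrakk>a \<in> carrier A; u \<in> carrier T'; x \<in> carrier T\<rbrakk> \<Longrightarrow> lact C a (u \<diamondop>\<^bsub>C\<^esub> x) = lact T' a u \<diamondop>\<^bsub>C\<^esub> x"
  "\<lbrakk>a \<in> carrier A; u \<in> carrier T'; x \<in> carrier T\<rbrakk> \<Longrightarrow> ract C (u \<diamondop>\<^bsub>C\<^esub> x) a = u \<diamondop>\<^bsub>C\<^esub> ract T x a"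
proof -
  have b: "bimodule A S (restr id \<beta> T')" "bimodule S A (restr \<beta> id T)" by (rule hbal)+
  show "\<lbrakk>a \<in> carrier A; u \<in> carrier T'; x \<in> carrier T\<rbrakk> \<Longrightarrow> lact C a (u \<diamondop>\<^bsub>C\<^esub> x) = lact T' a u \<diamondop>\<^bsub>C\<^esub> x"
    using lact_pure_eq[OF b] by (simp add: restr_simps)
  show "\<lbrakk>a \<in> carrier A; u \<in> carrier T'; x \<in> carrier T\<rbrakk> \<Longrightarrow> ract C (u \<diamondop>\<^bsub>C\<^esub> x) a = u \<diamondop>\<^bsub>C\<^esub> ract T x a"
    using ract_pure_eq[OF b] by (simp add: restr_simps)
qed

lemma act_E:
  "\<lbrakk>b \<in> carrier B; x \<in> carrier T; u \<in> carrier T'\<rbrakk> \<Longrightarrow> lact E b (x \<diamondop>\<^bsub>E\<^esub> u) = lact T b x \<diamondop>\<^bsub>E\<^esub> u"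
  "\<lbrakk>b \<in> carrier B; x \<in> carrier T; u \<in> carrier T'\<rbrakk> \<Longrightarrow> ract E (x \<diamondop>\<^bsub>E\<^esub> u) b = x \<diamondop>\<^bsub>E\<^esub> ract T' u b"
proof -
  have b: "bimodule B R (restr id \<alpha> T)" "bimodule R B (restr \<alpha> id T')" by (rule hbal)+
  show "\<lbrakk>b \<in> carrier B; x \<in> carrier T; u \<in> carrier T'\<rbrakk> \<Longrightarrow> lact E b (x \<diamondop>\<^bsub>E\<^esub> u) = lact T b x \<diamondop>\<^bsub>E\<^esub> u"
    using lact_pure_eq[OF b] by (simp add: restr_simps)
  show "\<lbrakk>b \<in> carrier B; x \<in> carrier T; u \<in> carrier T'\<rbrakk> \<Longrightarrow> ract E (x \<diamondop>\<^bsub>E\<^esub> u) b = x \<diamondop>\<^bsub>E\<^esub> ract T' u b"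
    using ract_pure_eq[OF b] by (simp add: restr_simps)
qed

text \<open>Inserting the shepherd of \<open>x\<close> puts the factor
  \<open>ev' (x1 \<otimes> x2)\<close> in front of either side, with \<open>x3\<close> in place of
  \<open>x\<close>. The second evaluation is absorbed into \<open>x2\<close> by the formal dual,
  which turns it into \<open>ev (x2 \<otimes> x3 a) u\<close>; there \<open>a\<close> passes to
  \<open>u\<close> because \<open>ev\<close> is linear over \<open>A\<close> on both sides.\<close>

lemma ev'_middle:
  assumes h: "x \<in> carrier T" "a \<in> carrier A" "u \<in> carrier T'"
  shows "ev' (ract T x a \<diamondop>\<^bsub>E\<^esub> u) = ev' (x \<diamondop>\<^bsub>E\<^esub> lact T' a u)"
proof -
  let ?I = "tlift (regular B)"
  have "balanced S (restr id \<beta> (regular B)) (restr \<beta> id T) (regular B)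
      (\<lambda>b y. lact (regular B) b (ev' (ract T y a \<diamondop>\<^bsub>E\<^esub> u)))"
    by (rule h hbal)+
  note 1 = shepherd_ev'_int[OF h(1) this]
  have "balanced S (restr id \<beta> (regular B)) (restr \<beta> id T) (regular B)
      (\<lambda>b y. lact (regular B) b (ev' (y \<diamondop>\<^bsub>E\<^esub> lact T' a u)))"
    by (rule h hbal)+
  note 2 = shepherd_ev'_int[OF h(1) this]
  have eq: "lact (regular B) (ev' (x1 \<diamondop>\<^bsub>E\<^esub> x2)) (ev' (ract T x3 a \<diamondop>\<^bsub>E\<^esub> u)) =
    lact (regular B) (ev' (x1 \<diamondop>\<^bsub>E\<^esub> x2)) (ev' (x3 \<diamondop>\<^bsub>E\<^esub> lact T' a u))"
    if x: "x1 \<in> carrier T" "x2 \<in> carrier T'" "x3 \<in> carrier T" for x1 x2 x3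
  proof -
    have "ract T' x2 (ev' (ract T x3 a \<diamondop>\<^bsub>E\<^esub> u)) = ract T' x2 (ev' (x3 \<diamondop>\<^bsub>E\<^esub> lact T' a u))"
      using x h by (simp add: ev_ev' T.ract_closed T'.lact_closed ev_simps T'.lact_mult ev_pure_closed)
    then have "ev' (x1 \<diamondop>\<^bsub>E\<^esub> ract T' x2 (ev' (ract T x3 a \<diamondop>\<^bsub>E\<^esub> u))) = ev' (x1 \<diamondop>\<^bsub>E\<^esub> ract T' x2 (ev' (x3 \<diamondop>\<^bsub>E\<^esub> lact T' a u)))"
      by simp
    then show ?thesis
      using x h by (simp add: ev'_simps T.ract_closed T'.lact_closed ev_pure_closed regular_simps)
  qed
  have "?I (\<lambda>x1 c. ?I (\<lambda>x2 x3. lact (regular B) (ev' (x1 \<diamondop>\<^bsub>E\<^esub> x2)) (ev' (ract T x3 a \<diamondop>\<^bsub>E\<^esub> u))) c) (\<gamma> x) =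
    ?I (\<lambda>x1 c. ?I (\<lambda>x2 x3. lact (regular B) (ev' (x1 \<diamondop>\<^bsub>E\<^esub> x2)) (ev' (x3 \<diamondop>\<^bsub>E\<^esub> lact T' a u))) c) (\<gamma> x)"
    by (rule eq tlift_cong h hbal | assumption | drule restr_out)+
  with 1 2 show ?thesis
    using h by (simp add: regular_simps ev_pure_closed T.ract_closed T'.lact_closed)
qed

text \<open>As for \<open>ev'_middle\<close>, with the other evaluation law: the factor
  \<open>ev (x2 \<otimes> x3)\<close> is put behind, the evaluation in front is absorbed into
  \<open>x2\<close> as \<open>u b ev' (x1 \<otimes> x2)\<close>, and \<open>b\<close> passes to
  \<open>x1\<close>.\<close>

lemma ev_middle:
  assumes h: "u \<in> carrier T'" "b \<in> carrier B" "x \<in> carrier T"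
  shows "ev (ract T' u b \<diamondop>\<^bsub>C\<^esub> x) = ev (u \<diamondop>\<^bsub>C\<^esub> lact T b x)"
proof -
  let ?I = "tlift (regular A)"
  have b1: "balanced R (restr id \<alpha> T) (restr \<alpha> id (regular A)) (regular A)
      (\<lambda>y a. lact (regular A) (ev (ract T' u b \<diamondop>\<^bsub>C\<^esub> y)) a)"
    by (rule h hbal)+
  note 1 = shepherd_ev_int[OF h(3) this]
  have b2: "balanced R (restr id \<alpha> T) (restr \<alpha> id (regular A)) (regular A)
      (\<lambda>y a. lact (regular A) (ev (u \<diamondop>\<^bsub>C\<^esub> lact T b y)) a)"
    by (rule h hbal)+
  note 2 = shepherd_ev_int[OF h(3) this]
  have eq: "lact (regular A) (ev (ract T' u b \<diamondop>\<^bsub>C\<^esub> x1)) (ev c) = lact (regular A) (ev (u \<diamondop>\<^bsub>C\<^esub> lact T b x1)) (ev c)"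
    if x: "x1 \<in> carrier T" and c: "c \<in> carrier C" for x1 c
  proof (rule tensor_ext[OF _ _ _ _ _ c])
    show "add_map C (regular A) (\<lambda>c. lact (regular A) (ev (ract T' u b \<diamondop>\<^bsub>C\<^esub> x1)) (ev c))"
      "add_map C (regular A) (\<lambda>c. lact (regular A) (ev (u \<diamondop>\<^bsub>C\<^esub> lact T b x1)) (ev c))"
      by (rule rlinD(3), (rule x h hbal)+)+
    show "rmod S (restr id \<beta> T')" "lmod S (restr \<beta> id T)" by (rule hbal)+
    fix x2 x3 assume "x2 \<in> carrier (restr id \<beta> T')" "x3 \<in> carrier (restr \<beta> id T)"
    then have y: "x2 \<in> carrier T'" "x3 \<in> carrier T" by (simp_all add: restr_simps)
    have "lact T' (ev (ract T' u b \<diamondop>\<^bsub>C\<^esub> x1)) x2 = lact T' (ev (u \<diamondop>\<^bsub>C\<^esub> lact T b x1)) x2"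
      using x y h by (simp add: ev_ev'[symmetric] T'.ract_closed T.lact_closed ev'_simps T'.ract_mult ev_pure_closed)
    then have "ev (lact T' (ev (ract T' u b \<diamondop>\<^bsub>C\<^esub> x1)) x2 \<diamondop>\<^bsub>C\<^esub> x3) = ev (lact T' (ev (u \<diamondop>\<^bsub>C\<^esub> lact T b x1)) x2 \<diamondop>\<^bsub>C\<^esub> x3)"
      by simp
    then show "lact (regular A) (ev (ract T' u b \<diamondop>\<^bsub>C\<^esub> x1)) (ev (x2 \<diamondop>\<^bsub>C\<^esub> x3)) =
      lact (regular A) (ev (u \<diamondop>\<^bsub>C\<^esub> lact T b x1)) (ev (x2 \<diamondop>\<^bsub>C\<^esub> x3))"
      using x y h by (simp add: ev_simps T'.ract_closed T.lact_closed ev_pure_closed regular_simps)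
  qed
  have "?I (\<lambda>x1 c. lact (regular A) (ev (ract T' u b \<diamondop>\<^bsub>C\<^esub> x1)) (ev c)) (\<gamma> x) =
    ?I (\<lambda>x1 c. lact (regular A) (ev (u \<diamondop>\<^bsub>C\<^esub> lact T b x1)) (ev c)) (\<gamma> x)"
    by (rule eq tlift_cong h hbal | assumption | drule restr_out)+
  with 1 2 show ?thesis
    using h by (simp add: regular_simps ev_pure_closed T'.ract_closed T.lact_closed)
qed

lemma balanced_ev: "balanced B T' T (regular A) (\<lambda>u x. ev (u \<diamondop>\<^bsub>C\<^esub> x))"
proof -
  have "balanced S (restr id \<beta> T') (restr \<beta> id T) (regular A) (\<lambda>u x. ev (u \<diamondop>\<^bsub>C\<^esub> x))"
    by (rule hbal)+
  note D = balancedD[OF this, unfolded restr_simps]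
  show ?thesis
    by (rule balancedI[OF _ _ D(3,6,7,8)]) (rule ev_middle hbal | assumption)+
qed

lemma balanced_ev': "balanced A T T' (regular B) (\<lambda>x u. ev' (x \<diamondop>\<^bsub>E\<^esub> u))"
proof -
  have "balanced R (restr id \<alpha> T) (restr \<alpha> id T') (regular B) (\<lambda>x u. ev' (x \<diamondop>\<^bsub>E\<^esub> u))"
    by (rule hbal)+
  note D = balancedD[OF this, unfolded restr_simps]
  show ?thesis
    by (rule balancedI[OF _ _ D(3,6,7,8)]) (rule ev'_middle hbal | assumption)+
qed

lemmas ebal = balanced_precomp[OF balanced_ev] balanced_precomp[OF balanced_ev']

section \<open>The right coaction of C on T\<close>

abbreviation "TAC \<equiv> T \<^bold>\<otimes>\<^bsub>A\<^esub> C"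

lemma \<gamma>A_eq: "\<gamma>A = (\<lambda>x. tlift TAC (\<lambda>x1 c. x1 \<diamondop>\<^bsub>TAC\<^esub> c) (\<gamma> x))"
  by (simp add: fun_eq_iff shepherd_right_def Let_def)

lemma \<gamma>A_l: "llin S (restr \<beta> id T) (restr \<beta> id TAC) \<gamma>A"
  unfolding \<gamma>A_eq by (rule hbal | assumption | drule restr_out)+

lemma \<gamma>A_closed: "x \<in> carrier T \<Longrightarrow> \<gamma>A x \<in> carrier TAC"
  using llinD(4)[OF \<gamma>A_l] by (simp add: restr_simps)

text \<open>With \<open>b = ev' (x1 \<otimes> x2)\<close>, the formal dual gives
  \<open>b y1 = x1 ev (x2 \<otimes> y1)\<close>. This scalar lies in \<open>A\<close> and crosses
  the tensor sign, where it turns \<open>y2\<close> into \<open>x2 ev' (y1 \<otimes> y2)\<close>;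
  the evaluation law for \<open>y\<close> then leaves \<open>x2 \<otimes> y\<close>. The projection
  to the tensor product over \<open>A\<close> is what makes the crossing possible.\<close>

lemma lact_\<gamma>A:
  assumes h: "x1 \<in> carrier T" "x2 \<in> carrier T'" "y \<in> carrier T"
  shows "lact TAC (ev' (x1 \<diamondop>\<^bsub>E\<^esub> x2)) (\<gamma>A y) = x1 \<diamondop>\<^bsub>TAC\<^esub> (x2 \<diamondop>\<^bsub>C\<^esub> y)"
proof -
  let ?I = "tlift TAC" and ?b = "ev' (x1 \<diamondop>\<^bsub>E\<^esub> x2)"
  note r = h hbal
  have "lact TAC ?b (\<gamma>A y) = ?I (\<lambda>y1 c. lact T ?b y1 \<diamondop>\<^bsub>TAC\<^esub> c) (\<gamma> y)"
    unfolding \<gamma>A_eq by (rule lact_tlift lact_pure_eq r | assumption | drule restr_out)+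
  also have "\<dots> = ?I (\<lambda>y1 c. ?I (\<lambda>y2 y3. lact T ?b y1 \<diamondop>\<^bsub>TAC\<^esub> (y2 \<diamondop>\<^bsub>C\<^esub> y3)) c) (\<gamma> y)"
    by (rule tlift_cong tlift_expand[symmetric] r | assumption | drule restr_out)+
  also have "\<dots> = ?I (\<lambda>y1 c. ?I (\<lambda>y2 y3. x1 \<diamondop>\<^bsub>TAC\<^esub> (ract T' x2 (ev' (y1 \<diamondop>\<^bsub>E\<^esub> y2)) \<diamondop>\<^bsub>C\<^esub> y3)) c) (\<gamma> y)"
  proof -
    have eq: "lact T ?b y1 \<diamondop>\<^bsub>TAC\<^esub> (y2 \<diamondop>\<^bsub>C\<^esub> y3) = x1 \<diamondop>\<^bsub>TAC\<^esub> (ract T' x2 (ev' (y1 \<diamondop>\<^bsub>E\<^esub> y2)) \<diamondop>\<^bsub>C\<^esub> y3)"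
      if y: "y1 \<in> carrier T" "y2 \<in> carrier T'" "y3 \<in> carrier T" for y1 y2 y3
    proof -
      have "lact T ?b y1 \<diamondop>\<^bsub>TAC\<^esub> (y2 \<diamondop>\<^bsub>C\<^esub> y3) = x1 \<diamondop>\<^bsub>TAC\<^esub> lact C (ev (x2 \<diamondop>\<^bsub>C\<^esub> y1)) (y2 \<diamondop>\<^bsub>C\<^esub> y3)"
        unfolding ev'_ev[OF h(1,2) y(1)] by (rule pure_middle_eq) (rule y r)+
      also have "lact C (ev (x2 \<diamondop>\<^bsub>C\<^esub> y1)) (y2 \<diamondop>\<^bsub>C\<^esub> y3) = lact T' (ev (x2 \<diamondop>\<^bsub>C\<^esub> y1)) y2 \<diamondop>\<^bsub>C\<^esub> y3"
        by (rule act_C) (rule y r)+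
      finally show ?thesis unfolding ev_ev'[OF h(2) y(1,2)] .
    qed
    show ?thesis
      by (rule eq tlift_cong r | assumption | drule restr_out)+
  qed
  also have "\<dots> = x1 \<diamondop>\<^bsub>TAC\<^esub> (ract T' x2 \<one>\<^bsub>B\<^esub> \<diamondop>\<^bsub>C\<^esub> y)"
    by (rule shepherd_ev'_int) (rule r)+
  finally show ?thesis by (simp add: T'.ract_one h)
qed

text \<open>The shepherd of \<open>x\<close>, inserted in front, writes
  \<open>\<gamma>A (x a)\<close> as the sum of \<open>ev' (x1 \<otimes> x2)\<close> acting on
  \<open>\<gamma>A (x3 a)\<close>. By \<open>lact_\<gamma>A\<close> each term is
  \<open>x1 \<otimes> (x2 \<otimes> x3 a)\<close>, in which \<open>a\<close> visibly acts on the
  right.\<close>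

lemma \<gamma>A_r: "rlin A T TAC \<gamma>A"
proof (rule rlinI)
  note r = llin_comp[OF \<gamma>A_l] \<gamma>A_closed hbal
  show "rmod A T" "rmod A TAC" by (rule hbal)+
  show "add_map T TAC \<gamma>A" using llinD(3)[OF \<gamma>A_l] unfolding restr_id_iff .
  fix a x assume a: "a \<in> carrier A" and x: "x \<in> carrier T"
  let ?I = "tlift TAC"
  interpret TAC: bimodule B A TAC by (rule hbal)+
  have g: "balanced S (restr id \<beta> (regular B)) (restr \<beta> id T) TAC (\<lambda>b y. lact TAC b (\<gamma>A (ract T y a)))"
    by (rule balanced_precomp[OF balanced_restr[OF balanced_lact_act]]) (rule a x r)+
  have "\<gamma>A (ract T x a) = lact TAC \<one>\<^bsub>B\<^esub> (\<gamma>A (ract T x a))"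
    using x a by (simp add: TAC.lact_one \<gamma>A_closed T.ract_closed)
  also have "\<dots> = ?I (\<lambda>x1 c. ?I (\<lambda>x2 x3. lact TAC (ev' (x1 \<diamondop>\<^bsub>E\<^esub> x2)) (\<gamma>A (ract T x3 a))) c) (\<gamma> x)"
    by (rule shepherd_ev'_int[OF x g, symmetric])
  also have "\<dots> = ?I (\<lambda>x1 c. ?I (\<lambda>x2 x3. x1 \<diamondop>\<^bsub>TAC\<^esub> (x2 \<diamondop>\<^bsub>C\<^esub> ract T x3 a)) c) (\<gamma> x)"
  proof -
    have "balanced S (restr id \<beta> T') (restr \<beta> id T) TAC (\<lambda>x2 x3. lact TAC (ev' (x1 \<diamondop>\<^bsub>E\<^esub> x2)) (\<gamma>A (ract T x3 a)))"
      if "x1 \<in> carrier T" for x1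
      by (rule balanced_precomp[OF balanced_restr[OF balanced_lact_act]]) (rule that a x r)+
    note bb = this
    show ?thesis
      by (rule tlift_cong lact_\<gamma>A bb a x r | assumption | drule restr_out)+
  qed
  also have "\<dots> = ?I (\<lambda>x1 c. x1 \<diamondop>\<^bsub>TAC\<^esub> ract C c a) (\<gamma> x)"
  proof -
    have eq: "?I (\<lambda>x2 x3. x1 \<diamondop>\<^bsub>TAC\<^esub> (x2 \<diamondop>\<^bsub>C\<^esub> ract T x3 a)) c = x1 \<diamondop>\<^bsub>TAC\<^esub> ract C c a"
      if h: "x1 \<in> carrier T" "c \<in> carrier C" for x1 c
    proof -
      have am: "add_map C TAC (\<lambda>c. x1 \<diamondop>\<^bsub>TAC\<^esub> ract C c a)"
        by (rule add_map_pure_right ract_add_map h a r)+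
      have "?I (\<lambda>x2 x3. x1 \<diamondop>\<^bsub>TAC\<^esub> (x2 \<diamondop>\<^bsub>C\<^esub> ract T x3 a)) c = ?I (\<lambda>x2 x3. x1 \<diamondop>\<^bsub>TAC\<^esub> ract C (x2 \<diamondop>\<^bsub>C\<^esub> x3) a) c"
        by (rule tlift_cong, (rule h a r | assumption | drule restr_out)+) (simp add: act_C restr_simps a)
      also have "\<dots> = x1 \<diamondop>\<^bsub>TAC\<^esub> ract C c a"
        by (rule tlift_expand[OF _ _ _ am]) (rule h r)+
      finally show ?thesis .
    qed
    show ?thesis
      by (rule tlift_cong eq a x r | assumption | drule restr_out)+
  qed
  also have "\<dots> = ract TAC (\<gamma>A x) a"
    unfolding \<gamma>A_eq
    by (rule sym, (rule ract_tlift ract_pure_eq a x r | assumption | drule restr_out)+)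
  finally show "\<gamma>A (ract T x a) = ract TAC (\<gamma>A x) a" .
qed

lemmas \<gamma>A_maps = llin_comp[OF \<gamma>A_l] rlin_comp[OF \<gamma>A_r] add_map_comp[OF rlinD(3)[OF \<gamma>A_r]] \<gamma>A_closed

text \<open>An integrand that is balanced over \<open>A\<close> does not notice the projection from
  the tensor product over \<open>R\<close>.\<close>

lemma \<gamma>A_int:
  assumes "x \<in> carrier T" "balanced A T C G f"
  shows "tlift G f (\<gamma>A x) = tlift G f (\<gamma> x)"
proof -
  have f: "balanced R (restr id \<alpha> T) (restr \<alpha> id C) G f"
    by (rule balanced_restr[OF assms(2)]) (rule hbal)
  show ?thesis
    unfolding \<gamma>A_eq by (rule tlift_tlift_eq tlift_pure_eq refl assms f hbal | assumption | drule restr_out)+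
qed

lemma \<gamma>A_counit:
  assumes x: "x \<in> carrier T"
  shows "tlift T (\<lambda>x1 c. ract T x1 (ev c)) (\<gamma>A x) = x"
proof -
  have "balanced A T C T (\<lambda>x1 c. ract T x1 (ev c))" by (rule hbal)+
  note \<gamma>A_int[OF x this]
  also have "tlift T (\<lambda>x1 c. ract T x1 (ev c)) (\<gamma> x) = ract T x \<one>\<^bsub>A\<^esub>"
    by (rule shepherd_ev_int[OF x]) (rule hbal)+
  finally show ?thesis by (simp add: T.ract_one x)
qed

lemma \<gamma>A_counit':
  assumes x: "x \<in> carrier T" and g: "balanced S (restr id \<beta> (regular B)) (restr \<beta> id T) G g"
  shows "tlift G (\<lambda>x1 c. tlift G (\<lambda>x2 x3. g (ev' (x1 \<diamondop>\<^bsub>E\<^esub> x2)) x3) c) (\<gamma>A x) = g \<one>\<^bsub>B\<^esub> x"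
proof -
  have g1: "balanced A T T' G (\<lambda>x1 x2. g (ev' (x1 \<diamondop>\<^bsub>E\<^esub> x2)) x3)" if "x3 \<in> carrier T" for x3
  proof (rule balanced_map[of "regular B"])
    show "add_map (regular B) G (\<lambda>b. g b x3)"
      using balancedD(4)[OF g, of x3] that by (simp add: restr_id_iff restr_simps)
  qed (rule balanced_ev')
  have g2: "balanced S (restr id \<beta> T') (restr \<beta> id T) G (\<lambda>x2 x3. g (ev' (x1 \<diamondop>\<^bsub>E\<^esub> x2)) x3)" if "x1 \<in> carrier T" for x1
    apply (rule balanced_precomp[OF g])
    by (rule that hbal)+
  have "balanced A T C G (\<lambda>x1 c. tlift G (\<lambda>x2 x3. g (ev' (x1 \<diamondop>\<^bsub>E\<^esub> x2)) x3) c)"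
    by (rule g1 g2 hbal | assumption | drule restr_out)+
  from \<gamma>A_int[OF x this] shepherd_ev'_int[OF x g] show ?thesis by simp
qed

text \<open>The coassociativity law is fed to the fourfold lift induced by \<open>F\<close>, whose
  five arguments alternate between \<open>T\<close> and \<open>T'\<close>; there is one balancedness
  condition for each gap.\<close>

lemma shepherd_coassoc_int:
  assumes x: "x \<in> carrier T"
    and b1: "\<And>a3 a4 a5. \<lbrakk>a3 \<in> carrier T; a4 \<in> carrier T'; a5 \<in> carrier T\<rbrakk> \<Longrightarrow>
      balanced R (restr id \<alpha> T) (restr \<alpha> id T') G (\<lambda>a1 a2. F a1 a2 a3 a4 a5)"
    and b2: "\<And>a1 a4 a5. \<lbrakk>a1 \<in> carrier T; a4 \<in> carrier T'; a5 \<in> carrier T\<rbrakk> \<Longrightarrow>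
      balanced S (restr id \<beta> T') (restr \<beta> id T) G (\<lambda>a2 a3. F a1 a2 a3 a4 a5)"
    and b3: "\<And>a1 a2 a5. \<lbrakk>a1 \<in> carrier T; a2 \<in> carrier T'; a5 \<in> carrier T\<rbrakk> \<Longrightarrow>
      balanced R (restr id \<alpha> T) (restr \<alpha> id T') G (\<lambda>a3 a4. F a1 a2 a3 a4 a5)"
    and b4: "\<And>a1 a2 a3. \<lbrakk>a1 \<in> carrier T; a2 \<in> carrier T'; a3 \<in> carrier T\<rbrakk> \<Longrightarrow>
      balanced S (restr id \<beta> T') (restr \<beta> id T) G (\<lambda>a4 a5. F a1 a2 a3 a4 a5)"
  shows "tlift G (\<lambda>x1. tlift G (\<lambda>x2 x3. tlift G (\<lambda>y1. tlift G (\<lambda>y2 y3. F y1 y2 y3 x2 x3)) (\<gamma> x1))) (\<gamma> x) =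
    tlift G (\<lambda>x1. tlift G (\<lambda>x2 x3. tlift G (\<lambda>y1. tlift G (\<lambda>y2 y3. F x1 x2 y1 y2 y3)) (\<gamma> x3))) (\<gamma> x)"
proof -
  let ?I = "tlift G"
  let ?k = "?I (\<lambda>a1. ?I (\<lambda>a2. ?I (\<lambda>a3. ?I (\<lambda>a4 a5. F a1 a2 a3 a4 a5))))"
  note eq = arg_cong[OF shepherd_coassoc[OF x, unfolded Let_def tlift3_def], of ?k]
  note r = x b1 b2 b3 b4 hbal
  have c: "tlift G (\<lambda>a4 a5. F a1 a2 a3 a4 a5) c = tlift G (\<lambda>a4 a5. F a1 a2 a3 a4 a5) c" for a1 a2 a3 c ..
  show ?thesis
    apply (rule trans[OF trans[OF _ eq]])
     apply (rule sym)
     apply (rule evals r | assumption | drule restr_out)+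
    done
qed

lemmas gbal = ebal \<gamma>A_maps hbal

section \<open>The coring C of a herd\<close>

abbreviation "\<Delta>C \<equiv> right_coring_comult A S \<beta> T T' \<gamma>"
abbreviation "CC \<equiv> C \<^bold>\<otimes>\<^bsub>A\<^esub> C"

lemma \<Delta>C_eq: "\<Delta>C = tlift CC (\<lambda>u x. tlift CC (\<lambda>x1 c. (u \<diamondop>\<^bsub>C\<^esub> x1) \<diamondop>\<^bsub>CC\<^esub> c) (\<gamma>A x))"
  by (simp add: right_coring_comult_def Let_def)

lemma \<Delta>C_hom: "\<Delta>C \<in> bimod_hom A A C CC"
  unfolding \<Delta>C_eq
  by (rule bimod_homI gbal | assumption | drule restr_out)+

lemma \<Delta>C_pure:
  assumes "u \<in> carrier T'" "x \<in> carrier T"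
  shows "\<Delta>C (u \<diamondop>\<^bsub>C\<^esub> x) = tlift CC (\<lambda>x1 c. (u \<diamondop>\<^bsub>C\<^esub> x1) \<diamondop>\<^bsub>CC\<^esub> c) (\<gamma>A x)"
  unfolding \<Delta>C_eq
  by (rule tlift_pure_eq refl assms gbal | assumption | drule restr_out)+

lemmas \<Delta>CD = bimod_homD[OF \<Delta>C_hom bimodule_C bimodule_tensor[OF bimodule_C bimodule_C]]
lemmas \<Delta>C_maps = rlin_comp[OF \<Delta>CD(2)] llin_comp[OF \<Delta>CD(1)] add_map_comp[OF \<Delta>CD(3)]
  balanced_map[OF \<Delta>CD(3)] llinD(4)[OF \<Delta>CD(1)]

lemma \<Delta>C_int:
  assumes "u \<in> carrier T'" "x \<in> carrier T" "balanced A C C G f"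
  shows "tlift G f (\<Delta>C (u \<diamondop>\<^bsub>C\<^esub> x)) = tlift G (\<lambda>x1 c. f (u \<diamondop>\<^bsub>C\<^esub> x1) c) (\<gamma>A x)"
  unfolding \<Delta>C_pure[OF assms(1,2)]
  by (rule evals assms gbal | assumption | drule restr_out)+

text \<open>For integrands balanced over \<open>A\<close> the coaction may be replaced by the
  shepherd, and components in \<open>C\<close> may be opened up into pairs. In that form the claim
  is coassociativity of the shepherd; afterwards the pairs are closed and the projections
  restored.\<close>

lemma \<gamma>A_coassoc:
  assumes x: "x \<in> carrier T"
  shows "tlift (T \<^bold>\<otimes>\<^bsub>A\<^esub> CC) (\<lambda>m1 c. tlift (T \<^bold>\<otimes>\<^bsub>A\<^esub> CC)
        (\<lambda>m0 d. m0 \<diamondop>\<^bsub>T \<^bold>\<otimes>\<^bsub>A\<^esub> CC\<^esub> (d \<diamondop>\<^bsub>CC\<^esub> c)) (\<gamma>A m1)) (\<gamma>A x) =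
      tlift (T \<^bold>\<otimes>\<^bsub>A\<^esub> CC) (\<lambda>m0 c. m0 \<diamondop>\<^bsub>T \<^bold>\<otimes>\<^bsub>A\<^esub> CC\<^esub> \<Delta>C c) (\<gamma>A x)"
proof -
  let ?Q = "T \<^bold>\<otimes>\<^bsub>A\<^esub> CC"
  let ?I = "tlift ?Q"
  note r = x \<Delta>C_maps gbal
  have 1: "?I (\<lambda>m1 c. ?I (\<lambda>m0 d. m0 \<diamondop>\<^bsub>?Q\<^esub> (d \<diamondop>\<^bsub>CC\<^esub> c)) (\<gamma>A m1)) (\<gamma>A x) =
    ?I (\<lambda>m1 c. ?I (\<lambda>m0 d. m0 \<diamondop>\<^bsub>?Q\<^esub> (d \<diamondop>\<^bsub>CC\<^esub> c)) (\<gamma>A m1)) (\<gamma> x)"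
    by (rule \<gamma>A_int) (rule r | assumption | drule restr_out)+
  also have "\<dots> = ?I (\<lambda>m1 c. ?I (\<lambda>x2 x3. ?I (\<lambda>m0 d. m0 \<diamondop>\<^bsub>?Q\<^esub> (d \<diamondop>\<^bsub>CC\<^esub> (x2 \<diamondop>\<^bsub>C\<^esub> x3))) (\<gamma>A m1)) c) (\<gamma> x)"
  proof -
    have eq: "?I (\<lambda>m0 d. m0 \<diamondop>\<^bsub>?Q\<^esub> (d \<diamondop>\<^bsub>CC\<^esub> c)) (\<gamma>A m1) =
      ?I (\<lambda>x2 x3. ?I (\<lambda>m0 d. m0 \<diamondop>\<^bsub>?Q\<^esub> (d \<diamondop>\<^bsub>CC\<^esub> (x2 \<diamondop>\<^bsub>C\<^esub> x3))) (\<gamma>A m1)) c"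
      if "m1 \<in> carrier T" "c \<in> carrier C" for m1 c
      apply (rule tlift_expand[symmetric])
      apply (rule that r | assumption | drule restr_out)+
      done
    have bb: "balanced R (restr id \<alpha> T) (restr \<alpha> id C) ?Q (\<lambda>m1 c. ?I (\<lambda>m0 d. m0 \<diamondop>\<^bsub>?Q\<^esub> (d \<diamondop>\<^bsub>CC\<^esub> c)) (\<gamma>A m1))"
      apply (rule balanced_restr)
      by (rule r | assumption | drule restr_out)+
    show ?thesis
      by (rule tlift_cong eq bb r | assumption | drule restr_out)+
  qed
  also have "\<dots> = ?I (\<lambda>m1. ?I (\<lambda>x2 x3. ?I (\<lambda>m0. ?I (\<lambda>y2 y3. m0 \<diamondop>\<^bsub>?Q\<^esub> ((y2 \<diamondop>\<^bsub>C\<^esub> y3) \<diamondop>\<^bsub>CC\<^esub> (x2 \<diamondop>\<^bsub>C\<^esub> x3)))) (\<gamma> m1))) (\<gamma> x)"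
  proof -
    have eq: "?I (\<lambda>m0 d. m0 \<diamondop>\<^bsub>?Q\<^esub> (d \<diamondop>\<^bsub>CC\<^esub> (x2 \<diamondop>\<^bsub>C\<^esub> x3))) (\<gamma>A m1) =
      ?I (\<lambda>m0. ?I (\<lambda>y2 y3. m0 \<diamondop>\<^bsub>?Q\<^esub> ((y2 \<diamondop>\<^bsub>C\<^esub> y3) \<diamondop>\<^bsub>CC\<^esub> (x2 \<diamondop>\<^bsub>C\<^esub> x3)))) (\<gamma> m1)"
      if h: "m1 \<in> carrier T" "x2 \<in> carrier T'" "x3 \<in> carrier T" for m1 x2 x3
    proof -
      have "?I (\<lambda>m0 d. m0 \<diamondop>\<^bsub>?Q\<^esub> (d \<diamondop>\<^bsub>CC\<^esub> (x2 \<diamondop>\<^bsub>C\<^esub> x3))) (\<gamma>A m1) = ?I (\<lambda>m0 d. m0 \<diamondop>\<^bsub>?Q\<^esub> (d \<diamondop>\<^bsub>CC\<^esub> (x2 \<diamondop>\<^bsub>C\<^esub> x3))) (\<gamma> m1)"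
        by (rule \<gamma>A_int) (rule h r | assumption | drule restr_out)+
      also have "\<dots> = ?I (\<lambda>m0. ?I (\<lambda>y2 y3. m0 \<diamondop>\<^bsub>?Q\<^esub> ((y2 \<diamondop>\<^bsub>C\<^esub> y3) \<diamondop>\<^bsub>CC\<^esub> (x2 \<diamondop>\<^bsub>C\<^esub> x3)))) (\<gamma> m1)"
        apply (rule tlift_cong, (rule h r | assumption | drule restr_out)+)
        apply (rule tlift_expand[symmetric])
        apply (rule h r | assumption | drule restr_out)+
        done
      finally show ?thesis .
    qed
    show ?thesis
      by (rule tlift_cong eq r | assumption | drule restr_out)+
  qed
  also have "\<dots> = ?I (\<lambda>x1. ?I (\<lambda>x2 x3. ?I (\<lambda>y1. ?I (\<lambda>y2 y3. x1 \<diamondop>\<^bsub>?Q\<^esub> ((x2 \<diamondop>\<^bsub>C\<^esub> y1) \<diamondop>\<^bsub>CC\<^esub> (y2 \<diamondop>\<^bsub>C\<^esub> y3)))) (\<gamma> x3))) (\<gamma> x)"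
    apply (rule shepherd_coassoc_int)
    apply (rule r | assumption | drule restr_out)+
    done
  also have "\<dots> = ?I (\<lambda>m0 c. m0 \<diamondop>\<^bsub>?Q\<^esub> \<Delta>C c) (\<gamma>A x)"
  proof -
    have eq: "?I (\<lambda>y1. ?I (\<lambda>y2 y3. x1 \<diamondop>\<^bsub>?Q\<^esub> ((x2 \<diamondop>\<^bsub>C\<^esub> y1) \<diamondop>\<^bsub>CC\<^esub> (y2 \<diamondop>\<^bsub>C\<^esub> y3)))) (\<gamma> x3) = x1 \<diamondop>\<^bsub>?Q\<^esub> \<Delta>C (x2 \<diamondop>\<^bsub>C\<^esub> x3)"
      if h: "x1 \<in> carrier T" "x2 \<in> carrier T'" "x3 \<in> carrier T" for x1 x2 x3
    proof -
      have "?I (\<lambda>y1. ?I (\<lambda>y2 y3. x1 \<diamondop>\<^bsub>?Q\<^esub> ((x2 \<diamondop>\<^bsub>C\<^esub> y1) \<diamondop>\<^bsub>CC\<^esub> (y2 \<diamondop>\<^bsub>C\<^esub> y3)))) (\<gamma> x3) =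
         ?I (\<lambda>y1 c. x1 \<diamondop>\<^bsub>?Q\<^esub> ((x2 \<diamondop>\<^bsub>C\<^esub> y1) \<diamondop>\<^bsub>CC\<^esub> c)) (\<gamma> x3)"
        apply (rule tlift_cong, (rule h r | assumption | drule restr_out)+)
        apply (rule tlift_expand)
        apply (rule h r | assumption | drule restr_out)+
        done
      also have "\<dots> = ?I (\<lambda>y1 c. x1 \<diamondop>\<^bsub>?Q\<^esub> ((x2 \<diamondop>\<^bsub>C\<^esub> y1) \<diamondop>\<^bsub>CC\<^esub> c)) (\<gamma>A x3)"
        by (rule \<gamma>A_int[symmetric]) (rule h r | assumption | drule restr_out)+
      also have "\<dots> = x1 \<diamondop>\<^bsub>?Q\<^esub> \<Delta>C (x2 \<diamondop>\<^bsub>C\<^esub> x3)"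
        unfolding \<Delta>C_pure[OF h(2,3)]
        by (rule sym, (rule evals h r | assumption | drule restr_out)+)
      finally show ?thesis .
    qed
    have "?I (\<lambda>x1. ?I (\<lambda>x2 x3. ?I (\<lambda>y1. ?I (\<lambda>y2 y3. x1 \<diamondop>\<^bsub>?Q\<^esub> ((x2 \<diamondop>\<^bsub>C\<^esub> y1) \<diamondop>\<^bsub>CC\<^esub> (y2 \<diamondop>\<^bsub>C\<^esub> y3)))) (\<gamma> x3))) (\<gamma> x) =
      ?I (\<lambda>x1. ?I (\<lambda>x2 x3. x1 \<diamondop>\<^bsub>?Q\<^esub> \<Delta>C (x2 \<diamondop>\<^bsub>C\<^esub> x3))) (\<gamma> x)"
      by (rule tlift_cong eq r | assumption | drule restr_out)+
    also have "\<dots> = ?I (\<lambda>m0 c. m0 \<diamondop>\<^bsub>?Q\<^esub> \<Delta>C c) (\<gamma> x)"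
      apply (rule tlift_cong, (rule r | assumption | drule restr_out)+)
      apply (rule tlift_expand)
      apply (rule r | assumption | drule restr_out)+
      done
    also have "\<dots> = ?I (\<lambda>m0 c. m0 \<diamondop>\<^bsub>?Q\<^esub> \<Delta>C c) (\<gamma>A x)"
      by (rule \<gamma>A_int[symmetric]) (rule r | assumption | drule restr_out)+
    finally show ?thesis .
  qed
  finally show ?thesis .
qed

lemma right_comodule_T: "right_comodule A B C \<Delta>C T \<gamma>A"
  by (intro right_comodule.intro bimodule_C herd_structure \<Delta>CD \<gamma>A_r \<gamma>A_coassoc)

text \<open>The coproduct is the coaction on the factor \<open>T\<close> with \<open>T'\<close> left
  alone, so the comodule law of \<open>T\<close> applies with \<open>u\<close> carried
  along.\<close>

lemma C_coassoc:
  assumes c: "c \<in> carrier C"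
  shows "tlift (C \<^bold>\<otimes>\<^bsub>A\<^esub> CC) (\<lambda>m1 c. tlift (C \<^bold>\<otimes>\<^bsub>A\<^esub> CC)
        (\<lambda>m0 d. m0 \<diamondop>\<^bsub>C \<^bold>\<otimes>\<^bsub>A\<^esub> CC\<^esub> (d \<diamondop>\<^bsub>CC\<^esub> c)) (\<Delta>C m1)) (\<Delta>C c) =
      tlift (C \<^bold>\<otimes>\<^bsub>A\<^esub> CC) (\<lambda>m0 c. m0 \<diamondop>\<^bsub>C \<^bold>\<otimes>\<^bsub>A\<^esub> CC\<^esub> \<Delta>C c) (\<Delta>C c)"
proof (rule tensor_ext[OF _ _ _ _ _ c])
  let ?Q = "C \<^bold>\<otimes>\<^bsub>A\<^esub> CC"
  let ?I = "tlift ?Q"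
  note r = \<Delta>C_maps gbal
  show "add_map C ?Q (\<lambda>c. ?I (\<lambda>m1 c. ?I (\<lambda>m0 d. m0 \<diamondop>\<^bsub>?Q\<^esub> (d \<diamondop>\<^bsub>CC\<^esub> c)) (\<Delta>C m1)) (\<Delta>C c))"
    "add_map C ?Q (\<lambda>c. ?I (\<lambda>m0 c. m0 \<diamondop>\<^bsub>?Q\<^esub> \<Delta>C c) (\<Delta>C c))"
    "rmod S (restr id \<beta> T')" "lmod S (restr \<beta> id T)"
    by (rule r | assumption | drule restr_out)+
  fix u x assume "u \<in> carrier (restr id \<beta> T')" "x \<in> carrier (restr \<beta> id T)"
  then have h: "u \<in> carrier T'" "x \<in> carrier T" by (simp_all add: restr_simps)
  interpret RT: right_comodule A B C \<Delta>C T \<gamma>A by (rule right_comodule_T)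
  have "?I (\<lambda>m1 c. ?I (\<lambda>m0 d. m0 \<diamondop>\<^bsub>?Q\<^esub> (d \<diamondop>\<^bsub>CC\<^esub> c)) (\<Delta>C m1)) (\<Delta>C (u \<diamondop>\<^bsub>C\<^esub> x)) =
    ?I (\<lambda>m1 c. ?I (\<lambda>m0 d. m0 \<diamondop>\<^bsub>?Q\<^esub> (d \<diamondop>\<^bsub>CC\<^esub> c)) (\<Delta>C (u \<diamondop>\<^bsub>C\<^esub> m1))) (\<gamma>A x)"
    by (rule \<Delta>C_int) (rule h r | assumption | drule restr_out)+
  also have "\<dots> = ?I (\<lambda>m1 c. ?I (\<lambda>m0 d. (u \<diamondop>\<^bsub>C\<^esub> m0) \<diamondop>\<^bsub>?Q\<^esub> (d \<diamondop>\<^bsub>CC\<^esub> c)) (\<gamma>A m1)) (\<gamma>A x)"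
    by (rule tlift_cong \<Delta>C_int h r | assumption | drule restr_out)+
  also have "\<dots> = ?I (\<lambda>m1 c. ?I (\<lambda>c1 c2. (u \<diamondop>\<^bsub>C\<^esub> m1) \<diamondop>\<^bsub>?Q\<^esub> (c1 \<diamondop>\<^bsub>CC\<^esub> c2)) (\<Delta>C c)) (\<gamma>A x)"
    by (rule RT.coassoc_int) (rule h r | assumption | drule restr_out)+
  also have "\<dots> = ?I (\<lambda>m1 c. (u \<diamondop>\<^bsub>C\<^esub> m1) \<diamondop>\<^bsub>?Q\<^esub> \<Delta>C c) (\<gamma>A x)"
    apply (rule tlift_cong, (rule h r | assumption | drule restr_out)+)
    apply (rule tlift_expand)
    apply (rule h r | assumption | drule restr_out)+
    done
  also have "\<dots> = ?I (\<lambda>m0 c. m0 \<diamondop>\<^bsub>?Q\<^esub> \<Delta>C c) (\<Delta>C (u \<diamondop>\<^bsub>C\<^esub> x))"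
    by (rule \<Delta>C_int[symmetric]) (rule h r | assumption | drule restr_out)+
  finally show "?I (\<lambda>m1 c. ?I (\<lambda>m0 d. m0 \<diamondop>\<^bsub>?Q\<^esub> (d \<diamondop>\<^bsub>CC\<^esub> c)) (\<Delta>C m1)) (\<Delta>C (u \<diamondop>\<^bsub>C\<^esub> x)) =
    ?I (\<lambda>m0 c. m0 \<diamondop>\<^bsub>?Q\<^esub> \<Delta>C c) (\<Delta>C (u \<diamondop>\<^bsub>C\<^esub> x))" .
qed

text \<open>By the formal dual, \<open>ev (u \<otimes> x1)\<close> acting on
  \<open>x2 \<otimes> x3\<close> is \<open>u ev' (x1 \<otimes> x2) \<otimes> x3\<close>, to which
  the evaluation law applies.\<close>

lemma C_counit_left:
  assumes c: "c \<in> carrier C"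
  shows "tlift C (\<lambda>c1 c2. lact C (ev c1) c2) (\<Delta>C c) = c"
proof (rule tensor_ext[OF _ _ _ _ _ c])
  note r = \<Delta>C_maps gbal
  show "add_map C C (\<lambda>c. tlift C (\<lambda>c1 c2. lact C (ev c1) c2) (\<Delta>C c))" "add_map C C (\<lambda>c. c)"
    "rmod S (restr id \<beta> T')" "lmod S (restr \<beta> id T)"
    by (rule r | assumption | drule restr_out)+
  fix u x assume "u \<in> carrier (restr id \<beta> T')" "x \<in> carrier (restr \<beta> id T)"
  then have h: "u \<in> carrier T'" "x \<in> carrier T" by (simp_all add: restr_simps)
  have "tlift C (\<lambda>c1 c2. lact C (ev c1) c2) (\<Delta>C (u \<diamondop>\<^bsub>C\<^esub> x)) = tlift C (\<lambda>x1 c. lact C (ev (u \<diamondop>\<^bsub>C\<^esub> x1)) c) (\<gamma>A x)"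
    by (rule \<Delta>C_int) (rule h r | assumption | drule restr_out)+
  also have "\<dots> = tlift C (\<lambda>x1 c. tlift C (\<lambda>x2 x3. ract T' u (ev' (x1 \<diamondop>\<^bsub>E\<^esub> x2)) \<diamondop>\<^bsub>C\<^esub> x3) c) (\<gamma>A x)"
  proof -
    have eq: "lact C (ev (u \<diamondop>\<^bsub>C\<^esub> x1)) c = tlift C (\<lambda>x2 x3. ract T' u (ev' (x1 \<diamondop>\<^bsub>E\<^esub> x2)) \<diamondop>\<^bsub>C\<^esub> x3) c"
      if "x1 \<in> carrier T" "c \<in> carrier C" for x1 c
    proof (rule tlift_ext[symmetric])
      show "add_map C C (lact C (ev (u \<diamondop>\<^bsub>C\<^esub> x1)))"
        by (rule rlinD(3), (rule that h r)+)
      show "ract T' u (ev' (x1 \<diamondop>\<^bsub>E\<^esub> x2)) \<diamondop>\<^bsub>C\<^esub> x3 = lact C (ev (u \<diamondop>\<^bsub>C\<^esub> x1)) (x2 \<diamondop>\<^bsub>C\<^esub> x3)"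
        if "x2 \<in> carrier (restr id \<beta> T')" "x3 \<in> carrier (restr \<beta> id T)" for x2 x3
        using that h \<open>x1 \<in> carrier T\<close> by (simp only: restr_simps ev_ev' act_C ev_pure_closed)
    qed (rule h that r | assumption | drule restr_out)+
    show ?thesis
      by (rule tlift_cong eq h r | assumption | drule restr_out)+
  qed
  also have "\<dots> = ract T' u \<one>\<^bsub>B\<^esub> \<diamondop>\<^bsub>C\<^esub> x"
    by (rule \<gamma>A_counit') (rule h r | assumption | drule restr_out)+
  finally show "tlift C (\<lambda>c1 c2. lact C (ev c1) c2) (\<Delta>C (u \<diamondop>\<^bsub>C\<^esub> x)) = u \<diamondop>\<^bsub>C\<^esub> x"
    by (simp add: T'.ract_one h)
qed

lemma C_counit_right:
  assumes c: "c \<in> carrier C"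
  shows "tlift C (\<lambda>c1 c2. ract C c1 (ev c2)) (\<Delta>C c) = c"
proof (rule tensor_ext[OF _ _ _ _ _ c])
  note r = \<Delta>C_maps gbal
  show "add_map C C (\<lambda>c. tlift C (\<lambda>c1 c2. ract C c1 (ev c2)) (\<Delta>C c))" "add_map C C (\<lambda>c. c)"
    "rmod S (restr id \<beta> T')" "lmod S (restr \<beta> id T)"
    by (rule r | assumption | drule restr_out)+
  fix u x assume "u \<in> carrier (restr id \<beta> T')" "x \<in> carrier (restr \<beta> id T)"
  then have h: "u \<in> carrier T'" "x \<in> carrier T" by (simp_all add: restr_simps)
  have "tlift C (\<lambda>c1 c2. ract C c1 (ev c2)) (\<Delta>C (u \<diamondop>\<^bsub>C\<^esub> x)) = tlift C (\<lambda>x1 c. ract C (u \<diamondop>\<^bsub>C\<^esub> x1) (ev c)) (\<gamma>A x)"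
    by (rule \<Delta>C_int) (rule h r | assumption | drule restr_out)+
  also have "\<dots> = tlift C (\<lambda>x1 c. u \<diamondop>\<^bsub>C\<^esub> ract T x1 (ev c)) (\<gamma>A x)"
    by (rule tlift_cong act_C(2) h r | assumption | drule restr_out)+
  also have "\<dots> = u \<diamondop>\<^bsub>C\<^esub> tlift T (\<lambda>x1 c. ract T x1 (ev c)) (\<gamma>A x)"
    by (rule sym, rule tlift_map_eq[where k = "\<lambda>x. u \<diamondop>\<^bsub>C\<^esub> x"]) (rule refl h r | assumption | drule restr_out)+
  finally show "tlift C (\<lambda>c1 c2. ract C c1 (ev c2)) (\<Delta>C (u \<diamondop>\<^bsub>C\<^esub> x)) = u \<diamondop>\<^bsub>C\<^esub> x"
    by (simp add: \<gamma>A_counit h)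
qed

lemma right_comodule_C: "right_comodule A A C \<Delta>C C \<Delta>C"
  by (intro right_comodule.intro bimodule_C herd_structure \<Delta>CD C_coassoc)

end

text \<open>The left coaction of \<open>E = T \<otimes>\<^sub>R T'\<close> on \<open>T\<close>: the reassociated form of \<^const>\<open>shepherd_left\<close>.\<close>

definition shepherd_coact ::
  "('r, 'r1) ring_scheme \<Rightarrow> ('r \<Rightarrow> 'a) \<Rightarrow> ('b, 'b1) ring_scheme
    \<Rightarrow> ('b, 'a, 't) bimod \<Rightarrow> ('a, 'b, 'u) bimod \<Rightarrow> ('t \<Rightarrow> ('t, ('u, 't) tens) tens)
    \<Rightarrow> 't \<Rightarrow> (('t, 'u) tens, 't) tens"
  where "shepherd_coact R \<alpha> B T T' \<gamma> x =
    (let E = T \<^bold>\<otimes>\<^bsub>R,\<alpha>\<^esub> T'; Q = E \<^bold>\<otimes>\<^bsub>B\<^esub> T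
     in tlift3 Q (\<lambda>x1 x2 x3. (x1 \<diamondop>\<^bsub>E\<^esub> x2) \<diamondop>\<^bsub>Q\<^esub> x3) (\<gamma> x))"

section \<open>The left coaction of E on T and the coring E\<close>

context herd
begin

abbreviation "\<tau> \<equiv> shepherd_coact R \<alpha> B T T' \<gamma>"
abbreviation "EBT \<equiv> E \<^bold>\<otimes>\<^bsub>B\<^esub> T"
abbreviation "EE \<equiv> E \<^bold>\<otimes>\<^bsub>B\<^esub> E"
abbreviation "\<Delta>E \<equiv> left_coring_comult R \<alpha> B T T' \<gamma>"
abbreviation "\<gamma>B \<equiv> shepherd_left R \<alpha> B T T' \<gamma>"
abbreviation "T'BT \<equiv> T' \<^bold>\<otimes>\<^bsub>B\<^esub> T"

lemma \<tau>_eq: "\<tau> = (\<lambda>x. tlift EBT (\<lambda>x1. tlift EBT (\<lambda>x2 x3. (x1 \<diamondop>\<^bsub>E\<^esub> x2) \<diamondop>\<^bsub>EBT\<^esub> x3)) (\<gamma> x))"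
  by (simp add: fun_eq_iff shepherd_coact_def Let_def tlift3_def)

lemma \<tau>_r: "rlin R (restr id \<alpha> T) (restr id \<alpha> EBT) \<tau>"
  unfolding \<tau>_eq by (rule gbal | assumption | drule restr_out)+

lemma \<tau>_closed: "x \<in> carrier T \<Longrightarrow> \<tau> x \<in> carrier EBT"
  using rlinD(4)[OF \<tau>_r] by (simp add: restr_simps)

text \<open>The mirror image of \<open>lact_\<gamma>A\<close>:
  \<open>y3 ev (x2 \<otimes> x3)\<close> equals \<open>ev' (y3 \<otimes> x2) x3\<close>, the scalar
  crosses the tensor sign over \<open>B\<close>, and on the other side it turns into
  \<open>ev (y2 \<otimes> y3)\<close> acting on \<open>x2\<close>.\<close>

lemma ract_\<tau>:
  assumes h: "y \<in> carrier T" "x2 \<in> carrier T'" "x3 \<in> carrier T"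
  shows "ract EBT (\<tau> y) (ev (x2 \<diamondop>\<^bsub>C\<^esub> x3)) = (y \<diamondop>\<^bsub>E\<^esub> x2) \<diamondop>\<^bsub>EBT\<^esub> x3"
proof -
  let ?I = "tlift EBT" and ?a = "ev (x2 \<diamondop>\<^bsub>C\<^esub> x3)"
  note r = h gbal
  have "ract EBT (\<tau> y) ?a = ?I (\<lambda>y1 c. ?I (\<lambda>y2 y3. (y1 \<diamondop>\<^bsub>E\<^esub> y2) \<diamondop>\<^bsub>EBT\<^esub> ract T y3 ?a) c) (\<gamma> y)"
    unfolding \<tau>_eq by (rule ract_tlift ract_pure_eq r | assumption | drule restr_out)+
  also have "\<dots> = ?I (\<lambda>y1 c. ?I (\<lambda>y2 y3. (y1 \<diamondop>\<^bsub>E\<^esub> lact T' (ev (y2 \<diamondop>\<^bsub>C\<^esub> y3)) x2) \<diamondop>\<^bsub>EBT\<^esub> x3) c) (\<gamma> y)"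
  proof -
    have eq: "(y1 \<diamondop>\<^bsub>E\<^esub> y2) \<diamondop>\<^bsub>EBT\<^esub> ract T y3 ?a = (y1 \<diamondop>\<^bsub>E\<^esub> lact T' (ev (y2 \<diamondop>\<^bsub>C\<^esub> y3)) x2) \<diamondop>\<^bsub>EBT\<^esub> x3"
      if y: "y1 \<in> carrier T" "y2 \<in> carrier T'" "y3 \<in> carrier T" for y1 y2 y3
    proof -
      have "(y1 \<diamondop>\<^bsub>E\<^esub> y2) \<diamondop>\<^bsub>EBT\<^esub> ract T y3 ?a = ract E (y1 \<diamondop>\<^bsub>E\<^esub> y2) (ev' (y3 \<diamondop>\<^bsub>E\<^esub> x2)) \<diamondop>\<^bsub>EBT\<^esub> x3"
        unfolding ev'_ev[OF y(3) h(2,3), symmetric] by (rule pure_middle_eq[symmetric]) (rule y r)+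
      also have "ract E (y1 \<diamondop>\<^bsub>E\<^esub> y2) (ev' (y3 \<diamondop>\<^bsub>E\<^esub> x2)) = y1 \<diamondop>\<^bsub>E\<^esub> ract T' y2 (ev' (y3 \<diamondop>\<^bsub>E\<^esub> x2))"
        by (rule act_E) (rule y r)+
      finally show ?thesis unfolding ev_ev'[OF y(2,3) h(2)] .
    qed
    show ?thesis
      by (rule eq tlift_cong r | assumption | drule restr_out)+
  qed
  also have "\<dots> = ?I (\<lambda>y1 c. (y1 \<diamondop>\<^bsub>E\<^esub> lact T' (ev c) x2) \<diamondop>\<^bsub>EBT\<^esub> x3) (\<gamma> y)"
  proof -
    have eq: "?I (\<lambda>y2 y3. (y1 \<diamondop>\<^bsub>E\<^esub> lact T' (ev (y2 \<diamondop>\<^bsub>C\<^esub> y3)) x2) \<diamondop>\<^bsub>EBT\<^esub> x3) c = (y1 \<diamondop>\<^bsub>E\<^esub> lact T' (ev c) x2) \<diamondop>\<^bsub>EBT\<^esub> x3"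
      if y: "y1 \<in> carrier T" "c \<in> carrier C" for y1 c
    proof (rule tlift_expand[OF y(2)])
      have "llin A C T' (\<lambda>c. lact T' (ev c) x2)" by (rule r)+
      from llinD(3)[OF this] show "add_map C EBT (\<lambda>c. (y1 \<diamondop>\<^bsub>E\<^esub> lact T' (ev c) x2) \<diamondop>\<^bsub>EBT\<^esub> x3)"
        by - (rule add_map_pure_left add_map_pure_right restr_intros y r | assumption)+
    qed (rule r)+
    show ?thesis
      by (rule tlift_cong eq r | assumption | drule restr_out)+
  qed
  also have "\<dots> = (y \<diamondop>\<^bsub>E\<^esub> lact T' \<one>\<^bsub>A\<^esub> x2) \<diamondop>\<^bsub>EBT\<^esub> x3"
    by (rule shepherd_ev_int) (rule r)+
  finally show ?thesis by (simp add: T'.lact_one h)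
qed

text \<open>The evaluation law inserts \<open>ev (x2 \<otimes> x3)\<close> behind;
  \<open>ract_\<tau>\<close> then exhibits every term with \<open>b\<close> acting on the first
  factor.\<close>

lemma \<tau>_l: "llin B T EBT \<tau>"
proof (rule llinI)
  note r = rlin_comp[OF \<tau>_r] \<tau>_closed gbal
  show "lmod B T" "lmod B EBT" by (rule gbal)+
  show am: "add_map T EBT \<tau>" using rlinD(3)[OF \<tau>_r] unfolding restr_id_iff .
  fix b x assume b: "b \<in> carrier B" and x: "x \<in> carrier T"
  let ?I = "tlift EBT"
  interpret EBT: bimodule B A EBT by (rule gbal)+
  have g: "balanced R (restr id \<alpha> T) (restr \<alpha> id (regular A)) EBT (\<lambda>y a. ract EBT (\<tau> (lact T b y)) a)"
    by (rule balanced_precomp[OF balanced_restr[OF balanced_ract_act]]) (rule b x r)+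
  have g': "balanced R (restr id \<alpha> T) (restr \<alpha> id C) EBT (\<lambda>y c. ract EBT (\<tau> (lact T b y)) (ev c))"
    by (rule balanced_precomp[OF balanced_restr[OF balanced_ract_act]]) (rule b x r)+
  have "\<tau> (lact T b x) = ract EBT (\<tau> (lact T b x)) \<one>\<^bsub>A\<^esub>"
    using x b by (simp add: EBT.ract_one \<tau>_closed T.lact_closed)
  also have "\<dots> = ?I (\<lambda>x1 c. ract EBT (\<tau> (lact T b x1)) (ev c)) (\<gamma> x)"
    by (rule shepherd_ev_int[OF x g, symmetric])
  also have "\<dots> = ?I (\<lambda>x1 c. ?I (\<lambda>x2 x3. (lact T b x1 \<diamondop>\<^bsub>E\<^esub> x2) \<diamondop>\<^bsub>EBT\<^esub> x3) c) (\<gamma> x)"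
  proof -
    have eq: "ract EBT (\<tau> (lact T b x1)) (ev c) = ?I (\<lambda>x2 x3. (lact T b x1 \<diamondop>\<^bsub>E\<^esub> x2) \<diamondop>\<^bsub>EBT\<^esub> x3) c"
      if y: "x1 \<in> carrier T" "c \<in> carrier C" for x1 c
    proof -
      have b': "lact T b x1 \<in> carrier T" by (rule y b r)+
      have am: "add_map C EBT (\<lambda>c. ract EBT (\<tau> (lact T b x1)) (ev c))"
        by (rule rlinD(3), (rule y b r)+)
      have "ract EBT (\<tau> (lact T b x1)) (ev c) = ?I (\<lambda>x2 x3. ract EBT (\<tau> (lact T b x1)) (ev (x2 \<diamondop>\<^bsub>C\<^esub> x3))) c"
        by (rule tlift_expand[symmetric, OF y(2) _ _ am]) (rule r)+
      also have "\<dots> = ?I (\<lambda>x2 x3. (lact T b x1 \<diamondop>\<^bsub>E\<^esub> x2) \<diamondop>\<^bsub>EBT\<^esub> x3) c"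
        by (rule tlift_cong ract_\<tau> y b r | assumption | drule restr_out)+
      finally show ?thesis .
    qed
    show ?thesis
      by (rule tlift_cong eq g' x | assumption | (rule r) | drule restr_out)+
  qed
  also have "\<dots> = lact EBT b (\<tau> x)"
  proof -
    have eq: "lact EBT b ((x1 \<diamondop>\<^bsub>E\<^esub> x2) \<diamondop>\<^bsub>EBT\<^esub> x3) = (lact T b x1 \<diamondop>\<^bsub>E\<^esub> x2) \<diamondop>\<^bsub>EBT\<^esub> x3"
      if y: "x1 \<in> carrier T" "x2 \<in> carrier T'" "x3 \<in> carrier T" for x1 x2 x3
      using y b by (subst lact_pure_eq[OF bimodule_E herd_structure(3)]) (simp_all add: act_E pure_E_closed)
    show ?thesis
      unfolding \<tau>_eq
      by (rule sym, (rule lact_tlift eq b x r | assumption | drule restr_out)+)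
  qed
  finally show "\<tau> (lact T b x) = lact EBT b (\<tau> x)" .
qed

lemmas \<tau>_maps = rlin_comp[OF \<tau>_r] llin_comp[OF \<tau>_l] add_map_comp[OF llinD(3)[OF \<tau>_l]] \<tau>_closed

lemmas hrules = \<tau>_maps gbal

lemma \<tau>_int:
  assumes "x \<in> carrier T" "balanced B E T G f"
  shows "tlift G f (\<tau> x) = tlift G (\<lambda>x1. tlift G (\<lambda>x2 x3. f (x1 \<diamondop>\<^bsub>E\<^esub> x2) x3)) (\<gamma> x)"
  unfolding \<tau>_eq by (rule evals assms gbal | assumption | drule restr_out)+

lemma \<tau>_counit:
  assumes x: "x \<in> carrier T"
  shows "tlift T (\<lambda>e x3. lact T (ev' e) x3) (\<tau> x) = x"
proof -
  have "balanced B E T T (\<lambda>e x3. lact T (ev' e) x3)" by (rule hrules)+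
  note \<tau>_int[OF x this]
  also have "tlift T (\<lambda>x1. tlift T (\<lambda>x2 x3. lact T (ev' (x1 \<diamondop>\<^bsub>E\<^esub> x2)) x3)) (\<gamma> x) = lact T \<one>\<^bsub>B\<^esub> x"
    by (rule shepherd_ev'_int[OF x]) (rule hrules)+
  finally show ?thesis by (simp add: T.lact_one x)
qed

text \<open>In the codomain of \<open>\<tau>\<close> the factors \<open>x2\<close> and
  \<open>x3\<close> are joined over \<open>B\<close>, so the integrand is admissible because
  \<open>ev\<close> has been shown to be balanced over \<open>B\<close>.\<close>

lemma \<tau>_counit':
  assumes x: "x \<in> carrier T" and g: "balanced R (restr id \<alpha> T) (restr \<alpha> id (regular A)) G g"
  shows "tlift G (\<lambda>e x3. tlift G (\<lambda>x1 x2. g x1 (ev (x2 \<diamondop>\<^bsub>C\<^esub> x3))) e) (\<tau> x) = g x \<one>\<^bsub>A\<^esub>"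
proof -
  have gm: "add_map (regular A) G (\<lambda>a. g x1 a)" if "x1 \<in> carrier T" for x1
    using balancedD(5)[OF g, of x1] that by (simp add: restr_id_iff restr_simps)
  have g1: "balanced B T' T G (\<lambda>x2 x3. g x1 (ev (x2 \<diamondop>\<^bsub>C\<^esub> x3)))" if "x1 \<in> carrier T" for x1
    by (rule balanced_map[OF gm[OF that]]) (rule balanced_ev)
  have g2: "balanced R (restr id \<alpha> T) (restr \<alpha> id T') G (\<lambda>x1 x2. g x1 (ev (x2 \<diamondop>\<^bsub>C\<^esub> x3)))" if "x3 \<in> carrier T" for x3
    apply (rule balanced_precomp[OF g])
    by (rule that hrules)+
  have b: "balanced B E T G (\<lambda>e x3. tlift G (\<lambda>x1 x2. g x1 (ev (x2 \<diamondop>\<^bsub>C\<^esub> x3))) e)"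
    by (rule g1 g2 hrules | assumption | drule restr_out)+
  have g3: "balanced R (restr id \<alpha> T) (restr \<alpha> id C) G (\<lambda>x1 c. g x1 (ev c))"
    apply (rule balanced_precomp[OF g])
    by (rule hrules)+
  have g4: "add_map C G (\<lambda>c. g x1 (ev c))" if "x1 \<in> carrier T" for x1
    by (rule add_map_comp[OF gm[OF that] rlinD(3)[OF evD(2)]])
  note \<tau>_int[OF x b]
  also have "tlift G (\<lambda>x1. tlift G (\<lambda>x2 x3. tlift G (\<lambda>x1 x2. g x1 (ev (x2 \<diamondop>\<^bsub>C\<^esub> x3))) (x1 \<diamondop>\<^bsub>E\<^esub> x2))) (\<gamma> x) = 
    tlift G (\<lambda>x1 c. g x1 (ev c)) (\<gamma> x)"
  proof -
    have eq: "g x1 (ev c) = tlift G (\<lambda>x2 x3. tlift G (\<lambda>x1 x2. g x1 (ev (x2 \<diamondop>\<^bsub>C\<^esub> x3))) (x1 \<diamondop>\<^bsub>E\<^esub> x2)) c"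
      if "x1 \<in> carrier T" "c \<in> carrier C" for x1 c
    proof -
      have p: "g x1 (ev (x2 \<diamondop>\<^bsub>C\<^esub> x3)) = tlift G (\<lambda>x1 x2. g x1 (ev (x2 \<diamondop>\<^bsub>C\<^esub> x3))) (x1 \<diamondop>\<^bsub>E\<^esub> x2)"
        if "x2 \<in> carrier T'" "x3 \<in> carrier T" for x2 x3
        by (rule sym, rule tlift_pure_eq[OF g2]) (use that \<open>x1 \<in> carrier T\<close> in \<open>auto simp: restr_simps\<close>)
      have gb: "balanced S (restr id \<beta> T') (restr \<beta> id T) G (\<lambda>x2 x3. g x1 (ev (x2 \<diamondop>\<^bsub>C\<^esub> x3)))"
        by (rule balanced_map[OF g4[OF that(1)]]) (rule hrules)+
      have "g x1 (ev c) = tlift G (\<lambda>x2 x3. g x1 (ev (x2 \<diamondop>\<^bsub>C\<^esub> x3))) c"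
        by (rule tlift_expand[symmetric, OF that(2) _ _ g4[OF that(1)]]) (rule hrules)+
      also have "\<dots> = tlift G (\<lambda>x2 x3. tlift G (\<lambda>x1 x2. g x1 (ev (x2 \<diamondop>\<^bsub>C\<^esub> x3))) (x1 \<diamondop>\<^bsub>E\<^esub> x2)) c"
        by (rule tlift_cong p gb that | assumption | drule restr_out)+
      finally show ?thesis .
    qed
    show ?thesis
      by (rule sym, (rule tlift_cong eq g3 x hrules | assumption | drule restr_out)+)
  qed
  also have "\<dots> = g x \<one>\<^bsub>A\<^esub>" by (rule shepherd_ev_int[OF x g])
  finally show ?thesis .
qed

lemma \<gamma>B_int:
  assumes x: "x \<in> carrier T" and h: "balanced R (restr id \<alpha> T) (restr \<alpha> id T'BT) G h"
  shows "tlift G h (\<gamma>B x) = tlift G (\<lambda>x1. tlift G (\<lambda>x2 x3. h x1 (x2 \<diamondop>\<^bsub>T'BT\<^esub> x3))) (\<gamma> x)"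
  unfolding shepherd_left_def Let_def tlift3_def
  by (rule evals x h hrules | assumption | drule restr_out)+

text \<open>The coproduct of \<open>E\<close> is defined through \<open>shepherd_left\<close>, with
  values grouped as \<open>x1 \<otimes> (x2 \<otimes> x3)\<close>, while the comodule structure
  needs the grouping of \<open>\<tau>\<close>. Both sums unfold to the same sum over the
  shepherd.\<close>

lemma \<Delta>E_inner:
  assumes h: "x \<in> carrier T" "u \<in> carrier T'"
  shows "tlift3 EE (\<lambda>x1 x2 x3. (x1 \<diamondop>\<^bsub>E\<^esub> x2) \<diamondop>\<^bsub>EE\<^esub> (x3 \<diamondop>\<^bsub>E\<^esub> u)) (\<gamma>B x) =
    tlift EE (\<lambda>e x3. e \<diamondop>\<^bsub>EE\<^esub> (x3 \<diamondop>\<^bsub>E\<^esub> u)) (\<tau> x)"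
proof -
  note r = h hrules
  have "tlift3 EE (\<lambda>x1 x2 x3. (x1 \<diamondop>\<^bsub>E\<^esub> x2) \<diamondop>\<^bsub>EE\<^esub> (x3 \<diamondop>\<^bsub>E\<^esub> u)) (\<gamma>B x) =
    tlift EE (\<lambda>x1. tlift EE (\<lambda>x2 x3. tlift EE (\<lambda>x2 x3. (x1 \<diamondop>\<^bsub>E\<^esub> x2) \<diamondop>\<^bsub>EE\<^esub> (x3 \<diamondop>\<^bsub>E\<^esub> u)) (x2 \<diamondop>\<^bsub>T'BT\<^esub> x3))) (\<gamma> x)"
    unfolding tlift3_def by (rule \<gamma>B_int) (rule r | assumption | drule restr_out)+
  also have "\<dots> = tlift EE (\<lambda>x1. tlift EE (\<lambda>x2 x3. (x1 \<diamondop>\<^bsub>E\<^esub> x2) \<diamondop>\<^bsub>EE\<^esub> (x3 \<diamondop>\<^bsub>E\<^esub> u))) (\<gamma> x)"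
    by (rule tlift_pure_eq refl tlift_cong r | assumption | drule restr_out)+
  also have "\<dots> = tlift EE (\<lambda>e x3. e \<diamondop>\<^bsub>EE\<^esub> (x3 \<diamondop>\<^bsub>E\<^esub> u)) (\<tau> x)"
    by (rule \<tau>_int[symmetric]) (rule r | assumption | drule restr_out)+
  finally show ?thesis .
qed

lemma \<Delta>E_eq:
  assumes "w \<in> carrier E"
  shows "\<Delta>E w = tlift EE (\<lambda>x u. tlift EE (\<lambda>e x3. e \<diamondop>\<^bsub>EE\<^esub> (x3 \<diamondop>\<^bsub>E\<^esub> u)) (\<tau> x)) w"
  unfolding left_coring_comult_def Let_def
  by (rule sym, (rule tlift_cong \<Delta>E_inner[symmetric] assms hrules | assumption | drule restr_out)+)

lemma \<Delta>E_hom: "\<Delta>E \<in> bimod_hom B B E EE"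
  by (rule bimod_hom_cong[OF _ bimodule_E \<Delta>E_eq])
    (rule bimod_homI hrules | assumption | drule restr_out)+

lemma \<Delta>E_pure:
  assumes "x \<in> carrier T" "u \<in> carrier T'"
  shows "\<Delta>E (x \<diamondop>\<^bsub>E\<^esub> u) = tlift EE (\<lambda>e x3. e \<diamondop>\<^bsub>EE\<^esub> (x3 \<diamondop>\<^bsub>E\<^esub> u)) (\<tau> x)"
  unfolding \<Delta>E_eq[OF pure_E_closed[OF assms]]
  by (rule tlift_pure_eq refl assms hrules | assumption | drule restr_out)+

lemmas \<Delta>ED = bimod_homD[OF \<Delta>E_hom bimodule_E bimodule_tensor[OF bimodule_E bimodule_E]]
lemmas \<Delta>E_maps = rlin_comp[OF \<Delta>ED(2)] llin_comp[OF \<Delta>ED(1)] add_map_comp[OF \<Delta>ED(3)]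
  balanced_map[OF \<Delta>ED(3)] llinD(4)[OF \<Delta>ED(1)]

lemma \<Delta>E_int:
  assumes "x \<in> carrier T" "u \<in> carrier T'" "balanced B E E G f"
  shows "tlift G f (\<Delta>E (x \<diamondop>\<^bsub>E\<^esub> u)) = tlift G (\<lambda>e x3. f e (x3 \<diamondop>\<^bsub>E\<^esub> u)) (\<tau> x)"
  unfolding \<Delta>E_pure[OF assms(1,2)]
  by (rule evals assms hrules | assumption | drule restr_out)+

text \<open>Opening every coaction by \<open>\<tau>_int\<close> yields the two sides of the
  coassociativity of the shepherd.\<close>

lemma \<tau>_coassoc:
  assumes x: "x \<in> carrier T"
  shows "tlift (EE \<^bold>\<otimes>\<^bsub>B\<^esub> T) (\<lambda>e n1. tlift (EE \<^bold>\<otimes>\<^bsub>B\<^esub> T)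
        (\<lambda>d n0. (e \<diamondop>\<^bsub>EE\<^esub> d) \<diamondop>\<^bsub>EE \<^bold>\<otimes>\<^bsub>B\<^esub> T\<^esub> n0) (\<tau> n1)) (\<tau> x) =
      tlift (EE \<^bold>\<otimes>\<^bsub>B\<^esub> T) (\<lambda>e n0. \<Delta>E e \<diamondop>\<^bsub>EE \<^bold>\<otimes>\<^bsub>B\<^esub> T\<^esub> n0) (\<tau> x)"
proof -
  let ?Q = "EE \<^bold>\<otimes>\<^bsub>B\<^esub> T"
  let ?I = "tlift ?Q"
  note r = x \<Delta>E_maps hrules
  have "?I (\<lambda>e n1. ?I (\<lambda>d n0. (e \<diamondop>\<^bsub>EE\<^esub> d) \<diamondop>\<^bsub>?Q\<^esub> n0) (\<tau> n1)) (\<tau> x) =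
    ?I (\<lambda>x1. ?I (\<lambda>x2 x3. ?I (\<lambda>d n0. ((x1 \<diamondop>\<^bsub>E\<^esub> x2) \<diamondop>\<^bsub>EE\<^esub> d) \<diamondop>\<^bsub>?Q\<^esub> n0) (\<tau> x3))) (\<gamma> x)"
    by (rule \<tau>_int) (rule r | assumption | drule restr_out)+
  also have "\<dots> = ?I (\<lambda>x1. ?I (\<lambda>x2 x3. ?I (\<lambda>y1. ?I (\<lambda>y2 y3. ((x1 \<diamondop>\<^bsub>E\<^esub> x2) \<diamondop>\<^bsub>EE\<^esub> (y1 \<diamondop>\<^bsub>E\<^esub> y2)) \<diamondop>\<^bsub>?Q\<^esub> y3)) (\<gamma> x3))) (\<gamma> x)"
    by (rule tlift_cong \<tau>_int r | assumption | drule restr_out)+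
  also have "\<dots> = ?I (\<lambda>x1. ?I (\<lambda>x2 x3. ?I (\<lambda>y1. ?I (\<lambda>y2 y3. ((y1 \<diamondop>\<^bsub>E\<^esub> y2) \<diamondop>\<^bsub>EE\<^esub> (y3 \<diamondop>\<^bsub>E\<^esub> x2)) \<diamondop>\<^bsub>?Q\<^esub> x3)) (\<gamma> x1))) (\<gamma> x)"
    by (rule shepherd_coassoc_int[symmetric]) (rule r | assumption | drule restr_out)+
  also have "\<dots> = ?I (\<lambda>x1. ?I (\<lambda>x2 x3. \<Delta>E (x1 \<diamondop>\<^bsub>E\<^esub> x2) \<diamondop>\<^bsub>?Q\<^esub> x3)) (\<gamma> x)"
  proof -
    have eq: "\<Delta>E (x1 \<diamondop>\<^bsub>E\<^esub> x2) \<diamondop>\<^bsub>?Q\<^esub> x3 = ?I (\<lambda>y1. ?I (\<lambda>y2 y3. ((y1 \<diamondop>\<^bsub>E\<^esub> y2) \<diamondop>\<^bsub>EE\<^esub> (y3 \<diamondop>\<^bsub>E\<^esub> x2)) \<diamondop>\<^bsub>?Q\<^esub> x3)) (\<gamma> x1)"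
      if h: "x1 \<in> carrier T" "x2 \<in> carrier T'" "x3 \<in> carrier T" for x1 x2 x3
    proof -
      have "\<Delta>E (x1 \<diamondop>\<^bsub>E\<^esub> x2) \<diamondop>\<^bsub>?Q\<^esub> x3 = ?I (\<lambda>e y3. (e \<diamondop>\<^bsub>EE\<^esub> (y3 \<diamondop>\<^bsub>E\<^esub> x2)) \<diamondop>\<^bsub>?Q\<^esub> x3) (\<tau> x1)"
        unfolding \<Delta>E_pure[OF h(1,2)]
        by (rule evals h r | assumption | drule restr_out)+
      also have "\<dots> = ?I (\<lambda>y1. ?I (\<lambda>y2 y3. ((y1 \<diamondop>\<^bsub>E\<^esub> y2) \<diamondop>\<^bsub>EE\<^esub> (y3 \<diamondop>\<^bsub>E\<^esub> x2)) \<diamondop>\<^bsub>?Q\<^esub> x3)) (\<gamma> x1)"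
        by (rule \<tau>_int) (rule h r | assumption | drule restr_out)+
      finally show ?thesis .
    qed
    show ?thesis
      by (rule sym, (rule tlift_cong eq r | assumption | drule restr_out)+)
  qed
  also have "\<dots> = ?I (\<lambda>e n0. \<Delta>E e \<diamondop>\<^bsub>?Q\<^esub> n0) (\<tau> x)"
    by (rule \<tau>_int[symmetric]) (rule r | assumption | drule restr_out)+
  finally show ?thesis .
qed

lemma left_comodule_T: "left_comodule B A E \<Delta>E T \<tau>"
  by (intro left_comodule.intro bimodule_E herd_structure \<Delta>ED \<tau>_l \<tau>_coassoc)

lemma E_coassoc:
  assumes c: "w \<in> carrier E"
  shows "tlift (EE \<^bold>\<otimes>\<^bsub>B\<^esub> E) (\<lambda>e n1. tlift (EE \<^bold>\<otimes>\<^bsub>B\<^esub> E)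
        (\<lambda>d n0. (e \<diamondop>\<^bsub>EE\<^esub> d) \<diamondop>\<^bsub>EE \<^bold>\<otimes>\<^bsub>B\<^esub> E\<^esub> n0) (\<Delta>E n1)) (\<Delta>E w) =
      tlift (EE \<^bold>\<otimes>\<^bsub>B\<^esub> E) (\<lambda>e n0. \<Delta>E e \<diamondop>\<^bsub>EE \<^bold>\<otimes>\<^bsub>B\<^esub> E\<^esub> n0) (\<Delta>E w)"
proof (rule tensor_ext[OF _ _ _ _ _ c])
  let ?Q = "EE \<^bold>\<otimes>\<^bsub>B\<^esub> E"
  let ?I = "tlift ?Q"
  note r = \<Delta>E_maps hrules
  show "add_map E ?Q (\<lambda>w. ?I (\<lambda>e n1. ?I (\<lambda>d n0. (e \<diamondop>\<^bsub>EE\<^esub> d) \<diamondop>\<^bsub>?Q\<^esub> n0) (\<Delta>E n1)) (\<Delta>E w))"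
    "add_map E ?Q (\<lambda>w. ?I (\<lambda>e n0. \<Delta>E e \<diamondop>\<^bsub>?Q\<^esub> n0) (\<Delta>E w))"
    "rmod R (restr id \<alpha> T)" "lmod R (restr \<alpha> id T')"
    by (rule r | assumption | drule restr_out)+
  fix x u assume "x \<in> carrier (restr id \<alpha> T)" "u \<in> carrier (restr \<alpha> id T')"
  then have h: "x \<in> carrier T" "u \<in> carrier T'" by (simp_all add: restr_simps)
  interpret LT: left_comodule B A E \<Delta>E T \<tau> by (rule left_comodule_T)
  have "?I (\<lambda>e n1. ?I (\<lambda>d n0. (e \<diamondop>\<^bsub>EE\<^esub> d) \<diamondop>\<^bsub>?Q\<^esub> n0) (\<Delta>E n1)) (\<Delta>E (x \<diamondop>\<^bsub>E\<^esub> u)) =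
    ?I (\<lambda>e n1. ?I (\<lambda>d n0. (e \<diamondop>\<^bsub>EE\<^esub> d) \<diamondop>\<^bsub>?Q\<^esub> n0) (\<Delta>E (n1 \<diamondop>\<^bsub>E\<^esub> u))) (\<tau> x)"
    by (rule \<Delta>E_int) (rule h r | assumption | drule restr_out)+
  also have "\<dots> = ?I (\<lambda>e n1. ?I (\<lambda>d n0. (e \<diamondop>\<^bsub>EE\<^esub> d) \<diamondop>\<^bsub>?Q\<^esub> (n0 \<diamondop>\<^bsub>E\<^esub> u)) (\<tau> n1)) (\<tau> x)"
    by (rule tlift_cong \<Delta>E_int h r | assumption | drule restr_out)+
  also have "\<dots> = ?I (\<lambda>e n0. ?I (\<lambda>e1 e2. (e1 \<diamondop>\<^bsub>EE\<^esub> e2) \<diamondop>\<^bsub>?Q\<^esub> (n0 \<diamondop>\<^bsub>E\<^esub> u)) (\<Delta>E e)) (\<tau> x)"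
    by (rule LT.coassoc_int) (rule h r | assumption | drule restr_out)+
  also have "\<dots> = ?I (\<lambda>e n0. \<Delta>E e \<diamondop>\<^bsub>?Q\<^esub> (n0 \<diamondop>\<^bsub>E\<^esub> u)) (\<tau> x)"
  proof -
    have eq: "?I (\<lambda>e1 e2. (e1 \<diamondop>\<^bsub>EE\<^esub> e2) \<diamondop>\<^bsub>?Q\<^esub> (n0 \<diamondop>\<^bsub>E\<^esub> u)) (\<Delta>E e) = \<Delta>E e \<diamondop>\<^bsub>?Q\<^esub> (n0 \<diamondop>\<^bsub>E\<^esub> u)"
      if "e \<in> carrier E" "n0 \<in> carrier T" for e n0
      by (rule tlift_expand[where k = "\<lambda>w. w \<diamondop>\<^bsub>?Q\<^esub> (n0 \<diamondop>\<^bsub>E\<^esub> u)"]) (rule that h r | assumption | drule restr_out)+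
    show ?thesis
      by (rule tlift_cong eq h r | assumption | drule restr_out)+
  qed
  also have "\<dots> = ?I (\<lambda>e n0. \<Delta>E e \<diamondop>\<^bsub>?Q\<^esub> n0) (\<Delta>E (x \<diamondop>\<^bsub>E\<^esub> u))"
    by (rule \<Delta>E_int[symmetric]) (rule h r | assumption | drule restr_out)+
  finally show "?I (\<lambda>e n1. ?I (\<lambda>d n0. (e \<diamondop>\<^bsub>EE\<^esub> d) \<diamondop>\<^bsub>?Q\<^esub> n0) (\<Delta>E n1)) (\<Delta>E (x \<diamondop>\<^bsub>E\<^esub> u)) =
    ?I (\<lambda>e n0. \<Delta>E e \<diamondop>\<^bsub>?Q\<^esub> n0) (\<Delta>E (x \<diamondop>\<^bsub>E\<^esub> u))" .
qed

text \<open>For \<open>e = x1 \<otimes> x2\<close>, the action of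
  \<open>ev' (x3 \<otimes> u)\<close> is rewritten by the formal dual as
  \<open>x1 \<otimes> ev (x2 \<otimes> x3) u\<close>, which \<open>\<tau>_counit'\<close>
  collapses.\<close>

lemma E_counit_right:
  assumes c: "w \<in> carrier E"
  shows "tlift E (\<lambda>e1 e2. ract E e1 (ev' e2)) (\<Delta>E w) = w"
proof (rule tensor_ext[OF _ _ _ _ _ c])
  note r = \<Delta>E_maps hrules
  show "add_map E E (\<lambda>w. tlift E (\<lambda>e1 e2. ract E e1 (ev' e2)) (\<Delta>E w))" "add_map E E (\<lambda>w. w)"
    "rmod R (restr id \<alpha> T)" "lmod R (restr \<alpha> id T')"
    by (rule r | assumption | drule restr_out)+
  fix x u assume "x \<in> carrier (restr id \<alpha> T)" "u \<in> carrier (restr \<alpha> id T')"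
  then have h: "x \<in> carrier T" "u \<in> carrier T'" by (simp_all add: restr_simps)
  have "tlift E (\<lambda>e1 e2. ract E e1 (ev' e2)) (\<Delta>E (x \<diamondop>\<^bsub>E\<^esub> u)) = tlift E (\<lambda>e x3. ract E e (ev' (x3 \<diamondop>\<^bsub>E\<^esub> u))) (\<tau> x)"
    by (rule \<Delta>E_int) (rule h r | assumption | drule restr_out)+
  also have "\<dots> = tlift E (\<lambda>e x3. tlift E (\<lambda>x1 x2. x1 \<diamondop>\<^bsub>E\<^esub> lact T' (ev (x2 \<diamondop>\<^bsub>C\<^esub> x3)) u) e) (\<tau> x)"
  proof -
    have eq: "ract E e (ev' (x3 \<diamondop>\<^bsub>E\<^esub> u)) = tlift E (\<lambda>x1 x2. x1 \<diamondop>\<^bsub>E\<^esub> lact T' (ev (x2 \<diamondop>\<^bsub>C\<^esub> x3)) u) e"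
      if "e \<in> carrier E" "x3 \<in> carrier T" for e x3
    proof (rule tlift_ext[symmetric])
      show "add_map E E (\<lambda>e. ract E e (ev' (x3 \<diamondop>\<^bsub>E\<^esub> u)))"
        by (rule llinD(3), (rule that h r)+)
      show "x1 \<diamondop>\<^bsub>E\<^esub> lact T' (ev (x2 \<diamondop>\<^bsub>C\<^esub> x3)) u = ract E (x1 \<diamondop>\<^bsub>E\<^esub> x2) (ev' (x3 \<diamondop>\<^bsub>E\<^esub> u))"
        if "x1 \<in> carrier (restr id \<alpha> T)" "x2 \<in> carrier (restr \<alpha> id T')" for x1 x2
        using that h \<open>x3 \<in> carrier T\<close> by (simp only: restr_simps ev_ev'[symmetric] act_E ev_pure_closed)
    qed (rule h that r | assumption | drule restr_out)+
    show ?thesis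
      by (rule tlift_cong eq h r | assumption | drule restr_out)+
  qed
  also have "\<dots> = x \<diamondop>\<^bsub>E\<^esub> lact T' \<one>\<^bsub>A\<^esub> u"
    by (rule \<tau>_counit') (rule h r | assumption | drule restr_out)+
  finally show "tlift E (\<lambda>e1 e2. ract E e1 (ev' e2)) (\<Delta>E (x \<diamondop>\<^bsub>E\<^esub> u)) = x \<diamondop>\<^bsub>E\<^esub> u"
    by (simp add: T'.lact_one h)
qed

lemma E_counit_left:
  assumes c: "w \<in> carrier E"
  shows "tlift E (\<lambda>e1 e2. lact E (ev' e1) e2) (\<Delta>E w) = w"
proof (rule tensor_ext[OF _ _ _ _ _ c])
  note r = \<Delta>E_maps hrules
  show "add_map E E (\<lambda>w. tlift E (\<lambda>e1 e2. lact E (ev' e1) e2) (\<Delta>E w))" "add_map E E (\<lambda>w. w)"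
    "rmod R (restr id \<alpha> T)" "lmod R (restr \<alpha> id T')"
    by (rule r | assumption | drule restr_out)+
  fix x u assume "x \<in> carrier (restr id \<alpha> T)" "u \<in> carrier (restr \<alpha> id T')"
  then have h: "x \<in> carrier T" "u \<in> carrier T'" by (simp_all add: restr_simps)
  have "tlift E (\<lambda>e1 e2. lact E (ev' e1) e2) (\<Delta>E (x \<diamondop>\<^bsub>E\<^esub> u)) = tlift E (\<lambda>e x3. lact E (ev' e) (x3 \<diamondop>\<^bsub>E\<^esub> u)) (\<tau> x)"
    by (rule \<Delta>E_int) (rule h r | assumption | drule restr_out)+
  also have "\<dots> = tlift E (\<lambda>e x3. lact T (ev' e) x3 \<diamondop>\<^bsub>E\<^esub> u) (\<tau> x)"
    by (rule tlift_cong act_E(1) h r | assumption | drule restr_out)+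
  also have "\<dots> = tlift T (\<lambda>e x3. lact T (ev' e) x3) (\<tau> x) \<diamondop>\<^bsub>E\<^esub> u"
    by (rule sym, rule tlift_map_eq[where k = "\<lambda>x. x \<diamondop>\<^bsub>E\<^esub> u"]) (rule refl h r | assumption | drule restr_out)+
  finally show "tlift E (\<lambda>e1 e2. lact E (ev' e1) e2) (\<Delta>E (x \<diamondop>\<^bsub>E\<^esub> u)) = x \<diamondop>\<^bsub>E\<^esub> u"
    by (simp add: \<tau>_counit h)
qed

lemma left_comodule_E: "left_comodule B B E \<Delta>E E \<Delta>E"
  by (intro left_comodule.intro bimodule_E herd_structure \<Delta>ED E_coassoc)

end

section \<open>The composite of two herds\<close>

locale herd_pair = T: herd R A \<alpha> S B \<beta> T T' ev\<^sub>T ev'\<^sub>T \<gamma>\<^sub>T + P: herd Z K \<kappa> R A \<alpha> P P' ev\<^sub>P ev'\<^sub>P \<gamma>\<^sub>P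
  for R :: "('r, 'r1) ring_scheme" and A :: "('a, 'a1) ring_scheme" and \<alpha>
    and S :: "('s, 's1) ring_scheme" and B :: "('b, 'b1) ring_scheme" and \<beta>
    and T :: "('b, 'a, 't) bimod" and T' :: "('a, 'b, 'u) bimod" and ev\<^sub>T ev'\<^sub>T \<gamma>\<^sub>T
    and Z :: "('z, 'z1) ring_scheme" and K :: "('k, 'k1) ring_scheme" and \<kappa>
    and P :: "('a, 'k, 'p) bimod" and P' :: "('k, 'a, 'q) bimod" and ev\<^sub>P ev'\<^sub>P \<gamma>\<^sub>P
begin

section \<open>The composite bimodules and the partial evaluations\<close>

abbreviation "V \<equiv> T \<^bold>\<otimes>\<^bsub>A\<^esub> P"
abbreviation "V' \<equiv> P' \<^bold>\<otimes>\<^bsub>A\<^esub> T'"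
abbreviation "ev\<^sub>V \<equiv> comp_ev R \<alpha> S \<beta> K T T' ev\<^sub>T P P' ev\<^sub>P"
abbreviation "ev'\<^sub>V \<equiv> comp_ev' R \<alpha> Z \<kappa> B T T' ev'\<^sub>T P P' ev'\<^sub>P"
abbreviation "CV \<equiv> V' \<^bold>\<otimes>\<^bsub>S,\<beta>\<^esub> V"
abbreviation "EV \<equiv> V \<^bold>\<otimes>\<^bsub>Z,\<kappa>\<^esub> V'"
abbreviation "VCV \<equiv> V \<^bold>\<otimes>\<^bsub>Z,\<kappa>\<^esub> CV"

definition "\<theta>\<^sub>1 u v = tlift P (\<lambda>t p. lact P (ev\<^sub>T (u \<diamondop>\<^bsub>T.C\<^esub> t)) p) v"
definition "\<theta>\<^sub>3 v q = tlift T (\<lambda>t p. ract T t (ev'\<^sub>P (p \<diamondop>\<^bsub>P.E\<^esub> q))) v"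

lemmas pre_rules = T.ebal P.ebal T.\<gamma>A_maps P.\<tau>_maps T.\<Delta>C_maps P.\<Delta>E_maps T.herd_maps P.herd_maps rbal bal rlin_restr llin_restr

lemma \<theta>\<^sub>1_l: "v \<in> carrier V \<Longrightarrow> llin A T' P (\<lambda>u. \<theta>\<^sub>1 u v)"
  unfolding \<theta>\<^sub>1_def by (rule pre_rules | assumption | drule restr_out)+

lemma \<theta>\<^sub>1_r: "u \<in> carrier T' \<Longrightarrow> rlin K V P (\<theta>\<^sub>1 u)"
  unfolding \<theta>\<^sub>1_def[abs_def] by (rule pre_rules | assumption | drule restr_out)+

lemma \<theta>\<^sub>1_balanced: "balanced B T' V P \<theta>\<^sub>1"
  unfolding \<theta>\<^sub>1_def[abs_def] by (rule pre_rules | assumption | drule restr_out)+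

lemma \<theta>\<^sub>3_l: "q \<in> carrier P' \<Longrightarrow> llin B V T (\<lambda>v. \<theta>\<^sub>3 v q)"
  unfolding \<theta>\<^sub>3_def by (rule pre_rules | assumption | drule restr_out)+

lemma \<theta>\<^sub>3_r: "v \<in> carrier V \<Longrightarrow> rlin A P' T (\<theta>\<^sub>3 v)"
  unfolding \<theta>\<^sub>3_def[abs_def] by (rule pre_rules | assumption | drule restr_out)+

lemma \<theta>\<^sub>3_balanced: "balanced K V P' T \<theta>\<^sub>3"
  unfolding \<theta>\<^sub>3_def[abs_def] by (rule pre_rules | assumption | drule restr_out)+

lemma \<theta>_closed: "u \<in> carrier T' \<Longrightarrow> v \<in> carrier V \<Longrightarrow> \<theta>\<^sub>1 u v \<in> carrier P"
  "v \<in> carrier V \<Longrightarrow> q \<in> carrier P' \<Longrightarrow> \<theta>\<^sub>3 v q \<in> carrier T"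
  using balancedD(6)[OF \<theta>\<^sub>1_balanced] balancedD(6)[OF \<theta>\<^sub>3_balanced] by auto

lemma \<theta>_pure:
  "\<lbrakk>u \<in> carrier T'; t \<in> carrier T; p \<in> carrier P\<rbrakk> \<Longrightarrow> \<theta>\<^sub>1 u (t \<diamondop>\<^bsub>V\<^esub> p) = lact P (ev\<^sub>T (u \<diamondop>\<^bsub>T.C\<^esub> t)) p"
  "\<lbrakk>q \<in> carrier P'; t \<in> carrier T; p \<in> carrier P\<rbrakk> \<Longrightarrow> \<theta>\<^sub>3 (t \<diamondop>\<^bsub>V\<^esub> p) q = ract T t (ev'\<^sub>P (p \<diamondop>\<^bsub>P.E\<^esub> q))"
  unfolding \<theta>\<^sub>1_def \<theta>\<^sub>3_def by (rule tlift_pure_eq refl pre_rules | assumption | drule restr_out)+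

lemmas \<theta>_rules = llin_comp[OF \<theta>\<^sub>1_l] rlin_comp[OF \<theta>\<^sub>1_r] llin_comp[OF \<theta>\<^sub>3_l] rlin_comp[OF \<theta>\<^sub>3_r]
  balanced_precomp[OF \<theta>\<^sub>1_balanced] balanced_precomp[OF \<theta>\<^sub>3_balanced]
  balanced_restr[OF balanced_precomp[OF \<theta>\<^sub>1_balanced]] balanced_restr[OF balanced_precomp[OF \<theta>\<^sub>3_balanced]]
  balanced_map[OF rlinD(3)[OF \<theta>\<^sub>1_r]] balanced_map[OF llinD(3)[OF \<theta>\<^sub>1_l]]
  balanced_map[OF rlinD(3)[OF \<theta>\<^sub>3_r]] balanced_map[OF llinD(3)[OF \<theta>\<^sub>3_l]]
  add_map_comp[OF rlinD(3)[OF \<theta>\<^sub>1_r]] add_map_comp[OF llinD(3)[OF \<theta>\<^sub>1_l]]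
  add_map_comp[OF rlinD(3)[OF \<theta>\<^sub>3_r]] add_map_comp[OF llinD(3)[OF \<theta>\<^sub>3_l]] \<theta>_closed

lemmas prules = \<theta>_rules pre_rules

lemma V_ext:
  assumes "v \<in> carrier V" "add_map V G f" "add_map V G g"
    "\<And>t p. t \<in> carrier T \<Longrightarrow> p \<in> carrier P \<Longrightarrow> f (t \<diamondop>\<^bsub>V\<^esub> p) = g (t \<diamondop>\<^bsub>V\<^esub> p)"
  shows "f v = g v"
  by (rule tensor_ext[OF assms(2,3) _ _ _ assms(1)]) (rule assms prules | assumption)+

lemma V'_ext:
  assumes "v \<in> carrier V'" "add_map V' G f" "add_map V' G g"
    "\<And>q u. q \<in> carrier P' \<Longrightarrow> u \<in> carrier T' \<Longrightarrow> f (q \<diamondop>\<^bsub>V'\<^esub> u) = g (q \<diamondop>\<^bsub>V'\<^esub> u)"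
  shows "f v = g v"
  by (rule tensor_ext[OF assms(2,3) _ _ _ assms(1)]) (rule assms prules | assumption)+

lemma bimodule_V: "bimodule B K V" and bimodule_V': "bimodule K B V'"
  and bimodule_CV: "bimodule K K CV" and bimodule_EV: "bimodule B B EV" and bimodule_VCV: "bimodule B K VCV"
  by (rule prules)+

text \<open>At \<open>v = t \<otimes> p\<close> either side is the product of
  \<open>ev\<^sub>T (u \<otimes> t)\<close> and \<open>ev'\<^sub>P (p \<otimes> q)\<close>: the two
  partial evaluations may be performed in either order.\<close>

lemma \<theta>_swap:
  assumes h: "u \<in> carrier T'" "v \<in> carrier V" "q \<in> carrier P'"
  shows "ev'\<^sub>P (\<theta>\<^sub>1 u v \<diamondop>\<^bsub>P.E\<^esub> q) = ev\<^sub>T (u \<diamondop>\<^bsub>T.C\<^esub> \<theta>\<^sub>3 v q)"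
proof (rule V_ext[OF h(2)])
  show "add_map V (regular A) (\<lambda>v. ev'\<^sub>P (\<theta>\<^sub>1 u v \<diamondop>\<^bsub>P.E\<^esub> q))" "add_map V (regular A) (\<lambda>v. ev\<^sub>T (u \<diamondop>\<^bsub>T.C\<^esub> \<theta>\<^sub>3 v q))"
    by (rule h prules | assumption | drule restr_out)+
  show "ev'\<^sub>P (\<theta>\<^sub>1 u (t \<diamondop>\<^bsub>V\<^esub> p) \<diamondop>\<^bsub>P.E\<^esub> q) = ev\<^sub>T (u \<diamondop>\<^bsub>T.C\<^esub> \<theta>\<^sub>3 (t \<diamondop>\<^bsub>V\<^esub> p) q)"
    if "t \<in> carrier T" "p \<in> carrier P" for t p
    using that h by (simp add: \<theta>_pure P.ev'_simps T.ev_simps T.ev_pure_closed P.ev_pure_closed)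
qed

text \<open>A law of the formal dual carried over from \<open>T\<close> to \<open>V\<close>: at
  \<open>v = t \<otimes> p\<close> the scalar \<open>ev\<^sub>T (u \<otimes> t)\<close> crosses the
  tensor sign to \<open>x\<close>, and \<open>x ev\<^sub>T (u \<otimes> t)\<close> is
  \<open>ev'\<^sub>T (x \<otimes> u) t\<close>.\<close>

lemma pure_\<theta>\<^sub>1:
  assumes h: "x \<in> carrier T" "u \<in> carrier T'" "v \<in> carrier V"
  shows "x \<diamondop>\<^bsub>V\<^esub> \<theta>\<^sub>1 u v = lact V (ev'\<^sub>T (x \<diamondop>\<^bsub>T.E\<^esub> u)) v"
proof (rule V_ext[OF h(3)])
  show "add_map V V (\<lambda>v. x \<diamondop>\<^bsub>V\<^esub> \<theta>\<^sub>1 u v)" "add_map V V (\<lambda>v. lact V (ev'\<^sub>T (x \<diamondop>\<^bsub>T.E\<^esub> u)) v)"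
    by (rule rlinD(3), (rule h prules | assumption | drule restr_out)+)+
  show "x \<diamondop>\<^bsub>V\<^esub> \<theta>\<^sub>1 u (t \<diamondop>\<^bsub>V\<^esub> p) = lact V (ev'\<^sub>T (x \<diamondop>\<^bsub>T.E\<^esub> u)) (t \<diamondop>\<^bsub>V\<^esub> p)"
    if y: "t \<in> carrier T" "p \<in> carrier P" for t p
  proof -
    have "x \<diamondop>\<^bsub>V\<^esub> \<theta>\<^sub>1 u (t \<diamondop>\<^bsub>V\<^esub> p) = ract T x (ev\<^sub>T (u \<diamondop>\<^bsub>T.C\<^esub> t)) \<diamondop>\<^bsub>V\<^esub> p"
      unfolding \<theta>_pure(1)[OF h(2) y] by (rule pure_middle_eq[symmetric]) (rule y h prules | assumption | drule restr_out)+
    also have "\<dots> = lact V (ev'\<^sub>T (x \<diamondop>\<^bsub>T.E\<^esub> u)) (t \<diamondop>\<^bsub>V\<^esub> p)"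
      unfolding T.ev'_ev[OF h(1,2) y(1), symmetric] by (rule lact_pure_eq[symmetric]) (rule y h prules | assumption | drule restr_out)+
    finally show ?thesis .
  qed
qed

lemma \<theta>\<^sub>3_pure:
  assumes h: "v \<in> carrier V" "q \<in> carrier P'" "y \<in> carrier P"
  shows "\<theta>\<^sub>3 v q \<diamondop>\<^bsub>V\<^esub> y = ract V v (ev\<^sub>P (q \<diamondop>\<^bsub>P.C\<^esub> y))"
proof (rule V_ext[OF h(1)])
  show "add_map V V (\<lambda>v. \<theta>\<^sub>3 v q \<diamondop>\<^bsub>V\<^esub> y)" "add_map V V (\<lambda>v. ract V v (ev\<^sub>P (q \<diamondop>\<^bsub>P.C\<^esub> y)))"
    by (rule llinD(3), (rule h prules | assumption | drule restr_out)+)+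
  show "\<theta>\<^sub>3 (t \<diamondop>\<^bsub>V\<^esub> p) q \<diamondop>\<^bsub>V\<^esub> y = ract V (t \<diamondop>\<^bsub>V\<^esub> p) (ev\<^sub>P (q \<diamondop>\<^bsub>P.C\<^esub> y))"
    if x: "t \<in> carrier T" "p \<in> carrier P" for t p
  proof -
    have "\<theta>\<^sub>3 (t \<diamondop>\<^bsub>V\<^esub> p) q \<diamondop>\<^bsub>V\<^esub> y = t \<diamondop>\<^bsub>V\<^esub> lact P (ev'\<^sub>P (p \<diamondop>\<^bsub>P.E\<^esub> q)) y"
      unfolding \<theta>_pure(2)[OF h(2) x] by (rule pure_middle_eq) (rule x h prules | assumption | drule restr_out)+
    also have "\<dots> = ract V (t \<diamondop>\<^bsub>V\<^esub> p) (ev\<^sub>P (q \<diamondop>\<^bsub>P.C\<^esub> y))"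
      unfolding P.ev'_ev[OF x(2) h(2,3)] by (rule ract_pure_eq[symmetric]) (rule x h prules | assumption | drule restr_out)+
    finally show ?thesis .
  qed
qed

section \<open>The composite formal dual\<close>

lemma ev\<^sub>V_balanced: "balanced S (restr id \<beta> V') (restr \<beta> id V) (regular K)
    (\<lambda>v' v. tlift (regular K) (\<lambda>q u. ev\<^sub>P (q \<diamondop>\<^bsub>P.C\<^esub> \<theta>\<^sub>1 u v)) v')"
  by (rule prules | assumption | drule restr_out)+

lemma ev'\<^sub>V_balanced: "balanced Z (restr id \<kappa> V) (restr \<kappa> id V') (regular B)
    (\<lambda>v v'. tlift (regular B) (\<lambda>q u. ev'\<^sub>T (\<theta>\<^sub>3 v q \<diamondop>\<^bsub>T.E\<^esub> u)) v')"
  by (rule prules | assumption | drule restr_out)+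

text \<open>Additive maps commute with lifts, so the lift over \<open>v\<close> in
  \<open>comp_ev\<close> may be performed inside, where it is \<open>\<theta>\<^sub>1 u v\<close>;
  on the way the target changes from the ring to its regular bimodule.\<close>

lemma ev\<^sub>V_inner:
  assumes h: "v' \<in> carrier V'" "v \<in> carrier V"
  shows "tlift K (\<lambda>q u. tlift K (\<lambda>t p. ev\<^sub>P (q \<diamondop>\<^bsub>P.C\<^esub> lact P (ev\<^sub>T (u \<diamondop>\<^bsub>T.C\<^esub> t)) p)) v) v' =
    tlift (regular K) (\<lambda>q u. ev\<^sub>P (q \<diamondop>\<^bsub>P.C\<^esub> \<theta>\<^sub>1 u v)) v'"
proof -
  have ring: "ring K" by (rule prules)
  have b: "balanced A P' T' (regular K) (\<lambda>q u. ev\<^sub>P (q \<diamondop>\<^bsub>P.C\<^esub> \<theta>\<^sub>1 u v))"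
    by (rule h prules | assumption | drule restr_out)+
  have eq: "tlift K (\<lambda>t p. ev\<^sub>P (q \<diamondop>\<^bsub>P.C\<^esub> lact P (ev\<^sub>T (u \<diamondop>\<^bsub>T.C\<^esub> t)) p)) v = ev\<^sub>P (q \<diamondop>\<^bsub>P.C\<^esub> \<theta>\<^sub>1 u v)"
    if y: "q \<in> carrier P'" "u \<in> carrier T'" for q u
  proof -
    have b: "balanced A T P (regular K) (\<lambda>t p. ev\<^sub>P (q \<diamondop>\<^bsub>P.C\<^esub> lact P (ev\<^sub>T (u \<diamondop>\<^bsub>T.C\<^esub> t)) p))"
      by (rule y prules | assumption | drule restr_out)+
    have "tlift (regular K) (\<lambda>t p. ev\<^sub>P (q \<diamondop>\<^bsub>P.C\<^esub> lact P (ev\<^sub>T (u \<diamondop>\<^bsub>T.C\<^esub> t)) p)) v = ev\<^sub>P (q \<diamondop>\<^bsub>P.C\<^esub> \<theta>\<^sub>1 u v)"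
      unfolding \<theta>\<^sub>1_def
      by (rule sym, rule tlift_map_eq[where k = "\<lambda>x. ev\<^sub>P (q \<diamondop>\<^bsub>P.C\<^esub> x)"]) (rule refl h y prules | assumption | drule restr_out)+
    then show ?thesis using tlift_regular[OF ring h(2) b] by simp
  qed
  show ?thesis
    unfolding tlift_regular[OF ring h(1) b, symmetric]
    by (rule sym, rule tlift_cong[OF h(1)]) (use b eq in \<open>auto simp: balanced_regular[OF ring]\<close>)
qed

lemma ev'\<^sub>V_inner:
  assumes h: "v' \<in> carrier V'" "v \<in> carrier V"
  shows "tlift B (\<lambda>t p. tlift B (\<lambda>q u. ev'\<^sub>T (ract T t (ev'\<^sub>P (p \<diamondop>\<^bsub>P.E\<^esub> q)) \<diamondop>\<^bsub>T.E\<^esub> u)) v') v =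
    tlift (regular B) (\<lambda>q u. ev'\<^sub>T (\<theta>\<^sub>3 v q \<diamondop>\<^bsub>T.E\<^esub> u)) v'"
proof -
  have ring: "ring B" by (rule prules)
  let ?f = "\<lambda>q u t p. ev'\<^sub>T (ract T t (ev'\<^sub>P (p \<diamondop>\<^bsub>P.E\<^esub> q)) \<diamondop>\<^bsub>T.E\<^esub> u)"
  have b1: "balanced A P' T' (regular B) (\<lambda>q u. ?f q u t p)" if "t \<in> carrier T" "p \<in> carrier P" for t p
    by (rule that h prules | assumption | drule restr_out)+
  have b2: "balanced A T P (regular B) (\<lambda>t p. ?f q u t p)" if "q \<in> carrier P'" "u \<in> carrier T'" for q u
    by (rule that h prules | assumption | drule restr_out)+
  have b3: "balanced A T P (regular B) (\<lambda>t p. tlift (regular B) (\<lambda>q u. ?f q u t p) v')"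
    by (rule b1 b2 h prules | assumption | drule restr_out)+
  have "tlift B (\<lambda>t p. tlift B (\<lambda>q u. ?f q u t p) v') v = tlift B (\<lambda>t p. tlift (regular B) (\<lambda>q u. ?f q u t p) v') v"
    by (rule sym, rule tlift_cong[OF h(2)]) (use b3 tlift_regular[OF ring h(1) b1] in \<open>auto simp: balanced_regular[OF ring]\<close>)
  also have "\<dots> = tlift (regular B) (\<lambda>t p. tlift (regular B) (\<lambda>q u. ?f q u t p) v') v"
    by (rule tlift_regular[OF ring h(2) b3])
  \<comment> \<open>\<open>comp_ev'\<close> sums over \<open>v'\<close> inside the sum over
    \<open>v\<close>; folding into \<open>\<theta>\<^sub>3\<close> needs the opposite order.\<close>
  also have "\<dots> = tlift (regular B) (\<lambda>q u. tlift (regular B) (\<lambda>t p. ?f q u t p) v) v'"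
    by (rule tlift_swap[OF h(2,1)]) (rule b1 b2 h prules | assumption | drule restr_out)+
  also have "\<dots> = tlift (regular B) (\<lambda>q u. ev'\<^sub>T (\<theta>\<^sub>3 v q \<diamondop>\<^bsub>T.E\<^esub> u)) v'"
  proof (rule sym, rule tlift_cong[OF h(1)])
    show "balanced A P' T' (regular B) (\<lambda>q u. ev'\<^sub>T (\<theta>\<^sub>3 v q \<diamondop>\<^bsub>T.E\<^esub> u))"
      by (rule h prules | assumption | drule restr_out)+
    show "ev'\<^sub>T (\<theta>\<^sub>3 v q \<diamondop>\<^bsub>T.E\<^esub> u) = tlift (regular B) (\<lambda>t p. ?f q u t p) v"
      if y: "q \<in> carrier P'" "u \<in> carrier T'" for q u
      unfolding \<theta>\<^sub>3_def
      by (rule tlift_map_eq[where k = "\<lambda>x. ev'\<^sub>T (x \<diamondop>\<^bsub>T.E\<^esub> u)"]) (rule refl h y prules | assumption | drule restr_out)+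
  qed
  finally show ?thesis .
qed

lemma ev\<^sub>V_pure:
  assumes h: "v' \<in> carrier V'" "v \<in> carrier V"
  shows "ev\<^sub>V (v' \<diamondop>\<^bsub>CV\<^esub> v) = tlift (regular K) (\<lambda>q u. ev\<^sub>P (q \<diamondop>\<^bsub>P.C\<^esub> \<theta>\<^sub>1 u v)) v'"
proof -
  have ring: "ring K" by (rule prules)
  have "balanced S (restr id \<beta> V') (restr \<beta> id V) K
    (\<lambda>v' v. tlift K (\<lambda>q u. tlift K (\<lambda>t p. ev\<^sub>P (q \<diamondop>\<^bsub>P.C\<^esub> lact P (ev\<^sub>T (u \<diamondop>\<^bsub>T.C\<^esub> t)) p)) v) v')"
    using ev\<^sub>V_balanced unfolding balanced_regular[OF ring]
    by (rule balanced_cong) (simp add: ev\<^sub>V_inner restr_simps)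
  then show ?thesis
    unfolding comp_ev_def by (rule tlift_pure_eq) (use h ev\<^sub>V_inner in \<open>auto simp: restr_simps\<close>)
qed

lemma ev'\<^sub>V_pure:
  assumes h: "v \<in> carrier V" "v' \<in> carrier V'"
  shows "ev'\<^sub>V (v \<diamondop>\<^bsub>EV\<^esub> v') = tlift (regular B) (\<lambda>q u. ev'\<^sub>T (\<theta>\<^sub>3 v q \<diamondop>\<^bsub>T.E\<^esub> u)) v'"
proof -
  have ring: "ring B" by (rule prules)
  have "balanced Z (restr id \<kappa> V) (restr \<kappa> id V') B
    (\<lambda>v v'. tlift B (\<lambda>t p. tlift B (\<lambda>q u. ev'\<^sub>T (ract T t (ev'\<^sub>P (p \<diamondop>\<^bsub>P.E\<^esub> q)) \<diamondop>\<^bsub>T.E\<^esub> u)) v') v)"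
    using ev'\<^sub>V_balanced unfolding balanced_regular[OF ring]
    by (rule balanced_cong) (simp add: ev'\<^sub>V_inner restr_simps)
  then show ?thesis
    unfolding comp_ev'_def by (rule tlift_pure_eq) (use h ev'\<^sub>V_inner in \<open>auto simp: restr_simps\<close>)
qed

lemma ev\<^sub>V_hom: "ev\<^sub>V \<in> bimod_hom K K CV (regular K)"
proof (rule bimod_hom_cong[OF _ bimodule_CV])
  let ?f = "tlift (regular K) (\<lambda>v' v. tlift (regular K) (\<lambda>q u. ev\<^sub>P (q \<diamondop>\<^bsub>P.C\<^esub> \<theta>\<^sub>1 u v)) v')"
  show "?f \<in> bimod_hom K K CV (regular K)"
    by (rule bimod_homI prules | assumption | drule restr_out)+
  have ring: "ring K" by (rule prules)
  have b: "balanced S (restr id \<beta> V') (restr \<beta> id V) K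
    (\<lambda>v' v. tlift K (\<lambda>q u. tlift K (\<lambda>t p. ev\<^sub>P (q \<diamondop>\<^bsub>P.C\<^esub> lact P (ev\<^sub>T (u \<diamondop>\<^bsub>T.C\<^esub> t)) p)) v) v')"
    using ev\<^sub>V_balanced unfolding balanced_regular[OF ring]
    by (rule balanced_cong) (simp add: ev\<^sub>V_inner restr_simps)
  show "ev\<^sub>V w = ?f w" if "w \<in> carrier CV" for w
    unfolding comp_ev_def tlift_regular[OF ring that ev\<^sub>V_balanced, symmetric]
    by (rule tlift_cong[OF that b]) (simp add: ev\<^sub>V_inner restr_simps)
qed

lemma ev'\<^sub>V_hom: "ev'\<^sub>V \<in> bimod_hom B B EV (regular B)"
proof (rule bimod_hom_cong[OF _ bimodule_EV])
  let ?f = "tlift (regular B) (\<lambda>v v'. tlift (regular B) (\<lambda>q u. ev'\<^sub>T (\<theta>\<^sub>3 v q \<diamondop>\<^bsub>T.E\<^esub> u)) v')"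
  show "?f \<in> bimod_hom B B EV (regular B)"
    by (rule bimod_homI prules | assumption | drule restr_out)+
  have ring: "ring B" by (rule prules)
  have b: "balanced Z (restr id \<kappa> V) (restr \<kappa> id V') B
    (\<lambda>v v'. tlift B (\<lambda>t p. tlift B (\<lambda>q u. ev'\<^sub>T (ract T t (ev'\<^sub>P (p \<diamondop>\<^bsub>P.E\<^esub> q)) \<diamondop>\<^bsub>T.E\<^esub> u)) v') v)"
    using ev'\<^sub>V_balanced unfolding balanced_regular[OF ring]
    by (rule balanced_cong) (simp add: ev'\<^sub>V_inner restr_simps)
  show "ev'\<^sub>V w = ?f w" if "w \<in> carrier EV" for w
    unfolding comp_ev'_def tlift_regular[OF ring that ev'\<^sub>V_balanced, symmetric]
    by (rule tlift_cong[OF that b]) (simp add: ev'\<^sub>V_inner restr_simps)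
qed

lemma ev\<^sub>V_pures:
  assumes "q \<in> carrier P'" "u \<in> carrier T'" "v \<in> carrier V"
  shows "ev\<^sub>V ((q \<diamondop>\<^bsub>V'\<^esub> u) \<diamondop>\<^bsub>CV\<^esub> v) = ev\<^sub>P (q \<diamondop>\<^bsub>P.C\<^esub> \<theta>\<^sub>1 u v)"
proof -
  have c: "q \<diamondop>\<^bsub>V'\<^esub> u \<in> carrier V'" by (rule assms prules)+
  show ?thesis
    unfolding ev\<^sub>V_pure[OF c assms(3)]
    by (rule tlift_pure_eq refl assms prules | assumption | drule restr_out)+
qed

lemma ev'\<^sub>V_pures:
  assumes "v \<in> carrier V" "q \<in> carrier P'" "u \<in> carrier T'"
  shows "ev'\<^sub>V (v \<diamondop>\<^bsub>EV\<^esub> (q \<diamondop>\<^bsub>V'\<^esub> u)) = ev'\<^sub>T (\<theta>\<^sub>3 v q \<diamondop>\<^bsub>T.E\<^esub> u)"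
proof -
  have c: "q \<diamondop>\<^bsub>V'\<^esub> u \<in> carrier V'" by (rule assms prules)+
  show ?thesis
    unfolding ev'\<^sub>V_pure[OF assms(1) c]
    by (rule tlift_pure_eq refl assms prules | assumption | drule restr_out)+
qed

lemma rings: "ring A" "ring B" "ring K" by (rule prules)+

lemmas ev\<^sub>VD = bimod_homD[OF ev\<^sub>V_hom bimodule_CV bimodule_regular[OF rings(3)]]
lemmas ev'\<^sub>VD = bimod_homD[OF ev'\<^sub>V_hom bimodule_EV bimodule_regular[OF rings(2)]]

lemmas ev\<^sub>V_rules = rlin_comp[OF ev\<^sub>VD(2)] llin_comp[OF ev\<^sub>VD(1)] balanced_map[OF ev\<^sub>VD(3)]
  rlin_comp[OF ev'\<^sub>VD(2)] llin_comp[OF ev'\<^sub>VD(1)] balanced_map[OF ev'\<^sub>VD(3)]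

lemma ev\<^sub>V_closed: "w \<in> carrier CV \<Longrightarrow> ev\<^sub>V w \<in> carrier K" "w' \<in> carrier EV \<Longrightarrow> ev'\<^sub>V w' \<in> carrier B"
  using llinD(4)[OF ev\<^sub>VD(1)] llinD(4)[OF ev'\<^sub>VD(1)] by (auto simp: regular_simps)

text \<open>At \<open>v' = q \<otimes> u\<close> both sides of the first law equal
  \<open>\<theta>\<^sub>3 x q \<otimes> \<theta>\<^sub>1 u y\<close>. In the second law an
  evaluation of \<open>T\<close> and one of \<open>P\<close> become scalars of \<open>A\<close>
  between \<open>P'\<close> and \<open>T'\<close>, and \<open>\<theta>_swap\<close> identifies these
  scalars.\<close>

lemma formal_dual_V: "formal_dual Z K \<kappa> S B \<beta> V V' ev\<^sub>V ev'\<^sub>V"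
proof (intro formal_dual.intro formal_dual_axioms.intro bimodule_V bimodule_V' ev\<^sub>V_hom ev'\<^sub>V_hom
    P.\<alpha>.ring_hom_ring_axioms T.\<beta>.ring_hom_ring_axioms)
  note r = ev\<^sub>V_rules ev\<^sub>V_closed prules
  fix x v' y assume h: "x \<in> carrier V" "v' \<in> carrier V'" "y \<in> carrier V"
  show "lact V (ev'\<^sub>V (x \<diamondop>\<^bsub>EV\<^esub> v')) y = ract V x (ev\<^sub>V (v' \<diamondop>\<^bsub>CV\<^esub> y))"
  proof (rule V'_ext[OF h(2)])
    show "add_map V' V (\<lambda>v'. lact V (ev'\<^sub>V (x \<diamondop>\<^bsub>EV\<^esub> v')) y)"
    proof (rule add_map_comp[of "regular B"])
      show "add_map (regular B) V (\<lambda>b. lact V b y)" by (rule balancedD(4)[OF balanced_lact_act]) (rule h r)+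
    qed (rule rlinD(3), (rule h r)+)
    show "add_map V' V (\<lambda>v'. ract V x (ev\<^sub>V (v' \<diamondop>\<^bsub>CV\<^esub> y)))"
    proof (rule add_map_comp[of "regular K"])
      show "add_map (regular K) V (\<lambda>b. ract V x b)" by (rule balancedD(5)[OF balanced_ract_act]) (rule h r)+
    qed (rule llinD(3), (rule h r)+)
    show "lact V (ev'\<^sub>V (x \<diamondop>\<^bsub>EV\<^esub> (q \<diamondop>\<^bsub>V'\<^esub> u))) y = ract V x (ev\<^sub>V ((q \<diamondop>\<^bsub>V'\<^esub> u) \<diamondop>\<^bsub>CV\<^esub> y))"
      if "q \<in> carrier P'" "u \<in> carrier T'" for q u
      using that h by (simp add: ev\<^sub>V_pures ev'\<^sub>V_pures pure_\<theta>\<^sub>1[symmetric] \<theta>\<^sub>3_pure[symmetric] \<theta>_closed)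
  qed
next
  note r = ev\<^sub>V_rules ev\<^sub>V_closed prules
  fix v' x w' assume h: "v' \<in> carrier V'" "x \<in> carrier V" "w' \<in> carrier V'"
  show "ract V' v' (ev'\<^sub>V (x \<diamondop>\<^bsub>EV\<^esub> w')) = lact V' (ev\<^sub>V (v' \<diamondop>\<^bsub>CV\<^esub> x)) w'"
  proof (rule V'_ext[OF h(1)])
    have e: "ev'\<^sub>V (x \<diamondop>\<^bsub>EV\<^esub> w') \<in> carrier B" by (rule h r)+
    show "add_map V' V' (\<lambda>v'. ract V' v' (ev'\<^sub>V (x \<diamondop>\<^bsub>EV\<^esub> w')))"
      by (rule llinD(3), (rule e h r)+)
    show "add_map V' V' (\<lambda>v'. lact V' (ev\<^sub>V (v' \<diamondop>\<^bsub>CV\<^esub> x)) w')"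
      by (rule llinD(3), (rule h r)+)
    fix q u assume y: "q \<in> carrier P'" "u \<in> carrier T'"
    then have qu: "q \<diamondop>\<^bsub>V'\<^esub> u \<in> carrier V'" by - (rule r | assumption)+
    have e1: "ev\<^sub>V ((q \<diamondop>\<^bsub>V'\<^esub> u) \<diamondop>\<^bsub>CV\<^esub> x) \<in> carrier K" by (rule qu h r)+
    show "ract V' (q \<diamondop>\<^bsub>V'\<^esub> u) (ev'\<^sub>V (x \<diamondop>\<^bsub>EV\<^esub> w')) = lact V' (ev\<^sub>V ((q \<diamondop>\<^bsub>V'\<^esub> u) \<diamondop>\<^bsub>CV\<^esub> x)) w'"
    proof (rule V'_ext[OF h(3)])
      show "add_map V' V' (\<lambda>w'. ract V' (q \<diamondop>\<^bsub>V'\<^esub> u) (ev'\<^sub>V (x \<diamondop>\<^bsub>EV\<^esub> w')))"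
        by (rule rlinD(3), (rule qu h r)+)
      show "add_map V' V' (\<lambda>w'. lact V' (ev\<^sub>V ((q \<diamondop>\<^bsub>V'\<^esub> u) \<diamondop>\<^bsub>CV\<^esub> x)) w')"
        by (rule rlinD(3), (rule e1 h r)+)
      fix q' u' assume z: "q' \<in> carrier P'" "u' \<in> carrier T'"
      note c = \<theta>_closed T.ev_pure_closed P.ev_pure_closed
      have "ract V' (q \<diamondop>\<^bsub>V'\<^esub> u) (ev'\<^sub>T (\<theta>\<^sub>3 x q' \<diamondop>\<^bsub>T.E\<^esub> u')) = q \<diamondop>\<^bsub>V'\<^esub> lact T' (ev\<^sub>T (u \<diamondop>\<^bsub>T.C\<^esub> \<theta>\<^sub>3 x q')) u'"
        using y z h by (simp add: ract_pure_eq[OF P.herd_structure(4) T.herd_structure(4)] T.ev_ev' c)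
      also have "\<dots> = ract P' q (ev'\<^sub>P (\<theta>\<^sub>1 u x \<diamondop>\<^bsub>P.E\<^esub> q')) \<diamondop>\<^bsub>V'\<^esub> u'"
        unfolding \<theta>_swap[OF y(2) h(2) z(1), symmetric]
        by (rule pure_middle_eq[symmetric]) (rule y z h r)+
      also have "\<dots> = lact V' (ev\<^sub>P (q \<diamondop>\<^bsub>P.C\<^esub> \<theta>\<^sub>1 u x)) (q' \<diamondop>\<^bsub>V'\<^esub> u')"
        using y z h by (simp add: lact_pure_eq[OF P.herd_structure(4) T.herd_structure(4)] P.ev_ev' c)
      finally show "ract V' (q \<diamondop>\<^bsub>V'\<^esub> u) (ev'\<^sub>V (x \<diamondop>\<^bsub>EV\<^esub> (q' \<diamondop>\<^bsub>V'\<^esub> u'))) =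
          lact V' (ev\<^sub>V ((q \<diamondop>\<^bsub>V'\<^esub> u) \<diamondop>\<^bsub>CV\<^esub> x)) (q' \<diamondop>\<^bsub>V'\<^esub> u')"
        using y z h by (simp add: ev\<^sub>V_pures ev'\<^sub>V_pures)
    qed
  qed
qed

section \<open>The compatibility conditions in Sweedler form\<close>

lemma V_ball:
  assumes "add_map V G f" "add_map V G g"
  shows "(\<forall>v\<in>carrier V. f v = g v) \<longleftrightarrow> (\<forall>t\<in>carrier T. \<forall>p\<in>carrier P. f (t \<diamondop>\<^bsub>V\<^esub> p) = g (t \<diamondop>\<^bsub>V\<^esub> p))"
proof (intro iffI ballI)
  fix t p assume *: "\<forall>v\<in>carrier V. f v = g v" and tp: "t \<in> carrier T" "p \<in> carrier P"
  have "t \<diamondop>\<^bsub>V\<^esub> p \<in> carrier V" by (rule tp prules)+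
  with * show "f (t \<diamondop>\<^bsub>V\<^esub> p) = g (t \<diamondop>\<^bsub>V\<^esub> p)" by blast
next
  fix v assume *: "\<forall>t\<in>carrier T. \<forall>p\<in>carrier P. f (t \<diamondop>\<^bsub>V\<^esub> p) = g (t \<diamondop>\<^bsub>V\<^esub> p)" and v: "v \<in> carrier V"
  show "f v = g v" by (rule V_ext[OF v assms]) (use * in blast)
qed

abbreviation "TW \<equiv> T' \<^bold>\<otimes>\<^bsub>S,\<beta>\<^esub> V"
abbreviation "TTW \<equiv> T \<^bold>\<otimes>\<^bsub>A\<^esub> TW"
abbreviation "PP \<equiv> P' \<^bold>\<otimes>\<^bsub>A\<^esub> P"
abbreviation "VPP \<equiv> V \<^bold>\<otimes>\<^bsub>Z,\<kappa>\<^esub> PP"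

lemma compat_right_inner:
  assumes h: "v1 \<in> carrier V" "v2 \<in> carrier V'" "v3 \<in> carrier V"
  shows "tlift TTW (\<lambda>t p. tlift TTW (\<lambda>q u. ract T t (ev'\<^sub>P (p \<diamondop>\<^bsub>P.E\<^esub> q)) \<diamondop>\<^bsub>TTW\<^esub> (u \<diamondop>\<^bsub>TW\<^esub> v3)) v2) v1 =
    tlift TTW (\<lambda>q u. \<theta>\<^sub>3 v1 q \<diamondop>\<^bsub>TTW\<^esub> (u \<diamondop>\<^bsub>TW\<^esub> v3)) v2"
proof -
  have "tlift TTW (\<lambda>t p. tlift TTW (\<lambda>q u. ract T t (ev'\<^sub>P (p \<diamondop>\<^bsub>P.E\<^esub> q)) \<diamondop>\<^bsub>TTW\<^esub> (u \<diamondop>\<^bsub>TW\<^esub> v3)) v2) v1 =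
    tlift TTW (\<lambda>q u. tlift TTW (\<lambda>t p. ract T t (ev'\<^sub>P (p \<diamondop>\<^bsub>P.E\<^esub> q)) \<diamondop>\<^bsub>TTW\<^esub> (u \<diamondop>\<^bsub>TW\<^esub> v3)) v1) v2"
    by (rule tlift_swap h prules | assumption | drule restr_out)+
  also have "\<dots> = tlift TTW (\<lambda>q u. \<theta>\<^sub>3 v1 q \<diamondop>\<^bsub>TTW\<^esub> (u \<diamondop>\<^bsub>TW\<^esub> v3)) v2"
  proof -
    have eq: "\<theta>\<^sub>3 v1 q \<diamondop>\<^bsub>TTW\<^esub> (u \<diamondop>\<^bsub>TW\<^esub> v3) = tlift TTW (\<lambda>t p. ract T t (ev'\<^sub>P (p \<diamondop>\<^bsub>P.E\<^esub> q)) \<diamondop>\<^bsub>TTW\<^esub> (u \<diamondop>\<^bsub>TW\<^esub> v3)) v1"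
      if "q \<in> carrier P'" "u \<in> carrier T'" for q u
      unfolding \<theta>\<^sub>3_def by (rule evals that h prules | assumption | drule restr_out)+
    show ?thesis
      by (rule sym, (rule tlift_cong eq h prules | assumption | drule restr_out)+)
  qed
  finally show ?thesis .
qed

lemma compat_left_inner:
  assumes h: "v1 \<in> carrier V" "v2 \<in> carrier V'" "v3 \<in> carrier V"
  shows "tlift VPP (\<lambda>q u. tlift VPP (\<lambda>t p. v1 \<diamondop>\<^bsub>VPP\<^esub> (q \<diamondop>\<^bsub>PP\<^esub> lact P (ev\<^sub>T (u \<diamondop>\<^bsub>T.C\<^esub> t)) p)) v3) v2 =
    tlift VPP (\<lambda>q u. v1 \<diamondop>\<^bsub>VPP\<^esub> (q \<diamondop>\<^bsub>PP\<^esub> \<theta>\<^sub>1 u v3)) v2"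
proof -
  have eq: "v1 \<diamondop>\<^bsub>VPP\<^esub> (q \<diamondop>\<^bsub>PP\<^esub> \<theta>\<^sub>1 u v3) = tlift VPP (\<lambda>t p. v1 \<diamondop>\<^bsub>VPP\<^esub> (q \<diamondop>\<^bsub>PP\<^esub> lact P (ev\<^sub>T (u \<diamondop>\<^bsub>T.C\<^esub> t)) p)) v3"
    if "q \<in> carrier P'" "u \<in> carrier T'" for q u
    unfolding \<theta>\<^sub>1_def
    by (rule tlift_map_eq[where k = "\<lambda>x. v1 \<diamondop>\<^bsub>VPP\<^esub> (q \<diamondop>\<^bsub>PP\<^esub> x)"]) (rule refl that h prules | assumption | drule restr_out)+
  show ?thesis
    by (rule sym, (rule tlift_cong eq h prules | assumption | drule restr_out)+)
qed

text \<open>Both sides of the definition are additive in \<open>v\<close> when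
  \<open>\<gamma>\<^sub>V\<close> is, so pure tensors decide; the sum over \<open>v1\<close> inside
  the definition folds into the partial evaluation.\<close>

lemma compat_right_iff:
  assumes \<gamma>: "add_map V VCV \<gamma>\<^sub>V"
  shows "shepherd_compat_right A S \<beta> Z \<kappa> T T' \<gamma>\<^sub>T P P' ev'\<^sub>P \<gamma>\<^sub>V \<longleftrightarrow>
    (\<forall>t\<in>carrier T. \<forall>p\<in>carrier P.
      tlift TTW (\<lambda>t1. tlift TTW (\<lambda>t2 t3. t1 \<diamondop>\<^bsub>TTW\<^esub> (t2 \<diamondop>\<^bsub>TW\<^esub> (t3 \<diamondop>\<^bsub>V\<^esub> p)))) (T.\<gamma>A t) =
      tlift TTW (\<lambda>v1. tlift TTW (\<lambda>v2 v3. tlift TTW (\<lambda>q u. \<theta>\<^sub>3 v1 q \<diamondop>\<^bsub>TTW\<^esub> (u \<diamondop>\<^bsub>TW\<^esub> v3)) v2)) (\<gamma>\<^sub>V (t \<diamondop>\<^bsub>V\<^esub> p)))"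
proof -
  let ?f = "\<lambda>v. tlift TTW (\<lambda>t p. tlift TTW (\<lambda>t1. tlift TTW (\<lambda>t2 t3. t1 \<diamondop>\<^bsub>TTW\<^esub> (t2 \<diamondop>\<^bsub>TW\<^esub> (t3 \<diamondop>\<^bsub>V\<^esub> p)))) (T.\<gamma>A t)) v"
  let ?g = "\<lambda>v. tlift TTW (\<lambda>v1. tlift TTW (\<lambda>v2 v3. tlift TTW (\<lambda>q u. \<theta>\<^sub>3 v1 q \<diamondop>\<^bsub>TTW\<^esub> (u \<diamondop>\<^bsub>TW\<^esub> v3)) v2)) (\<gamma>\<^sub>V v)"
  let ?h = "\<lambda>t p. tlift TTW (\<lambda>t1. tlift TTW (\<lambda>t2 t3. t1 \<diamondop>\<^bsub>TTW\<^esub> (t2 \<diamondop>\<^bsub>TW\<^esub> (t3 \<diamondop>\<^bsub>V\<^esub> p)))) (T.\<gamma>A t)"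
  note r = add_map_comp[OF \<gamma>] add_map_closed[OF \<gamma>] prules
  have f: "add_map V TTW ?f"
    by (rule r | assumption | drule restr_out)+
  have g: "add_map V TTW ?g"
    by (rule r | assumption | drule restr_out)+
  have fp: "?f (t \<diamondop>\<^bsub>V\<^esub> p) = tlift TTW (\<lambda>t1. tlift TTW (\<lambda>t2 t3. t1 \<diamondop>\<^bsub>TTW\<^esub> (t2 \<diamondop>\<^bsub>TW\<^esub> (t3 \<diamondop>\<^bsub>V\<^esub> p)))) (T.\<gamma>A t)"
    if "t \<in> carrier T" "p \<in> carrier P" for t p
    by (rule tlift_pure_eq refl that r | assumption | drule restr_out)+
  have eq: "tlift TTW (\<lambda>v1. tlift TTW (\<lambda>v2 v3.
      tlift TTW (\<lambda>t p. tlift TTW (\<lambda>q u. ract T t (ev'\<^sub>P (p \<diamondop>\<^bsub>P.E\<^esub> q)) \<diamondop>\<^bsub>TTW\<^esub> (u \<diamondop>\<^bsub>TW\<^esub> v3)) v2) v1)) (\<gamma>\<^sub>V v) = ?g v"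
    if v: "v \<in> carrier V" for v
    by (rule sym, (rule compat_right_inner[symmetric] tlift_cong v r | assumption | drule restr_out)+)
  have "shepherd_compat_right A S \<beta> Z \<kappa> T T' \<gamma>\<^sub>T P P' ev'\<^sub>P \<gamma>\<^sub>V \<longleftrightarrow> (\<forall>v\<in>carrier V. ?f v = ?g v)"
    unfolding shepherd_compat_right_def Let_def tlift3_def by (intro ball_cong refl) (simp only: eq)
  also have "\<dots> \<longleftrightarrow> (\<forall>t\<in>carrier T. \<forall>p\<in>carrier P. ?f (t \<diamondop>\<^bsub>V\<^esub> p) = ?g (t \<diamondop>\<^bsub>V\<^esub> p))"
    by (rule V_ball[OF f g])
  also have "\<dots> \<longleftrightarrow> (\<forall>t\<in>carrier T. \<forall>p\<in>carrier P. ?h t p = ?g (t \<diamondop>\<^bsub>V\<^esub> p))"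
    by (intro ball_cong refl) (simp only: fp)
  finally show ?thesis .
qed

lemma compat_left_iff:
  assumes \<gamma>: "add_map V VCV \<gamma>\<^sub>V"
  shows "shepherd_compat_left A S \<beta> Z \<kappa> T T' ev\<^sub>T P P' \<gamma>\<^sub>P \<gamma>\<^sub>V \<longleftrightarrow>
    (\<forall>t\<in>carrier T. \<forall>p\<in>carrier P.
      tlift VPP (\<lambda>p1. tlift VPP (\<lambda>p2 p3. (t \<diamondop>\<^bsub>V\<^esub> p1) \<diamondop>\<^bsub>VPP\<^esub> (p2 \<diamondop>\<^bsub>PP\<^esub> p3))) (\<gamma>\<^sub>P p) =
      tlift VPP (\<lambda>v1. tlift VPP (\<lambda>v2 v3. tlift VPP (\<lambda>q u. v1 \<diamondop>\<^bsub>VPP\<^esub> (q \<diamondop>\<^bsub>PP\<^esub> \<theta>\<^sub>1 u v3)) v2)) (\<gamma>\<^sub>V (t \<diamondop>\<^bsub>V\<^esub> p)))"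
proof -
  let ?f' = "\<lambda>v. tlift VPP (\<lambda>t p. tlift VPP (\<lambda>p1 w. (t \<diamondop>\<^bsub>V\<^esub> p1) \<diamondop>\<^bsub>VPP\<^esub> w) (P.\<gamma>B p)) v"
  \<comment> \<open>The coaction \<open>P.\<tau>\<close> takes the place of
    \<open>P.\<gamma>B\<close>: additivity of the left side in \<open>v\<close> rests on linearity
    over \<open>A\<close>, which has been established for \<open>P.\<tau>\<close>.\<close>
  let ?f = "\<lambda>v. tlift VPP (\<lambda>t p. tlift VPP (\<lambda>e p3. tlift VPP (\<lambda>p1 p2. (t \<diamondop>\<^bsub>V\<^esub> p1) \<diamondop>\<^bsub>VPP\<^esub> (p2 \<diamondop>\<^bsub>PP\<^esub> p3)) e) (P.\<tau> p)) v"
  let ?g = "\<lambda>v. tlift VPP (\<lambda>v1. tlift VPP (\<lambda>v2 v3. tlift VPP (\<lambda>q u. v1 \<diamondop>\<^bsub>VPP\<^esub> (q \<diamondop>\<^bsub>PP\<^esub> \<theta>\<^sub>1 u v3)) v2)) (\<gamma>\<^sub>V v)"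
  let ?h = "\<lambda>t p. tlift VPP (\<lambda>p1. tlift VPP (\<lambda>p2 p3. (t \<diamondop>\<^bsub>V\<^esub> p1) \<diamondop>\<^bsub>VPP\<^esub> (p2 \<diamondop>\<^bsub>PP\<^esub> p3))) (\<gamma>\<^sub>P p)"
  note r = add_map_comp[OF \<gamma>] add_map_closed[OF \<gamma>] prules
  have f: "add_map V VPP ?f"
    by (rule r | assumption | drule restr_out)+
  have g: "add_map V VPP ?g"
    by (rule r | assumption | drule restr_out)+
  have inner: "tlift VPP (\<lambda>p1 w. (t \<diamondop>\<^bsub>V\<^esub> p1) \<diamondop>\<^bsub>VPP\<^esub> w) (P.\<gamma>B p) =
      tlift VPP (\<lambda>p1. tlift VPP (\<lambda>p2 p3. (t \<diamondop>\<^bsub>V\<^esub> p1) \<diamondop>\<^bsub>VPP\<^esub> (p2 \<diamondop>\<^bsub>PP\<^esub> p3))) (\<gamma>\<^sub>P p)" (is ?A)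
    and inner': "tlift VPP (\<lambda>e p3. tlift VPP (\<lambda>p1 p2. (t \<diamondop>\<^bsub>V\<^esub> p1) \<diamondop>\<^bsub>VPP\<^esub> (p2 \<diamondop>\<^bsub>PP\<^esub> p3)) e) (P.\<tau> p) =
      tlift VPP (\<lambda>p1. tlift VPP (\<lambda>p2 p3. (t \<diamondop>\<^bsub>V\<^esub> p1) \<diamondop>\<^bsub>VPP\<^esub> (p2 \<diamondop>\<^bsub>PP\<^esub> p3))) (\<gamma>\<^sub>P p)" (is ?B)
    if h: "t \<in> carrier T" "p \<in> carrier P" for t p
  proof -
    show ?A by (rule P.\<gamma>B_int) (rule h r | assumption | drule restr_out)+
    have "tlift VPP (\<lambda>e p3. tlift VPP (\<lambda>p1 p2. (t \<diamondop>\<^bsub>V\<^esub> p1) \<diamondop>\<^bsub>VPP\<^esub> (p2 \<diamondop>\<^bsub>PP\<^esub> p3)) e) (P.\<tau> p) =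
      tlift VPP (\<lambda>p1. tlift VPP (\<lambda>p2 p3. tlift VPP (\<lambda>p1 p2. (t \<diamondop>\<^bsub>V\<^esub> p1) \<diamondop>\<^bsub>VPP\<^esub> (p2 \<diamondop>\<^bsub>PP\<^esub> p3)) (p1 \<diamondop>\<^bsub>P.E\<^esub> p2))) (\<gamma>\<^sub>P p)"
      by (rule P.\<tau>_int) (rule h r | assumption | drule restr_out)+
    also have "\<dots> = tlift VPP (\<lambda>p1. tlift VPP (\<lambda>p2 p3. (t \<diamondop>\<^bsub>V\<^esub> p1) \<diamondop>\<^bsub>VPP\<^esub> (p2 \<diamondop>\<^bsub>PP\<^esub> p3))) (\<gamma>\<^sub>P p)"
    proof -
      have eq: "tlift VPP (\<lambda>p1 p2. (t \<diamondop>\<^bsub>V\<^esub> p1) \<diamondop>\<^bsub>VPP\<^esub> (p2 \<diamondop>\<^bsub>PP\<^esub> p3)) (p1 \<diamondop>\<^bsub>P.E\<^esub> p2) = (t \<diamondop>\<^bsub>V\<^esub> p1) \<diamondop>\<^bsub>VPP\<^esub> (p2 \<diamondop>\<^bsub>PP\<^esub> p3)"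
        if "p1 \<in> carrier P" "p2 \<in> carrier P'" "p3 \<in> carrier P" for p1 p2 p3
        by (rule tlift_pure_eq refl that h r | assumption | drule restr_out)+
      show ?thesis
        by (rule sym, (rule tlift_cong eq[symmetric] h r | assumption | drule restr_out)+)
    qed
    finally show ?B .
  qed
  have ff: "?f' v = ?f v" if v: "v \<in> carrier V" for v
  proof -
    have eq: "tlift VPP (\<lambda>e p3. tlift VPP (\<lambda>p1 p2. (t \<diamondop>\<^bsub>V\<^esub> p1) \<diamondop>\<^bsub>VPP\<^esub> (p2 \<diamondop>\<^bsub>PP\<^esub> p3)) e) (P.\<tau> p) =
       tlift VPP (\<lambda>p1 w. (t \<diamondop>\<^bsub>V\<^esub> p1) \<diamondop>\<^bsub>VPP\<^esub> w) (P.\<gamma>B p)" if "t \<in> carrier T" "p \<in> carrier P" for t p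
      using inner[OF that] inner'[OF that] by simp
    show ?thesis
      by (rule sym, rule tlift_cong[OF v _ eq]) (rule r | assumption | drule restr_out)+
  qed
  have fp: "?f (t \<diamondop>\<^bsub>V\<^esub> p) = tlift VPP (\<lambda>p1. tlift VPP (\<lambda>p2 p3. (t \<diamondop>\<^bsub>V\<^esub> p1) \<diamondop>\<^bsub>VPP\<^esub> (p2 \<diamondop>\<^bsub>PP\<^esub> p3))) (\<gamma>\<^sub>P p)"
    if "t \<in> carrier T" "p \<in> carrier P" for t p
    by (rule tlift_pure_eq inner' that r | assumption | drule restr_out)+
  have eq: "tlift VPP (\<lambda>v1. tlift VPP (\<lambda>v2 v3.
      tlift VPP (\<lambda>q u. tlift VPP (\<lambda>t p. v1 \<diamondop>\<^bsub>VPP\<^esub> (q \<diamondop>\<^bsub>PP\<^esub> lact P (ev\<^sub>T (u \<diamondop>\<^bsub>T.C\<^esub> t)) p)) v3) v2)) (\<gamma>\<^sub>V v) = ?g v"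
    if v: "v \<in> carrier V" for v
    by (rule sym, (rule compat_left_inner[symmetric] tlift_cong v r | assumption | drule restr_out)+)
  have "shepherd_compat_left A S \<beta> Z \<kappa> T T' ev\<^sub>T P P' \<gamma>\<^sub>P \<gamma>\<^sub>V \<longleftrightarrow> (\<forall>v\<in>carrier V. ?f v = ?g v)"
    unfolding shepherd_compat_left_def Let_def tlift3_def by (intro ball_cong refl) (simp only: eq ff)
  also have "\<dots> \<longleftrightarrow> (\<forall>t\<in>carrier T. \<forall>p\<in>carrier P. ?f (t \<diamondop>\<^bsub>V\<^esub> p) = ?g (t \<diamondop>\<^bsub>V\<^esub> p))"
    by (rule V_ball[OF f g])
  also have "\<dots> \<longleftrightarrow> (\<forall>t\<in>carrier T. \<forall>p\<in>carrier P. ?h t p = ?g (t \<diamondop>\<^bsub>V\<^esub> p))"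
    by (intro ball_cong refl) (simp only: fp)
  finally show ?thesis .
qed

text \<open>Integrated form of the condition. Read from right to left, a sum over
  \<open>\<gamma>\<^sub>V\<close> whose first component is closed by \<open>\<theta>\<^sub>3\<close>
  becomes a sum over the coaction of \<open>t\<close>, with \<open>p\<close> kept in the last
  component.\<close>

lemma compat_right_imp:
  assumes \<gamma>: "add_map V VCV \<gamma>\<^sub>V"
    and compat: "shepherd_compat_right A S \<beta> Z \<kappa> T T' \<gamma>\<^sub>T P P' ev'\<^sub>P \<gamma>\<^sub>V"
    and h: "t \<in> carrier T" "p \<in> carrier P"
    and f1: "\<And>v. v \<in> carrier V \<Longrightarrow> balanced A T T' G (\<lambda>x u. f x u v)"
    and f2: "\<And>x. x \<in> carrier T \<Longrightarrow> balanced S (restr id \<beta> T') (restr \<beta> id V) G (f x)"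
  shows "tlift G (\<lambda>t1. tlift G (\<lambda>t2 t3. f t1 t2 (t3 \<diamondop>\<^bsub>V\<^esub> p))) (T.\<gamma>A t) =
    tlift G (\<lambda>v1. tlift G (\<lambda>v2 v3. tlift G (\<lambda>q u. f (\<theta>\<^sub>3 v1 q) u v3) v2)) (\<gamma>\<^sub>V (t \<diamondop>\<^bsub>V\<^esub> p))"
proof -
  let ?k = "tlift G (\<lambda>x. tlift G (f x))"
  note eq = compat[unfolded compat_right_iff[OF \<gamma>], rule_format, OF h, THEN arg_cong[where f = ?k]]
  note r = h f1 f2 balanced_precomp[OF f1] balanced_restr[OF balanced_precomp[OF f1]] balanced_precomp[OF f2] add_map_comp[OF \<gamma>] add_map_closed[OF \<gamma>] prules
  have 1: "balanced A T T.C G (\<lambda>t1. tlift G (\<lambda>t2 t3. f t1 t2 (t3 \<diamondop>\<^bsub>V\<^esub> p)))"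
    by (rule r | assumption | drule restr_out)+
  have 2: "balanced Z (restr id \<kappa> V) (restr \<kappa> id P') G (\<lambda>v1 q. f (\<theta>\<^sub>3 v1 q) u v3)" if "u \<in> carrier T'" "v3 \<in> carrier V" for u v3
  proof (rule balanced_map[of T])
    show "add_map T G (\<lambda>x. f x u v3)" by (rule balancedD(4)[OF f1]) (rule that)+
  qed (rule r | assumption | drule restr_out)+
  have 3: "balanced A P' T' G (\<lambda>q u. f (\<theta>\<^sub>3 v1 q) u v3)" if "v1 \<in> carrier V" "v3 \<in> carrier V" for v1 v3
    by (rule that r | assumption | drule restr_out)+
  note r' = 1 2 3 r
  show ?thesis
    apply (rule trans[OF trans[OF _ eq]])
     apply (rule sym)
     apply (rule evals r' | assumption | drule restr_out)+
    done
qed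

text \<open>Here a last component closed by \<open>\<theta>\<^sub>1\<close> turns the sum over
  \<open>\<gamma>\<^sub>V\<close> into one over the shepherd of \<open>p\<close>, with
  \<open>t\<close> kept in the first component.\<close>

lemma compat_left_imp:
  assumes \<gamma>: "add_map V VCV \<gamma>\<^sub>V"
    and compat: "shepherd_compat_left A S \<beta> Z \<kappa> T T' ev\<^sub>T P P' \<gamma>\<^sub>P \<gamma>\<^sub>V"
    and h: "t \<in> carrier T" "p \<in> carrier P"
    and f1: "\<And>p. p \<in> carrier P \<Longrightarrow> balanced Z (restr id \<kappa> V) (restr \<kappa> id P') G (\<lambda>v q. f v q p)"
    and f2: "\<And>v. v \<in> carrier V \<Longrightarrow> balanced A P' P G (f v)"
  shows "tlift G (\<lambda>p1. tlift G (\<lambda>p2 p3. f (t \<diamondop>\<^bsub>V\<^esub> p1) p2 p3)) (\<gamma>\<^sub>P p) =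
    tlift G (\<lambda>v1. tlift G (\<lambda>v2 v3. tlift G (\<lambda>q u. f v1 q (\<theta>\<^sub>1 u v3)) v2)) (\<gamma>\<^sub>V (t \<diamondop>\<^bsub>V\<^esub> p))"
proof -
  let ?k = "tlift G (\<lambda>x. tlift G (f x))"
  note eq = compat[unfolded compat_left_iff[OF \<gamma>], rule_format, OF h, THEN arg_cong[where f = ?k]]
  note r = h f1 f2 balanced_precomp[OF f1] balanced_precomp[OF f2] balanced_restr[OF balanced_precomp[OF f2]] add_map_comp[OF \<gamma>] add_map_closed[OF \<gamma>] prules
  have 2: "balanced S (restr id \<beta> T') (restr \<beta> id V) G (\<lambda>u v3. f v1 q (\<theta>\<^sub>1 u v3))" if "v1 \<in> carrier V" "q \<in> carrier P'" for v1 q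
  proof (rule balanced_map[of P])
    show "add_map P G (f v1 q)" by (rule balancedD(5)[OF f2]) (rule that)+
  qed (rule r | assumption | drule restr_out)+
  have 3: "balanced A P' T' G (\<lambda>q u. f v1 q (\<theta>\<^sub>1 u v3))" if "v1 \<in> carrier V" "v3 \<in> carrier V" for v1 v3
    by (rule that r | assumption | drule restr_out)+
  note r' = 2 3 r
  show ?thesis
    apply (rule trans[OF trans[OF _ eq]])
     apply (rule sym)
     apply (rule evals r' | assumption | drule restr_out)+
    done
qed

end

text \<open>A lift depends on the additive structure of its target, which restriction leaves
  unchanged.\<close>

lemma tlift_restr:
  assumes u: "u \<in> carrier (tensor H M N)" and f: "balanced H M N G f"
  shows "tlift G f u = tlift (restr \<phi> \<psi> G) f u"
proof (rule tlift_ext[OF u f])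
  have f': "balanced H M N (restr \<phi> \<psi> G) f" using f by (simp only: restr_id_iff)
  show "add_map (tensor H M N) G (tlift (restr \<phi> \<psi> G) f)"
    using tlift_add_map[OF f'] by (simp only: restr_id_iff)
  show "f x y = tlift (restr \<phi> \<psi> G) f (x \<diamondop>\<^bsub>tensor H M N\<^esub> y)" if "x \<in> carrier M" "y \<in> carrier N" for x y
    using tlift_pure[OF f' that] by simp
qed

lemma rlin_cong:
  assumes "rlin H M N f" "\<And>x. x \<in> carrier M \<Longrightarrow> f x = g x"
  shows "rlin H M N g"
proof -
  have "g \<in> carrier M \<rightarrow> carrier N"
    using rlinD(4)[OF assms(1)] assms(2) by fastforce
  then show ?thesis
    using assms by (auto simp: rlin_def rmod_def add_map_def abelian_monoid.a_closed[OF abelian_group.axioms(1)])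
qed

lemma rlin_tlift_fun_restr:
  assumes u: "u \<in> carrier (tensor K P Q)" and ab: "rmod H M" "rmod K P" "lmod K Q"
    and N: "bimodule L R N" and \<phi>: "ring_hom_ring H R \<phi>" and f: "\<And>x. x \<in> carrier M \<Longrightarrow> balanced K P Q N (f x)"
    and b: "\<And>z w. z \<in> carrier P \<Longrightarrow> w \<in> carrier Q \<Longrightarrow> rlin H M (restr id \<phi> N) (\<lambda>x. f x z w)"
  shows "rlin H M (restr id \<phi> N) (\<lambda>x. tlift N (f x) u)"
proof -
  interpret N: bimodule L R N by fact
  have "bimodule L H (restr id \<phi> N)"
    by (rule bimodule_restr[OF _ \<phi> N]) (rule ring_hom_ring_id[OF N.L.ring_axioms])
  then have "rlin H M (restr id \<phi> N) (\<lambda>x. tlift (restr id \<phi> N) (f x) u)"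
    by (rule rlin_tlift_fun[OF u ab]) (use f b in \<open>simp_all only: restr_id_iff\<close>)
  then show ?thesis
    by (rule rlin_cong) (rule tlift_restr[OF u f, symmetric])
qed

section \<open>The shepherd induced by a smash coproduct\<close>

locale smash_herds = herd_pair +
  fixes \<sigma>
  assumes smash: "smash_coproduct A (T' \<^bold>\<otimes>\<^bsub>S,\<beta>\<^esub> T) (right_coring_comult A S \<beta> T T' \<gamma>\<^sub>T) ev\<^sub>T
    (P \<^bold>\<otimes>\<^bsub>Z,\<kappa>\<^esub> P') (left_coring_comult Z \<kappa> A P P' \<gamma>\<^sub>P) ev'\<^sub>P \<sigma>"
begin

sublocale SM: smash_comodules A T.C T.\<Delta>C ev\<^sub>T P.E P.\<Delta>E ev'\<^sub>P \<sigma> B T T.\<gamma>A K P P.\<tau>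
  by (intro smash_comodules.intro smash.intro smash_axioms.intro smash coring_pair.intro T.bimodule_C P.bimodule_E
    T.\<Delta>C_hom P.\<Delta>E_hom T.ev_hom P.ev'_hom T.right_comodule_T P.left_comodule_T)

abbreviation "EC \<equiv> P.E \<^bold>\<otimes>\<^bsub>A\<^esub> T.C"
abbreviation "CE \<equiv> T.C \<^bold>\<otimes>\<^bsub>A\<^esub> P.E"

lemma bimodule_CE: "bimodule A A CE" "bimodule A A EC" by (rule prules)+

lemmas \<sigma>D = bimod_homD[OF SM.\<sigma>_hom bimodule_CE]
lemmas srules = rlin_comp[OF \<sigma>D(2)] llin_comp[OF \<sigma>D(1)] add_map_comp[OF \<sigma>D(3)]
  balanced_map[OF \<sigma>D(3)] llinD(4)[OF \<sigma>D(1)] prules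

text \<open>The counit condition of \<open>\<sigma>\<close> turns the inner sum into
  \<open>k\<close> at \<open>c ev'\<^sub>P e\<close> and \<open>p3\<close>; the scalar passes to
  \<open>p3\<close>, and the coaction of \<open>p\<close> contracts to \<open>p\<close>.\<close>

lemma counit_E_int:
  assumes k: "balanced A T.C P G k" and c: "c \<in> carrier T.C" and p: "p \<in> carrier P"
  shows "tlift G (\<lambda>e p3. tlift G (\<lambda>e' c'. k (lact T.C (ev'\<^sub>P e') c') p3) (\<sigma> (c \<diamondop>\<^bsub>CE\<^esub> e))) (P.\<tau> p) = k c p"
proof -
  note r = c p balanced_precomp[OF k] srules
  have k1: "add_map T.C G (\<lambda>c. k c y)" if "y \<in> carrier P" for y by (rule balancedD(4)[OF k that])
  have eq: "k c (lact P (ev'\<^sub>P e) p3) = tlift G (\<lambda>e' c'. k (lact T.C (ev'\<^sub>P e') c') p3) (\<sigma> (c \<diamondop>\<^bsub>CE\<^esub> e))"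
    if y: "e \<in> carrier P.E" "p3 \<in> carrier P" for e p3
  proof -
    have a: "ev'\<^sub>P e \<in> carrier A" by (rule y r)+
    have "k c (lact P (ev'\<^sub>P e) p3) = k (ract T.C c (ev'\<^sub>P e)) p3"
      by (rule balancedD(9)[OF k c a y(2), symmetric])
    also have "\<dots> = k (tlift T.C (\<lambda>e c. lact T.C (ev'\<^sub>P e) c) (\<sigma> (c \<diamondop>\<^bsub>CE\<^esub> e))) p3"
      unfolding SM.smash_counit(1)[OF c y(1)] ..
    also have "\<dots> = tlift G (\<lambda>e' c'. k (lact T.C (ev'\<^sub>P e') c') p3) (\<sigma> (c \<diamondop>\<^bsub>CE\<^esub> e))"
      by (rule tlift_map_eq[where k = "\<lambda>c. k c p3"]) (rule refl k1 y r)+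
    finally show ?thesis .
  qed
  have "k c (tlift P (\<lambda>e p3. lact P (ev'\<^sub>P e) p3) (P.\<tau> p)) =
    tlift G (\<lambda>e p3. tlift G (\<lambda>e' c'. k (lact T.C (ev'\<^sub>P e') c') p3) (\<sigma> (c \<diamondop>\<^bsub>CE\<^esub> e))) (P.\<tau> p)"
  proof (rule tlift_map_eq)
    show "add_map P G (k c)" by (rule balancedD(5)[OF k c])
  qed (rule eq r | assumption)+
  then show ?thesis unfolding P.\<tau>_counit[OF p] by simp
qed

text \<open>Dually, the counit of \<open>C\<close> after \<open>\<sigma>\<close> becomes the action
  of \<open>ev\<^sub>T c\<close> on \<open>e\<close>, passes to \<open>t1\<close> and contracts the
  coaction of \<open>t\<close>.\<close>

lemma counit_C_int:
  assumes k: "balanced A T P.E G k" and e: "e \<in> carrier P.E" and t: "t \<in> carrier T"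
  shows "tlift G (\<lambda>t1 c. tlift G (\<lambda>e' c'. k t1 (ract P.E e' (ev\<^sub>T c'))) (\<sigma> (c \<diamondop>\<^bsub>CE\<^esub> e))) (T.\<gamma>A t) = k t e"
proof -
  note r = e t balanced_precomp[OF k] srules
  have k1: "add_map P.E G (k x)" if "x \<in> carrier T" for x by (rule balancedD(5)[OF k that])
  have eq: "k (ract T t1 (ev\<^sub>T c)) e = tlift G (\<lambda>e' c'. k t1 (ract P.E e' (ev\<^sub>T c'))) (\<sigma> (c \<diamondop>\<^bsub>CE\<^esub> e))"
    if y: "t1 \<in> carrier T" "c \<in> carrier T.C" for t1 c
  proof -
    have a: "ev\<^sub>T c \<in> carrier A" by (rule y r)+
    have "k (ract T t1 (ev\<^sub>T c)) e = k t1 (lact P.E (ev\<^sub>T c) e)"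
      by (rule balancedD(9)[OF k y(1) a e])
    also have "\<dots> = k t1 (tlift P.E (\<lambda>e c. ract P.E e (ev\<^sub>T c)) (\<sigma> (c \<diamondop>\<^bsub>CE\<^esub> e)))"
      unfolding SM.smash_counit(2)[OF y(2) e] ..
    also have "\<dots> = tlift G (\<lambda>e' c'. k t1 (ract P.E e' (ev\<^sub>T c'))) (\<sigma> (c \<diamondop>\<^bsub>CE\<^esub> e))"
      by (rule tlift_map_eq[where k = "k t1"]) (rule refl k1 y r)+
    finally show ?thesis .
  qed
  have "k (tlift T (\<lambda>t1 c. ract T t1 (ev\<^sub>T c)) (T.\<gamma>A t)) e =
    tlift G (\<lambda>t1 c. tlift G (\<lambda>e' c'. k t1 (ract P.E e' (ev\<^sub>T c'))) (\<sigma> (c \<diamondop>\<^bsub>CE\<^esub> e))) (T.\<gamma>A t)"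
  proof (rule tlift_map_eq[where k = "\<lambda>t. k t e"])
    show "add_map T G (\<lambda>t. k t e)" by (rule balancedD(4)[OF k e])
  qed (rule eq r | assumption)+
  then show ?thesis unfolding T.\<gamma>A_counit[OF t] by simp
qed

text \<open>
  \<open>J\<gamma> G f t p\<close> is the value of the trilinear map \<open>f\<close> on the shepherd at \<open>t \<otimes> p\<close>; the other abbreviations are
  its inner integrands.
\<close>

abbreviation "J G f t1 p3 e' c' \<equiv> tlift G (\<lambda>x x'. tlift G (\<lambda>u s. f (t1 \<diamondop>\<^bsub>V\<^esub> x) (x' \<diamondop>\<^bsub>V'\<^esub> u) (s \<diamondop>\<^bsub>V\<^esub> p3)) c') e'"
abbreviation "J\<sigma> G f t1 c e p3 \<equiv> tlift G (J G f t1 p3) (\<sigma> (c \<diamondop>\<^bsub>CE\<^esub> e))"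
abbreviation "J\<tau> G f p t1 c \<equiv> tlift G (J\<sigma> G f t1 c) (P.\<tau> p)"
abbreviation "J\<gamma> G f t p \<equiv> tlift G (J\<tau> G f p) (T.\<gamma>A t)"

text \<open>The three statements are the three tensor signs over \<open>A\<close> in
  \<open>T \<otimes> E \<otimes> C \<otimes> P\<close>. The neighbours across each sign are
  regrouped into one factor, \<open>t1\<close> with \<open>x\<close> and \<open>s\<close> with
  \<open>p3\<close> in \<open>V\<close>, \<open>x'\<close> with \<open>u\<close> in
  \<open>V'\<close>, and these factors are tensor products over \<open>A\<close>.\<close>

lemma J_balanced:
  assumes f1: "\<And>v. v \<in> carrier V \<Longrightarrow> balanced Z (restr id \<kappa> V) (restr \<kappa> id V') G (\<lambda>a b. f a b v)"
    and f2: "\<And>v. v \<in> carrier V \<Longrightarrow> balanced S (restr id \<beta> V') (restr \<beta> id V) G (f v)"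
  shows "\<lbrakk>t1 \<in> carrier T; p3 \<in> carrier P\<rbrakk> \<Longrightarrow> balanced A P.E T.C G (J G f t1 p3)"
    and "\<lbrakk>t1 \<in> carrier T; e' \<in> carrier P.E\<rbrakk> \<Longrightarrow> balanced A T.C P G (\<lambda>c' p3. J G f t1 p3 e' c')"
    and "\<lbrakk>p3 \<in> carrier P; c' \<in> carrier T.C\<rbrakk> \<Longrightarrow> balanced A T P.E G (\<lambda>t1 e'. J G f t1 p3 e' c')"
proof -
  have a1: "add_map V G (\<lambda>a. f a b c)" if "b \<in> carrier V'" "c \<in> carrier V" for b c
    using balancedD(4)[OF f1, of c b] that by (simp add: restr_id_iff restr_simps)
  have a2: "add_map V' G (\<lambda>b. f a b c)" if "a \<in> carrier V" "c \<in> carrier V" for a c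
    using balancedD(5)[OF f1, of c a] that by (simp add: restr_id_iff restr_simps)
  have a3: "add_map V G (f a b)" if "a \<in> carrier V" "b \<in> carrier V'" for a b
    using balancedD(5)[OF f2, of a b] that by (simp add: restr_id_iff restr_simps)
  note r = balanced_precomp[OF f1] balanced_precomp[OF f2] balanced_map[OF a1] balanced_map[OF a2] balanced_map[OF a3] srules
  show "\<lbrakk>t1 \<in> carrier T; p3 \<in> carrier P\<rbrakk> \<Longrightarrow> balanced A P.E T.C G (J G f t1 p3)"
    by (rule r | assumption | drule restr_out)+
  show "\<lbrakk>t1 \<in> carrier T; e' \<in> carrier P.E\<rbrakk> \<Longrightarrow> balanced A T.C P G (\<lambda>c' p3. J G f t1 p3 e' c')"
    by (rule r | assumption | drule restr_out)+
  show "\<lbrakk>p3 \<in> carrier P; c' \<in> carrier T.C\<rbrakk> \<Longrightarrow> balanced A T P.E G (\<lambda>t1 e'. J G f t1 p3 e' c')"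
    by (rule r | assumption | drule restr_out)+
qed

lemma J\<sigma>_balanced:
  assumes f1: "\<And>v. v \<in> carrier V \<Longrightarrow> balanced Z (restr id \<kappa> V) (restr \<kappa> id V') G (\<lambda>a b. f a b v)"
    and f2: "\<And>v. v \<in> carrier V \<Longrightarrow> balanced S (restr id \<beta> V') (restr \<beta> id V) G (f v)"
  shows "\<lbrakk>t1 \<in> carrier T; c \<in> carrier T.C\<rbrakk> \<Longrightarrow> balanced A P.E P G (J\<sigma> G f t1 c)"
    and "\<lbrakk>e \<in> carrier P.E; p3 \<in> carrier P\<rbrakk> \<Longrightarrow> balanced A T T.C G (\<lambda>t1 c. J\<sigma> G f t1 c e p3)"
    and "\<lbrakk>t1 \<in> carrier T; p3 \<in> carrier P\<rbrakk> \<Longrightarrow> balanced A T.C P.E G (\<lambda>c e. J\<sigma> G f t1 c e p3)"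
proof -
  note r = J_balanced[OF f1 f2] srules
  show "\<lbrakk>t1 \<in> carrier T; c \<in> carrier T.C\<rbrakk> \<Longrightarrow> balanced A P.E P G (J\<sigma> G f t1 c)"
    by (rule r | assumption | drule restr_out)+
  show "\<lbrakk>e \<in> carrier P.E; p3 \<in> carrier P\<rbrakk> \<Longrightarrow> balanced A T T.C G (\<lambda>t1 c. J\<sigma> G f t1 c e p3)"
    by (rule r | assumption | drule restr_out)+
  show "\<lbrakk>t1 \<in> carrier T; p3 \<in> carrier P\<rbrakk> \<Longrightarrow> balanced A T.C P.E G (\<lambda>c e. J\<sigma> G f t1 c e p3)"
    by (rule r | assumption | drule restr_out)+
qed

lemma J\<tau>_balanced:
  assumes f1: "\<And>v. v \<in> carrier V \<Longrightarrow> balanced Z (restr id \<kappa> V) (restr \<kappa> id V') G (\<lambda>a b. f a b v)"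
    and f2: "\<And>v. v \<in> carrier V \<Longrightarrow> balanced S (restr id \<beta> V') (restr \<beta> id V) G (f v)"
  shows "p \<in> carrier P \<Longrightarrow> balanced A T T.C G (J\<tau> G f p)"
    and "t1 \<in> carrier T \<Longrightarrow> balanced A T.C P G (\<lambda>c p. J\<tau> G f p t1 c)"
    and "balanced A T P G (J\<gamma> G f)"
proof -
  note r = J\<sigma>_balanced[OF f1 f2] srules
  show 1: "p \<in> carrier P \<Longrightarrow> balanced A T T.C G (J\<tau> G f p)" for p
    by (rule r | assumption | drule restr_out)+
  show 2: "t1 \<in> carrier T \<Longrightarrow> balanced A T.C P G (\<lambda>c p. J\<tau> G f p t1 c)" for t1
    by (rule r | assumption | drule restr_out)+
  show "balanced A T P G (J\<gamma> G f)"
    by (rule 1 2 srules | assumption | drule restr_out)+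
qed

abbreviation "pureV a b c \<equiv> a \<diamondop>\<^bsub>VCV\<^esub> (b \<diamondop>\<^bsub>CV\<^esub> c)"

lemma pureV_balanced:
  "v \<in> carrier V \<Longrightarrow> balanced Z (restr id \<kappa> V) (restr \<kappa> id V') VCV (\<lambda>a b. pureV a b v)"
  "v \<in> carrier V \<Longrightarrow> balanced S (restr id \<beta> V') (restr \<beta> id V) VCV (pureV v)"
  by (rule srules | assumption | drule restr_out)+

definition "\<gamma>\<^sub>V = tlift VCV (J\<gamma> VCV pureV)"

text \<open>The inner sums are linear over \<open>B\<close> in \<open>t1\<close>. The linearity of
  the coaction of \<open>T\<close> on that side is over \<open>S\<close>, and this is where the
  large ring is lost.\<close>

lemma \<gamma>\<^sub>V_l: "llin S (restr \<beta> id V) (restr \<beta> id VCV) \<gamma>\<^sub>V"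
proof -
  note b = J\<tau>_balanced[OF pureV_balanced]
  note r = J_balanced[OF pureV_balanced] J\<sigma>_balanced[OF pureV_balanced] srules
  have 1: "llin B T VCV (\<lambda>t1. J\<sigma> VCV pureV t1 c e p3)" if "c \<in> carrier T.C" "e \<in> carrier P.E" "p3 \<in> carrier P" for c e p3
    by (rule that r | assumption | drule restr_out)+
  have 2: "llin B T VCV (\<lambda>t1. J\<tau> VCV pureV p t1 c)" if "p \<in> carrier P" "c \<in> carrier T.C" for p c
    by (rule that 1 r | assumption | drule restr_out)+
  have 3: "llin S (restr \<beta> id T) (restr \<beta> id VCV) (\<lambda>t. J\<gamma> VCV pureV t p)" if "p \<in> carrier P" for p
    by (rule llin_tlift_arg_restr[OF T.\<gamma>A_l]) (rule llin_restr 2 b that srules | assumption | drule restr_out)+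
  have i: "llin S (restr \<beta> id V) (restr \<beta> id V) (\<lambda>v. v)"
    by (rule llin_id) (rule srules)+
  show ?thesis
    unfolding \<gamma>\<^sub>V_def by (rule llin_tlift_arg_restr[OF i T.herd_structure(3) P.herd_structure(3) T.herd_structure(2) bimodule_VCV b(3) 3])
qed

lemma \<gamma>\<^sub>V_r: "rlin Z (restr id \<kappa> V) (restr id \<kappa> VCV) \<gamma>\<^sub>V"
proof -
  note b = J\<tau>_balanced[OF pureV_balanced]
  note r = J_balanced[OF pureV_balanced] J\<sigma>_balanced[OF pureV_balanced] srules
  have 1: "rlin K P VCV (J\<sigma> VCV pureV t1 c e)" if "t1 \<in> carrier T" "c \<in> carrier T.C" "e \<in> carrier P.E" for t1 c e
    by (rule that r | assumption | drule restr_out)+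
  have 2: "rlin Z (restr id \<kappa> P) (restr id \<kappa> VCV) (\<lambda>p. J\<tau> VCV pureV p t1 c)" if "t1 \<in> carrier T" "c \<in> carrier T.C" for t1 c
    by (rule rlin_tlift_arg_restr[OF P.\<tau>_r]) (rule rlin_restr 1 that r | assumption | drule restr_out)+
  have 3: "rlin Z (restr id \<kappa> P) (restr id \<kappa> VCV) (J\<gamma> VCV pureV t)" if "t \<in> carrier T" for t
    by (rule rlin_tlift_fun_restr) (rule 2 b that srules | assumption | drule restr_out)+
  have i: "rlin Z (restr id \<kappa> V) (restr id \<kappa> V) (\<lambda>v. v)"
    by (rule rlin_id) (rule srules)+
  show ?thesis
    unfolding \<gamma>\<^sub>V_def by (rule rlin_tlift_arg_restr[OF i T.herd_structure(3) P.herd_structure(3) P.herd_structure(1) bimodule_VCV b(3) 3])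
qed

lemma \<gamma>\<^sub>V_add: "add_map V VCV \<gamma>\<^sub>V"
  using llinD(3)[OF \<gamma>\<^sub>V_l] by (simp only: restr_id_iff)

lemma \<gamma>\<^sub>V_hom: "\<gamma>\<^sub>V \<in> bimod_hom S Z (restr \<beta> \<kappa> V) (restr \<beta> \<kappa> VCV)"
  by (rule bimod_homI llin_restr_source[OF llin_restr_target[OF \<gamma>\<^sub>V_l]] rlin_restr_source[OF rlin_restr_target[OF \<gamma>\<^sub>V_r]])+

text \<open>The additive map induced by \<open>f\<close> is carried through the nested sums that
  make up \<open>\<gamma>\<^sub>V\<close>, one level at a time from the innermost integrand
  \<open>J\<close> outwards.\<close>

lemma \<gamma>\<^sub>V_int:
  assumes h: "t \<in> carrier T" "p \<in> carrier P"
    and f1: "\<And>v. v \<in> carrier V \<Longrightarrow> balanced Z (restr id \<kappa> V) (restr \<kappa> id V') G (\<lambda>a b. f a b v)"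
    and f2: "\<And>v. v \<in> carrier V \<Longrightarrow> balanced S (restr id \<beta> V') (restr \<beta> id V) G (f v)"
  shows "tlift G (\<lambda>v1. tlift G (f v1)) (\<gamma>\<^sub>V (t \<diamondop>\<^bsub>V\<^esub> p)) = J\<gamma> G f t p"
proof -
  note b1 = J_balanced[OF pureV_balanced] and b2 = J\<sigma>_balanced[OF pureV_balanced] and b3 = J\<tau>_balanced[OF pureV_balanced]
  let ?k = "tlift G (\<lambda>v1. tlift G (f v1))"
  have fb: "balanced Z (restr id \<kappa> V) (restr \<kappa> id CV) G (\<lambda>v1. tlift G (f v1))"
    by (rule f1 f2 balanced_precomp[OF f1] balanced_precomp[OF f2] srules | assumption | drule restr_out)+
  note k = tlift_add_map[OF fb]
  have 1: "?k (J VCV pureV t1 p3 e' c') = J G f t1 p3 e' c'"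
    if y: "t1 \<in> carrier T" "p3 \<in> carrier P" "e' \<in> carrier P.E" "c' \<in> carrier T.C" for t1 p3 e' c'
  proof -
    note r = y fb balanced_precomp[OF f1] balanced_precomp[OF f2] srules
    show ?thesis
      by (rule evals r | assumption | drule restr_out)+
  qed
  have 2: "?k (J\<sigma> VCV pureV t1 c e p3) = J\<sigma> G f t1 c e p3"
    if y: "t1 \<in> carrier T" "c \<in> carrier T.C" "e \<in> carrier P.E" "p3 \<in> carrier P" for t1 c e p3
  proof -
    have s: "\<sigma> (c \<diamondop>\<^bsub>CE\<^esub> e) \<in> carrier EC" by (rule y srules)+
    have b: "balanced A P.E T.C VCV (J VCV pureV t1 p3)" by (rule b1 y | assumption)+
    show ?thesis
      by (rule tlift_map_eq[OF k s b]) (rule 1 y | assumption)+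
  qed
  have 3: "?k (J\<tau> VCV pureV p t1 c) = J\<tau> G f p t1 c" if y: "t1 \<in> carrier T" "c \<in> carrier T.C" for t1 c
  proof -
    have b: "balanced A P.E P VCV (J\<sigma> VCV pureV t1 c)" by (rule b2 y | assumption)+
    show ?thesis by (rule tlift_map_eq[OF k P.\<tau>_closed[OF h(2)] b]) (rule 2 y | assumption)+
  qed
  have b4: "balanced A T T.C VCV (J\<tau> VCV pureV p)" and b5: "balanced A T P VCV (J\<gamma> VCV pureV)"
    by (rule b3 h | assumption)+
  have eq: "\<gamma>\<^sub>V (t \<diamondop>\<^bsub>V\<^esub> p) = J\<gamma> VCV pureV t p"
    unfolding \<gamma>\<^sub>V_def by (rule tlift_pure[OF b5 h])
  show ?thesis
    unfolding eq by (rule tlift_map_eq[OF k T.\<gamma>A_closed[OF h(1)] b4]) (rule 3 | assumption)+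
qed

end

text \<open>The evaluation law with the component in \<open>C\<close> opened up, which is the shape
  that the second compatibility condition produces.\<close>

lemma (in herd) shepherd_ev_int':
  assumes x: "x \<in> carrier T" and g: "balanced R (restr id \<alpha> T) (restr \<alpha> id (regular A)) G g"
  shows "tlift G (\<lambda>x1. tlift G (\<lambda>x2 x3. g x1 (ev (x2 \<diamondop>\<^bsub>C\<^esub> x3)))) (\<gamma> x) = g x \<one>\<^bsub>A\<^esub>"
proof -
  have g3: "balanced R (restr id \<alpha> T) (restr \<alpha> id C) G (\<lambda>x1 c. g x1 (ev c))"
    apply (rule balanced_precomp[OF g])
    by (rule hrules)+
  have eq: "g x1 (ev c) = tlift G (\<lambda>x2 x3. g x1 (ev (x2 \<diamondop>\<^bsub>C\<^esub> x3))) c" if "x1 \<in> carrier T" "c \<in> carrier C" for x1 c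
  proof (rule tlift_expand[symmetric, OF that(2)])
    have "add_map (regular A) G (g x1)"
      using balancedD(5)[OF g, of x1] that(1) by (simp add: restr_id_iff restr_simps)
    then show "add_map C G (\<lambda>c. g x1 (ev c))" by (rule add_map_comp[OF _ rlinD(3)[OF evD(2)]])
  qed (rule hrules)+
  have "tlift G (\<lambda>x1 c. g x1 (ev c)) (\<gamma> x) = tlift G (\<lambda>x1. tlift G (\<lambda>x2 x3. g x1 (ev (x2 \<diamondop>\<^bsub>C\<^esub> x3)))) (\<gamma> x)"
    by (rule eq tlift_cong g3 x hrules | assumption | drule restr_out)+
  then show ?thesis using shepherd_ev_int[OF x g] by simp
qed

section \<open>Compatibility and evaluation laws of the new shepherd\<close>

context smash_herds
begin

text \<open>The integrand \<open>?f\<close> contracts a component \<open>x \<otimes> x'\<close> of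
  \<open>e'\<close> to a scalar of \<open>A\<close>, which crosses over to \<open>c'\<close>. Thus
  \<open>e'\<close> enters through \<open>ev'\<^sub>P e'\<close> acting on \<open>c'\<close>, and
  \<open>counit_E_int\<close> removes \<open>\<sigma>\<close> together with the coaction of
  \<open>p\<close>.\<close>

lemma compat_right: "shepherd_compat_right A S \<beta> Z \<kappa> T T' \<gamma>\<^sub>T P P' ev'\<^sub>P \<gamma>\<^sub>V"
  unfolding compat_right_iff[OF \<gamma>\<^sub>V_add]
proof (intro ballI)
  fix t p assume h: "t \<in> carrier T" "p \<in> carrier P"
  let ?f = "\<lambda>v1 v2 v3. tlift TTW (\<lambda>q u. \<theta>\<^sub>3 v1 q \<diamondop>\<^bsub>TTW\<^esub> (u \<diamondop>\<^bsub>TW\<^esub> v3)) v2"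
  let ?k = "\<lambda>t1 d y. tlift TTW (\<lambda>u s. t1 \<diamondop>\<^bsub>TTW\<^esub> (u \<diamondop>\<^bsub>TW\<^esub> (s \<diamondop>\<^bsub>V\<^esub> y))) d"
  have f1: "balanced Z (restr id \<kappa> V) (restr \<kappa> id V') TTW (\<lambda>a b. ?f a b v)" if "v \<in> carrier V" for v
    by (rule that srules | assumption | drule restr_out)+
  have f2: "balanced S (restr id \<beta> V') (restr \<beta> id V) TTW (?f v)" if "v \<in> carrier V" for v
    by (rule that srules | assumption | drule restr_out)+
  have kb: "balanced A T.C P TTW (?k t1)" if "t1 \<in> carrier T" for t1
    by (rule that srules | assumption | drule restr_out)+
  have J: "?k t1 (lact T.C (ev'\<^sub>P e') c') p3 = J TTW ?f t1 p3 e' c'"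
    if y: "t1 \<in> carrier T" "p3 \<in> carrier P" "e' \<in> carrier P.E" "c' \<in> carrier T.C" for t1 p3 e' c'
  proof -
    have k1: "add_map T.C TTW (\<lambda>c. ?k t1 c p3)" by (rule balancedD(4)[OF kb[OF y(1)] y(2)])
    have am: "add_map P.E TTW (\<lambda>e'. ?k t1 (lact T.C (ev'\<^sub>P e') c') p3)"
      by (rule add_map_comp[OF k1], rule llinD(3), (rule y srules)+)
    have eq: "?k t1 (lact T.C (ev'\<^sub>P (x \<diamondop>\<^bsub>P.E\<^esub> x')) c') p3 = tlift TTW (\<lambda>u s. ?f (t1 \<diamondop>\<^bsub>V\<^esub> x) (x' \<diamondop>\<^bsub>V'\<^esub> u) (s \<diamondop>\<^bsub>V\<^esub> p3)) c'"
      if z: "x \<in> carrier P" "x' \<in> carrier P'" for x x'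
    proof (rule sym, rule tlift_ext[OF y(4)])
      have v1: "t1 \<diamondop>\<^bsub>V\<^esub> x \<in> carrier V" by (rule y z srules)+
      have a: "ev'\<^sub>P (x \<diamondop>\<^bsub>P.E\<^esub> x') \<in> carrier A" by (rule y z srules)+
      show "balanced S (restr id \<beta> T') (restr \<beta> id T) TTW (\<lambda>u s. ?f (t1 \<diamondop>\<^bsub>V\<^esub> x) (x' \<diamondop>\<^bsub>V'\<^esub> u) (s \<diamondop>\<^bsub>V\<^esub> p3))"
        by (rule balanced_precomp[OF f2[OF v1]]) (rule y z srules | assumption | drule restr_out)+
      show "add_map T.C TTW (\<lambda>c'. ?k t1 (lact T.C (ev'\<^sub>P (x \<diamondop>\<^bsub>P.E\<^esub> x')) c') p3)"
        by (rule add_map_comp[OF k1], rule rlinD(3), (rule a y z srules)+)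
      fix u s assume "u \<in> carrier (restr id \<beta> T')" "s \<in> carrier (restr \<beta> id T)"
      then have us: "u \<in> carrier T'" "s \<in> carrier T" by (simp_all only: restr_simps)
      have w: "u \<diamondop>\<^bsub>TW\<^esub> (s \<diamondop>\<^bsub>V\<^esub> p3) \<in> carrier TW" "s \<diamondop>\<^bsub>V\<^esub> p3 \<in> carrier V" by (rule y us srules)+
      have au: "lact T' (ev'\<^sub>P (x \<diamondop>\<^bsub>P.E\<^esub> x')) u \<in> carrier T'" by (rule us T.T'.lact_closed a)+
      have "?f (t1 \<diamondop>\<^bsub>V\<^esub> x) (x' \<diamondop>\<^bsub>V'\<^esub> u) (s \<diamondop>\<^bsub>V\<^esub> p3) = \<theta>\<^sub>3 (t1 \<diamondop>\<^bsub>V\<^esub> x) x' \<diamondop>\<^bsub>TTW\<^esub> (u \<diamondop>\<^bsub>TW\<^esub> (s \<diamondop>\<^bsub>V\<^esub> p3))"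
        by (rule tlift_pure_eq refl v1 w us y z srules | assumption | drule restr_out)+
      also have "\<dots> = t1 \<diamondop>\<^bsub>TTW\<^esub> lact TW (ev'\<^sub>P (x \<diamondop>\<^bsub>P.E\<^esub> x')) (u \<diamondop>\<^bsub>TW\<^esub> (s \<diamondop>\<^bsub>V\<^esub> p3))"
        unfolding \<theta>_pure(2)[OF z(2) y(1) z(1)] by (rule pure_middle_eq) (rule a w us y z srules | assumption | drule restr_out)+
      also have "lact TW (ev'\<^sub>P (x \<diamondop>\<^bsub>P.E\<^esub> x')) (u \<diamondop>\<^bsub>TW\<^esub> (s \<diamondop>\<^bsub>V\<^esub> p3)) = lact T' (ev'\<^sub>P (x \<diamondop>\<^bsub>P.E\<^esub> x')) u \<diamondop>\<^bsub>TW\<^esub> (s \<diamondop>\<^bsub>V\<^esub> p3)"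
      proof -
        have "lact TW (ev'\<^sub>P (x \<diamondop>\<^bsub>P.E\<^esub> x')) (u \<diamondop>\<^bsub>TW\<^esub> (s \<diamondop>\<^bsub>V\<^esub> p3)) = lact (restr id \<beta> T') (ev'\<^sub>P (x \<diamondop>\<^bsub>P.E\<^esub> x')) u \<diamondop>\<^bsub>TW\<^esub> (s \<diamondop>\<^bsub>V\<^esub> p3)"
          by (rule lact_pure_eq) (rule a w us y z srules | assumption | drule restr_out)+
        then show ?thesis by (simp only: restr_simps id_apply)
      qed
      also have "t1 \<diamondop>\<^bsub>TTW\<^esub> (lact T' (ev'\<^sub>P (x \<diamondop>\<^bsub>P.E\<^esub> x')) u \<diamondop>\<^bsub>TW\<^esub> (s \<diamondop>\<^bsub>V\<^esub> p3)) = ?k t1 (lact T' (ev'\<^sub>P (x \<diamondop>\<^bsub>P.E\<^esub> x')) u \<diamondop>\<^bsub>T.C\<^esub> s) p3"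
        by (rule sym, (rule tlift_pure_eq refl au us y z srules | assumption | drule restr_out)+)
      finally show "?f (t1 \<diamondop>\<^bsub>V\<^esub> x) (x' \<diamondop>\<^bsub>V'\<^esub> u) (s \<diamondop>\<^bsub>V\<^esub> p3) = ?k t1 (lact T.C (ev'\<^sub>P (x \<diamondop>\<^bsub>P.E\<^esub> x')) (u \<diamondop>\<^bsub>T.C\<^esub> s)) p3"
        unfolding T.act_C(1)[OF a us] .
    qed
    show ?thesis
    proof (rule sym, rule tlift_ext[OF y(3) _ am])
      show "balanced Z (restr id \<kappa> P) (restr \<kappa> id P') TTW (\<lambda>x x'. tlift TTW (\<lambda>u s. ?f (t1 \<diamondop>\<^bsub>V\<^esub> x) (x' \<diamondop>\<^bsub>V'\<^esub> u) (s \<diamondop>\<^bsub>V\<^esub> p3)) c')"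
        by (rule balanced_precomp[OF f1] balanced_precomp[OF f2] y srules | assumption | drule restr_out)+
    qed (rule eq[symmetric], (assumption | drule restr_out)+)
  qed
  have eq: "tlift TTW (\<lambda>v1. tlift TTW (\<lambda>v2 v3. tlift TTW (\<lambda>q u. \<theta>\<^sub>3 v1 q \<diamondop>\<^bsub>TTW\<^esub> (u \<diamondop>\<^bsub>TW\<^esub> v3)) v2)) (\<gamma>\<^sub>V (t \<diamondop>\<^bsub>V\<^esub> p)) = J\<gamma> TTW ?f t p"
    by (rule \<gamma>\<^sub>V_int) (rule h f1 f2 | assumption)+
  show "tlift TTW (\<lambda>t1. tlift TTW (\<lambda>t2 t3. t1 \<diamondop>\<^bsub>TTW\<^esub> (t2 \<diamondop>\<^bsub>TW\<^esub> (t3 \<diamondop>\<^bsub>V\<^esub> p)))) (T.\<gamma>A t) =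
      tlift TTW (\<lambda>v1. tlift TTW (\<lambda>v2 v3. tlift TTW (\<lambda>q u. \<theta>\<^sub>3 v1 q \<diamondop>\<^bsub>TTW\<^esub> (u \<diamondop>\<^bsub>TW\<^esub> v3)) v2)) (\<gamma>\<^sub>V (t \<diamondop>\<^bsub>V\<^esub> p))"
  proof (rule trans[OF _ eq[symmetric]], rule tlift_cong)
    show "T.\<gamma>A t \<in> carrier T.TAC" by (rule T.\<gamma>A_closed[OF h(1)])
    show "balanced A T T.C TTW (\<lambda>t1 c. ?k t1 c p)"
      by (rule h srules | assumption | drule restr_out)+
    fix t1 c assume y: "t1 \<in> carrier T" "c \<in> carrier T.C"
    have "J\<tau> TTW ?f p t1 c = tlift TTW (\<lambda>e p3. tlift TTW (\<lambda>e' c'. ?k t1 (lact T.C (ev'\<^sub>P e') c') p3) (\<sigma> (c \<diamondop>\<^bsub>CE\<^esub> e))) (P.\<tau> p)"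
    proof (rule tlift_cong[OF P.\<tau>_closed[OF h(2)]])
      show "balanced A P.E P TTW (J\<sigma> TTW ?f t1 c)"
        by (rule J\<sigma>_balanced f1 f2 y | assumption)+
      fix e p3 assume z: "e \<in> carrier P.E" "p3 \<in> carrier P"
      have "\<sigma> (c \<diamondop>\<^bsub>CE\<^esub> e) \<in> carrier EC" by (rule y z srules)+
      then show "J\<sigma> TTW ?f t1 c e p3 = tlift TTW (\<lambda>e' c'. ?k t1 (lact T.C (ev'\<^sub>P e') c') p3) (\<sigma> (c \<diamondop>\<^bsub>CE\<^esub> e))"
      proof (rule tlift_cong)
        show "balanced A P.E T.C TTW (J TTW ?f t1 p3)"
          by (rule J_balanced f1 f2 y z | assumption)+
      qed (rule J[symmetric, OF y(1) z(2)])
    qed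
    then show "?k t1 c p = J\<tau> TTW ?f p t1 c"
      using counit_E_int[OF kb[OF y(1)] y(2) h(2)] by (simp only:)
  qed
qed

text \<open>Now \<open>c'\<close> enters through \<open>ev\<^sub>T c'\<close> acting on
  \<open>e'\<close>, and \<open>counit_C_int\<close> removes \<open>\<sigma>\<close> together with
  the coaction of \<open>t\<close>; the coaction of \<open>p\<close> survives and is unfolded to the
  shepherd.\<close>

lemma compat_left: "shepherd_compat_left A S \<beta> Z \<kappa> T T' ev\<^sub>T P P' \<gamma>\<^sub>P \<gamma>\<^sub>V"
  unfolding compat_left_iff[OF \<gamma>\<^sub>V_add]
proof (intro ballI)
  fix t p assume h: "t \<in> carrier T" "p \<in> carrier P"
  let ?f = "\<lambda>v1 v2 v3. tlift VPP (\<lambda>q u. v1 \<diamondop>\<^bsub>VPP\<^esub> (q \<diamondop>\<^bsub>PP\<^esub> \<theta>\<^sub>1 u v3)) v2"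
  let ?k = "\<lambda>y t1 e. tlift VPP (\<lambda>x x'. (t1 \<diamondop>\<^bsub>V\<^esub> x) \<diamondop>\<^bsub>VPP\<^esub> (x' \<diamondop>\<^bsub>PP\<^esub> y)) e"
  have f1: "balanced Z (restr id \<kappa> V) (restr \<kappa> id V') VPP (\<lambda>a b. ?f a b v)" if "v \<in> carrier V" for v
    by (rule that srules | assumption | drule restr_out)+
  have f2: "balanced S (restr id \<beta> V') (restr \<beta> id V) VPP (?f v)" if "v \<in> carrier V" for v
    by (rule that srules | assumption | drule restr_out)+
  have kb: "balanced A T P.E VPP (?k y)" if "y \<in> carrier P" for y
    by (rule that srules | assumption | drule restr_out)+
  have J: "J VPP ?f t1 p3 e' c' = ?k p3 t1 (ract P.E e' (ev\<^sub>T c'))"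
    if y: "t1 \<in> carrier T" "p3 \<in> carrier P" "e' \<in> carrier P.E" "c' \<in> carrier T.C" for t1 p3 e' c'
  proof (rule tlift_ext[OF y(3)])
    have a: "ev\<^sub>T c' \<in> carrier A" by (rule y srules)+
    have k1: "add_map P.E VPP (?k p3 t1)" by (rule balancedD(5)[OF kb[OF y(2)] y(1)])
    show "add_map P.E VPP (\<lambda>e'. ?k p3 t1 (ract P.E e' (ev\<^sub>T c')))"
      by (rule add_map_comp[OF k1], rule llinD(3), (rule a y srules)+)
    show "balanced Z (restr id \<kappa> P) (restr \<kappa> id P') VPP (\<lambda>x x'. tlift VPP (\<lambda>u s. ?f (t1 \<diamondop>\<^bsub>V\<^esub> x) (x' \<diamondop>\<^bsub>V'\<^esub> u) (s \<diamondop>\<^bsub>V\<^esub> p3)) c')"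
      by (rule balanced_precomp[OF f1] balanced_precomp[OF f2] y srules | assumption | drule restr_out)+
    fix x x' assume "x \<in> carrier (restr id \<kappa> P)" "x' \<in> carrier (restr \<kappa> id P')"
    then have z: "x \<in> carrier P" "x' \<in> carrier P'" by (simp_all only: restr_simps)
    have v1: "t1 \<diamondop>\<^bsub>V\<^esub> x \<in> carrier V" by (rule y z srules)+
    have xa: "ract P' x' (ev\<^sub>T c') \<in> carrier P'" by (rule z P.T'.ract_closed a)+
    have "tlift VPP (\<lambda>u s. ?f (t1 \<diamondop>\<^bsub>V\<^esub> x) (x' \<diamondop>\<^bsub>V'\<^esub> u) (s \<diamondop>\<^bsub>V\<^esub> p3)) c' =
      (t1 \<diamondop>\<^bsub>V\<^esub> x) \<diamondop>\<^bsub>VPP\<^esub> (x' \<diamondop>\<^bsub>PP\<^esub> lact P (ev\<^sub>T c') p3)"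
    proof (rule tlift_ext[OF y(4)])
      show "balanced S (restr id \<beta> T') (restr \<beta> id T) VPP (\<lambda>u s. ?f (t1 \<diamondop>\<^bsub>V\<^esub> x) (x' \<diamondop>\<^bsub>V'\<^esub> u) (s \<diamondop>\<^bsub>V\<^esub> p3))"
        by (rule balanced_precomp[OF f2[OF v1]]) (rule y z srules | assumption | drule restr_out)+
      have "llin A T.C P (\<lambda>c. lact P (ev\<^sub>T c) p3)" by (rule y srules)+
      from llinD(3)[OF this] show "add_map T.C VPP (\<lambda>c'. (t1 \<diamondop>\<^bsub>V\<^esub> x) \<diamondop>\<^bsub>VPP\<^esub> (x' \<diamondop>\<^bsub>PP\<^esub> lact P (ev\<^sub>T c') p3))"
        by - (rule add_map_pure_right add_map_pure_left restr_intros v1 y z srules | assumption | drule restr_out)+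
      fix u s assume "u \<in> carrier (restr id \<beta> T')" "s \<in> carrier (restr \<beta> id T)"
      then have us: "u \<in> carrier T'" "s \<in> carrier T" by (simp_all only: restr_simps)
      have w: "s \<diamondop>\<^bsub>V\<^esub> p3 \<in> carrier V" by (rule y us srules)+
      have "?f (t1 \<diamondop>\<^bsub>V\<^esub> x) (x' \<diamondop>\<^bsub>V'\<^esub> u) (s \<diamondop>\<^bsub>V\<^esub> p3) = (t1 \<diamondop>\<^bsub>V\<^esub> x) \<diamondop>\<^bsub>VPP\<^esub> (x' \<diamondop>\<^bsub>PP\<^esub> \<theta>\<^sub>1 u (s \<diamondop>\<^bsub>V\<^esub> p3))"
        by (rule tlift_pure_eq refl v1 w us y z srules | assumption | drule restr_out)+
      then show "?f (t1 \<diamondop>\<^bsub>V\<^esub> x) (x' \<diamondop>\<^bsub>V'\<^esub> u) (s \<diamondop>\<^bsub>V\<^esub> p3) =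
          (t1 \<diamondop>\<^bsub>V\<^esub> x) \<diamondop>\<^bsub>VPP\<^esub> (x' \<diamondop>\<^bsub>PP\<^esub> lact P (ev\<^sub>T (u \<diamondop>\<^bsub>T.C\<^esub> s)) p3)"
        unfolding \<theta>_pure(1)[OF us y(2)] .
    qed
    also have "x' \<diamondop>\<^bsub>PP\<^esub> lact P (ev\<^sub>T c') p3 = ract P' x' (ev\<^sub>T c') \<diamondop>\<^bsub>PP\<^esub> p3"
      by (rule pure_middle_eq[symmetric]) (rule a y z srules)+
    also have "(t1 \<diamondop>\<^bsub>V\<^esub> x) \<diamondop>\<^bsub>VPP\<^esub> (ract P' x' (ev\<^sub>T c') \<diamondop>\<^bsub>PP\<^esub> p3) = ?k p3 t1 (x \<diamondop>\<^bsub>P.E\<^esub> ract P' x' (ev\<^sub>T c'))"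
      by (rule sym, (rule tlift_pure_eq refl xa y z srules | assumption | drule restr_out)+)
    finally show "tlift VPP (\<lambda>u s. ?f (t1 \<diamondop>\<^bsub>V\<^esub> x) (x' \<diamondop>\<^bsub>V'\<^esub> u) (s \<diamondop>\<^bsub>V\<^esub> p3)) c' =
        ?k p3 t1 (ract P.E (x \<diamondop>\<^bsub>P.E\<^esub> x') (ev\<^sub>T c'))"
      unfolding P.act_E(2)[OF a z] .
  qed
  have eq: "tlift VPP (\<lambda>v1. tlift VPP (\<lambda>v2 v3. tlift VPP (\<lambda>q u. v1 \<diamondop>\<^bsub>VPP\<^esub> (q \<diamondop>\<^bsub>PP\<^esub> \<theta>\<^sub>1 u v3)) v2)) (\<gamma>\<^sub>V (t \<diamondop>\<^bsub>V\<^esub> p)) = J\<gamma> VPP ?f t p"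
    by (rule \<gamma>\<^sub>V_int) (rule h f1 f2 | assumption)+
  have J\<sigma>: "J\<sigma> VPP ?f t1 c e p3 = tlift VPP (\<lambda>e' c'. ?k p3 t1 (ract P.E e' (ev\<^sub>T c'))) (\<sigma> (c \<diamondop>\<^bsub>CE\<^esub> e))"
    if y: "t1 \<in> carrier T" "c \<in> carrier T.C" "e \<in> carrier P.E" "p3 \<in> carrier P" for t1 c e p3
  proof (rule tlift_cong)
    show "\<sigma> (c \<diamondop>\<^bsub>CE\<^esub> e) \<in> carrier EC" by (rule y srules)+
    show "balanced A P.E T.C VPP (J VPP ?f t1 p3)"
      by (rule J_balanced f1 f2 y | assumption)+
  qed (rule J[OF y(1,4)])
  \<comment> \<open>\<open>counit_C_int\<close> contracts the sum over the coaction of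
    \<open>t\<close>, which therefore has to be moved inside the sum over the coaction of
    \<open>p\<close>.\<close>
  have "J\<gamma> VPP ?f t p = tlift VPP (\<lambda>e p3. tlift VPP (\<lambda>t1 c. J\<sigma> VPP ?f t1 c e p3) (T.\<gamma>A t)) (P.\<tau> p)"
    by (rule tlift_swap) (rule J\<sigma>_balanced T.\<gamma>A_closed P.\<tau>_closed f1 f2 h bal | assumption)+
  also have "\<dots> = tlift VPP (\<lambda>e p3. ?k p3 t e) (P.\<tau> p)"
  proof (rule sym, rule tlift_cong[OF P.\<tau>_closed[OF h(2)]])
    show "balanced A P.E P VPP (\<lambda>e p3. ?k p3 t e)"
      by (rule h srules | assumption | drule restr_out)+
    fix e p3 assume z: "e \<in> carrier P.E" "p3 \<in> carrier P"
    have "tlift VPP (\<lambda>t1 c. J\<sigma> VPP ?f t1 c e p3) (T.\<gamma>A t) =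
      tlift VPP (\<lambda>t1 c. tlift VPP (\<lambda>e' c'. ?k p3 t1 (ract P.E e' (ev\<^sub>T c'))) (\<sigma> (c \<diamondop>\<^bsub>CE\<^esub> e))) (T.\<gamma>A t)"
    proof (rule tlift_cong[OF T.\<gamma>A_closed[OF h(1)]])
      show "balanced A T T.C VPP (\<lambda>t1 c. J\<sigma> VPP ?f t1 c e p3)"
        by (rule J\<sigma>_balanced f1 f2 z | assumption)+
    qed (rule J\<sigma>, (assumption | rule z)+)
    then show "?k p3 t e = tlift VPP (\<lambda>t1 c. J\<sigma> VPP ?f t1 c e p3) (T.\<gamma>A t)"
      using counit_C_int[OF kb[OF z(2)] z(1) h(1)] by (simp only:)
  qed
  also have "\<dots> = tlift VPP (\<lambda>p1. tlift VPP (\<lambda>p2 p3. ?k p3 t (p1 \<diamondop>\<^bsub>P.E\<^esub> p2))) (\<gamma>\<^sub>P p)"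
    by (rule P.\<tau>_int[OF h(2)]) (rule h srules | assumption | drule restr_out)+
  also have "\<dots> = tlift VPP (\<lambda>p1. tlift VPP (\<lambda>p2 p3. (t \<diamondop>\<^bsub>V\<^esub> p1) \<diamondop>\<^bsub>VPP\<^esub> (p2 \<diamondop>\<^bsub>PP\<^esub> p3))) (\<gamma>\<^sub>P p)"
    by (rule tlift_pure_eq tlift_cong refl h srules | assumption | drule restr_out)+
  finally show "tlift VPP (\<lambda>p1. tlift VPP (\<lambda>p2 p3. (t \<diamondop>\<^bsub>V\<^esub> p1) \<diamondop>\<^bsub>VPP\<^esub> (p2 \<diamondop>\<^bsub>PP\<^esub> p3))) (\<gamma>\<^sub>P p) =
      tlift VPP (\<lambda>v1. tlift VPP (\<lambda>v2 v3. tlift VPP (\<lambda>q u. v1 \<diamondop>\<^bsub>VPP\<^esub> (q \<diamondop>\<^bsub>PP\<^esub> \<theta>\<^sub>1 u v3)) v2)) (\<gamma>\<^sub>V (t \<diamondop>\<^bsub>V\<^esub> p))"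
    unfolding eq by (rule sym)
qed

lemma \<gamma>\<^sub>V_closed: "v \<in> carrier V \<Longrightarrow> \<gamma>\<^sub>V v \<in> carrier VCV"
  by (rule add_map_closed[OF \<gamma>\<^sub>V_add])

lemmas vrules = \<gamma>\<^sub>V_closed ev\<^sub>V_rules ev\<^sub>V_closed add_map_comp[OF \<gamma>\<^sub>V_add] srules

text \<open>\<open>ev'\<^sub>V (v1 \<otimes> v2)\<close> is a sum of values
  \<open>ev'\<^sub>T (\<theta>\<^sub>3 v1 q \<otimes> u)\<close>, so the first compatibility
  condition reduces the claim to the evaluation law of \<open>T\<close>, with
  \<open>t3 \<otimes> p\<close> in the last place.\<close>

lemma \<gamma>\<^sub>V_ev':
  assumes x: "x \<in> carrier V"
  shows "(let Q = regular B \<^bold>\<otimes>\<^bsub>S,\<beta>\<^esub> V in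
    tlift3 Q (\<lambda>x1 x2 x3. ev'\<^sub>V (x1 \<diamondop>\<^bsub>EV\<^esub> x2) \<diamondop>\<^bsub>Q\<^esub> x3) (\<gamma>\<^sub>V x) = \<one>\<^bsub>B\<^esub> \<diamondop>\<^bsub>Q\<^esub> x)"
  unfolding Let_def tlift3_def
proof (rule V_ext[OF x])
  let ?Q = "regular B \<^bold>\<otimes>\<^bsub>S,\<beta>\<^esub> V"
  have one: "\<one>\<^bsub>B\<^esub> \<in> carrier (regular B)"
    using T.\<beta>.S.one_closed by (simp add: regular_simps)
  show "add_map V ?Q (\<lambda>x. tlift ?Q (\<lambda>x1. tlift ?Q (\<lambda>x2 x3. ev'\<^sub>V (x1 \<diamondop>\<^bsub>EV\<^esub> x2) \<diamondop>\<^bsub>?Q\<^esub> x3)) (\<gamma>\<^sub>V x))"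
    by (rule vrules | assumption | drule restr_out)+
  show "add_map V ?Q (\<lambda>x. \<one>\<^bsub>B\<^esub> \<diamondop>\<^bsub>?Q\<^esub> x)"
    by (rule add_map_pure_right restr_intros one add_map_id vrules | assumption | drule restr_out)+
  fix t p assume h: "t \<in> carrier T" "p \<in> carrier P"
  have v: "t \<diamondop>\<^bsub>V\<^esub> p \<in> carrier V" by (rule h srules)+
  let ?h = "\<lambda>x u v. ev'\<^sub>T (x \<diamondop>\<^bsub>T.E\<^esub> u) \<diamondop>\<^bsub>?Q\<^esub> v"
  have am: "add_map (regular B) ?Q (\<lambda>b. b \<diamondop>\<^bsub>?Q\<^esub> v)" if "v \<in> carrier V" for v
    by (rule add_map_pure_left restr_intros that add_map_id vrules | assumption | drule restr_out)+
  have h1: "balanced A T T' ?Q (\<lambda>x u. ?h x u v)" if "v \<in> carrier V" for v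
    by (rule balanced_map[OF am[OF that] T.balanced_ev'])
  have h2: "balanced S (restr id \<beta> T') (restr \<beta> id V) ?Q (?h x)" if "x \<in> carrier T" for x
    by (rule that vrules | assumption | drule restr_out)+
  have eq: "tlift ?Q (\<lambda>q u. ?h (\<theta>\<^sub>3 v1 q) u v3) v2 = ev'\<^sub>V (v1 \<diamondop>\<^bsub>EV\<^esub> v2) \<diamondop>\<^bsub>?Q\<^esub> v3"
    if y: "v1 \<in> carrier V" "v2 \<in> carrier V'" "v3 \<in> carrier V" for v1 v2 v3
  proof (rule tlift_ext[OF y(2)])
    show "balanced A P' T' ?Q (\<lambda>q u. ?h (\<theta>\<^sub>3 v1 q) u v3)"
      by (rule balanced_precomp[OF h1[OF y(3)]]) (rule y srules)+
    show "add_map V' ?Q (\<lambda>v2. ev'\<^sub>V (v1 \<diamondop>\<^bsub>EV\<^esub> v2) \<diamondop>\<^bsub>?Q\<^esub> v3)"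
      by (rule add_map_comp[OF am[OF y(3)]], rule rlinD(3)) (rule y vrules)+
    show "?h (\<theta>\<^sub>3 v1 q) u v3 = ev'\<^sub>V (v1 \<diamondop>\<^bsub>EV\<^esub> (q \<diamondop>\<^bsub>V'\<^esub> u)) \<diamondop>\<^bsub>?Q\<^esub> v3"
      if "q \<in> carrier P'" "u \<in> carrier T'" for q u
      unfolding ev'\<^sub>V_pures[OF y(1) that] ..
  qed
  have "tlift ?Q (\<lambda>x1. tlift ?Q (\<lambda>x2 x3. ev'\<^sub>V (x1 \<diamondop>\<^bsub>EV\<^esub> x2) \<diamondop>\<^bsub>?Q\<^esub> x3)) (\<gamma>\<^sub>V (t \<diamondop>\<^bsub>V\<^esub> p)) =
    tlift ?Q (\<lambda>v1. tlift ?Q (\<lambda>v2 v3. tlift ?Q (\<lambda>q u. ?h (\<theta>\<^sub>3 v1 q) u v3) v2)) (\<gamma>\<^sub>V (t \<diamondop>\<^bsub>V\<^esub> p))"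
    by (rule eq[symmetric] tlift_cong v vrules | assumption | drule restr_out)+
  also have "\<dots> = tlift ?Q (\<lambda>t1. tlift ?Q (\<lambda>t2 t3. ?h t1 t2 (t3 \<diamondop>\<^bsub>V\<^esub> p))) (T.\<gamma>A t)"
    by (rule compat_right_imp[OF \<gamma>\<^sub>V_add compat_right h, symmetric]) (rule h1 h2 | assumption)+
  also have "\<dots> = \<one>\<^bsub>B\<^esub> \<diamondop>\<^bsub>?Q\<^esub> (t \<diamondop>\<^bsub>V\<^esub> p)"
    by (rule T.\<gamma>A_counit'[OF h(1)]) (rule h vrules | assumption | drule restr_out)+
  finally show "tlift ?Q (\<lambda>x1. tlift ?Q (\<lambda>x2 x3. ev'\<^sub>V (x1 \<diamondop>\<^bsub>EV\<^esub> x2) \<diamondop>\<^bsub>?Q\<^esub> x3)) (\<gamma>\<^sub>V (t \<diamondop>\<^bsub>V\<^esub> p)) =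
    \<one>\<^bsub>B\<^esub> \<diamondop>\<^bsub>?Q\<^esub> (t \<diamondop>\<^bsub>V\<^esub> p)" .
qed

text \<open>\<open>ev\<^sub>V\<close> closes the last component by \<open>\<theta>\<^sub>1\<close>,
  so the second compatibility condition reduces the claim to the evaluation law of
  \<open>P\<close>.\<close>

lemma \<gamma>\<^sub>V_ev:
  assumes x: "x \<in> carrier V"
  shows "(let Q = V \<^bold>\<otimes>\<^bsub>Z,\<kappa>\<^esub> regular K in
    tlift3 Q (\<lambda>x1 x2 x3. x1 \<diamondop>\<^bsub>Q\<^esub> ev\<^sub>V (x2 \<diamondop>\<^bsub>CV\<^esub> x3)) (\<gamma>\<^sub>V x) = x \<diamondop>\<^bsub>Q\<^esub> \<one>\<^bsub>K\<^esub>)"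
  unfolding Let_def tlift3_def
proof (rule V_ext[OF x])
  let ?Q = "V \<^bold>\<otimes>\<^bsub>Z,\<kappa>\<^esub> regular K"
  have one: "\<one>\<^bsub>K\<^esub> \<in> carrier (regular K)"
    using P.\<alpha>.S.one_closed by (simp add: regular_simps)
  show "add_map V ?Q (\<lambda>x. tlift ?Q (\<lambda>x1. tlift ?Q (\<lambda>x2 x3. x1 \<diamondop>\<^bsub>?Q\<^esub> ev\<^sub>V (x2 \<diamondop>\<^bsub>CV\<^esub> x3))) (\<gamma>\<^sub>V x))"
    by (rule vrules | assumption | drule restr_out)+
  show "add_map V ?Q (\<lambda>x. x \<diamondop>\<^bsub>?Q\<^esub> \<one>\<^bsub>K\<^esub>)"
    by (rule add_map_pure_left restr_intros one add_map_id vrules | assumption | drule restr_out)+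
  fix t p assume h: "t \<in> carrier T" "p \<in> carrier P"
  have v: "t \<diamondop>\<^bsub>V\<^esub> p \<in> carrier V" by (rule h srules)+
  let ?h = "\<lambda>v q y. v \<diamondop>\<^bsub>?Q\<^esub> ev\<^sub>P (q \<diamondop>\<^bsub>P.C\<^esub> y)"
  have am: "add_map (regular K) ?Q (\<lambda>k. v \<diamondop>\<^bsub>?Q\<^esub> k)" if "v \<in> carrier V" for v
    by (rule add_map_pure_right restr_intros that add_map_id vrules | assumption | drule restr_out)+
  have h1: "balanced Z (restr id \<kappa> V) (restr \<kappa> id P') ?Q (\<lambda>v q. ?h v q y)" if "y \<in> carrier P" for y
    by (rule that vrules | assumption | drule restr_out)+
  have h2: "balanced A P' P ?Q (?h v)" if "v \<in> carrier V" for v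
    by (rule balanced_map[OF am[OF that] P.balanced_ev])
  have eq: "tlift ?Q (\<lambda>q u. ?h v1 q (\<theta>\<^sub>1 u v3)) v2 = v1 \<diamondop>\<^bsub>?Q\<^esub> ev\<^sub>V (v2 \<diamondop>\<^bsub>CV\<^esub> v3)"
    if y: "v1 \<in> carrier V" "v2 \<in> carrier V'" "v3 \<in> carrier V" for v1 v2 v3
  proof (rule tlift_ext[OF y(2)])
    show "balanced A P' T' ?Q (\<lambda>q u. ?h v1 q (\<theta>\<^sub>1 u v3))"
      by (rule balanced_precomp[OF h2[OF y(1)]]) (rule y srules)+
    show "add_map V' ?Q (\<lambda>v2. v1 \<diamondop>\<^bsub>?Q\<^esub> ev\<^sub>V (v2 \<diamondop>\<^bsub>CV\<^esub> v3))"
      by (rule add_map_comp[OF am[OF y(1)]], rule llinD(3)) (rule y vrules)+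
    show "?h v1 q (\<theta>\<^sub>1 u v3) = v1 \<diamondop>\<^bsub>?Q\<^esub> ev\<^sub>V ((q \<diamondop>\<^bsub>V'\<^esub> u) \<diamondop>\<^bsub>CV\<^esub> v3)"
      if "q \<in> carrier P'" "u \<in> carrier T'" for q u
      unfolding ev\<^sub>V_pures[OF that y(3)] ..
  qed
  have "tlift ?Q (\<lambda>x1. tlift ?Q (\<lambda>x2 x3. x1 \<diamondop>\<^bsub>?Q\<^esub> ev\<^sub>V (x2 \<diamondop>\<^bsub>CV\<^esub> x3))) (\<gamma>\<^sub>V (t \<diamondop>\<^bsub>V\<^esub> p)) =
    tlift ?Q (\<lambda>v1. tlift ?Q (\<lambda>v2 v3. tlift ?Q (\<lambda>q u. ?h v1 q (\<theta>\<^sub>1 u v3)) v2)) (\<gamma>\<^sub>V (t \<diamondop>\<^bsub>V\<^esub> p))"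
    by (rule eq[symmetric] tlift_cong v vrules | assumption | drule restr_out)+
  also have "\<dots> = tlift ?Q (\<lambda>p1. tlift ?Q (\<lambda>p2 p3. ?h (t \<diamondop>\<^bsub>V\<^esub> p1) p2 p3)) (\<gamma>\<^sub>P p)"
    by (rule compat_left_imp[OF \<gamma>\<^sub>V_add compat_left h, symmetric]) (rule h1 h2 | assumption)+
  also have "\<dots> = (t \<diamondop>\<^bsub>V\<^esub> p) \<diamondop>\<^bsub>?Q\<^esub> \<one>\<^bsub>K\<^esub>"
    by (rule P.shepherd_ev_int'[OF h(2)]) (rule h vrules | assumption | drule restr_out)+
  finally show "tlift ?Q (\<lambda>x1. tlift ?Q (\<lambda>x2 x3. x1 \<diamondop>\<^bsub>?Q\<^esub> ev\<^sub>V (x2 \<diamondop>\<^bsub>CV\<^esub> x3))) (\<gamma>\<^sub>V (t \<diamondop>\<^bsub>V\<^esub> p)) =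
    (t \<diamondop>\<^bsub>V\<^esub> p) \<diamondop>\<^bsub>?Q\<^esub> \<one>\<^bsub>K\<^esub>" .
qed

section \<open>Coassociativity of the new shepherd\<close>

abbreviation "V4 \<equiv> V' \<^bold>\<otimes>\<^bsub>S,\<beta>\<^esub> VCV"
abbreviation "V5 \<equiv> V \<^bold>\<otimes>\<^bsub>Z,\<kappa>\<^esub> V4"
abbreviation "pure5 a1 a2 a3 a4 a5 \<equiv> a1 \<diamondop>\<^bsub>V5\<^esub> (a2 \<diamondop>\<^bsub>V4\<^esub> pureV a3 a4 a5)"
text \<open>The integrand to which \<open>comult_coassoc\<close> is applied. The six factors
  \<open>T, E, C, E, C, P\<close> are opened up into ten, and these regroup in pairs as
  \<open>V, V', V, V', V\<close>.\<close>

abbreviation "F5 m e1 d e2 c n \<equiv> tlift V5 (\<lambda>y y'. tlift V5 (\<lambda>w r. tlift V5 (\<lambda>x x'. tlift V5 (\<lambda>u s.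
  pure5 (m \<diamondop>\<^bsub>V\<^esub> y) (y' \<diamondop>\<^bsub>V'\<^esub> w) (r \<diamondop>\<^bsub>V\<^esub> x) (x' \<diamondop>\<^bsub>V'\<^esub> u) (s \<diamondop>\<^bsub>V\<^esub> n)) c) e2) d) e1"

lemmas wrules = rlin_comp[OF \<gamma>\<^sub>V_r] llin_comp[OF \<gamma>\<^sub>V_l] vrules

lemma pure5_balanced:
  "\<lbrakk>a3 \<in> carrier V; a4 \<in> carrier V'; a5 \<in> carrier V\<rbrakk> \<Longrightarrow> balanced Z (restr id \<kappa> V) (restr \<kappa> id V') V5 (\<lambda>a1 a2. pure5 a1 a2 a3 a4 a5)"
  "\<lbrakk>a1 \<in> carrier V; a4 \<in> carrier V'; a5 \<in> carrier V\<rbrakk> \<Longrightarrow> balanced S (restr id \<beta> V') (restr \<beta> id V) V5 (\<lambda>a2 a3. pure5 a1 a2 a3 a4 a5)"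
  "\<lbrakk>a1 \<in> carrier V; a2 \<in> carrier V'; a5 \<in> carrier V\<rbrakk> \<Longrightarrow> balanced Z (restr id \<kappa> V) (restr \<kappa> id V') V5 (\<lambda>a3 a4. pure5 a1 a2 a3 a4 a5)"
  "\<lbrakk>a1 \<in> carrier V; a2 \<in> carrier V'; a3 \<in> carrier V\<rbrakk> \<Longrightarrow> balanced S (restr id \<beta> V') (restr \<beta> id V) V5 (\<lambda>a4 a5. pure5 a1 a2 a3 a4 a5)"
  by (rule srules | assumption | drule restr_out)+

lemma F5_balanced1:
  "\<lbrakk>d \<in> carrier T.C; e2 \<in> carrier P.E; c \<in> carrier T.C; n \<in> carrier P\<rbrakk> \<Longrightarrow> balanced A T P.E V5 (\<lambda>m e1. F5 m e1 d e2 c n)"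
  by (rule srules | assumption | drule restr_out)+
lemma F5_balanced2:
  "\<lbrakk>m \<in> carrier T; e2 \<in> carrier P.E; c \<in> carrier T.C; n \<in> carrier P\<rbrakk> \<Longrightarrow> balanced A P.E T.C V5 (\<lambda>e1 d. F5 m e1 d e2 c n)"
  by (rule srules | assumption | drule restr_out)+
lemma F5_balanced3:
  "\<lbrakk>m \<in> carrier T; e1 \<in> carrier P.E; c \<in> carrier T.C; n \<in> carrier P\<rbrakk> \<Longrightarrow> balanced A T.C P.E V5 (\<lambda>d e2. F5 m e1 d e2 c n)"
  by (rule srules | assumption | drule restr_out)+
lemma F5_balanced4:
  "\<lbrakk>m \<in> carrier T; e1 \<in> carrier P.E; d \<in> carrier T.C; n \<in> carrier P\<rbrakk> \<Longrightarrow> balanced A P.E T.C V5 (\<lambda>e2 c. F5 m e1 d e2 c n)"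
  by (rule srules | assumption | drule restr_out)+
lemma F5_balanced5:
  "\<lbrakk>m \<in> carrier T; e1 \<in> carrier P.E; d \<in> carrier T.C; e2 \<in> carrier P.E\<rbrakk> \<Longrightarrow> balanced A T.C P V5 (\<lambda>c n. F5 m e1 d e2 c n)"
  by (rule srules | assumption | drule restr_out)+

lemmas F5_balanced = F5_balanced1 F5_balanced2 F5_balanced3 F5_balanced4 F5_balanced5

lemma coassoc_L_balanced:
  "v \<in> carrier V \<Longrightarrow> balanced Z (restr id \<kappa> V) (restr \<kappa> id V') V5
    (\<lambda>a b. tlift V5 (\<lambda>y1. tlift V5 (\<lambda>y2 y3. pure5 y1 y2 y3 b v)) (\<gamma>\<^sub>V a))"
  "v \<in> carrier V \<Longrightarrow> balanced S (restr id \<beta> V') (restr \<beta> id V) V5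
    (\<lambda>b c. tlift V5 (\<lambda>y1. tlift V5 (\<lambda>y2 y3. pure5 y1 y2 y3 b c)) (\<gamma>\<^sub>V v))"
  by (rule wrules | assumption | drule restr_out)+

lemma coassoc_R_balanced:
  "v \<in> carrier V \<Longrightarrow> balanced Z (restr id \<kappa> V) (restr \<kappa> id V') V5
    (\<lambda>a b. tlift V5 (\<lambda>y1. tlift V5 (\<lambda>y2 y3. pure5 a b y1 y2 y3)) (\<gamma>\<^sub>V v))"
  "v \<in> carrier V \<Longrightarrow> balanced S (restr id \<beta> V') (restr \<beta> id V) V5
    (\<lambda>b c. tlift V5 (\<lambda>y1. tlift V5 (\<lambda>y2 y3. pure5 v b y1 y2 y3)) (\<gamma>\<^sub>V c))"
  by (rule wrules | assumption | drule restr_out)+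

text \<open>The second shepherd is taken at \<open>t1 \<otimes> x\<close>, where
  \<open>x \<otimes> x'\<close> is a component of \<open>e'\<close>. It coacts on \<open>x\<close>
  while \<open>x'\<close> is carried along, and that is the coproduct of \<open>E\<close> at
  \<open>x \<otimes> x'\<close>.\<close>

lemma coassoc_L:
  assumes y: "t1 \<in> carrier T" "p3 \<in> carrier P" "e' \<in> carrier P.E" "c' \<in> carrier T.C"
  shows "J V5 (\<lambda>a b c. tlift V5 (\<lambda>y1. tlift V5 (\<lambda>y2 y3. pure5 y1 y2 y3 b c)) (\<gamma>\<^sub>V a)) t1 p3 e' c' =
    tlift V5 (\<lambda>m1 d. tlift V5 (\<lambda>e1 e2. tlift V5 (\<lambda>e1' d'. F5 m1 e1' d' e2 c' p3)
      (\<sigma> (d \<diamondop>\<^bsub>CE\<^esub> e1))) (P.\<Delta>E e')) (T.\<gamma>A t1)"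
proof (rule tlift_ext[OF y(3)])
  let ?g = "\<lambda>a b c. tlift V5 (\<lambda>y1. tlift V5 (\<lambda>y2 y3. pure5 y1 y2 y3 b c)) (\<gamma>\<^sub>V a)"
  let ?G = "\<lambda>e' c'. tlift V5 (\<lambda>m1 d. tlift V5 (\<lambda>e1 e2. tlift V5 (\<lambda>e1' d'. F5 m1 e1' d' e2 c' p3)
      (\<sigma> (d \<diamondop>\<^bsub>CE\<^esub> e1))) (P.\<Delta>E e')) (T.\<gamma>A t1)"
  note g = balanced_precomp[OF coassoc_L_balanced(1)] balanced_precomp[OF coassoc_L_balanced(2)]
  show "balanced Z (restr id \<kappa> P) (restr \<kappa> id P') V5 (\<lambda>x x'. tlift V5 (\<lambda>u s. ?g (t1 \<diamondop>\<^bsub>V\<^esub> x) (x' \<diamondop>\<^bsub>V'\<^esub> u) (s \<diamondop>\<^bsub>V\<^esub> p3)) c')"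
    by (rule g y srules | assumption | drule restr_out)+
  show "add_map P.E V5 (\<lambda>e'. ?G e' c')"
    by (rule F5_balanced y srules | assumption | drule restr_out)+
  fix x x' assume "x \<in> carrier (restr id \<kappa> P)" "x' \<in> carrier (restr \<kappa> id P')"
  then have z: "x \<in> carrier P" "x' \<in> carrier P'" by (simp_all only: restr_simps)
  have e: "x \<diamondop>\<^bsub>P.E\<^esub> x' \<in> carrier P.E" and v1: "t1 \<diamondop>\<^bsub>V\<^esub> x \<in> carrier V" by (rule y z srules)+
  show "tlift V5 (\<lambda>u s. ?g (t1 \<diamondop>\<^bsub>V\<^esub> x) (x' \<diamondop>\<^bsub>V'\<^esub> u) (s \<diamondop>\<^bsub>V\<^esub> p3)) c' = ?G (x \<diamondop>\<^bsub>P.E\<^esub> x') c'"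
  proof (rule tlift_ext[OF y(4)])
    show "balanced S (restr id \<beta> T') (restr \<beta> id T) V5 (\<lambda>u s. ?g (t1 \<diamondop>\<^bsub>V\<^esub> x) (x' \<diamondop>\<^bsub>V'\<^esub> u) (s \<diamondop>\<^bsub>V\<^esub> p3))"
      by (rule g v1 y z srules | assumption | drule restr_out)+
    show "add_map T.C V5 (\<lambda>c'. ?G (x \<diamondop>\<^bsub>P.E\<^esub> x') c')"
      by (rule F5_balanced e y srules | assumption | drule restr_out)+
    fix u s assume "u \<in> carrier (restr id \<beta> T')" "s \<in> carrier (restr \<beta> id T)"
    then have us: "u \<in> carrier T'" "s \<in> carrier T" by (simp_all only: restr_simps)
    have b: "x' \<diamondop>\<^bsub>V'\<^esub> u \<in> carrier V'" and v: "s \<diamondop>\<^bsub>V\<^esub> p3 \<in> carrier V" and c: "u \<diamondop>\<^bsub>T.C\<^esub> s \<in> carrier T.C" by (rule us y z srules)+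
    let ?f = "\<lambda>a1 a2 a3. pure5 a1 a2 a3 (x' \<diamondop>\<^bsub>V'\<^esub> u) (s \<diamondop>\<^bsub>V\<^esub> p3)"
    note f = pure5_balanced(1,2)[OF _ b v]
    have F: "J V5 ?f m p' e1 d = F5 m e1 d (p' \<diamondop>\<^bsub>P.E\<^esub> x') (u \<diamondop>\<^bsub>T.C\<^esub> s) p3"
      if "m \<in> carrier T" "e1 \<in> carrier P.E" "d \<in> carrier T.C" "p' \<in> carrier P" for m e1 d p'
      by (rule sym, (rule tlift_pure_eq tlift_cong refl that y z us srules | assumption | drule restr_out)+)
    have 1: "?g (t1 \<diamondop>\<^bsub>V\<^esub> x) (x' \<diamondop>\<^bsub>V'\<^esub> u) (s \<diamondop>\<^bsub>V\<^esub> p3) = J\<gamma> V5 ?f t1 x"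
      by (rule \<gamma>\<^sub>V_int) (rule y z f | assumption)+
    have 2: "J\<gamma> V5 ?f t1 x = tlift V5 (\<lambda>m1 d. tlift V5 (\<lambda>e1 p'. tlift V5 (\<lambda>e1' d'. F5 m1 e1' d' (p' \<diamondop>\<^bsub>P.E\<^esub> x') (u \<diamondop>\<^bsub>T.C\<^esub> s) p3)
      (\<sigma> (d \<diamondop>\<^bsub>CE\<^esub> e1))) (P.\<tau> x)) (T.\<gamma>A t1)"
    proof (rule tlift_cong[OF T.\<gamma>A_closed[OF y(1)]])
      show "balanced A T T.C V5 (J\<tau> V5 ?f x)" by (rule J\<tau>_balanced f z | assumption)+
      fix m1 d assume md: "m1 \<in> carrier T" "d \<in> carrier T.C"
      show "J\<tau> V5 ?f x m1 d = tlift V5 (\<lambda>e1 p'. tlift V5 (\<lambda>e1' d'. F5 m1 e1' d' (p' \<diamondop>\<^bsub>P.E\<^esub> x') (u \<diamondop>\<^bsub>T.C\<^esub> s) p3)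
        (\<sigma> (d \<diamondop>\<^bsub>CE\<^esub> e1))) (P.\<tau> x)"
      proof (rule tlift_cong[OF P.\<tau>_closed[OF z(1)]])
        show "balanced A P.E P V5 (J\<sigma> V5 ?f m1 d)" by (rule J\<sigma>_balanced f md | assumption)+
        fix e1 p' assume ep: "e1 \<in> carrier P.E" "p' \<in> carrier P"
        show "J\<sigma> V5 ?f m1 d e1 p' = tlift V5 (\<lambda>e1' d'. F5 m1 e1' d' (p' \<diamondop>\<^bsub>P.E\<^esub> x') (u \<diamondop>\<^bsub>T.C\<^esub> s) p3) (\<sigma> (d \<diamondop>\<^bsub>CE\<^esub> e1))"
        proof (rule tlift_cong)
          show "\<sigma> (d \<diamondop>\<^bsub>CE\<^esub> e1) \<in> carrier EC" by (rule md ep srules)+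
          show "balanced A P.E T.C V5 (J V5 ?f m1 p')" by (rule J_balanced f md ep | assumption)+
        qed (rule F md ep | assumption)+
      qed
    qed
    have 3: "?G (x \<diamondop>\<^bsub>P.E\<^esub> x') (u \<diamondop>\<^bsub>T.C\<^esub> s) = tlift V5 (\<lambda>m1 d. tlift V5 (\<lambda>e1 p'. tlift V5 (\<lambda>e1' d'. F5 m1 e1' d' (p' \<diamondop>\<^bsub>P.E\<^esub> x') (u \<diamondop>\<^bsub>T.C\<^esub> s) p3)
      (\<sigma> (d \<diamondop>\<^bsub>CE\<^esub> e1))) (P.\<tau> x)) (T.\<gamma>A t1)"
    proof (rule tlift_cong[OF T.\<gamma>A_closed[OF y(1)]])
      show "balanced A T T.C V5 (\<lambda>m1 d. tlift V5 (\<lambda>e1 e2. tlift V5 (\<lambda>e1' d'. F5 m1 e1' d' e2 (u \<diamondop>\<^bsub>T.C\<^esub> s) p3)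
        (\<sigma> (d \<diamondop>\<^bsub>CE\<^esub> e1))) (P.\<Delta>E (x \<diamondop>\<^bsub>P.E\<^esub> x')))"
        by (rule F5_balanced c e y srules | assumption | drule restr_out)+
      fix m1 d assume md: "m1 \<in> carrier T" "d \<in> carrier T.C"
      show "tlift V5 (\<lambda>e1 e2. tlift V5 (\<lambda>e1' d'. F5 m1 e1' d' e2 (u \<diamondop>\<^bsub>T.C\<^esub> s) p3) (\<sigma> (d \<diamondop>\<^bsub>CE\<^esub> e1))) (P.\<Delta>E (x \<diamondop>\<^bsub>P.E\<^esub> x')) =
        tlift V5 (\<lambda>e1 p'. tlift V5 (\<lambda>e1' d'. F5 m1 e1' d' (p' \<diamondop>\<^bsub>P.E\<^esub> x') (u \<diamondop>\<^bsub>T.C\<^esub> s) p3) (\<sigma> (d \<diamondop>\<^bsub>CE\<^esub> e1))) (P.\<tau> x)"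
        by (rule P.\<Delta>E_int[OF z]) (rule F5_balanced md c e y srules | assumption | drule restr_out)+
    qed
    show "?g (t1 \<diamondop>\<^bsub>V\<^esub> x) (x' \<diamondop>\<^bsub>V'\<^esub> u) (s \<diamondop>\<^bsub>V\<^esub> p3) = ?G (x \<diamondop>\<^bsub>P.E\<^esub> x') (u \<diamondop>\<^bsub>T.C\<^esub> s)"
      unfolding 1 2 3 ..
  qed
qed

text \<open>Here the second shepherd is taken at \<open>s \<otimes> p3\<close>, with
  \<open>u \<otimes> s\<close> a component of \<open>c'\<close>; coacting on \<open>s\<close> with
  \<open>u\<close> carried along is the coproduct of \<open>C\<close>.\<close>

lemma coassoc_R:
  assumes y: "t1 \<in> carrier T" "p3 \<in> carrier P" "e' \<in> carrier P.E" "c' \<in> carrier T.C"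
  shows "J V5 (\<lambda>a b c. tlift V5 (\<lambda>y1. tlift V5 (\<lambda>y2 y3. pure5 a b y1 y2 y3)) (\<gamma>\<^sub>V c)) t1 p3 e' c' =
    tlift V5 (\<lambda>f n1. tlift V5 (\<lambda>c1 c2. tlift V5 (\<lambda>f' c2'. F5 t1 e' c1 f' c2' n1)
      (\<sigma> (c2 \<diamondop>\<^bsub>CE\<^esub> f))) (T.\<Delta>C c')) (P.\<tau> p3)"
proof (rule tlift_ext[OF y(3)])
  let ?g = "\<lambda>a b c. tlift V5 (\<lambda>y1. tlift V5 (\<lambda>y2 y3. pure5 a b y1 y2 y3)) (\<gamma>\<^sub>V c)"
  let ?G = "\<lambda>e' c'. tlift V5 (\<lambda>f n1. tlift V5 (\<lambda>c1 c2. tlift V5 (\<lambda>f' c2'. F5 t1 e' c1 f' c2' n1)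
      (\<sigma> (c2 \<diamondop>\<^bsub>CE\<^esub> f))) (T.\<Delta>C c')) (P.\<tau> p3)"
  note g = balanced_precomp[OF coassoc_R_balanced(1)] balanced_precomp[OF coassoc_R_balanced(2)]
  show "balanced Z (restr id \<kappa> P) (restr \<kappa> id P') V5 (\<lambda>x x'. tlift V5 (\<lambda>u s. ?g (t1 \<diamondop>\<^bsub>V\<^esub> x) (x' \<diamondop>\<^bsub>V'\<^esub> u) (s \<diamondop>\<^bsub>V\<^esub> p3)) c')"
    by (rule g y srules | assumption | drule restr_out)+
  show "add_map P.E V5 (\<lambda>e'. ?G e' c')"
    by (rule F5_balanced y srules | assumption | drule restr_out)+
  fix x x' assume "x \<in> carrier (restr id \<kappa> P)" "x' \<in> carrier (restr \<kappa> id P')"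
  then have z: "x \<in> carrier P" "x' \<in> carrier P'" by (simp_all only: restr_simps)
  have e: "x \<diamondop>\<^bsub>P.E\<^esub> x' \<in> carrier P.E" and v1: "t1 \<diamondop>\<^bsub>V\<^esub> x \<in> carrier V" by (rule y z srules)+
  show "tlift V5 (\<lambda>u s. ?g (t1 \<diamondop>\<^bsub>V\<^esub> x) (x' \<diamondop>\<^bsub>V'\<^esub> u) (s \<diamondop>\<^bsub>V\<^esub> p3)) c' = ?G (x \<diamondop>\<^bsub>P.E\<^esub> x') c'"
  proof (rule tlift_ext[OF y(4)])
    show "balanced S (restr id \<beta> T') (restr \<beta> id T) V5 (\<lambda>u s. ?g (t1 \<diamondop>\<^bsub>V\<^esub> x) (x' \<diamondop>\<^bsub>V'\<^esub> u) (s \<diamondop>\<^bsub>V\<^esub> p3))"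
      by (rule g v1 y z srules | assumption | drule restr_out)+
    show "add_map T.C V5 (\<lambda>c'. ?G (x \<diamondop>\<^bsub>P.E\<^esub> x') c')"
      by (rule F5_balanced e y srules | assumption | drule restr_out)+
    fix u s assume "u \<in> carrier (restr id \<beta> T')" "s \<in> carrier (restr \<beta> id T)"
    then have us: "u \<in> carrier T'" "s \<in> carrier T" by (simp_all only: restr_simps)
    have b: "x' \<diamondop>\<^bsub>V'\<^esub> u \<in> carrier V'" by (rule us y z srules)+
    let ?f = "pure5 (t1 \<diamondop>\<^bsub>V\<^esub> x) (x' \<diamondop>\<^bsub>V'\<^esub> u)"
    note f = pure5_balanced(3)[OF v1 b] pure5_balanced(4)[OF v1 b]
    have F: "J V5 ?f s1 n1 f c2 = F5 t1 (x \<diamondop>\<^bsub>P.E\<^esub> x') (u \<diamondop>\<^bsub>T.C\<^esub> s1) f c2 n1"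
      if "s1 \<in> carrier T" "f \<in> carrier P.E" "c2 \<in> carrier T.C" "n1 \<in> carrier P" for s1 f c2 n1
      by (rule sym, (rule tlift_pure_eq tlift_cong refl that y z us srules | assumption | drule restr_out)+)
    have 1: "?g (t1 \<diamondop>\<^bsub>V\<^esub> x) (x' \<diamondop>\<^bsub>V'\<^esub> u) (s \<diamondop>\<^bsub>V\<^esub> p3) = J\<gamma> V5 ?f s p3"
      by (rule \<gamma>\<^sub>V_int) (rule y us f | assumption)+
    have 2: "J\<gamma> V5 ?f s p3 = tlift V5 (\<lambda>f n1. tlift V5 (\<lambda>s1 c2. J\<sigma> V5 ?f s1 c2 f n1) (T.\<gamma>A s)) (P.\<tau> p3)"
      by (rule tlift_swap) (rule J\<sigma>_balanced T.\<gamma>A_closed P.\<tau>_closed f y us bal | assumption)+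
    have 3: "?G (x \<diamondop>\<^bsub>P.E\<^esub> x') (u \<diamondop>\<^bsub>T.C\<^esub> s) = tlift V5 (\<lambda>f n1. tlift V5 (\<lambda>s1 c2. J\<sigma> V5 ?f s1 c2 f n1) (T.\<gamma>A s)) (P.\<tau> p3)"
    proof (rule tlift_cong[OF P.\<tau>_closed[OF y(2)]])
      have c: "u \<diamondop>\<^bsub>T.C\<^esub> s \<in> carrier T.C" by (rule us srules)+
      show "balanced A P.E P V5 (\<lambda>f n1. tlift V5 (\<lambda>c1 c2. tlift V5 (\<lambda>f' c2'. F5 t1 (x \<diamondop>\<^bsub>P.E\<^esub> x') c1 f' c2' n1)
        (\<sigma> (c2 \<diamondop>\<^bsub>CE\<^esub> f))) (T.\<Delta>C (u \<diamondop>\<^bsub>T.C\<^esub> s)))"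
        by (rule F5_balanced c e y srules | assumption | drule restr_out)+
      fix f n1 assume fn: "f \<in> carrier P.E" "n1 \<in> carrier P"
      have "tlift V5 (\<lambda>c1 c2. tlift V5 (\<lambda>f' c2'. F5 t1 (x \<diamondop>\<^bsub>P.E\<^esub> x') c1 f' c2' n1) (\<sigma> (c2 \<diamondop>\<^bsub>CE\<^esub> f))) (T.\<Delta>C (u \<diamondop>\<^bsub>T.C\<^esub> s)) =
        tlift V5 (\<lambda>s1 c2. tlift V5 (\<lambda>f' c2'. F5 t1 (x \<diamondop>\<^bsub>P.E\<^esub> x') (u \<diamondop>\<^bsub>T.C\<^esub> s1) f' c2' n1) (\<sigma> (c2 \<diamondop>\<^bsub>CE\<^esub> f))) (T.\<gamma>A s)"
        by (rule T.\<Delta>C_int[OF us]) (rule F5_balanced fn e y srules | assumption | drule restr_out)+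
      also have "\<dots> = tlift V5 (\<lambda>s1 c2. J\<sigma> V5 ?f s1 c2 f n1) (T.\<gamma>A s)"
      proof (rule sym, rule tlift_cong[OF T.\<gamma>A_closed[OF us(2)]])
        show "balanced A T T.C V5 (\<lambda>s1 c2. J\<sigma> V5 ?f s1 c2 f n1)" by (rule J\<sigma>_balanced f fn | assumption)+
        fix s1 c2 assume sc: "s1 \<in> carrier T" "c2 \<in> carrier T.C"
        show "J\<sigma> V5 ?f s1 c2 f n1 = tlift V5 (\<lambda>f' c2'. F5 t1 (x \<diamondop>\<^bsub>P.E\<^esub> x') (u \<diamondop>\<^bsub>T.C\<^esub> s1) f' c2' n1) (\<sigma> (c2 \<diamondop>\<^bsub>CE\<^esub> f))"
        proof (rule tlift_cong)
          show "\<sigma> (c2 \<diamondop>\<^bsub>CE\<^esub> f) \<in> carrier EC" by (rule sc fn srules)+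
          show "balanced A P.E T.C V5 (J V5 ?f s1 n1)" by (rule J_balanced f sc fn | assumption)+
        qed (rule F sc fn | assumption)+
      qed
      finally show "tlift V5 (\<lambda>c1 c2. tlift V5 (\<lambda>f' c2'. F5 t1 (x \<diamondop>\<^bsub>P.E\<^esub> x') c1 f' c2' n1) (\<sigma> (c2 \<diamondop>\<^bsub>CE\<^esub> f))) (T.\<Delta>C (u \<diamondop>\<^bsub>T.C\<^esub> s)) =
        tlift V5 (\<lambda>s1 c2. J\<sigma> V5 ?f s1 c2 f n1) (T.\<gamma>A s)" .
    qed
    show "?g (t1 \<diamondop>\<^bsub>V\<^esub> x) (x' \<diamondop>\<^bsub>V'\<^esub> u) (s \<diamondop>\<^bsub>V\<^esub> p3) = ?G (x \<diamondop>\<^bsub>P.E\<^esub> x') (u \<diamondop>\<^bsub>T.C\<^esub> s)"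
      unfolding 1 2 3 ..
  qed
qed

lemma J\<gamma>_cong:
  assumes h: "t \<in> carrier T" "p \<in> carrier P"
    and f1: "\<And>v. v \<in> carrier V \<Longrightarrow> balanced Z (restr id \<kappa> V) (restr \<kappa> id V') G (\<lambda>a b. f a b v)"
    and f2: "\<And>v. v \<in> carrier V \<Longrightarrow> balanced S (restr id \<beta> V') (restr \<beta> id V) G (f v)"
    and eq: "\<And>t1 p3 e' c'. \<lbrakk>t1 \<in> carrier T; p3 \<in> carrier P; e' \<in> carrier P.E; c' \<in> carrier T.C\<rbrakk> \<Longrightarrow>
      J G f t1 p3 e' c' = k t1 p3 e' c'"
  shows "J\<gamma> G f t p = tlift G (\<lambda>t1 c. tlift G (\<lambda>e p3. tlift G (k t1 p3) (\<sigma> (c \<diamondop>\<^bsub>CE\<^esub> e))) (P.\<tau> p)) (T.\<gamma>A t)"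
proof (rule tlift_cong[OF T.\<gamma>A_closed[OF h(1)]])
  show "balanced A T T.C G (J\<tau> G f p)" by (rule J\<tau>_balanced f1 f2 h | assumption)+
  fix t1 c assume y: "t1 \<in> carrier T" "c \<in> carrier T.C"
  show "J\<tau> G f p t1 c = tlift G (\<lambda>e p3. tlift G (k t1 p3) (\<sigma> (c \<diamondop>\<^bsub>CE\<^esub> e))) (P.\<tau> p)"
  proof (rule tlift_cong[OF P.\<tau>_closed[OF h(2)]])
    show "balanced A P.E P G (J\<sigma> G f t1 c)" by (rule J\<sigma>_balanced f1 f2 y | assumption)+
    fix e p3 assume z: "e \<in> carrier P.E" "p3 \<in> carrier P"
    have "\<sigma> (c \<diamondop>\<^bsub>CE\<^esub> e) \<in> carrier EC" by (rule y z srules)+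
    then show "J\<sigma> G f t1 c e p3 = tlift G (k t1 p3) (\<sigma> (c \<diamondop>\<^bsub>CE\<^esub> e))"
    proof (rule tlift_cong)
      show "balanced A P.E T.C G (J G f t1 p3)" by (rule J_balanced f1 f2 y z | assumption)+
    qed (rule eq[OF y(1) z(2)])
  qed
qed

text \<open>Once both sides are written over the coactions of \<open>t\<close> and \<open>p\<close>,
  they are the two sides of \<open>comult_coassoc\<close> for the comodules \<open>T\<close> and
  \<open>P\<close> and the integrand \<open>F5\<close>.\<close>

lemma \<gamma>\<^sub>V_coassoc:
  assumes x: "x \<in> carrier V"
  shows "(let C = V' \<^bold>\<otimes>\<^bsub>S,\<beta>\<^esub> V; W = V \<^bold>\<otimes>\<^bsub>Z,\<kappa>\<^esub> C; W' = V' \<^bold>\<otimes>\<^bsub>S,\<beta>\<^esub> W; Q = V \<^bold>\<otimes>\<^bsub>Z,\<kappa>\<^esub> W' in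
    tlift3 Q (\<lambda>x1 x2 x3. tlift3 Q (\<lambda>y1 y2 y3. y1 \<diamondop>\<^bsub>Q\<^esub> (y2 \<diamondop>\<^bsub>W'\<^esub> (y3 \<diamondop>\<^bsub>W\<^esub> (x2 \<diamondop>\<^bsub>C\<^esub> x3)))) (\<gamma>\<^sub>V x1)) (\<gamma>\<^sub>V x) =
    tlift3 Q (\<lambda>x1 x2 x3. x1 \<diamondop>\<^bsub>Q\<^esub> (x2 \<diamondop>\<^bsub>W'\<^esub> \<gamma>\<^sub>V x3)) (\<gamma>\<^sub>V x))"
  unfolding Let_def tlift3_def
proof (rule V_ext[OF x])
  let ?L = "\<lambda>a b c. tlift V5 (\<lambda>y1. tlift V5 (\<lambda>y2 y3. pure5 y1 y2 y3 b c)) (\<gamma>\<^sub>V a)"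
  let ?R = "\<lambda>a b c. tlift V5 (\<lambda>y1. tlift V5 (\<lambda>y2 y3. pure5 a b y1 y2 y3)) (\<gamma>\<^sub>V c)"
  note l = balanced_precomp[OF coassoc_L_balanced(1)] balanced_precomp[OF coassoc_L_balanced(2)]
  show "add_map V V5 (\<lambda>x. tlift V5 (\<lambda>x1. tlift V5 (\<lambda>x2 x3. ?L x1 x2 x3)) (\<gamma>\<^sub>V x))"
    by (rule l wrules | assumption | drule restr_out)+
  show "add_map V V5 (\<lambda>x. tlift V5 (\<lambda>x1. tlift V5 (\<lambda>x2 x3. x1 \<diamondop>\<^bsub>V5\<^esub> (x2 \<diamondop>\<^bsub>V4\<^esub> \<gamma>\<^sub>V x3))) (\<gamma>\<^sub>V x))"
    by (rule wrules | assumption | drule restr_out)+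
  fix t p assume h: "t \<in> carrier T" "p \<in> carrier P"
  have v: "t \<diamondop>\<^bsub>V\<^esub> p \<in> carrier V" by (rule h srules)+
  have 1: "tlift V5 (\<lambda>x1. tlift V5 (\<lambda>x2 x3. ?L x1 x2 x3)) (\<gamma>\<^sub>V (t \<diamondop>\<^bsub>V\<^esub> p)) = J\<gamma> V5 ?L t p"
    by (rule \<gamma>\<^sub>V_int) (rule h coassoc_L_balanced | assumption)+
  have 2: "tlift V5 (\<lambda>x1. tlift V5 (\<lambda>x2 x3. ?R x1 x2 x3)) (\<gamma>\<^sub>V (t \<diamondop>\<^bsub>V\<^esub> p)) = J\<gamma> V5 ?R t p"
    by (rule \<gamma>\<^sub>V_int) (rule h coassoc_R_balanced | assumption)+
  \<comment> \<open>The inner shepherd \<open>\<gamma>\<^sub>V x3\<close> occurs as an element of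
    the tensor; it is expanded into its components, so that both sides become sums over two
    shepherds.\<close>
  have 3: "tlift V5 (\<lambda>x1. tlift V5 (\<lambda>x2 x3. x1 \<diamondop>\<^bsub>V5\<^esub> (x2 \<diamondop>\<^bsub>V4\<^esub> \<gamma>\<^sub>V x3))) (\<gamma>\<^sub>V (t \<diamondop>\<^bsub>V\<^esub> p)) =
    tlift V5 (\<lambda>x1. tlift V5 (\<lambda>x2 x3. ?R x1 x2 x3)) (\<gamma>\<^sub>V (t \<diamondop>\<^bsub>V\<^esub> p))"
  proof -
    have eq: "x1 \<diamondop>\<^bsub>V5\<^esub> (x2 \<diamondop>\<^bsub>V4\<^esub> \<gamma>\<^sub>V x3) = ?R x1 x2 x3" if y: "x1 \<in> carrier V" "x2 \<in> carrier V'" "x3 \<in> carrier V" for x1 x2 x3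
    proof -
      have am: "add_map VCV V5 (\<lambda>w. x1 \<diamondop>\<^bsub>V5\<^esub> (x2 \<diamondop>\<^bsub>V4\<^esub> w))"
        by (rule add_map_pure_right restr_intros y add_map_id wrules | assumption | drule restr_out)+
      show ?thesis
      proof (rule sym, rule tlift_ext[OF \<gamma>\<^sub>V_closed[OF y(3)] _ am])
        show "balanced Z (restr id \<kappa> V) (restr \<kappa> id CV) V5 (\<lambda>y1. tlift V5 (\<lambda>y2 y3. pure5 x1 x2 y1 y2 y3))"
          by (rule y wrules | assumption | drule restr_out)+
        fix a b assume "a \<in> carrier (restr id \<kappa> V)" "b \<in> carrier (restr \<kappa> id CV)"
        then have ab: "a \<in> carrier V" "b \<in> carrier CV" by (simp_all only: restr_simps)
        show "tlift V5 (\<lambda>y2 y3. pure5 x1 x2 a y2 y3) b = x1 \<diamondop>\<^bsub>V5\<^esub> (x2 \<diamondop>\<^bsub>V4\<^esub> (a \<diamondop>\<^bsub>VCV\<^esub> b))"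
        proof (rule tlift_expand[OF ab(2)])
          have "add_map CV VCV (\<lambda>b. a \<diamondop>\<^bsub>VCV\<^esub> b)"
            by (rule add_map_pure_right restr_intros ab add_map_id wrules | assumption | drule restr_out)+
          then show "add_map CV V5 (\<lambda>b. x1 \<diamondop>\<^bsub>V5\<^esub> (x2 \<diamondop>\<^bsub>V4\<^esub> (a \<diamondop>\<^bsub>VCV\<^esub> b)))"
            by (rule add_map_comp[OF am])
        qed (rule wrules)+
      qed
    qed
    show ?thesis
      by (rule eq tlift_cong v wrules | assumption | drule restr_out)+
  qed
  have 4: "J\<gamma> V5 ?L t p = tlift V5 (\<lambda>t1 c. tlift V5 (\<lambda>e p3. tlift V5 (\<lambda>e' c'. tlift V5 (\<lambda>m1 d. tlift V5 (\<lambda>e1 e2. tlift V5 (\<lambda>e1' d'. F5 m1 e1' d' e2 c' p3)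
      (\<sigma> (d \<diamondop>\<^bsub>CE\<^esub> e1))) (P.\<Delta>E e')) (T.\<gamma>A t1)) (\<sigma> (c \<diamondop>\<^bsub>CE\<^esub> e))) (P.\<tau> p)) (T.\<gamma>A t)"
    by (rule J\<gamma>_cong) (rule h coassoc_L_balanced coassoc_L | assumption)+
  have 5: "J\<gamma> V5 ?R t p = tlift V5 (\<lambda>t1 c. tlift V5 (\<lambda>e p3. tlift V5 (\<lambda>e' c'. tlift V5 (\<lambda>f n1. tlift V5 (\<lambda>c1 c2. tlift V5 (\<lambda>f' c2'. F5 t1 e' c1 f' c2' n1)
      (\<sigma> (c2 \<diamondop>\<^bsub>CE\<^esub> f))) (T.\<Delta>C c')) (P.\<tau> p3)) (\<sigma> (c \<diamondop>\<^bsub>CE\<^esub> e))) (P.\<tau> p)) (T.\<gamma>A t)"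
    by (rule J\<gamma>_cong) (rule h coassoc_R_balanced coassoc_R | assumption)+
  show "tlift V5 (\<lambda>x1. tlift V5 (\<lambda>x2 x3. ?L x1 x2 x3)) (\<gamma>\<^sub>V (t \<diamondop>\<^bsub>V\<^esub> p)) =
    tlift V5 (\<lambda>x1. tlift V5 (\<lambda>x2 x3. x1 \<diamondop>\<^bsub>V5\<^esub> (x2 \<diamondop>\<^bsub>V4\<^esub> \<gamma>\<^sub>V x3))) (\<gamma>\<^sub>V (t \<diamondop>\<^bsub>V\<^esub> p))"
    unfolding 1 3 2 4 5
    by (rule SM.comult_coassoc) (rule h F5_balanced | assumption)+
qed

lemma herd_V: "herd Z K \<kappa> S B \<beta> V V' ev\<^sub>V ev'\<^sub>V \<gamma>\<^sub>V"
  by (intro herd.intro[OF formal_dual_V] herd_axioms.intro \<gamma>\<^sub>V_hom \<gamma>\<^sub>V_ev' \<gamma>\<^sub>V_ev \<gamma>\<^sub>V_coassoc)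

end

section \<open>The smash coproduct induced by a shepherd\<close>

locale composite_herd = herd_pair +
  VH: herd Z K \<kappa> S B \<beta> V V' ev\<^sub>V ev'\<^sub>V \<gamma>\<^sub>V for \<gamma>\<^sub>V +
  assumes compat_right: "shepherd_compat_right A S \<beta> Z \<kappa> T T' \<gamma>\<^sub>T P P' ev'\<^sub>P \<gamma>\<^sub>V"
    and compat_left: "shepherd_compat_left A S \<beta> Z \<kappa> T T' ev\<^sub>T P P' \<gamma>\<^sub>P \<gamma>\<^sub>V"
begin

lemmas crules = VH.herd_maps prules

lemmas compat_right_int = compat_right_imp[OF VH.\<gamma>_add compat_right]
lemmas compat_left_int = compat_left_imp[OF VH.\<gamma>_add compat_left]

abbreviation "EC \<equiv> P.E \<^bold>\<otimes>\<^bsub>A\<^esub> T.C"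
abbreviation "CE \<equiv> T.C \<^bold>\<otimes>\<^bsub>A\<^esub> P.E"

text \<open>This is \<open>\<sigma>\<close> with its two middle arguments fused into one element
  \<open>v\<close> of \<open>V\<close>. Scalars of \<open>B\<close> and \<open>K\<close> can then
  act on \<open>v\<close>, which is how an iterated \<open>\<sigma>\<close> is treated in the proofs
  of multiplicativity.\<close>

definition "\<Psi> u' v q' = tlift EC (\<lambda>v1. tlift EC (\<lambda>v2 v3. tlift EC (\<lambda>q u.
  (\<theta>\<^sub>1 u' v1 \<diamondop>\<^bsub>P.E\<^esub> q) \<diamondop>\<^bsub>EC\<^esub> (u \<diamondop>\<^bsub>T.C\<^esub> \<theta>\<^sub>3 v3 q')) v2)) (\<gamma>\<^sub>V v)"

definition "\<sigma> = tlift EC (\<lambda>c e. tlift EC (\<lambda>u t. tlift EC (\<lambda>p q. \<Psi> u (t \<diamondop>\<^bsub>V\<^esub> p) q) e) c)"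

lemma \<Psi>_l: "v \<in> carrier V \<Longrightarrow> q' \<in> carrier P' \<Longrightarrow> llin A T' EC (\<lambda>u. \<Psi> u v q')"
  unfolding \<Psi>_def by (rule crules | assumption | drule restr_out)+

lemma \<Psi>_r: "v \<in> carrier V \<Longrightarrow> u \<in> carrier T' \<Longrightarrow> rlin A P' EC (\<Psi> u v)"
  unfolding \<Psi>_def[abs_def] by (rule crules | assumption | drule restr_out)+

lemma \<Psi>_S: "q' \<in> carrier P' \<Longrightarrow> balanced S (restr id \<beta> T') (restr \<beta> id V) EC (\<lambda>u v. \<Psi> u v q')"
  unfolding \<Psi>_def by (rule crules | assumption | drule restr_out)+

lemma \<Psi>_Z: "u \<in> carrier T' \<Longrightarrow> balanced Z (restr id \<kappa> V) (restr \<kappa> id P') EC (\<lambda>v q'. \<Psi> u v q')"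
  unfolding \<Psi>_def by (rule crules | assumption | drule restr_out)+

lemma \<Psi>_add: "u \<in> carrier T' \<Longrightarrow> q' \<in> carrier P' \<Longrightarrow> add_map V EC (\<lambda>v. \<Psi> u v q')"
  using balancedD(4)[OF \<Psi>_Z, of u q'] by (simp add: restr_id_iff restr_simps)

lemma \<Psi>_closed: "u \<in> carrier T' \<Longrightarrow> v \<in> carrier V \<Longrightarrow> q' \<in> carrier P' \<Longrightarrow> \<Psi> u v q' \<in> carrier EC"
  by (rule add_map_closed[OF \<Psi>_add])

lemmas \<Psi>_rules = llin_comp[OF \<Psi>_l] rlin_comp[OF \<Psi>_r] balanced_precomp[OF \<Psi>_S] balanced_precomp[OF \<Psi>_Z]
  balanced_map[OF \<Psi>_add] add_map_comp[OF \<Psi>_add] add_map_comp[OF llinD(3)[OF \<Psi>_l]] add_map_comp[OF rlinD(3)[OF \<Psi>_r]] \<Psi>_closed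

lemma \<Psi>_int:
  assumes h: "u' \<in> carrier T'" "v \<in> carrier V" "q' \<in> carrier P'" and f: "balanced A P.E T.C G f"
  shows "tlift G f (\<Psi> u' v q') = tlift G (\<lambda>v1. tlift G (\<lambda>v2 v3. tlift G (\<lambda>q u.
    f (\<theta>\<^sub>1 u' v1 \<diamondop>\<^bsub>P.E\<^esub> q) (u \<diamondop>\<^bsub>T.C\<^esub> \<theta>\<^sub>3 v3 q')) v2)) (\<gamma>\<^sub>V v)"
  unfolding \<Psi>_def by (rule evals h f crules | assumption | drule restr_out)+

text \<open>\<open>t\<close> and \<open>p\<close> enter through \<open>t \<otimes> p\<close> in
  \<open>V\<close>, a tensor product over \<open>A\<close>, so the map descends to
  \<open>C \<otimes> E\<close> over \<open>A\<close>; the outer actions are carried by the partial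
  evaluations.\<close>

lemma \<sigma>_hom: "\<sigma> \<in> bimod_hom A A CE EC"
  unfolding \<sigma>_def by (rule bimod_homI \<Psi>_rules crules | assumption | drule restr_out)+

lemma bimodule_CE: "bimodule A A CE" "bimodule A A EC" by (rule crules)+

lemmas \<sigma>D = bimod_homD[OF \<sigma>_hom bimodule_CE]
lemmas \<sigma>_rules = rlin_comp[OF \<sigma>D(2)] llin_comp[OF \<sigma>D(1)] add_map_comp[OF \<sigma>D(3)]
  balanced_map[OF \<sigma>D(3)] llinD(4)[OF \<sigma>D(1)]

lemma \<sigma>_pure:
  assumes "u \<in> carrier T'" "t \<in> carrier T" "p \<in> carrier P" "q \<in> carrier P'"
  shows "\<sigma> ((u \<diamondop>\<^bsub>T.C\<^esub> t) \<diamondop>\<^bsub>CE\<^esub> (p \<diamondop>\<^bsub>P.E\<^esub> q)) = \<Psi> u (t \<diamondop>\<^bsub>V\<^esub> p) q"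
  unfolding \<sigma>_def
  by (rule tlift_pure_eq refl assms \<Psi>_rules crules | assumption | drule restr_out)+

end

section \<open>The four conditions on the induced map\<close>

lemma regular_out: "x \<in> carrier (regular A) \<Longrightarrow> x \<in> carrier A"
  by (simp add: regular_simps)

lemma (in herd_pair) coring_pair: "coring_pair A T.C T.\<Delta>C ev\<^sub>T P.E P.\<Delta>E ev'\<^sub>P"
  by (intro coring_pair.intro T.bimodule_C P.bimodule_E T.\<Delta>C_hom P.\<Delta>E_hom T.ev_hom P.ev'_hom)

context composite_herd
begin

lemmas srules = \<sigma>_rules \<Psi>_rules crules

lemma CE_ext:
  assumes c: "c \<in> carrier T.C" and e: "e \<in> carrier P.E"
    and f: "\<And>e. e \<in> carrier P.E \<Longrightarrow> add_map T.C G (\<lambda>c. f c e)" "\<And>c. c \<in> carrier T.C \<Longrightarrow> add_map P.E G (f c)"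
    and g: "\<And>e. e \<in> carrier P.E \<Longrightarrow> add_map T.C G (\<lambda>c. g c e)" "\<And>c. c \<in> carrier T.C \<Longrightarrow> add_map P.E G (g c)"
    and eq: "\<And>u t p q. \<lbrakk>u \<in> carrier T'; t \<in> carrier T; p \<in> carrier P; q \<in> carrier P'\<rbrakk> \<Longrightarrow>
      f (u \<diamondop>\<^bsub>T.C\<^esub> t) (p \<diamondop>\<^bsub>P.E\<^esub> q) = g (u \<diamondop>\<^bsub>T.C\<^esub> t) (p \<diamondop>\<^bsub>P.E\<^esub> q)"
  shows "f c e = g c e"
proof (rule tensor_ext[OF f(1)[OF e] g(1)[OF e] _ _ _ c])
  show "rmod S (restr id \<beta> T')" "lmod S (restr \<beta> id T)" by (rule crules)+
  fix u t assume "u \<in> carrier (restr id \<beta> T')" "t \<in> carrier (restr \<beta> id T)"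
  then have ut: "u \<in> carrier T'" "t \<in> carrier T" by (simp_all add: restr_simps)
  note c' = T.pure_C_closed[OF ut]
  show "f (u \<diamondop>\<^bsub>T.C\<^esub> t) e = g (u \<diamondop>\<^bsub>T.C\<^esub> t) e"
  proof (rule tensor_ext[OF f(2)[OF c'] g(2)[OF c'] _ _ _ e])
    show "rmod Z (restr id \<kappa> P)" "lmod Z (restr \<kappa> id P')" by (rule crules)+
  qed (use ut eq in \<open>simp add: restr_simps\<close>)
qed

text \<open>\<open>\<theta>_swap\<close> trades the evaluation of \<open>P\<close> at
  \<open>\<theta>\<^sub>1 u' v1\<close> and \<open>q\<close> for the evaluation of \<open>T\<close>
  at \<open>u'\<close> and \<open>\<theta>\<^sub>3 v1 q\<close>. The first component is then closed
  by \<open>\<theta>\<^sub>3\<close>, so the first compatibility condition applies; the formal dual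
  and the evaluation law of \<open>T\<close> finish.\<close>

lemma counit_E_\<sigma>:
  assumes "c \<in> carrier T.C" "e \<in> carrier P.E"
  shows "tlift T.C (\<lambda>e c. lact T.C (ev'\<^sub>P e) c) (\<sigma> (c \<diamondop>\<^bsub>CE\<^esub> e)) = ract T.C c (ev'\<^sub>P e)"
proof (rule CE_ext[OF assms])
  show "add_map T.C T.C (\<lambda>c. tlift T.C (\<lambda>e c. lact T.C (ev'\<^sub>P e) c) (\<sigma> (c \<diamondop>\<^bsub>CE\<^esub> e)))" if "e \<in> carrier P.E" for e
    by (rule that srules | assumption | drule restr_out)+
  show "add_map P.E T.C (\<lambda>e. tlift T.C (\<lambda>e c. lact T.C (ev'\<^sub>P e) c) (\<sigma> (c \<diamondop>\<^bsub>CE\<^esub> e)))" if "c \<in> carrier T.C" for c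
    by (rule that srules | assumption | drule restr_out)+
  show "add_map T.C T.C (\<lambda>c. ract T.C c (ev'\<^sub>P e))" if "e \<in> carrier P.E" for e
    by (rule llinD(3), (rule that srules | assumption | drule restr_out)+)
  show "add_map P.E T.C (\<lambda>e. ract T.C c (ev'\<^sub>P e))" if "c \<in> carrier T.C" for c
    by (rule rlinD(3), (rule that srules | assumption | drule restr_out)+)
  fix u' t p q' assume h: "u' \<in> carrier T'" "t \<in> carrier T" "p \<in> carrier P" "q' \<in> carrier P'"
  let ?I = "tlift T.C" and ?a = "ev'\<^sub>P (p \<diamondop>\<^bsub>P.E\<^esub> q')"
  have v: "t \<diamondop>\<^bsub>V\<^esub> p \<in> carrier V" by (rule h crules)+
  note r = h v srules
  have "?I (\<lambda>e c. lact T.C (ev'\<^sub>P e) c) (\<Psi> u' (t \<diamondop>\<^bsub>V\<^esub> p) q') =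
    ?I (\<lambda>v1. ?I (\<lambda>v2 v3. ?I (\<lambda>q u. lact T.C (ev'\<^sub>P (\<theta>\<^sub>1 u' v1 \<diamondop>\<^bsub>P.E\<^esub> q)) (u \<diamondop>\<^bsub>T.C\<^esub> \<theta>\<^sub>3 v3 q')) v2)) (\<gamma>\<^sub>V (t \<diamondop>\<^bsub>V\<^esub> p))"
    by (rule \<Psi>_int) (rule r | assumption | drule restr_out)+
  also have "\<dots> = ?I (\<lambda>v1. ?I (\<lambda>v2 v3. ?I (\<lambda>q u. lact T.C (ev\<^sub>T (u' \<diamondop>\<^bsub>T.C\<^esub> \<theta>\<^sub>3 v1 q)) (u \<diamondop>\<^bsub>T.C\<^esub> \<theta>\<^sub>3 v3 q')) v2)) (\<gamma>\<^sub>V (t \<diamondop>\<^bsub>V\<^esub> p))"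
  proof -
    have eq: "lact T.C (ev'\<^sub>P (\<theta>\<^sub>1 u' v1 \<diamondop>\<^bsub>P.E\<^esub> q)) (u \<diamondop>\<^bsub>T.C\<^esub> \<theta>\<^sub>3 v3 q') = lact T.C (ev\<^sub>T (u' \<diamondop>\<^bsub>T.C\<^esub> \<theta>\<^sub>3 v1 q)) (u \<diamondop>\<^bsub>T.C\<^esub> \<theta>\<^sub>3 v3 q')"
      if "v1 \<in> carrier V" "q \<in> carrier P'" for v1 q u v3
      using \<theta>_swap[OF h(1) that] by simp
    show ?thesis
      by (rule eq tlift_cong r | assumption | drule restr_out)+
  qed
  also have "\<dots> = ?I (\<lambda>t1. ?I (\<lambda>t2 t3. lact T.C (ev\<^sub>T (u' \<diamondop>\<^bsub>T.C\<^esub> t1)) (t2 \<diamondop>\<^bsub>T.C\<^esub> \<theta>\<^sub>3 (t3 \<diamondop>\<^bsub>V\<^esub> p) q'))) (T.\<gamma>A t)"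
    by (rule compat_right_int[symmetric]) (rule r | assumption | drule restr_out)+
  also have "\<dots> = ?I (\<lambda>t1. ?I (\<lambda>t2 t3. ract T' u' (ev'\<^sub>T (t1 \<diamondop>\<^bsub>T.E\<^esub> t2)) \<diamondop>\<^bsub>T.C\<^esub> ract T t3 ?a)) (T.\<gamma>A t)"
  proof -
    have eq: "lact T.C (ev\<^sub>T (u' \<diamondop>\<^bsub>T.C\<^esub> t1)) (t2 \<diamondop>\<^bsub>T.C\<^esub> \<theta>\<^sub>3 (t3 \<diamondop>\<^bsub>V\<^esub> p) q') = ract T' u' (ev'\<^sub>T (t1 \<diamondop>\<^bsub>T.E\<^esub> t2)) \<diamondop>\<^bsub>T.C\<^esub> ract T t3 ?a"
      if "t1 \<in> carrier T" "t2 \<in> carrier T'" "t3 \<in> carrier T" for t1 t2 t3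
      using that h by (simp add: \<theta>_pure T.act_C T.ev_ev' T.ev_pure_closed P.ev_pure_closed T.T.ract_closed)
    show ?thesis
      by (rule eq tlift_cong r | assumption | drule restr_out)+
  qed
  also have "\<dots> = ract T' u' \<one>\<^bsub>B\<^esub> \<diamondop>\<^bsub>T.C\<^esub> ract T t ?a"
    by (rule T.\<gamma>A_counit') (rule r | assumption | drule restr_out)+
  also have "\<dots> = ract T.C (u' \<diamondop>\<^bsub>T.C\<^esub> t) ?a"
    using h by (simp add: T.act_C T.T'.ract_one P.ev_pure_closed)
  finally show "?I (\<lambda>e c. lact T.C (ev'\<^sub>P e) c) (\<sigma> ((u' \<diamondop>\<^bsub>T.C\<^esub> t) \<diamondop>\<^bsub>CE\<^esub> (p \<diamondop>\<^bsub>P.E\<^esub> q'))) = ract T.C (u' \<diamondop>\<^bsub>T.C\<^esub> t) ?a"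
    unfolding \<sigma>_pure[OF h] .
qed

text \<open>The same exchange is made in the last component, followed by the second compatibility
  condition and the evaluation law of \<open>P\<close>.\<close>

lemma counit_C_\<sigma>:
  assumes "c \<in> carrier T.C" "e \<in> carrier P.E"
  shows "tlift P.E (\<lambda>e c. ract P.E e (ev\<^sub>T c)) (\<sigma> (c \<diamondop>\<^bsub>CE\<^esub> e)) = lact P.E (ev\<^sub>T c) e"
proof (rule CE_ext[OF assms])
  show "add_map T.C P.E (\<lambda>c. tlift P.E (\<lambda>e c. ract P.E e (ev\<^sub>T c)) (\<sigma> (c \<diamondop>\<^bsub>CE\<^esub> e)))" if "e \<in> carrier P.E" for e
    by (rule that srules | assumption | drule restr_out)+
  show "add_map P.E P.E (\<lambda>e. tlift P.E (\<lambda>e c. ract P.E e (ev\<^sub>T c)) (\<sigma> (c \<diamondop>\<^bsub>CE\<^esub> e)))" if "c \<in> carrier T.C" for c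
    by (rule that srules | assumption | drule restr_out)+
  show "add_map T.C P.E (\<lambda>c. lact P.E (ev\<^sub>T c) e)" if "e \<in> carrier P.E" for e
    by (rule llinD(3), (rule that srules | assumption | drule restr_out)+)
  show "add_map P.E P.E (\<lambda>e. lact P.E (ev\<^sub>T c) e)" if "c \<in> carrier T.C" for c
    by (rule rlinD(3), (rule that srules | assumption | drule restr_out)+)
  fix u' t p q' assume h: "u' \<in> carrier T'" "t \<in> carrier T" "p \<in> carrier P" "q' \<in> carrier P'"
  let ?I = "tlift P.E" and ?a = "ev\<^sub>T (u' \<diamondop>\<^bsub>T.C\<^esub> t)"
  have v: "t \<diamondop>\<^bsub>V\<^esub> p \<in> carrier V" by (rule h crules)+
  have a: "?a \<in> carrier A" by (rule h crules)+
  note r = h v a srules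
  have "?I (\<lambda>e c. ract P.E e (ev\<^sub>T c)) (\<Psi> u' (t \<diamondop>\<^bsub>V\<^esub> p) q') =
    ?I (\<lambda>v1. ?I (\<lambda>v2 v3. ?I (\<lambda>q u. ract P.E (\<theta>\<^sub>1 u' v1 \<diamondop>\<^bsub>P.E\<^esub> q) (ev\<^sub>T (u \<diamondop>\<^bsub>T.C\<^esub> \<theta>\<^sub>3 v3 q'))) v2)) (\<gamma>\<^sub>V (t \<diamondop>\<^bsub>V\<^esub> p))"
    by (rule \<Psi>_int) (rule r | assumption | drule restr_out)+
  also have "\<dots> = ?I (\<lambda>v1. ?I (\<lambda>v2 v3. ?I (\<lambda>q u. ract P.E (\<theta>\<^sub>1 u' v1 \<diamondop>\<^bsub>P.E\<^esub> q) (ev'\<^sub>P (\<theta>\<^sub>1 u v3 \<diamondop>\<^bsub>P.E\<^esub> q'))) v2)) (\<gamma>\<^sub>V (t \<diamondop>\<^bsub>V\<^esub> p))"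
  proof -
    have eq: "ract P.E (\<theta>\<^sub>1 u' v1 \<diamondop>\<^bsub>P.E\<^esub> q) (ev\<^sub>T (u \<diamondop>\<^bsub>T.C\<^esub> \<theta>\<^sub>3 v3 q')) = ract P.E (\<theta>\<^sub>1 u' v1 \<diamondop>\<^bsub>P.E\<^esub> q) (ev'\<^sub>P (\<theta>\<^sub>1 u v3 \<diamondop>\<^bsub>P.E\<^esub> q'))"
      if "v3 \<in> carrier V" "u \<in> carrier T'" for v1 q u v3
      using \<theta>_swap[OF that(2,1) h(4)] by simp
    show ?thesis
      by (rule eq tlift_cong r | assumption | drule restr_out)+
  qed
  also have "\<dots> = ?I (\<lambda>p1. ?I (\<lambda>p2 p3. ract P.E (\<theta>\<^sub>1 u' (t \<diamondop>\<^bsub>V\<^esub> p1) \<diamondop>\<^bsub>P.E\<^esub> p2) (ev'\<^sub>P (p3 \<diamondop>\<^bsub>P.E\<^esub> q')))) (\<gamma>\<^sub>P p)"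
    by (rule compat_left_int[symmetric]) (rule r | assumption | drule restr_out)+
  also have "\<dots> = ?I (\<lambda>p1. ?I (\<lambda>p2 p3. lact P ?a p1 \<diamondop>\<^bsub>P.E\<^esub> lact P' (ev\<^sub>P (p2 \<diamondop>\<^bsub>P.C\<^esub> p3)) q')) (\<gamma>\<^sub>P p)"
  proof -
    have eq: "ract P.E (\<theta>\<^sub>1 u' (t \<diamondop>\<^bsub>V\<^esub> p1) \<diamondop>\<^bsub>P.E\<^esub> p2) (ev'\<^sub>P (p3 \<diamondop>\<^bsub>P.E\<^esub> q')) = lact P ?a p1 \<diamondop>\<^bsub>P.E\<^esub> lact P' (ev\<^sub>P (p2 \<diamondop>\<^bsub>P.C\<^esub> p3)) q'"
      if "p1 \<in> carrier P" "p2 \<in> carrier P'" "p3 \<in> carrier P" for p1 p2 p3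
      using that h a by (simp add: \<theta>_pure P.act_E P.ev_ev' T.ev_pure_closed P.ev_pure_closed P.T.lact_closed)
    show ?thesis
      by (rule eq tlift_cong r | assumption | drule restr_out)+
  qed
  also have "\<dots> = lact P ?a p \<diamondop>\<^bsub>P.E\<^esub> lact P' \<one>\<^bsub>K\<^esub> q'"
    by (rule P.shepherd_ev_int') (rule r | assumption | drule restr_out)+
  also have "\<dots> = lact P.E ?a (p \<diamondop>\<^bsub>P.E\<^esub> q')"
    using h a by (simp add: P.act_E P.T'.lact_one)
  finally show "?I (\<lambda>e c. ract P.E e (ev\<^sub>T c)) (\<sigma> ((u' \<diamondop>\<^bsub>T.C\<^esub> t) \<diamondop>\<^bsub>CE\<^esub> (p \<diamondop>\<^bsub>P.E\<^esub> q'))) = lact P.E ?a (p \<diamondop>\<^bsub>P.E\<^esub> q')"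
    unfolding \<sigma>_pure[OF h] .
qed

text \<open>At \<open>v = t \<otimes> p\<close> the coaction is taken at \<open>t\<close> times a
  scalar of \<open>A\<close>. By its right \<open>A\<close>-linearity the scalar lands on the
  component in \<open>C\<close>, where it turns \<open>t3\<close> into
  \<open>\<theta>\<^sub>3 (t3 \<otimes> p) q'\<close>; the sum then has the form of the first
  compatibility condition.\<close>

lemma \<gamma>A_\<theta>\<^sub>3_int:
  assumes v: "v \<in> carrier V" and q': "q' \<in> carrier P'" and f: "balanced A T T.C G f"
  shows "tlift G f (T.\<gamma>A (\<theta>\<^sub>3 v q')) = tlift G (\<lambda>w1. tlift G (\<lambda>w2 w3. tlift G (\<lambda>q u.
    f (\<theta>\<^sub>3 w1 q) (u \<diamondop>\<^bsub>T.C\<^esub> \<theta>\<^sub>3 w3 q')) w2)) (\<gamma>\<^sub>V v)"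
proof (rule V_ext[OF v])
  have fa: "add_map T.C G (f x)" if "x \<in> carrier T" for x
    by (rule balancedD(5)[OF f that])
  have f1: "balanced A T T' G (\<lambda>x u. f x (u \<diamondop>\<^bsub>T.C\<^esub> \<theta>\<^sub>3 w q'))" if "w \<in> carrier V" for w
    by (rule balanced_precomp[OF f]) (rule that v q' srules)+
  have f2: "balanced S (restr id \<beta> T') (restr \<beta> id V) G (\<lambda>u w. f x (u \<diamondop>\<^bsub>T.C\<^esub> \<theta>\<^sub>3 w q'))" if "x \<in> carrier T" for x
    by (rule balanced_map[OF fa[OF that]]) (rule that v q' srules)+
  have f3: "balanced Z (restr id \<kappa> V) (restr \<kappa> id P') G (\<lambda>w q. f (\<theta>\<^sub>3 w q) c)" if "c \<in> carrier T.C" for c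
    by (rule balanced_map[OF balancedD(4)[OF f that]]) (rule that v q' srules)+
  have f4: "balanced A P' T' G (\<lambda>q u. f (\<theta>\<^sub>3 w1 q) (u \<diamondop>\<^bsub>T.C\<^esub> \<theta>\<^sub>3 w3 q'))" if "w1 \<in> carrier V" "w3 \<in> carrier V" for w1 w3
    by (rule balanced_precomp[OF f]) (rule that v q' srules)+
  have f5: "balanced S (restr id \<beta> T') (restr \<beta> id V) G (\<lambda>u w3. f (\<theta>\<^sub>3 w1 q) (u \<diamondop>\<^bsub>T.C\<^esub> \<theta>\<^sub>3 w3 q'))" if "w1 \<in> carrier V" "q \<in> carrier P'" for w1 q
    by (rule f2) (rule that srules)+
  note r = f f3 f4 f5 q' srules
  show "add_map V G (\<lambda>v. tlift G f (T.\<gamma>A (\<theta>\<^sub>3 v q')))"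
    by (rule r | assumption | drule restr_out)+
  show "add_map V G (\<lambda>v. tlift G (\<lambda>w1. tlift G (\<lambda>w2 w3. tlift G (\<lambda>q u.
    f (\<theta>\<^sub>3 w1 q) (u \<diamondop>\<^bsub>T.C\<^esub> \<theta>\<^sub>3 w3 q')) w2)) (\<gamma>\<^sub>V v))"
    by (rule r | assumption | drule restr_out)+
  fix t p assume h: "t \<in> carrier T" "p \<in> carrier P"
  let ?a = "ev'\<^sub>P (p \<diamondop>\<^bsub>P.E\<^esub> q')"
  have a: "?a \<in> carrier A" by (rule h r)+
  have g: "balanced A T T.C G (\<lambda>x c. f x (ract T.C c ?a))"
    by (rule balanced_precomp[OF f]) (rule a h r)+
  have eq: "f x (ract T.C c ?a) = tlift G (\<lambda>t2 t3. f x (t2 \<diamondop>\<^bsub>T.C\<^esub> \<theta>\<^sub>3 (t3 \<diamondop>\<^bsub>V\<^esub> p) q')) c"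
    if x: "x \<in> carrier T" and c: "c \<in> carrier T.C" for x c
  proof (rule tlift_ext[OF c, symmetric])
    show "balanced S (restr id \<beta> T') (restr \<beta> id T) G (\<lambda>t2 t3. f x (t2 \<diamondop>\<^bsub>T.C\<^esub> \<theta>\<^sub>3 (t3 \<diamondop>\<^bsub>V\<^esub> p) q'))"
      by (rule balanced_precomp[OF f2[OF x]]) (rule h r)+
    show "add_map T.C G (\<lambda>c. f x (ract T.C c ?a))"
      by (rule balancedD(5)[OF g x])
    show "f x (t2 \<diamondop>\<^bsub>T.C\<^esub> \<theta>\<^sub>3 (t3 \<diamondop>\<^bsub>V\<^esub> p) q') = f x (ract T.C (t2 \<diamondop>\<^bsub>T.C\<^esub> t3) ?a)"
      if "t2 \<in> carrier (restr id \<beta> T')" "t3 \<in> carrier (restr \<beta> id T)" for t2 t3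
      using that h q' by (simp only: restr_simps \<theta>_pure T.act_C P.ev_pure_closed)
  qed
  have "tlift G f (T.\<gamma>A (\<theta>\<^sub>3 (t \<diamondop>\<^bsub>V\<^esub> p) q')) = tlift G f (ract T.TAC (T.\<gamma>A t) ?a)"
    using h q' a by (simp add: \<theta>_pure rlinD(6)[OF T.\<gamma>A_r])
  also have "\<dots> = tlift G (\<lambda>x c. f x (ract T.C c ?a)) (T.\<gamma>A t)"
    by (rule tlift_ract[OF T.herd_structure(3) T.bimodule_C f g a T.\<gamma>A_closed[OF h(1)]]) simp
  also have "\<dots> = tlift G (\<lambda>x. tlift G (\<lambda>t2 t3. f x (t2 \<diamondop>\<^bsub>T.C\<^esub> \<theta>\<^sub>3 (t3 \<diamondop>\<^bsub>V\<^esub> p) q'))) (T.\<gamma>A t)"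
    by (rule eq tlift_cong g h r | assumption | drule restr_out)+
  also have "\<dots> = tlift G (\<lambda>w1. tlift G (\<lambda>w2 w3. tlift G (\<lambda>q u.
    f (\<theta>\<^sub>3 w1 q) (u \<diamondop>\<^bsub>T.C\<^esub> \<theta>\<^sub>3 w3 q')) w2)) (\<gamma>\<^sub>V (t \<diamondop>\<^bsub>V\<^esub> p))"
    by (rule compat_right_int[OF h f1 f2])
  finally show "tlift G f (T.\<gamma>A (\<theta>\<^sub>3 (t \<diamondop>\<^bsub>V\<^esub> p) q')) = tlift G (\<lambda>w1. tlift G (\<lambda>w2 w3. tlift G (\<lambda>q u.
    f (\<theta>\<^sub>3 w1 q) (u \<diamondop>\<^bsub>T.C\<^esub> \<theta>\<^sub>3 w3 q')) w2)) (\<gamma>\<^sub>V (t \<diamondop>\<^bsub>V\<^esub> p))" .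
qed

text \<open>Dually, left \<open>A\<close>-linearity of the coaction puts
  \<open>ev\<^sub>T (u' \<otimes> t)\<close> on \<open>p1\<close>, which makes it
  \<open>\<theta>\<^sub>1 u' (t \<otimes> p1)\<close>, and the second compatibility condition
  applies.\<close>

lemma \<tau>_\<theta>\<^sub>1_int:
  assumes v: "v \<in> carrier V" and u': "u' \<in> carrier T'" and f: "balanced A P.E P G f"
  shows "tlift G f (P.\<tau> (\<theta>\<^sub>1 u' v)) = tlift G (\<lambda>w1. tlift G (\<lambda>w2 w3. tlift G (\<lambda>q u.
    f (\<theta>\<^sub>1 u' w1 \<diamondop>\<^bsub>P.E\<^esub> q) (\<theta>\<^sub>1 u w3)) w2)) (\<gamma>\<^sub>V v)"
proof (rule V_ext[OF v])
  have fa: "add_map P.E G (\<lambda>x. f x y)" if "y \<in> carrier P" for y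
    by (rule balancedD(4)[OF f that])
  have f1: "balanced A P' P G (\<lambda>q y. f (\<theta>\<^sub>1 u' w \<diamondop>\<^bsub>P.E\<^esub> q) y)" if "w \<in> carrier V" for w
    by (rule balanced_precomp[OF f]) (rule that v u' srules)+
  have f2: "balanced Z (restr id \<kappa> V) (restr \<kappa> id P') G (\<lambda>w q. f (\<theta>\<^sub>1 u' w \<diamondop>\<^bsub>P.E\<^esub> q) y)" if "y \<in> carrier P" for y
    by (rule balanced_map[OF fa[OF that]]) (rule that v u' srules)+
  have f3: "balanced S (restr id \<beta> T') (restr \<beta> id V) G (\<lambda>u w. f e (\<theta>\<^sub>1 u w))" if "e \<in> carrier P.E" for e
    by (rule balanced_map[OF balancedD(5)[OF f that]]) (rule that v u' srules)+
  have f4: "balanced A P' T' G (\<lambda>q u. f (\<theta>\<^sub>1 u' w1 \<diamondop>\<^bsub>P.E\<^esub> q) (\<theta>\<^sub>1 u w3))" if "w1 \<in> carrier V" "w3 \<in> carrier V" for w1 w3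
    by (rule balanced_precomp[OF f]) (rule that v u' srules)+
  have f5: "balanced Z (restr id \<kappa> V) (restr \<kappa> id P') G (\<lambda>w1 q. f (\<theta>\<^sub>1 u' w1 \<diamondop>\<^bsub>P.E\<^esub> q) (\<theta>\<^sub>1 u w3))" if "w3 \<in> carrier V" "u \<in> carrier T'" for w3 u
    by (rule f2) (rule that srules)+
  note r = f f3 f4 f5 u' srules
  show "add_map V G (\<lambda>v. tlift G f (P.\<tau> (\<theta>\<^sub>1 u' v)))"
    by (rule r | assumption | drule restr_out)+
  show "add_map V G (\<lambda>v. tlift G (\<lambda>w1. tlift G (\<lambda>w2 w3. tlift G (\<lambda>q u.
    f (\<theta>\<^sub>1 u' w1 \<diamondop>\<^bsub>P.E\<^esub> q) (\<theta>\<^sub>1 u w3)) w2)) (\<gamma>\<^sub>V v))"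
    by (rule r | assumption | drule restr_out)+
  fix t p assume h: "t \<in> carrier T" "p \<in> carrier P"
  let ?a = "ev\<^sub>T (u' \<diamondop>\<^bsub>T.C\<^esub> t)"
  have a: "?a \<in> carrier A" by (rule h r)+
  have g: "balanced A P.E P G (\<lambda>e y. f (lact P.E ?a e) y)"
    by (rule balanced_precomp[OF f]) (rule a h r)+
  have "tlift G f (P.\<tau> (\<theta>\<^sub>1 u' (t \<diamondop>\<^bsub>V\<^esub> p))) = tlift G f (lact P.EBT ?a (P.\<tau> p))"
    using h u' a by (simp add: \<theta>_pure llinD(6)[OF P.\<tau>_l])
  also have "\<dots> = tlift G (\<lambda>e y. f (lact P.E ?a e) y) (P.\<tau> p)"
    by (rule tlift_lact[OF P.bimodule_E P.herd_structure(3) f g a P.\<tau>_closed[OF h(2)]]) simp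
  also have "\<dots> = tlift G (\<lambda>p1. tlift G (\<lambda>p2 p3. f (lact P.E ?a (p1 \<diamondop>\<^bsub>P.E\<^esub> p2)) p3)) (\<gamma>\<^sub>P p)"
    by (rule P.\<tau>_int[OF h(2) g])
  also have "\<dots> = tlift G (\<lambda>p1. tlift G (\<lambda>p2 p3. f (\<theta>\<^sub>1 u' (t \<diamondop>\<^bsub>V\<^esub> p1) \<diamondop>\<^bsub>P.E\<^esub> p2) p3)) (\<gamma>\<^sub>P p)"
  proof -
    have eq: "f (\<theta>\<^sub>1 u' (t \<diamondop>\<^bsub>V\<^esub> p1) \<diamondop>\<^bsub>P.E\<^esub> p2) p3 = f (lact P.E ?a (p1 \<diamondop>\<^bsub>P.E\<^esub> p2)) p3"
      if "p1 \<in> carrier P" "p2 \<in> carrier P'" for p1 p2 p3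
      using that h u' a by (simp add: \<theta>_pure P.act_E)
    have b1: "balanced Z (restr id \<kappa> P) (restr \<kappa> id P') G (\<lambda>p1 p2. f (\<theta>\<^sub>1 u' (t \<diamondop>\<^bsub>V\<^esub> p1) \<diamondop>\<^bsub>P.E\<^esub> p2) p3)" if "p3 \<in> carrier P" for p3
      by (rule balanced_map[OF fa[OF that]]) (rule that h r)+
    have b2: "balanced R (restr id \<alpha> P') (restr \<alpha> id P) G (\<lambda>p2 p3. f (\<theta>\<^sub>1 u' (t \<diamondop>\<^bsub>V\<^esub> p1) \<diamondop>\<^bsub>P.E\<^esub> p2) p3)" if "p1 \<in> carrier P" for p1
      by (rule balanced_restr[OF f1]) (rule that h r)+
    show ?thesis
      by (rule sym, (rule eq tlift_cong b1 b2 h r | assumption | drule restr_out)+)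
  qed
  also have "\<dots> = tlift G (\<lambda>w1. tlift G (\<lambda>w2 w3. tlift G (\<lambda>q u.
    f (\<theta>\<^sub>1 u' w1 \<diamondop>\<^bsub>P.E\<^esub> q) (\<theta>\<^sub>1 u w3)) w2)) (\<gamma>\<^sub>V (t \<diamondop>\<^bsub>V\<^esub> p))"
    by (rule compat_left_int[OF h f2 f1])
  finally show "tlift G f (P.\<tau> (\<theta>\<^sub>1 u' (t \<diamondop>\<^bsub>V\<^esub> p))) = tlift G (\<lambda>w1. tlift G (\<lambda>w2 w3. tlift G (\<lambda>q u.
    f (\<theta>\<^sub>1 u' w1 \<diamondop>\<^bsub>P.E\<^esub> q) (\<theta>\<^sub>1 u w3)) w2)) (\<gamma>\<^sub>V (t \<diamondop>\<^bsub>V\<^esub> p))" .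
qed

text \<open>On the left, the coproduct of \<open>C\<close> at
  \<open>u \<otimes> \<theta>\<^sub>3 v3 q'\<close> opens \<open>v3\<close> by a second shepherd. On
  the right, the second \<open>\<sigma>\<close> is \<open>\<Psi> u'\<close> at
  \<open>t1 \<otimes> \<theta>\<^sub>1 t2 v1\<close>, which \<open>pure_\<theta>\<^sub>1\<close>
  identifies with \<open>ev'\<^sub>T (t1 \<otimes> t2)\<close> acting on \<open>v1\<close>; the
  evaluation law for \<open>t\<close> removes this scalar and leaves a second shepherd at
  \<open>v1\<close>. Coassociativity compares the two.\<close>

lemma mult_left_\<sigma>:
  assumes "c \<in> carrier T.C" "e \<in> carrier P.E"
  shows "smash_mult_left A T.C T.\<Delta>C P.E \<sigma> c e"
proof (rule CE_ext[OF assms])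
  let ?Q = "P.E \<^bold>\<otimes>\<^bsub>A\<^esub> T.CC"
  let ?I = "tlift ?Q"
  let ?f = "\<lambda>c e. ?I (\<lambda>e' c'. e' \<diamondop>\<^bsub>?Q\<^esub> T.\<Delta>C c') (\<sigma> (c \<diamondop>\<^bsub>CE\<^esub> e))"
  let ?g = "\<lambda>c e. ?I (\<lambda>c1 c2. ?I (\<lambda>e' c'. ?I (\<lambda>e'' c''. e'' \<diamondop>\<^bsub>?Q\<^esub> (c'' \<diamondop>\<^bsub>T.CC\<^esub> c'))
    (\<sigma> (c1 \<diamondop>\<^bsub>CE\<^esub> e'))) (\<sigma> (c2 \<diamondop>\<^bsub>CE\<^esub> e))) (T.\<Delta>C c)"
  show "add_map T.C ?Q (\<lambda>c. ?f c e)" "add_map T.C ?Q (\<lambda>c. ?g c e)" if "e \<in> carrier P.E" for e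
    by (rule that srules | assumption | drule restr_out)+
  show "add_map P.E ?Q (?f c)" "add_map P.E ?Q (?g c)" if "c \<in> carrier T.C" for c
    by (rule that srules | assumption | drule restr_out)+
  fix u' t p q' assume h: "u' \<in> carrier T'" "t \<in> carrier T" "p \<in> carrier P" "q' \<in> carrier P'"
  have v: "t \<diamondop>\<^bsub>V\<^esub> p \<in> carrier V" by (rule h crules)+
  have e: "p \<diamondop>\<^bsub>P.E\<^esub> q' \<in> carrier P.E" by (rule h crules)+
  note r = h v e srules
  \<comment> \<open>An integrand on \<open>V, V', V, V', V\<close>: both sides of the claim are sums
    of it over two shepherds, nested at \<open>v3\<close> on the left and at \<open>v1\<close> on
    the right.\<close>
  let ?F = "\<lambda>a1 a2 a3 a4 a5. ?I (\<lambda>q u. ?I (\<lambda>q2 u2. (\<theta>\<^sub>1 u' a1 \<diamondop>\<^bsub>P.E\<^esub> q) \<diamondop>\<^bsub>?Q\<^esub>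
    ((u \<diamondop>\<^bsub>T.C\<^esub> \<theta>\<^sub>3 a3 q2) \<diamondop>\<^bsub>T.CC\<^esub> (u2 \<diamondop>\<^bsub>T.C\<^esub> \<theta>\<^sub>3 a5 q'))) a4) a2"
  have L1: "?I (\<lambda>e' c'. e' \<diamondop>\<^bsub>?Q\<^esub> T.\<Delta>C c') (\<Psi> u' (t \<diamondop>\<^bsub>V\<^esub> p) q') =
    ?I (\<lambda>v1. ?I (\<lambda>v2 v3. ?I (\<lambda>q u. (\<theta>\<^sub>1 u' v1 \<diamondop>\<^bsub>P.E\<^esub> q) \<diamondop>\<^bsub>?Q\<^esub> T.\<Delta>C (u \<diamondop>\<^bsub>T.C\<^esub> \<theta>\<^sub>3 v3 q')) v2)) (\<gamma>\<^sub>V (t \<diamondop>\<^bsub>V\<^esub> p))"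
    by (rule \<Psi>_int) (rule r | assumption | drule restr_out)+
  have L2: "\<dots> = ?I (\<lambda>v1. ?I (\<lambda>v2 v3. ?I (\<lambda>q u. ?I (\<lambda>w1. ?I (\<lambda>w2 w3. ?I (\<lambda>q2 u2. (\<theta>\<^sub>1 u' v1 \<diamondop>\<^bsub>P.E\<^esub> q) \<diamondop>\<^bsub>?Q\<^esub>
    ((u \<diamondop>\<^bsub>T.C\<^esub> \<theta>\<^sub>3 w1 q2) \<diamondop>\<^bsub>T.CC\<^esub> (u2 \<diamondop>\<^bsub>T.C\<^esub> \<theta>\<^sub>3 w3 q'))) w2)) (\<gamma>\<^sub>V v3)) v2)) (\<gamma>\<^sub>V (t \<diamondop>\<^bsub>V\<^esub> p))"
  proof -
    have eq: "x \<diamondop>\<^bsub>?Q\<^esub> T.\<Delta>C (u \<diamondop>\<^bsub>T.C\<^esub> \<theta>\<^sub>3 v3 q') = ?I (\<lambda>w1. ?I (\<lambda>w2 w3. ?I (\<lambda>q2 u2. x \<diamondop>\<^bsub>?Q\<^esub>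
        ((u \<diamondop>\<^bsub>T.C\<^esub> \<theta>\<^sub>3 w1 q2) \<diamondop>\<^bsub>T.CC\<^esub> (u2 \<diamondop>\<^bsub>T.C\<^esub> \<theta>\<^sub>3 w3 q'))) w2)) (\<gamma>\<^sub>V v3)"
      if y: "x \<in> carrier P.E" "u \<in> carrier T'" "v3 \<in> carrier V" for x u v3
    proof -
      have c: "\<theta>\<^sub>3 v3 q' \<in> carrier T" by (rule y r)+
      have "x \<diamondop>\<^bsub>?Q\<^esub> T.\<Delta>C (u \<diamondop>\<^bsub>T.C\<^esub> \<theta>\<^sub>3 v3 q') = ?I (\<lambda>x1 d. x \<diamondop>\<^bsub>?Q\<^esub> ((u \<diamondop>\<^bsub>T.C\<^esub> x1) \<diamondop>\<^bsub>T.CC\<^esub> d)) (T.\<gamma>A (\<theta>\<^sub>3 v3 q'))"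
        unfolding T.\<Delta>C_pure[OF y(2) c]
        by (rule evals y r | assumption | drule restr_out)+
      also have "\<dots> = ?I (\<lambda>w1. ?I (\<lambda>w2 w3. ?I (\<lambda>q2 u2. x \<diamondop>\<^bsub>?Q\<^esub>
        ((u \<diamondop>\<^bsub>T.C\<^esub> \<theta>\<^sub>3 w1 q2) \<diamondop>\<^bsub>T.CC\<^esub> (u2 \<diamondop>\<^bsub>T.C\<^esub> \<theta>\<^sub>3 w3 q'))) w2)) (\<gamma>\<^sub>V v3)"
        by (rule \<gamma>A_\<theta>\<^sub>3_int[OF y(3) h(4)]) (rule y r | assumption | drule restr_out)+
      finally show ?thesis .
    qed
    show ?thesis
      by (rule eq tlift_cong r | assumption | drule restr_out)+
  qed
  have L3: "\<dots> = ?I (\<lambda>v1. ?I (\<lambda>v2 v3. ?I (\<lambda>w1. ?I (\<lambda>w2 w3. ?F v1 v2 w1 w2 w3)) (\<gamma>\<^sub>V v3))) (\<gamma>\<^sub>V (t \<diamondop>\<^bsub>V\<^esub> p))"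
  proof -
    have "?I (\<lambda>v1. ?I (\<lambda>v2 v3. ?I (\<lambda>q u. ?I (\<lambda>w1. ?I (\<lambda>w2 w3. ?I (\<lambda>q2 u2. (\<theta>\<^sub>1 u' v1 \<diamondop>\<^bsub>P.E\<^esub> q) \<diamondop>\<^bsub>?Q\<^esub>
    ((u \<diamondop>\<^bsub>T.C\<^esub> \<theta>\<^sub>3 w1 q2) \<diamondop>\<^bsub>T.CC\<^esub> (u2 \<diamondop>\<^bsub>T.C\<^esub> \<theta>\<^sub>3 w3 q'))) w2)) (\<gamma>\<^sub>V v3)) v2)) (\<gamma>\<^sub>V (t \<diamondop>\<^bsub>V\<^esub> p)) =
      ?I (\<lambda>v1. ?I (\<lambda>v2 v3. ?I (\<lambda>w1 d. ?I (\<lambda>q u. ?I (\<lambda>w2 w3. ?I (\<lambda>q2 u2. (\<theta>\<^sub>1 u' v1 \<diamondop>\<^bsub>P.E\<^esub> q) \<diamondop>\<^bsub>?Q\<^esub>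
    ((u \<diamondop>\<^bsub>T.C\<^esub> \<theta>\<^sub>3 w1 q2) \<diamondop>\<^bsub>T.CC\<^esub> (u2 \<diamondop>\<^bsub>T.C\<^esub> \<theta>\<^sub>3 w3 q'))) w2) d) v2) (\<gamma>\<^sub>V v3))) (\<gamma>\<^sub>V (t \<diamondop>\<^bsub>V\<^esub> p))"
      by (rule tlift_swap tlift_cong r | assumption | drule restr_out)+
    also have "\<dots> = ?I (\<lambda>v1. ?I (\<lambda>v2 v3. ?I (\<lambda>w1. ?I (\<lambda>w2 w3. ?F v1 v2 w1 w2 w3)) (\<gamma>\<^sub>V v3))) (\<gamma>\<^sub>V (t \<diamondop>\<^bsub>V\<^esub> p))"
      by (rule tlift_swap tlift_cong r | assumption | drule restr_out)+
    finally show ?thesis .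
  qed
  have M: "?I (\<lambda>v1. ?I (\<lambda>v2 v3. ?I (\<lambda>w1. ?I (\<lambda>w2 w3. ?F w1 w2 w3 v2 v3)) (\<gamma>\<^sub>V v1))) (\<gamma>\<^sub>V (t \<diamondop>\<^bsub>V\<^esub> p)) =
    ?I (\<lambda>v1. ?I (\<lambda>v2 v3. ?I (\<lambda>w1. ?I (\<lambda>w2 w3. ?F v1 v2 w1 w2 w3)) (\<gamma>\<^sub>V v3))) (\<gamma>\<^sub>V (t \<diamondop>\<^bsub>V\<^esub> p))"
    by (rule VH.shepherd_coassoc_int) (rule r | assumption | drule restr_out)+
  \<comment> \<open>The scalar \<open>ev'\<^sub>T (t1 \<otimes> t2)\<close> is kept as a separate
    variable \<open>b\<close>, because the evaluation law is integrated over the tensor product of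
    \<open>B\<close> and \<open>T\<close>.\<close>
  let ?h = "\<lambda>b y. ?I (\<lambda>v1. ?I (\<lambda>v2 v3. ?I (\<lambda>q u. ?I (\<lambda>e'' c''. e'' \<diamondop>\<^bsub>?Q\<^esub> (c'' \<diamondop>\<^bsub>T.CC\<^esub> (u \<diamondop>\<^bsub>T.C\<^esub> \<theta>\<^sub>3 v3 q')))
    (\<Psi> u' (lact V b v1) q)) v2)) (\<gamma>\<^sub>V (y \<diamondop>\<^bsub>V\<^esub> p))"
  have hb: "balanced S (restr id \<beta> (regular B)) (restr \<beta> id T) ?Q ?h"
    by (rule r | assumption | drule restr_out | drule regular_out)+
  have R1: "?g (u' \<diamondop>\<^bsub>T.C\<^esub> t) (p \<diamondop>\<^bsub>P.E\<^esub> q') = ?I (\<lambda>t1 c2. ?I (\<lambda>e' c'. ?I (\<lambda>e'' c''. e'' \<diamondop>\<^bsub>?Q\<^esub> (c'' \<diamondop>\<^bsub>T.CC\<^esub> c'))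
    (\<sigma> ((u' \<diamondop>\<^bsub>T.C\<^esub> t1) \<diamondop>\<^bsub>CE\<^esub> e'))) (\<sigma> (c2 \<diamondop>\<^bsub>CE\<^esub> (p \<diamondop>\<^bsub>P.E\<^esub> q')))) (T.\<gamma>A t)"
    by (rule T.\<Delta>C_int) (rule r | assumption | drule restr_out)+
  have R2: "\<dots> = ?I (\<lambda>t1. ?I (\<lambda>t2 t3. ?h (ev'\<^sub>T (t1 \<diamondop>\<^bsub>T.E\<^esub> t2)) t3)) (T.\<gamma>A t)"
  proof -
    have eq: "?I (\<lambda>e' c'. ?I (\<lambda>e'' c''. e'' \<diamondop>\<^bsub>?Q\<^esub> (c'' \<diamondop>\<^bsub>T.CC\<^esub> c')) (\<sigma> ((u' \<diamondop>\<^bsub>T.C\<^esub> t1) \<diamondop>\<^bsub>CE\<^esub> e')))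
        (\<sigma> ((t2 \<diamondop>\<^bsub>T.C\<^esub> t3) \<diamondop>\<^bsub>CE\<^esub> (p \<diamondop>\<^bsub>P.E\<^esub> q'))) = ?h (ev'\<^sub>T (t1 \<diamondop>\<^bsub>T.E\<^esub> t2)) t3"
      if y: "t1 \<in> carrier T" "t2 \<in> carrier T'" "t3 \<in> carrier T" for t1 t2 t3
    proof -
      have v': "t3 \<diamondop>\<^bsub>V\<^esub> p \<in> carrier V" by (rule y r)+
      have b: "ev'\<^sub>T (t1 \<diamondop>\<^bsub>T.E\<^esub> t2) \<in> carrier B" by (rule y r)+
      have "?I (\<lambda>e' c'. ?I (\<lambda>e'' c''. e'' \<diamondop>\<^bsub>?Q\<^esub> (c'' \<diamondop>\<^bsub>T.CC\<^esub> c')) (\<sigma> ((u' \<diamondop>\<^bsub>T.C\<^esub> t1) \<diamondop>\<^bsub>CE\<^esub> e'))) (\<Psi> t2 (t3 \<diamondop>\<^bsub>V\<^esub> p) q') =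
        ?I (\<lambda>v1. ?I (\<lambda>v2 v3. ?I (\<lambda>q u. ?I (\<lambda>e'' c''. e'' \<diamondop>\<^bsub>?Q\<^esub> (c'' \<diamondop>\<^bsub>T.CC\<^esub> (u \<diamondop>\<^bsub>T.C\<^esub> \<theta>\<^sub>3 v3 q')))
          (\<sigma> ((u' \<diamondop>\<^bsub>T.C\<^esub> t1) \<diamondop>\<^bsub>CE\<^esub> (\<theta>\<^sub>1 t2 v1 \<diamondop>\<^bsub>P.E\<^esub> q)))) v2)) (\<gamma>\<^sub>V (t3 \<diamondop>\<^bsub>V\<^esub> p))"
        by (rule \<Psi>_int) (rule y v' r | assumption | drule restr_out)+
      also have "\<dots> = ?h (ev'\<^sub>T (t1 \<diamondop>\<^bsub>T.E\<^esub> t2)) t3"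
      proof -
        have eq: "?I (\<lambda>e'' c''. e'' \<diamondop>\<^bsub>?Q\<^esub> (c'' \<diamondop>\<^bsub>T.CC\<^esub> w)) (\<Psi> u' (lact V (ev'\<^sub>T (t1 \<diamondop>\<^bsub>T.E\<^esub> t2)) v1) q) =
          ?I (\<lambda>e'' c''. e'' \<diamondop>\<^bsub>?Q\<^esub> (c'' \<diamondop>\<^bsub>T.CC\<^esub> w)) (\<sigma> ((u' \<diamondop>\<^bsub>T.C\<^esub> t1) \<diamondop>\<^bsub>CE\<^esub> (\<theta>\<^sub>1 t2 v1 \<diamondop>\<^bsub>P.E\<^esub> q)))"
          if z: "v1 \<in> carrier V" "q \<in> carrier P'" for v1 q w
          using y z h by (simp add: \<sigma>_pure pure_\<theta>\<^sub>1 \<theta>_closed)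
        show ?thesis
          by (rule sym, (rule eq tlift_cong y b v' r | assumption | drule restr_out)+)
      qed
      finally show ?thesis unfolding \<sigma>_pure[OF y(2,3) h(3,4)] .
    qed
    have eq2: "?I (\<lambda>t2 t3. ?h (ev'\<^sub>T (t1 \<diamondop>\<^bsub>T.E\<^esub> t2)) t3) c2 = ?I (\<lambda>e' c'. ?I (\<lambda>e'' c''. e'' \<diamondop>\<^bsub>?Q\<^esub> (c'' \<diamondop>\<^bsub>T.CC\<^esub> c'))
        (\<sigma> ((u' \<diamondop>\<^bsub>T.C\<^esub> t1) \<diamondop>\<^bsub>CE\<^esub> e'))) (\<sigma> (c2 \<diamondop>\<^bsub>CE\<^esub> (p \<diamondop>\<^bsub>P.E\<^esub> q')))"
      if y: "t1 \<in> carrier T" "c2 \<in> carrier T.C" for t1 c2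
    proof (rule tlift_ext[OF y(2)])
      show "balanced S (restr id \<beta> T') (restr \<beta> id T) ?Q (\<lambda>t2 t3. ?h (ev'\<^sub>T (t1 \<diamondop>\<^bsub>T.E\<^esub> t2)) t3)"
        by (rule balanced_precomp[OF hb]) (rule y r)+
      show "add_map T.C ?Q (\<lambda>c2. ?I (\<lambda>e' c'. ?I (\<lambda>e'' c''. e'' \<diamondop>\<^bsub>?Q\<^esub> (c'' \<diamondop>\<^bsub>T.CC\<^esub> c'))
        (\<sigma> ((u' \<diamondop>\<^bsub>T.C\<^esub> t1) \<diamondop>\<^bsub>CE\<^esub> e'))) (\<sigma> (c2 \<diamondop>\<^bsub>CE\<^esub> (p \<diamondop>\<^bsub>P.E\<^esub> q'))))"
        by (rule y r | assumption | drule restr_out)+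
      show "?h (ev'\<^sub>T (t1 \<diamondop>\<^bsub>T.E\<^esub> t2)) t3 = ?I (\<lambda>e' c'. ?I (\<lambda>e'' c''. e'' \<diamondop>\<^bsub>?Q\<^esub> (c'' \<diamondop>\<^bsub>T.CC\<^esub> c'))
        (\<sigma> ((u' \<diamondop>\<^bsub>T.C\<^esub> t1) \<diamondop>\<^bsub>CE\<^esub> e'))) (\<sigma> ((t2 \<diamondop>\<^bsub>T.C\<^esub> t3) \<diamondop>\<^bsub>CE\<^esub> (p \<diamondop>\<^bsub>P.E\<^esub> q')))"
        if "t2 \<in> carrier (restr id \<beta> T')" "t3 \<in> carrier (restr \<beta> id T)" for t2 t3
        using that by (intro eq[symmetric] y) (simp_all only: restr_simps)
    qed
    show ?thesis
      by (rule tlift_cong, (rule r | assumption | drule restr_out)+, rule eq2[symmetric])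
  qed
  have R3: "\<dots> = ?h \<one>\<^bsub>B\<^esub> t"
    by (rule T.\<gamma>A_counit'[OF h(2) hb])
  have R4: "\<dots> = ?I (\<lambda>v1. ?I (\<lambda>v2 v3. ?I (\<lambda>w1. ?I (\<lambda>w2 w3. ?F w1 w2 w3 v2 v3)) (\<gamma>\<^sub>V v1))) (\<gamma>\<^sub>V (t \<diamondop>\<^bsub>V\<^esub> p))"
  proof -
    have eq: "?I (\<lambda>w1. ?I (\<lambda>w2 w3. ?I (\<lambda>q2 u2. (\<theta>\<^sub>1 u' w1 \<diamondop>\<^bsub>P.E\<^esub> q2) \<diamondop>\<^bsub>?Q\<^esub> ((u2 \<diamondop>\<^bsub>T.C\<^esub> \<theta>\<^sub>3 w3 q) \<diamondop>\<^bsub>T.CC\<^esub> w)) w2)) (\<gamma>\<^sub>V v1) =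
       ?I (\<lambda>e'' c''. e'' \<diamondop>\<^bsub>?Q\<^esub> (c'' \<diamondop>\<^bsub>T.CC\<^esub> w)) (\<Psi> u' (lact V \<one>\<^bsub>B\<^esub> v1) q)"
      if z: "v1 \<in> carrier V" "q \<in> carrier P'" "w \<in> carrier T.C" for v1 q w
      unfolding VH.T.lact_one[OF z(1)]
      by (rule \<Psi>_int[symmetric]) (rule z r | assumption | drule restr_out)+
    have "?h \<one>\<^bsub>B\<^esub> t = ?I (\<lambda>v1. ?I (\<lambda>v2 v3. ?I (\<lambda>q u. ?I (\<lambda>w1. ?I (\<lambda>w2 w3. ?I (\<lambda>q2 u2. (\<theta>\<^sub>1 u' w1 \<diamondop>\<^bsub>P.E\<^esub> q2) \<diamondop>\<^bsub>?Q\<^esub>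
      ((u2 \<diamondop>\<^bsub>T.C\<^esub> \<theta>\<^sub>3 w3 q) \<diamondop>\<^bsub>T.CC\<^esub> (u \<diamondop>\<^bsub>T.C\<^esub> \<theta>\<^sub>3 v3 q'))) w2)) (\<gamma>\<^sub>V v1)) v2)) (\<gamma>\<^sub>V (t \<diamondop>\<^bsub>V\<^esub> p))"
      by (rule sym, (rule eq tlift_cong r | assumption | drule restr_out)+)
    also have "\<dots> = ?I (\<lambda>v1. ?I (\<lambda>v2 v3. ?I (\<lambda>w1 d. ?I (\<lambda>q u. ?I (\<lambda>w2 w3. ?I (\<lambda>q2 u2. (\<theta>\<^sub>1 u' w1 \<diamondop>\<^bsub>P.E\<^esub> q2) \<diamondop>\<^bsub>?Q\<^esub>
      ((u2 \<diamondop>\<^bsub>T.C\<^esub> \<theta>\<^sub>3 w3 q) \<diamondop>\<^bsub>T.CC\<^esub> (u \<diamondop>\<^bsub>T.C\<^esub> \<theta>\<^sub>3 v3 q'))) w2) d) v2) (\<gamma>\<^sub>V v1))) (\<gamma>\<^sub>V (t \<diamondop>\<^bsub>V\<^esub> p))"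
      by (rule tlift_swap tlift_cong r | assumption | drule restr_out)+
    also have "\<dots> = ?I (\<lambda>v1. ?I (\<lambda>v2 v3. ?I (\<lambda>w1 d. ?I (\<lambda>w2 w3. ?I (\<lambda>q u. ?I (\<lambda>q2 u2. (\<theta>\<^sub>1 u' w1 \<diamondop>\<^bsub>P.E\<^esub> q2) \<diamondop>\<^bsub>?Q\<^esub>
      ((u2 \<diamondop>\<^bsub>T.C\<^esub> \<theta>\<^sub>3 w3 q) \<diamondop>\<^bsub>T.CC\<^esub> (u \<diamondop>\<^bsub>T.C\<^esub> \<theta>\<^sub>3 v3 q'))) w2) v2) d) (\<gamma>\<^sub>V v1))) (\<gamma>\<^sub>V (t \<diamondop>\<^bsub>V\<^esub> p))"
      by (rule tlift_swap tlift_cong r | assumption | drule restr_out)+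
    also have "\<dots> = ?I (\<lambda>v1. ?I (\<lambda>v2 v3. ?I (\<lambda>w1. ?I (\<lambda>w2 w3. ?F w1 w2 w3 v2 v3)) (\<gamma>\<^sub>V v1))) (\<gamma>\<^sub>V (t \<diamondop>\<^bsub>V\<^esub> p))"
      by (rule tlift_swap tlift_cong r | assumption | drule restr_out)+
    finally show ?thesis .
  qed
  show "?f (u' \<diamondop>\<^bsub>T.C\<^esub> t) (p \<diamondop>\<^bsub>P.E\<^esub> q') = ?g (u' \<diamondop>\<^bsub>T.C\<^esub> t) (p \<diamondop>\<^bsub>P.E\<^esub> q')"
    unfolding R1 R2 R3 R4 M \<sigma>_pure[OF h] L1 L2 L3 ..
qed

text \<open>The two ends change roles: the coproduct of \<open>E\<close> at
  \<open>\<theta>\<^sub>1 u' v1 \<otimes> q\<close> opens \<open>v1\<close>, and the second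
  \<open>\<sigma>\<close> is \<open>\<Psi> u\<close> at
  \<open>\<theta>\<^sub>3 v3 p2 \<otimes> p3\<close>, that is, at \<open>v3\<close> acted on by
  \<open>ev\<^sub>P (p2 \<otimes> p3)\<close>, a scalar which the evaluation law for
  \<open>p\<close> removes.\<close>

lemma mult_right_\<sigma>:
  assumes "c \<in> carrier T.C" "e \<in> carrier P.E"
  shows "smash_mult_right A T.C P.E P.\<Delta>E \<sigma> c e"
proof (rule CE_ext[OF assms])
  let ?Q = "P.EE \<^bold>\<otimes>\<^bsub>A\<^esub> T.C"
  let ?I = "tlift ?Q"
  let ?f = "\<lambda>c e. ?I (\<lambda>e' c'. P.\<Delta>E e' \<diamondop>\<^bsub>?Q\<^esub> c') (\<sigma> (c \<diamondop>\<^bsub>CE\<^esub> e))"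
  let ?g = "\<lambda>c e. ?I (\<lambda>e1 e2. ?I (\<lambda>e' c'. ?I (\<lambda>e'' c''. (e' \<diamondop>\<^bsub>P.EE\<^esub> e'') \<diamondop>\<^bsub>?Q\<^esub> c'')
    (\<sigma> (c' \<diamondop>\<^bsub>CE\<^esub> e2))) (\<sigma> (c \<diamondop>\<^bsub>CE\<^esub> e1))) (P.\<Delta>E e)"
  show "add_map T.C ?Q (\<lambda>c. ?f c e)" "add_map T.C ?Q (\<lambda>c. ?g c e)" if "e \<in> carrier P.E" for e
    by (rule that srules | assumption | drule restr_out)+
  show "add_map P.E ?Q (?f c)" "add_map P.E ?Q (?g c)" if "c \<in> carrier T.C" for c
    by (rule that srules | assumption | drule restr_out)+
  fix u' t p q' assume h: "u' \<in> carrier T'" "t \<in> carrier T" "p \<in> carrier P" "q' \<in> carrier P'"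
  have v: "t \<diamondop>\<^bsub>V\<^esub> p \<in> carrier V" by (rule h crules)+
  have c: "u' \<diamondop>\<^bsub>T.C\<^esub> t \<in> carrier T.C" by (rule h crules)+
  note r = h v c srules
  let ?F = "\<lambda>a1 a2 a3 a4 a5. ?I (\<lambda>q u. ?I (\<lambda>q2 u2. ((\<theta>\<^sub>1 u' a1 \<diamondop>\<^bsub>P.E\<^esub> q) \<diamondop>\<^bsub>P.EE\<^esub>
    (\<theta>\<^sub>1 u a3 \<diamondop>\<^bsub>P.E\<^esub> q2)) \<diamondop>\<^bsub>?Q\<^esub> (u2 \<diamondop>\<^bsub>T.C\<^esub> \<theta>\<^sub>3 a5 q')) a4) a2"
  have L1: "?I (\<lambda>e' c'. P.\<Delta>E e' \<diamondop>\<^bsub>?Q\<^esub> c') (\<Psi> u' (t \<diamondop>\<^bsub>V\<^esub> p) q') =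
    ?I (\<lambda>v1. ?I (\<lambda>v2 v3. ?I (\<lambda>q u. P.\<Delta>E (\<theta>\<^sub>1 u' v1 \<diamondop>\<^bsub>P.E\<^esub> q) \<diamondop>\<^bsub>?Q\<^esub> (u \<diamondop>\<^bsub>T.C\<^esub> \<theta>\<^sub>3 v3 q')) v2)) (\<gamma>\<^sub>V (t \<diamondop>\<^bsub>V\<^esub> p))"
    by (rule \<Psi>_int) (rule r | assumption | drule restr_out)+
  have L2: "\<dots> = ?I (\<lambda>v1. ?I (\<lambda>v2 v3. ?I (\<lambda>q u. ?I (\<lambda>w1. ?I (\<lambda>w2 w3. ?I (\<lambda>q2 u2. ((\<theta>\<^sub>1 u' w1 \<diamondop>\<^bsub>P.E\<^esub> q2) \<diamondop>\<^bsub>P.EE\<^esub>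
    (\<theta>\<^sub>1 u2 w3 \<diamondop>\<^bsub>P.E\<^esub> q)) \<diamondop>\<^bsub>?Q\<^esub> (u \<diamondop>\<^bsub>T.C\<^esub> \<theta>\<^sub>3 v3 q')) w2)) (\<gamma>\<^sub>V v1)) v2)) (\<gamma>\<^sub>V (t \<diamondop>\<^bsub>V\<^esub> p))"
  proof -
    have eq: "P.\<Delta>E (\<theta>\<^sub>1 u' v1 \<diamondop>\<^bsub>P.E\<^esub> q) \<diamondop>\<^bsub>?Q\<^esub> x = ?I (\<lambda>w1. ?I (\<lambda>w2 w3. ?I (\<lambda>q2 u2. ((\<theta>\<^sub>1 u' w1 \<diamondop>\<^bsub>P.E\<^esub> q2) \<diamondop>\<^bsub>P.EE\<^esub>
        (\<theta>\<^sub>1 u2 w3 \<diamondop>\<^bsub>P.E\<^esub> q)) \<diamondop>\<^bsub>?Q\<^esub> x) w2)) (\<gamma>\<^sub>V v1)"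
      if y: "v1 \<in> carrier V" "q \<in> carrier P'" "x \<in> carrier T.C" for x v1 q
    proof -
      have d: "\<theta>\<^sub>1 u' v1 \<in> carrier P" by (rule y r)+
      have "P.\<Delta>E (\<theta>\<^sub>1 u' v1 \<diamondop>\<^bsub>P.E\<^esub> q) \<diamondop>\<^bsub>?Q\<^esub> x = ?I (\<lambda>d y. (d \<diamondop>\<^bsub>P.EE\<^esub> (y \<diamondop>\<^bsub>P.E\<^esub> q)) \<diamondop>\<^bsub>?Q\<^esub> x) (P.\<tau> (\<theta>\<^sub>1 u' v1))"
        unfolding P.\<Delta>E_pure[OF d y(2)]
        by (rule evals y r | assumption | drule restr_out)+
      also have "\<dots> = ?I (\<lambda>w1. ?I (\<lambda>w2 w3. ?I (\<lambda>q2 u2. ((\<theta>\<^sub>1 u' w1 \<diamondop>\<^bsub>P.E\<^esub> q2) \<diamondop>\<^bsub>P.EE\<^esub>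
        (\<theta>\<^sub>1 u2 w3 \<diamondop>\<^bsub>P.E\<^esub> q)) \<diamondop>\<^bsub>?Q\<^esub> x) w2)) (\<gamma>\<^sub>V v1)"
        by (rule \<tau>_\<theta>\<^sub>1_int[OF y(1) h(1)]) (rule y r | assumption | drule restr_out)+
      finally show ?thesis .
    qed
    show ?thesis
      by (rule eq tlift_cong r | assumption | drule restr_out)+
  qed
  have L3: "\<dots> = ?I (\<lambda>v1. ?I (\<lambda>v2 v3. ?I (\<lambda>w1. ?I (\<lambda>w2 w3. ?F w1 w2 w3 v2 v3)) (\<gamma>\<^sub>V v1))) (\<gamma>\<^sub>V (t \<diamondop>\<^bsub>V\<^esub> p))"
  proof -
    have "?I (\<lambda>v1. ?I (\<lambda>v2 v3. ?I (\<lambda>q u. ?I (\<lambda>w1. ?I (\<lambda>w2 w3. ?I (\<lambda>q2 u2. ((\<theta>\<^sub>1 u' w1 \<diamondop>\<^bsub>P.E\<^esub> q2) \<diamondop>\<^bsub>P.EE\<^esub>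
        (\<theta>\<^sub>1 u2 w3 \<diamondop>\<^bsub>P.E\<^esub> q)) \<diamondop>\<^bsub>?Q\<^esub> (u \<diamondop>\<^bsub>T.C\<^esub> \<theta>\<^sub>3 v3 q')) w2)) (\<gamma>\<^sub>V v1)) v2)) (\<gamma>\<^sub>V (t \<diamondop>\<^bsub>V\<^esub> p)) =
      ?I (\<lambda>v1. ?I (\<lambda>v2 v3. ?I (\<lambda>w1 d. ?I (\<lambda>q u. ?I (\<lambda>w2 w3. ?I (\<lambda>q2 u2. ((\<theta>\<^sub>1 u' w1 \<diamondop>\<^bsub>P.E\<^esub> q2) \<diamondop>\<^bsub>P.EE\<^esub>
        (\<theta>\<^sub>1 u2 w3 \<diamondop>\<^bsub>P.E\<^esub> q)) \<diamondop>\<^bsub>?Q\<^esub> (u \<diamondop>\<^bsub>T.C\<^esub> \<theta>\<^sub>3 v3 q')) w2) d) v2) (\<gamma>\<^sub>V v1))) (\<gamma>\<^sub>V (t \<diamondop>\<^bsub>V\<^esub> p))"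
      by (rule tlift_swap tlift_cong r | assumption | drule restr_out)+
    also have "\<dots> = ?I (\<lambda>v1. ?I (\<lambda>v2 v3. ?I (\<lambda>w1 d. ?I (\<lambda>w2 w3. ?I (\<lambda>q u. ?I (\<lambda>q2 u2. ((\<theta>\<^sub>1 u' w1 \<diamondop>\<^bsub>P.E\<^esub> q2) \<diamondop>\<^bsub>P.EE\<^esub>
        (\<theta>\<^sub>1 u2 w3 \<diamondop>\<^bsub>P.E\<^esub> q)) \<diamondop>\<^bsub>?Q\<^esub> (u \<diamondop>\<^bsub>T.C\<^esub> \<theta>\<^sub>3 v3 q')) w2) v2) d) (\<gamma>\<^sub>V v1))) (\<gamma>\<^sub>V (t \<diamondop>\<^bsub>V\<^esub> p))"
      by (rule tlift_swap tlift_cong r | assumption | drule restr_out)+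
    also have "\<dots> = ?I (\<lambda>v1. ?I (\<lambda>v2 v3. ?I (\<lambda>w1. ?I (\<lambda>w2 w3. ?F w1 w2 w3 v2 v3)) (\<gamma>\<^sub>V v1))) (\<gamma>\<^sub>V (t \<diamondop>\<^bsub>V\<^esub> p))"
      by (rule tlift_swap tlift_cong r | assumption | drule restr_out)+
    finally show ?thesis .
  qed
  have M: "?I (\<lambda>v1. ?I (\<lambda>v2 v3. ?I (\<lambda>w1. ?I (\<lambda>w2 w3. ?F w1 w2 w3 v2 v3)) (\<gamma>\<^sub>V v1))) (\<gamma>\<^sub>V (t \<diamondop>\<^bsub>V\<^esub> p)) =
    ?I (\<lambda>v1. ?I (\<lambda>v2 v3. ?I (\<lambda>w1. ?I (\<lambda>w2 w3. ?F v1 v2 w1 w2 w3)) (\<gamma>\<^sub>V v3))) (\<gamma>\<^sub>V (t \<diamondop>\<^bsub>V\<^esub> p))"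
    by (rule VH.shepherd_coassoc_int) (rule r | assumption | drule restr_out)+
  \<comment> \<open>\<open>k\<close> stands for \<open>ev\<^sub>P (p2 \<otimes> p3)\<close>;
    \<open>P.\<tau>_counit'\<close> sets it to one.\<close>
  let ?h = "\<lambda>y k. ?I (\<lambda>v1. ?I (\<lambda>v2 v3. ?I (\<lambda>q u. ?I (\<lambda>e'' c''. ((\<theta>\<^sub>1 u' v1 \<diamondop>\<^bsub>P.E\<^esub> q) \<diamondop>\<^bsub>P.EE\<^esub> e'') \<diamondop>\<^bsub>?Q\<^esub> c'')
    (\<Psi> u (ract V v3 k) q')) v2)) (\<gamma>\<^sub>V (t \<diamondop>\<^bsub>V\<^esub> y))"
  have hb: "balanced Z (restr id \<kappa> P) (restr \<kappa> id (regular K)) ?Q ?h"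
    by (rule r | assumption | drule restr_out | drule regular_out)+
  have R1: "?g (u' \<diamondop>\<^bsub>T.C\<^esub> t) (p \<diamondop>\<^bsub>P.E\<^esub> q') = ?I (\<lambda>e1 p3. ?I (\<lambda>e' c'. ?I (\<lambda>e'' c''. (e' \<diamondop>\<^bsub>P.EE\<^esub> e'') \<diamondop>\<^bsub>?Q\<^esub> c'')
    (\<sigma> (c' \<diamondop>\<^bsub>CE\<^esub> (p3 \<diamondop>\<^bsub>P.E\<^esub> q')))) (\<sigma> ((u' \<diamondop>\<^bsub>T.C\<^esub> t) \<diamondop>\<^bsub>CE\<^esub> e1))) (P.\<tau> p)"
    by (rule P.\<Delta>E_int) (rule r | assumption | drule restr_out)+
  have R2: "\<dots> = ?I (\<lambda>e p3. ?I (\<lambda>p1 p2. ?h p1 (ev\<^sub>P (p2 \<diamondop>\<^bsub>P.C\<^esub> p3))) e) (P.\<tau> p)"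
  proof -
    have eq: "?I (\<lambda>e' c'. ?I (\<lambda>e'' c''. (e' \<diamondop>\<^bsub>P.EE\<^esub> e'') \<diamondop>\<^bsub>?Q\<^esub> c'')
        (\<sigma> (c' \<diamondop>\<^bsub>CE\<^esub> (p3 \<diamondop>\<^bsub>P.E\<^esub> q')))) (\<sigma> ((u' \<diamondop>\<^bsub>T.C\<^esub> t) \<diamondop>\<^bsub>CE\<^esub> (p1 \<diamondop>\<^bsub>P.E\<^esub> p2))) = ?h p1 (ev\<^sub>P (p2 \<diamondop>\<^bsub>P.C\<^esub> p3))"
      if y: "p1 \<in> carrier P" "p2 \<in> carrier P'" "p3 \<in> carrier P" for p1 p2 p3
    proof -
      have v': "t \<diamondop>\<^bsub>V\<^esub> p1 \<in> carrier V" by (rule y r)+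
      have k: "ev\<^sub>P (p2 \<diamondop>\<^bsub>P.C\<^esub> p3) \<in> carrier K" by (rule y r)+
      have "?I (\<lambda>e' c'. ?I (\<lambda>e'' c''. (e' \<diamondop>\<^bsub>P.EE\<^esub> e'') \<diamondop>\<^bsub>?Q\<^esub> c'')
        (\<sigma> (c' \<diamondop>\<^bsub>CE\<^esub> (p3 \<diamondop>\<^bsub>P.E\<^esub> q')))) (\<Psi> u' (t \<diamondop>\<^bsub>V\<^esub> p1) p2) =
        ?I (\<lambda>v1. ?I (\<lambda>v2 v3. ?I (\<lambda>q u. ?I (\<lambda>e'' c''. ((\<theta>\<^sub>1 u' v1 \<diamondop>\<^bsub>P.E\<^esub> q) \<diamondop>\<^bsub>P.EE\<^esub> e'') \<diamondop>\<^bsub>?Q\<^esub> c'')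
          (\<sigma> ((u \<diamondop>\<^bsub>T.C\<^esub> \<theta>\<^sub>3 v3 p2) \<diamondop>\<^bsub>CE\<^esub> (p3 \<diamondop>\<^bsub>P.E\<^esub> q')))) v2)) (\<gamma>\<^sub>V (t \<diamondop>\<^bsub>V\<^esub> p1))"
        by (rule \<Psi>_int) (rule y v' r | assumption | drule restr_out)+
      also have "\<dots> = ?h p1 (ev\<^sub>P (p2 \<diamondop>\<^bsub>P.C\<^esub> p3))"
      proof -
        have eq: "?I (\<lambda>e'' c''. (w \<diamondop>\<^bsub>P.EE\<^esub> e'') \<diamondop>\<^bsub>?Q\<^esub> c'') (\<Psi> u (ract V v3 (ev\<^sub>P (p2 \<diamondop>\<^bsub>P.C\<^esub> p3))) q') =
          ?I (\<lambda>e'' c''. (w \<diamondop>\<^bsub>P.EE\<^esub> e'') \<diamondop>\<^bsub>?Q\<^esub> c'') (\<sigma> ((u \<diamondop>\<^bsub>T.C\<^esub> \<theta>\<^sub>3 v3 p2) \<diamondop>\<^bsub>CE\<^esub> (p3 \<diamondop>\<^bsub>P.E\<^esub> q')))"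
          if z: "v3 \<in> carrier V" "u \<in> carrier T'" for v3 u w
          using y z h by (simp add: \<sigma>_pure \<theta>\<^sub>3_pure \<theta>_closed)
        show ?thesis
          by (rule sym, (rule eq tlift_cong y k v' r | assumption | drule restr_out)+)
      qed
      finally show ?thesis unfolding \<sigma>_pure[OF h(1,2) y(1,2)] .
    qed
    have eq2: "?I (\<lambda>p1 p2. ?h p1 (ev\<^sub>P (p2 \<diamondop>\<^bsub>P.C\<^esub> p3))) e = ?I (\<lambda>e' c'. ?I (\<lambda>e'' c''. (e' \<diamondop>\<^bsub>P.EE\<^esub> e'') \<diamondop>\<^bsub>?Q\<^esub> c'')
        (\<sigma> (c' \<diamondop>\<^bsub>CE\<^esub> (p3 \<diamondop>\<^bsub>P.E\<^esub> q')))) (\<sigma> ((u' \<diamondop>\<^bsub>T.C\<^esub> t) \<diamondop>\<^bsub>CE\<^esub> e))"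
      if y: "e \<in> carrier P.E" "p3 \<in> carrier P" for e p3
    proof (rule tlift_ext[OF y(1)])
      show "balanced Z (restr id \<kappa> P) (restr \<kappa> id P') ?Q (\<lambda>p1 p2. ?h p1 (ev\<^sub>P (p2 \<diamondop>\<^bsub>P.C\<^esub> p3)))"
        by (rule balanced_precomp[OF hb]) (rule y r)+
      show "add_map P.E ?Q (\<lambda>e. ?I (\<lambda>e' c'. ?I (\<lambda>e'' c''. (e' \<diamondop>\<^bsub>P.EE\<^esub> e'') \<diamondop>\<^bsub>?Q\<^esub> c'')
        (\<sigma> (c' \<diamondop>\<^bsub>CE\<^esub> (p3 \<diamondop>\<^bsub>P.E\<^esub> q')))) (\<sigma> ((u' \<diamondop>\<^bsub>T.C\<^esub> t) \<diamondop>\<^bsub>CE\<^esub> e)))"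
        by (rule y r | assumption | drule restr_out)+
      show "?h p1 (ev\<^sub>P (p2 \<diamondop>\<^bsub>P.C\<^esub> p3)) = ?I (\<lambda>e' c'. ?I (\<lambda>e'' c''. (e' \<diamondop>\<^bsub>P.EE\<^esub> e'') \<diamondop>\<^bsub>?Q\<^esub> c'')
        (\<sigma> (c' \<diamondop>\<^bsub>CE\<^esub> (p3 \<diamondop>\<^bsub>P.E\<^esub> q')))) (\<sigma> ((u' \<diamondop>\<^bsub>T.C\<^esub> t) \<diamondop>\<^bsub>CE\<^esub> (p1 \<diamondop>\<^bsub>P.E\<^esub> p2)))"
        if "p1 \<in> carrier (restr id \<kappa> P)" "p2 \<in> carrier (restr \<kappa> id P')" for p1 p2
        using that by (intro eq[symmetric] y) (simp_all only: restr_simps)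
    qed
    show ?thesis
      by (rule tlift_cong, (rule r | assumption | drule restr_out)+, rule eq2[symmetric])
  qed
  have R3: "\<dots> = ?h p \<one>\<^bsub>K\<^esub>"
    by (rule P.\<tau>_counit'[OF h(3) hb])
  have R4: "\<dots> = ?I (\<lambda>v1. ?I (\<lambda>v2 v3. ?I (\<lambda>w1. ?I (\<lambda>w2 w3. ?F v1 v2 w1 w2 w3)) (\<gamma>\<^sub>V v3))) (\<gamma>\<^sub>V (t \<diamondop>\<^bsub>V\<^esub> p))"
  proof -
    have eq: "?I (\<lambda>w1. ?I (\<lambda>w2 w3. ?I (\<lambda>q2 u2. (w \<diamondop>\<^bsub>P.EE\<^esub> (\<theta>\<^sub>1 u w1 \<diamondop>\<^bsub>P.E\<^esub> q2)) \<diamondop>\<^bsub>?Q\<^esub> (u2 \<diamondop>\<^bsub>T.C\<^esub> \<theta>\<^sub>3 w3 q')) w2)) (\<gamma>\<^sub>V v3) =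
       ?I (\<lambda>e'' c''. (w \<diamondop>\<^bsub>P.EE\<^esub> e'') \<diamondop>\<^bsub>?Q\<^esub> c'') (\<Psi> u (ract V v3 \<one>\<^bsub>K\<^esub>) q')"
      if z: "v3 \<in> carrier V" "u \<in> carrier T'" "w \<in> carrier P.E" for v3 u w
      unfolding VH.T.ract_one[OF z(1)]
      by (rule \<Psi>_int[symmetric]) (rule z r | assumption | drule restr_out)+
    have "?h p \<one>\<^bsub>K\<^esub> = ?I (\<lambda>v1. ?I (\<lambda>v2 v3. ?I (\<lambda>q u. ?I (\<lambda>w1. ?I (\<lambda>w2 w3. ?I (\<lambda>q2 u2. ((\<theta>\<^sub>1 u' v1 \<diamondop>\<^bsub>P.E\<^esub> q) \<diamondop>\<^bsub>P.EE\<^esub>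
      (\<theta>\<^sub>1 u w1 \<diamondop>\<^bsub>P.E\<^esub> q2)) \<diamondop>\<^bsub>?Q\<^esub> (u2 \<diamondop>\<^bsub>T.C\<^esub> \<theta>\<^sub>3 w3 q')) w2)) (\<gamma>\<^sub>V v3)) v2)) (\<gamma>\<^sub>V (t \<diamondop>\<^bsub>V\<^esub> p))"
      by (rule sym, (rule eq tlift_cong r | assumption | drule restr_out)+)
    also have "\<dots> = ?I (\<lambda>v1. ?I (\<lambda>v2 v3. ?I (\<lambda>w1 d. ?I (\<lambda>q u. ?I (\<lambda>w2 w3. ?I (\<lambda>q2 u2. ((\<theta>\<^sub>1 u' v1 \<diamondop>\<^bsub>P.E\<^esub> q) \<diamondop>\<^bsub>P.EE\<^esub>
      (\<theta>\<^sub>1 u w1 \<diamondop>\<^bsub>P.E\<^esub> q2)) \<diamondop>\<^bsub>?Q\<^esub> (u2 \<diamondop>\<^bsub>T.C\<^esub> \<theta>\<^sub>3 w3 q')) w2) d) v2) (\<gamma>\<^sub>V v3))) (\<gamma>\<^sub>V (t \<diamondop>\<^bsub>V\<^esub> p))"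
      by (rule tlift_swap tlift_cong r | assumption | drule restr_out)+
    also have "\<dots> = ?I (\<lambda>v1. ?I (\<lambda>v2 v3. ?I (\<lambda>w1. ?I (\<lambda>w2 w3. ?F v1 v2 w1 w2 w3)) (\<gamma>\<^sub>V v3))) (\<gamma>\<^sub>V (t \<diamondop>\<^bsub>V\<^esub> p))"
      by (rule tlift_swap tlift_cong r | assumption | drule restr_out)+
    finally show ?thesis .
  qed
  show "?f (u' \<diamondop>\<^bsub>T.C\<^esub> t) (p \<diamondop>\<^bsub>P.E\<^esub> q') = ?g (u' \<diamondop>\<^bsub>T.C\<^esub> t) (p \<diamondop>\<^bsub>P.E\<^esub> q')"
    unfolding R1 R2 R3 R4 M[symmetric] \<sigma>_pure[OF h] L1 L2 L3 ..
qed

lemma smash_coproduct_\<sigma>: "smash_coproduct A T.C T.\<Delta>C ev\<^sub>T P.E P.\<Delta>E ev'\<^sub>P \<sigma>"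
  unfolding coring_pair.smash_coproduct_iff[OF coring_pair]
  by (intro conjI ballI \<sigma>_hom mult_left_\<sigma> mult_right_\<sigma> counit_E_\<sigma> counit_C_\<sigma>)

end

section \<open>The two implications and the resulting coring\<close>

context herd_pair
begin

lemma smash_coproduct_imp_herd:
  assumes "smash_coproduct A T.C T.\<Delta>C ev\<^sub>T P.E P.\<Delta>E ev'\<^sub>P \<sigma>"
  shows "\<exists>\<gamma>\<^sub>V. herd Z K \<kappa> S B \<beta> V V' ev\<^sub>V ev'\<^sub>V \<gamma>\<^sub>V \<and>
    shepherd_compat_right A S \<beta> Z \<kappa> T T' \<gamma>\<^sub>T P P' ev'\<^sub>P \<gamma>\<^sub>V \<and>
    shepherd_compat_left A S \<beta> Z \<kappa> T T' ev\<^sub>T P P' \<gamma>\<^sub>P \<gamma>\<^sub>V"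
proof -
  interpret smash_herds R A \<alpha> S B \<beta> T T' ev\<^sub>T ev'\<^sub>T \<gamma>\<^sub>T Z K \<kappa> P P' ev\<^sub>P ev'\<^sub>P \<gamma>\<^sub>P \<sigma>
    by (intro smash_herds.intro herd_pair_axioms smash_herds_axioms.intro assms)
  show ?thesis
    using herd_V compat_right compat_left by blast
qed

lemma herd_imp_smash_coproduct:
  assumes "herd Z K \<kappa> S B \<beta> V V' ev\<^sub>V ev'\<^sub>V \<gamma>\<^sub>V"
    and "shepherd_compat_right A S \<beta> Z \<kappa> T T' \<gamma>\<^sub>T P P' ev'\<^sub>P \<gamma>\<^sub>V"
    and "shepherd_compat_left A S \<beta> Z \<kappa> T T' ev\<^sub>T P P' \<gamma>\<^sub>P \<gamma>\<^sub>V"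
  shows "\<exists>\<sigma>. smash_coproduct A T.C T.\<Delta>C ev\<^sub>T P.E P.\<Delta>E ev'\<^sub>P \<sigma>"
proof -
  interpret composite_herd R A \<alpha> S B \<beta> T T' ev\<^sub>T ev'\<^sub>T \<gamma>\<^sub>T Z K \<kappa> P P' ev\<^sub>P ev'\<^sub>P \<gamma>\<^sub>P \<gamma>\<^sub>V
    by (intro composite_herd.intro herd_pair_axioms composite_herd_axioms.intro assms)
  show ?thesis
    using smash_coproduct_\<sigma> by blast
qed

lemma smash_coproduct_imp_coring:
  assumes "smash_coproduct A T.C T.\<Delta>C ev\<^sub>T P.E P.\<Delta>E ev'\<^sub>P \<sigma>"
  shows "coring A (T.C \<^bold>\<otimes>\<^bsub>A\<^esub> P.E) (smash_comult A T.C T.\<Delta>C P.E P.\<Delta>E \<sigma>) (smash_counit A ev\<^sub>T ev'\<^sub>P)"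
proof -
  interpret smash_corings A T.C T.\<Delta>C ev\<^sub>T P.E P.\<Delta>E ev'\<^sub>P \<sigma>
    by (intro smash_corings.intro smash_corings_axioms.intro smash_comodules.intro smash.intro smash_axioms.intro
      assms coring_pair T.right_comodule_C P.left_comodule_E T.C_counit_left T.C_counit_right P.E_counit_left P.E_counit_right)
  show ?thesis by (rule coring_smash)
qed

end

theorem theorem4p2:
  fixes R :: "('r, 'r1) ring_scheme" and A :: "('a, 'a1) ring_scheme"
    and S :: "('s, 's1) ring_scheme" and B :: "('b, 'b1) ring_scheme"
    and Z :: "('z, 'z1) ring_scheme" and K :: "('k, 'k1) ring_scheme"
    and \<alpha> :: "'r \<Rightarrow> 'a" and \<beta> :: "'s \<Rightarrow> 'b" and \<kappa> :: "'z \<Rightarrow> 'k"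
    and T :: "('b, 'a, 't) bimod" and T' :: "('a, 'b, 'u) bimod"
    and P :: "('a, 'k, 'p) bimod" and P' :: "('k, 'a, 'q) bimod"
  assumes "ring_hom_ring R A \<alpha>" and "ring_hom_ring S B \<beta>" and "ring_hom_ring Z K \<kappa>"
    and "herd R A \<alpha> S B \<beta> T T' ev\<^sub>T ev'\<^sub>T \<gamma>\<^sub>T"
    and "herd Z K \<kappa> R A \<alpha> P P' ev\<^sub>P ev'\<^sub>P \<gamma>\<^sub>P"
  shows
    "let C = T' \<^bold>\<otimes>\<^bsub>S,\<beta>\<^esub> T; \<Delta>\<^sub>C = right_coring_comult A S \<beta> T T' \<gamma>\<^sub>T;
         E = P \<^bold>\<otimes>\<^bsub>Z,\<kappa>\<^esub> P'; \<Delta>\<^sub>E = left_coring_comult Z \<kappa> A P P' \<gamma>\<^sub>P;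
         V = T \<^bold>\<otimes>\<^bsub>A\<^esub> P; V' = P' \<^bold>\<otimes>\<^bsub>A\<^esub> T';
         ev\<^sub>V = comp_ev R \<alpha> S \<beta> K T T' ev\<^sub>T P P' ev\<^sub>P;
         ev'\<^sub>V = comp_ev' R \<alpha> Z \<kappa> B T T' ev'\<^sub>T P P' ev'\<^sub>P
     in ((\<exists>\<gamma>\<^sub>V. herd Z K \<kappa> S B \<beta> V V' ev\<^sub>V ev'\<^sub>V \<gamma>\<^sub>V \<and>
              shepherd_compat_right A S \<beta> Z \<kappa> T T' \<gamma>\<^sub>T P P' ev'\<^sub>P \<gamma>\<^sub>V \<and>
              shepherd_compat_left A S \<beta> Z \<kappa> T T' ev\<^sub>T P P' \<gamma>\<^sub>P \<gamma>\<^sub>V)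
          \<longleftrightarrow> (\<exists>\<sigma>. smash_coproduct A C \<Delta>\<^sub>C ev\<^sub>T E \<Delta>\<^sub>E ev'\<^sub>P \<sigma>)) \<and>
        (\<forall>\<sigma>. smash_coproduct A C \<Delta>\<^sub>C ev\<^sub>T E \<Delta>\<^sub>E ev'\<^sub>P \<sigma> \<longrightarrow>
          coring A (C \<^bold>\<otimes>\<^bsub>A\<^esub> E) (smash_comult A C \<Delta>\<^sub>C E \<Delta>\<^sub>E \<sigma>) (smash_counit A ev\<^sub>T ev'\<^sub>P))"
proof -
  interpret herd_pair R A \<alpha> S B \<beta> T T' ev\<^sub>T ev'\<^sub>T \<gamma>\<^sub>T Z K \<kappa> P P' ev\<^sub>P ev'\<^sub>P \<gamma>\<^sub>P
    by (intro herd_pair.intro assms)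
  show ?thesis
    unfolding Let_def
    using smash_coproduct_imp_herd herd_imp_smash_coproduct smash_coproduct_imp_coring by blast
qed

end
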